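(* Let $M$ be a graded $QS$-manifold whose homological vector field $\hat Q$ has weight $q$ and whose Schouten bracket $\{\ ,\ \}_S$ has weight $s$. Let $Q=p_{\hat Q}\in C^{\infty}(T^*M)$ be the fiberwise linear Hamiltonian corresponding to $\hat Q$, and let $S\in C^\infty(T^*M)$ be the fiberwise quadratic odd Hamiltonian defining the Schouten bracket. Define the total weight on $T^*M$ as $w+(q-s)d$, where $w$ is the induced weight and $d$ is the fiberwise degree. For arbitrary $\lambda\in\mathbb R$ define the vector field $\hat Q_D=X_Q+\lambda X_S$ on $T^*M$, where $X_f=\{f,\ \}$ is the Hamiltonian vector field of $f$ with respect to the canonical Poisson bracket. Then $T^*M$ with the total weight and the field $\hat Q_D$ is a graded $Q$-manifold (i.e. $\hat Q_D$ is an odd vector field with $\hat Q_D^2=0$), and the homological vector field $\hat Q_D$ has total weight $q$, the same as the weight of $\hat Q$ on $M$.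
   Context: Everything is $\mathbb Z_2$-graded (manifold means supermanifold); tilde denotes parity. Graded manifold: a supermanifold with a distinguished class of atlases whose local coordinates $x^a$ (of parity $\tilde a$) carry weights $w(x^a)=w_a\in\mathbb Z$ (independent of parity), functions being smooth in all coordinates and polynomial in coordinates of nonzero weight, such that coordinate changes preserve weight. A vector field $X=X^a\partial_a$ is homogeneous of weight $w(X)$ if $w(X)=w(X^a)-w_a$ for all $a$. On $T^*M$ with coordinates $x^a$ and conjugate momenta $p_a$ ($\tilde p_a=\tilde a$) the canonical Poisson bracket is $$\{f,g\}=(-1)^{\tilde a(\tilde f+1)}\frac{\partial f}{\partial p_a}\frac{\partial g}{\partial x^a}-(-1)^{\tilde a\tilde f}\frac{\partial f}{\partial x^a}\frac{\partial g}{\partial p_a}.$$ The induced weight $w$ on $T^*M$ is given by $w(x^a)=w_a$, $w(p_a)=-w_a$; the fiberwise degree $d$ is the degree in the $p_a$: $d(x^a)=0$, $d(p_a)=1$. To a vector field $X=X^a(x)\partial/\partial x^a$ corresponds $p_X=X^a p_a$. A homological vector field is an odd vector field $\hat Q$ with $\hat Q^2=0$; a (graded) $Q$-manifold is a (graded) manifold with a homological vector field. A Schouten bracket on $M$ (odd Poisson bracket on $C^\infty(M)$) is given by an odd function $S=\frac12S^{ab}(x)p_bp_a$ on $T^*M$ with $\{S,S\}=0$ via $\{f,g\}_S=\{f,\{S,g\}\}$ (canonical Poisson brackets on the right); its weight is the induced weight of $S$, i.e. $\{f,g\}_S$ has weight $w(f)+w(g)+s$. A graded $QS$-manifold is a graded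 manifold with a homological vector field $\hat Q$ and a Schouten bracket such that $\hat Q$ is a derivation of the bracket.
   Formalization: Graded manifold here also requires the coordinate vector fields to have components polynomial in coordinates of nonzero weight in every other chart; otherwise T*M need not be graded (x'=x+yz, t'=t(1+(x+yz)^2), weights 0,1,-1,2). The dimension 0|0 is excluded. *)

theory Defs
  imports "HOL-Analysis.Analysis"
begin

section \<open>Superfunctions\<close>

text \<open>
  The index type \<open>'c\<close> numbers the local coordinates, even and odd ones together; a parity function
  \<open>pr\<close> tells which are odd.  A point of the body is a vector whose odd entries vanish.  A
  superfunction assigns to a body point \<open>u\<close> an element of the Grassmann algebra: \<open>f u $ I\<close> is the
  coefficient of the product, in increasing order, of the odd coordinates in \<open>I\<close>.
  The total functions below matter only on the open set of body points under consideration.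
\<close>

type_synonym 'c point = "real ^ 'c"
type_synonym 'c grass = "real ^ 'c set"
type_synonym 'c sfun = "'c point \<Rightarrow> 'c grass"

definition gsign :: "('c::linorder) set \<Rightarrow> 'c set \<Rightarrow> real" where
  "gsign I J = (- 1) ^ card {(i, j). i \<in> I \<and> j \<in> J \<and> j < i}"

definition gmul :: "('c::{finite,linorder}) grass \<Rightarrow> 'c grass \<Rightarrow> 'c grass" (infixl "\<cdot>" 70) where
  "x \<cdot> y = (\<chi> K. \<Sum>I\<in>Pow K. gsign I (K - I) * (x $ I) * (y $ (K - I)))"

definition gone :: "('c::finite) grass" where
  "gone = axis {} 1"

definition gprod :: "('c::{finite,linorder}) grass list \<Rightarrow> 'c grass" where
  "gprod xs = foldr (\<cdot>) xs gone"

definition body_space :: "('c::finite \<Rightarrow> bool) \<Rightarrow> 'c point set" where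
  "body_space pr = {u. \<forall>a. pr a \<longrightarrow> u $ a = 0}"

definition crd :: "('c::finite \<Rightarrow> bool) \<Rightarrow> 'c \<Rightarrow> 'c sfun" where
  "crd pr a u = (if pr a then axis {a} 1 else (u $ a) *\<^sub>R gone)"

text \<open>Partial derivatives; those along odd coordinates are left derivatives.\<close>

definition pder :: "('c::{finite,linorder} \<Rightarrow> bool) \<Rightarrow> 'c \<Rightarrow> 'c sfun \<Rightarrow> 'c sfun" where
  "pder pr a f u =
     (if pr a then \<chi> I. if a \<in> I then 0 else (- 1) ^ card {b\<in>I. b < a} * (f u $ insert a I)
      else vector_derivative (\<lambda>t. f (u + t *\<^sub>R axis a 1)) (at 0))"

definition smooth_on :: "('c::{finite,linorder} \<Rightarrow> bool) \<Rightarrow> 'c point set \<Rightarrow> 'c sfun \<Rightarrow> bool" where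
  "smooth_on pr U f \<longleftrightarrow>
     (\<forall>as. (\<forall>a\<in>set as. \<not> pr a) \<longrightarrow> fold (pder pr) as f differentiable_on U)"

definition superfun :: "('c::{finite,linorder} \<Rightarrow> bool) \<Rightarrow> 'c point set \<Rightarrow> 'c sfun \<Rightarrow> bool" where
  "superfun pr U f \<longleftrightarrow> smooth_on pr U f \<and> (\<forall>u\<in>U. \<forall>I. f u $ I \<noteq> 0 \<longrightarrow> I \<subseteq> {a. pr a})"

text \<open>Parities are truth values, \<open>True\<close> meaning odd.\<close>

definition has_parity :: "'c point set \<Rightarrow> bool \<Rightarrow> ('c::finite) sfun \<Rightarrow> bool" where
  "has_parity U e f \<longleftrightarrow> (\<forall>u\<in>U. \<forall>I. f u $ I \<noteq> 0 \<longrightarrow> odd (card I) = e)"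

text \<open>\<open>ksign a b\<close> is \<open>(-1)\<close> to the power \<open>a b\<close>.\<close>

definition ksign :: "bool \<Rightarrow> bool \<Rightarrow> real" where
  "ksign a b = (if a \<and> b then - 1 else 1)"

text \<open>
  Substitution of superfunctions \<open>y b\<close> (of the parity of the coordinate \<open>b\<close>) for the coordinates
  of \<open>F\<close>: Taylor expansion of \<open>F\<close> in all coordinates, even and odd, about the body of \<open>y\<close>,
  \[ F(y) = \sum_k \frac{1}{k!} \sum_{b_1,\dots,b_k} n^{b_1}\cdots n^{b_k}\,
       (\partial_{b_k}\cdots\partial_{b_1}F)(\mathrm{body}\ y), \]
  where \<open>n b\<close> is the nilpotent part of \<open>y b\<close>.  With left derivatives this order of the factors
  produces the right signs.  A product of more than \<open>CARD('c)\<close> nilpotent parts vanishes, so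
  the truncated sum is the whole series.
\<close>

definition bodymap :: "('d \<Rightarrow> ('c::finite) sfun) \<Rightarrow> 'c point \<Rightarrow> ('d::finite) point" where
  "bodymap y u = (\<chi> b. y b u $ {})"

definition nilp :: "('c::finite) sfun \<Rightarrow> 'c sfun" where
  "nilp f u = f u - (f u $ {}) *\<^sub>R gone"

definition subst_sfun ::
  "('d::{finite,linorder} \<Rightarrow> bool) \<Rightarrow> 'd sfun \<Rightarrow> ('d \<Rightarrow> ('c::{finite,linorder}) sfun) \<Rightarrow> 'c sfun" where
  "subst_sfun pr F y u =
     (\<Sum>k\<le>CARD('c). (1 / fact k) *\<^sub>R
        (\<Sum>bs\<in>{bs. length bs = k}.
           (fold (pder pr) bs F (bodymap y u) $ {}) *\<^sub>R gprod (map (\<lambda>b. nilp (y b) u) bs)))"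

section \<open>Weights\<close>

text \<open>
  \<open>f\<close> is a polynomial in the coordinates of nonzero weight, with coefficients \<open>c k\<close> smooth in those
  of weight zero (odd coordinates always occur polynomially).  The set \<open>U\<close> need not be a product;
  so the condition on \<open>c k\<close> is that it takes equal values at points of \<open>U\<close> with the same
  coordinates of weight zero.
\<close>

definition poly_expansion :: "('c::{finite,linorder} \<Rightarrow> bool) \<Rightarrow> ('c \<Rightarrow> int) \<Rightarrow> 'c point set \<Rightarrow> 'c sfun
    \<Rightarrow> ('c \<Rightarrow> nat) set \<Rightarrow> (('c \<Rightarrow> nat) \<Rightarrow> 'c sfun) \<Rightarrow> bool" where
  "poly_expansion pr w U f N c \<longleftrightarrow> finite N \<and>
     (\<forall>k\<in>N. superfun pr U (c k) \<and>
        (\<forall>u\<in>U. \<forall>v\<in>U. (\<forall>a. w a = 0 \<longrightarrow> u $ a = v $ a) \<longrightarrow> c k u = c k v)) \<and>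
     (\<forall>u\<in>U. f u = (\<Sum>k\<in>N. (\<Prod>a | \<not> pr a \<and> w a \<noteq> 0. (u $ a) ^ k a) *\<^sub>R c k u))"

definition graded_fun :: "('c::{finite,linorder} \<Rightarrow> bool) \<Rightarrow> ('c \<Rightarrow> int) \<Rightarrow> 'c point set \<Rightarrow> 'c sfun \<Rightarrow> bool" where
  "graded_fun pr w U f \<longleftrightarrow> superfun pr U f \<and> (\<exists>N c. poly_expansion pr w U f N c)"

definition has_weight ::
  "('c::{finite,linorder} \<Rightarrow> bool) \<Rightarrow> ('c \<Rightarrow> int) \<Rightarrow> 'c point set \<Rightarrow> int \<Rightarrow> 'c sfun \<Rightarrow> bool" where
  "has_weight pr w U r f \<longleftrightarrow> superfun pr U f \<and>
     (\<exists>N c. poly_expansion pr w U f N c \<and>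
        (\<forall>k\<in>N. \<forall>u\<in>U. \<forall>I. c k u $ I \<noteq> 0 \<longrightarrow>
           (\<Sum>a | \<not> pr a. int (k a) * w a) + (\<Sum>a\<in>I. w a) = r))"

section \<open>Graded manifolds\<close>

text \<open>
  A supermanifold is given by an atlas: \<open>overlap A i j\<close> is the part of the domain of chart \<open>i\<close> that
  also lies in chart \<open>j\<close>, and \<open>change A i j b\<close> is the coordinate \<open>b\<close> of chart \<open>j\<close> as a function
  of the coordinates of chart \<open>i\<close>.
\<close>

record ('i, 'c) atlas =
  charts :: "'i set"
  par :: "'i \<Rightarrow> 'c \<Rightarrow> bool"
  wt :: "'i \<Rightarrow> 'c \<Rightarrow> int"
  domain :: "'i \<Rightarrow> 'c point set"
  overlap :: "'i \<Rightarrow> 'i \<Rightarrow> 'c point set"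
  change :: "'i \<Rightarrow> 'i \<Rightarrow> 'c \<Rightarrow> 'c sfun"

text \<open>\<open>pullback A i j F\<close>: the function \<open>F\<close> on chart \<open>j\<close> in the coordinates of chart \<open>i\<close>.\<close>

definition pullback :: "('i, 'c::{finite,linorder}) atlas \<Rightarrow> 'i \<Rightarrow> 'i \<Rightarrow> 'c sfun \<Rightarrow> 'c sfun" where
  "pullback A i j F = subst_sfun (par A j) F (change A i j)"

text \<open>
  The last two conditions say that the body glued from the charts is Hausdorff (the graphs
  of the changes of coordinates are closed) and second countable (countably many charts cover).
\<close>

definition supermanifold :: "('i, 'c::{finite,linorder}) atlas \<Rightarrow> bool" where
  "supermanifold A \<longleftrightarrow>
     (\<forall>i\<in>charts A. openin (top_of_set (body_space (par A i))) (domain A i) \<and>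
        overlap A i i = domain A i \<and>
        (\<forall>b. \<forall>u\<in>domain A i. change A i i b u = crd (par A i) b u)) \<and>
     (\<forall>i\<in>charts A. \<forall>j\<in>charts A.
        openin (top_of_set (domain A i)) (overlap A i j) \<and>
        bodymap (change A i j) ` overlap A i j \<subseteq> overlap A j i \<and>
        (\<forall>b. superfun (par A i) (overlap A i j) (change A i j b) \<and>
             has_parity (overlap A i j) (par A j b) (change A i j b))) \<and>
     (\<forall>i\<in>charts A. \<forall>j\<in>charts A. \<forall>k\<in>charts A. \<forall>u\<in>overlap A i j.
        bodymap (change A i j) u \<in> overlap A j k \<longrightarrow>
        u \<in> overlap A i k \<and> (\<forall>b. change A i k b u = pullback A i j (change A j k b) u)) \<and>
     (\<forall>i\<in>charts A. \<forall>j\<in>charts A.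
        closedin (top_of_set (domain A i \<times> domain A j))
          ((\<lambda>u. (u, bodymap (change A i j) u)) ` overlap A i j)) \<and>
     (\<exists>J\<subseteq>charts A. countable J \<and> (\<forall>i\<in>charts A. domain A i \<subseteq> (\<Union>j\<in>J. overlap A i j)))"

text \<open>
  \<open>jacobian A i j a b\<close> is the derivative of the coordinate \<open>a\<close> of chart \<open>i\<close> by the coordinate \<open>b\<close>
  of chart \<open>j\<close>, written in chart \<open>i\<close>: the component \<open>a\<close> of the coordinate vector field \<open>b\<close> of
  chart \<open>j\<close>.
\<close>

definition jacobian :: "('i, 'c::{finite,linorder}) atlas \<Rightarrow> 'i \<Rightarrow> 'i \<Rightarrow> 'c \<Rightarrow> 'c \<Rightarrow> 'c sfun" where
  "jacobian A i j a b = pullback A i j (pder (par A j) b (change A j i a))"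

text \<open>
  Changes of coordinates preserve weights: the coordinate \<open>b\<close> of one chart has weight \<open>wt A j b\<close>,
  and the coordinate vector field \<open>b\<close> weight \<open>- wt A j b\<close>, in every other chart.  The latter adds to
  the former only that the components of the coordinate vector fields are polynomial, i.e. that it
  does not depend on the chart whether a vector field has admissible components.  This holds
  automatically if it does not depend on the chart whether a function is admissible.  It must
  be required separately if a change of coordinates involves products of coordinates of opposite
  weights:  \<open>x' = x + y z\<close>, \<open>y' = y\<close>, \<open>z' = z\<close>, \<open>t' = t (1 + (x + y z)^2)\<close> with \<open>x, y, z, t\<close> even of
  weights \<open>0, 1, -1, 2\<close> is polynomial in both directions, but the derivative of \<open>t\<close> by \<open>t'\<close> is not
  polynomial in \<open>y, z\<close>.
\<close>

definition graded_manifold :: "('i, 'c::{finite,linorder}) atlas \<Rightarrow> bool" where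
  "graded_manifold A \<longleftrightarrow> supermanifold A \<and>
     (\<forall>i\<in>charts A. \<forall>j\<in>charts A.
        (\<forall>b. has_weight (par A i) (wt A i) (overlap A i j) (wt A j b) (change A i j b)) \<and>
        (\<forall>a b. has_weight (par A i) (wt A i) (overlap A i j) (wt A i a - wt A j b)
                 (jacobian A i j a b)))"

text \<open>A function on the manifold is a family of functions on the charts that agree on overlaps.\<close>

definition global_fun :: "('i, 'c::{finite,linorder}) atlas \<Rightarrow> ('i \<Rightarrow> 'c sfun) \<Rightarrow> bool" where
  "global_fun A F \<longleftrightarrow>
     (\<forall>i\<in>charts A. graded_fun (par A i) (wt A i) (domain A i) (F i)) \<and>
     (\<forall>i\<in>charts A. \<forall>j\<in>charts A. \<forall>u\<in>overlap A i j. F i u = pullback A i j (F j) u)"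

definition local_fun :: "('i, 'c::{finite,linorder}) atlas \<Rightarrow> 'i \<Rightarrow> 'c point set \<Rightarrow> 'c sfun \<Rightarrow> bool" where
  "local_fun A i W f \<longleftrightarrow>
     i \<in> charts A \<and> openin (top_of_set (domain A i)) W \<and> graded_fun (par A i) (wt A i) W f"

section \<open>Vector fields\<close>

text \<open>A vector field acts on the local functions in every chart; its components are its values on
  the coordinates.\<close>

type_synonym ('i, 'c) oper = "'i \<Rightarrow> 'c sfun \<Rightarrow> 'c sfun"

definition component :: "('i, 'c::{finite,linorder}) atlas \<Rightarrow> ('i, 'c) oper \<Rightarrow> 'i \<Rightarrow> 'c \<Rightarrow> 'c sfun" where
  "component A X i a = X i (crd (par A i) a)"

definition vector_field :: "('i, 'c::{finite,linorder}) atlas \<Rightarrow> ('i, 'c) oper \<Rightarrow> bool" where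
  "vector_field A X \<longleftrightarrow>
     (\<forall>i\<in>charts A. \<forall>a. graded_fun (par A i) (wt A i) (domain A i) (component A X i a)) \<and>
     (\<forall>i W f. local_fun A i W f \<longrightarrow>
        (\<forall>u\<in>W. X i f u = (\<Sum>a\<in>UNIV. component A X i a u \<cdot> pder (par A i) a f u))) \<and>
     (\<forall>i\<in>charts A. \<forall>j\<in>charts A. \<forall>b. \<forall>u\<in>overlap A i j.
        X i (change A i j b) u = pullback A i j (component A X j b) u)"

definition odd_vector_field :: "('i, 'c::{finite,linorder}) atlas \<Rightarrow> ('i, 'c) oper \<Rightarrow> bool" where
  "odd_vector_field A X \<longleftrightarrow> vector_field A X \<and>
     (\<forall>i\<in>charts A. \<forall>a. has_parity (domain A i) (\<not> par A i a) (component A X i a))"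

definition homological :: "('i, 'c::{finite,linorder}) atlas \<Rightarrow> ('i, 'c) oper \<Rightarrow> bool" where
  "homological A X \<longleftrightarrow> odd_vector_field A X \<and>
     (\<forall>i W f. local_fun A i W f \<longrightarrow> (\<forall>u\<in>W. X i (X i f) u = 0))"

definition graded_Q_manifold :: "('i, 'c::{finite,linorder}) atlas \<Rightarrow> ('i, 'c) oper \<Rightarrow> bool" where
  "graded_Q_manifold A X \<longleftrightarrow> graded_manifold A \<and> homological A X"

definition vf_has_weight :: "('i, 'c::{finite,linorder}) atlas \<Rightarrow> ('i, 'c) oper \<Rightarrow> int \<Rightarrow> bool" where
  "vf_has_weight A X r \<longleftrightarrow>
     (\<forall>i\<in>charts A. \<forall>a.
        has_weight (par A i) (wt A i) (domain A i) (r + wt A i a) (component A X i a))"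

section \<open>The cotangent bundle\<close>

datatype 'c cot = Pos 'c | Mom 'c

instance cot :: (finite) finite
proof
  have "(UNIV :: 'a cot set) = range Pos \<union> range Mom"
    by (metis (no_types) UNIV_eq_I Un_iff cot.exhaust rangeI)
  then show "finite (UNIV :: 'a cot set)"
    by (metis finite finite_Un finite_imageI)
qed

text \<open>The order only fixes how odd coordinates are arranged in monomials.\<close>

instantiation cot :: (linorder) linorder
begin

fun less_eq_cot :: "'a cot \<Rightarrow> 'a cot \<Rightarrow> bool" where
  "less_eq_cot (Pos a) (Pos b) = (a \<le> b)"
| "less_eq_cot (Pos a) (Mom b) = True"
| "less_eq_cot (Mom a) (Pos b) = False"
| "less_eq_cot (Mom a) (Mom b) = (a \<le> b)"

definition less_cot :: "'a cot \<Rightarrow> 'a cot \<Rightarrow> bool" where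
  "less_cot x y \<longleftrightarrow> x \<le> y \<and> \<not> y \<le> x"

instance
proof
  fix x y z :: "'a cot"
  show "(x < y) = (x \<le> y \<and> \<not> y \<le> x)" by (simp add: less_cot_def)
  show "x \<le> x" by (cases x) auto
  show "x \<le> y \<Longrightarrow> y \<le> z \<Longrightarrow> x \<le> z" by (cases x; cases y; cases z) auto
  show "x \<le> y \<Longrightarrow> y \<le> x \<Longrightarrow> x = y" by (cases x; cases y) auto
  show "x \<le> y \<or> y \<le> x" by (cases x; cases y) auto
qed

end

fun cot_par :: "('c \<Rightarrow> bool) \<Rightarrow> 'c cot \<Rightarrow> bool" where
  "cot_par pr (Pos a) = pr a"
| "cot_par pr (Mom a) = pr a"

fun induced_wt :: "('c \<Rightarrow> int) \<Rightarrow> 'c cot \<Rightarrow> int" where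
  "induced_wt w (Pos a) = w a"
| "induced_wt w (Mom a) = - w a"

fun fibre_deg :: "'c cot \<Rightarrow> int" where
  "fibre_deg (Pos a) = 0"
| "fibre_deg (Mom a) = 1"

definition base_point :: "('c::finite) cot point \<Rightarrow> 'c point" where
  "base_point z = (\<chi> a. z $ Pos a)"

definition zero_section :: "('c::finite) point \<Rightarrow> 'c cot point" where
  "zero_section u = (\<chi> x. case x of Pos a \<Rightarrow> u $ a | Mom a \<Rightarrow> 0)"

text \<open>\<open>lift\<close> pulls functions back along the projection of the cotangent bundle, \<open>restrict0\<close> restricts
  functions to the zero section.\<close>

definition lift :: "('c::finite) sfun \<Rightarrow> 'c cot sfun" where
  "lift f z = (\<chi> J. if J \<subseteq> range Pos then f (base_point z) $ (Pos -` J) else 0)"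

definition restrict0 :: "('c::finite) cot sfun \<Rightarrow> 'c sfun" where
  "restrict0 F u = (\<chi> I. F (zero_section u) $ (Pos ` I))"

definition cot_set :: "('c::finite \<Rightarrow> bool) \<Rightarrow> 'c point set \<Rightarrow> 'c cot point set" where
  "cot_set pr U = {z \<in> body_space (cot_par pr). base_point z \<in> U}"

text \<open>The momenta transform as the coordinate vector fields do.  The weights are the induced ones.\<close>

definition cotangent :: "('i, 'c::{finite,linorder}) atlas \<Rightarrow> ('i, 'c cot) atlas" where
  "cotangent A = \<lparr>
     charts = charts A,
     par = (\<lambda>i. cot_par (par A i)),
     wt = (\<lambda>i. induced_wt (wt A i)),
     domain = (\<lambda>i. cot_set (par A i) (domain A i)),
     overlap = (\<lambda>i j. cot_set (par A i) (overlap A i j)),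
     change = (\<lambda>i j x z. case x of
         Pos b \<Rightarrow> lift (change A i j b) z
       | Mom b \<Rightarrow> (\<Sum>a\<in>UNIV. lift (jacobian A i j a b) z \<cdot> crd (cot_par (par A i)) (Mom a) z))\<rparr>"

text \<open>\<open>total_cotangent A m\<close> carries the weight \<open>w + m d\<close>.\<close>

definition total_cotangent :: "('i, 'c::{finite,linorder}) atlas \<Rightarrow> int \<Rightarrow> ('i, 'c cot) atlas" where
  "total_cotangent A m =
     (cotangent A)\<lparr>wt := (\<lambda>i x. wt (cotangent A) i x + m * fibre_deg x)\<rparr>"

text \<open>The formula for the canonical Poisson bracket involves the parity \<open>e\<close> of its first
  argument; it is extended linearly to inhomogeneous functions.\<close>

definition part :: "bool \<Rightarrow> ('c::finite) sfun \<Rightarrow> 'c sfun" where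
  "part e f u = (\<chi> I. if odd (card I) = e then f u $ I else 0)"

definition poisson_hom :: "('c::{finite,linorder} \<Rightarrow> bool) \<Rightarrow> bool \<Rightarrow> 'c cot sfun \<Rightarrow> 'c cot sfun \<Rightarrow> 'c cot sfun" where
  "poisson_hom pr e f g z = (\<Sum>a\<in>UNIV.
       ksign (pr a) (\<not> e) *\<^sub>R (pder (cot_par pr) (Mom a) f z \<cdot> pder (cot_par pr) (Pos a) g z)
     - ksign (pr a) e *\<^sub>R (pder (cot_par pr) (Pos a) f z \<cdot> pder (cot_par pr) (Mom a) g z))"

definition poisson :: "('c::{finite,linorder} \<Rightarrow> bool) \<Rightarrow> 'c cot sfun \<Rightarrow> 'c cot sfun \<Rightarrow> 'c cot sfun" where
  "poisson pr f g z = poisson_hom pr False (part False f) g z + poisson_hom pr True (part True f) g z"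

definition hamiltonian_vf ::
  "('i, 'c::{finite,linorder}) atlas \<Rightarrow> ('i \<Rightarrow> 'c cot sfun) \<Rightarrow> ('i, 'c cot) oper" where
  "hamiltonian_vf A F i g = poisson (par A i) (F i) g"

definition linear_hamiltonian ::
  "('i, 'c::{finite,linorder}) atlas \<Rightarrow> ('i, 'c) oper \<Rightarrow> 'i \<Rightarrow> 'c cot sfun" where
  "linear_hamiltonian A X i z =
     (\<Sum>a\<in>UNIV. lift (component A X i a) z \<cdot> crd (cot_par (par A i)) (Mom a) z)"

section \<open>QS-manifolds\<close>

definition fibrewise_quadratic ::
  "('i, 'c::{finite,linorder}) atlas \<Rightarrow> ('i \<Rightarrow> 'c cot sfun) \<Rightarrow> bool" where
  "fibrewise_quadratic A S \<longleftrightarrow>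
     (\<forall>i\<in>charts A. \<exists>s. (\<forall>a b. graded_fun (par A i) (wt A i) (domain A i) (s a b)) \<and>
        (\<forall>z\<in>domain (cotangent A) i. S i z = (1/2) *\<^sub>R (\<Sum>a\<in>UNIV. \<Sum>b\<in>UNIV. lift (s a b) z \<cdot>
            (crd (cot_par (par A i)) (Mom b) z \<cdot> crd (cot_par (par A i)) (Mom a) z))))"

definition schouten_function ::
  "('i, 'c::{finite,linorder}) atlas \<Rightarrow> ('i \<Rightarrow> 'c cot sfun) \<Rightarrow> bool" where
  "schouten_function A S \<longleftrightarrow>
     global_fun (cotangent A) S \<and> fibrewise_quadratic A S \<and>
     (\<forall>i\<in>charts A. has_parity (domain (cotangent A) i) True (S i) \<and>
        (\<forall>z\<in>domain (cotangent A) i. poisson (par A i) (S i) (S i) z = 0))"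

text \<open>The double bracket does not depend on the momenta; restriction to the zero section
  makes it a function on the base.\<close>

definition schouten_bracket ::
  "('i, 'c::{finite,linorder}) atlas \<Rightarrow> ('i \<Rightarrow> 'c cot sfun) \<Rightarrow> 'i \<Rightarrow> 'c sfun \<Rightarrow> 'c sfun \<Rightarrow> 'c sfun" where
  "schouten_bracket A S i f g =
     restrict0 (poisson (par A i) (lift f) (poisson (par A i) (S i) (lift g)))"

text \<open>An odd vector field differentiates an odd bracket with the sign obtained by moving it past the
  first argument and the bracket itself, \<open>Q{f,g} = {Qf,g} + (-1)^(e+1) {f,Qg}\<close> for \<open>f\<close> of parity \<open>e\<close>.\<close>

definition derivation_of_bracket ::
  "('i, 'c::{finite,linorder}) atlas \<Rightarrow> ('i, 'c) oper \<Rightarrow> ('i \<Rightarrow> 'c cot sfun) \<Rightarrow> bool" where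
  "derivation_of_bracket A X S \<longleftrightarrow>
     (\<forall>i W f g e. local_fun A i W f \<and> local_fun A i W g \<and> has_parity W e f \<longrightarrow>
        (\<forall>u\<in>W. X i (schouten_bracket A S i f g) u =
           schouten_bracket A S i (X i f) g u
           + ksign True (\<not> e) *\<^sub>R schouten_bracket A S i f (X i g) u))"

definition graded_QS_manifold ::
  "('i, 'c::{finite,linorder}) atlas \<Rightarrow> ('i, 'c) oper \<Rightarrow> ('i \<Rightarrow> 'c cot sfun) \<Rightarrow> bool" where
  "graded_QS_manifold A X S \<longleftrightarrow>
     graded_Q_manifold A X \<and> schouten_function A S \<and> derivation_of_bracket A X S"

definition schouten_has_weight ::
  "('i, 'c::{finite,linorder}) atlas \<Rightarrow> ('i \<Rightarrow> 'c cot sfun) \<Rightarrow> int \<Rightarrow> bool" where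
  "schouten_has_weight A S r \<longleftrightarrow>
     (\<forall>i\<in>charts A. has_weight (par (cotangent A) i) (wt (cotangent A) i)
        (domain (cotangent A) i) r (S i))"

definition Q_double :: "('i, 'c::{finite,linorder}) atlas \<Rightarrow> ('i, 'c) oper \<Rightarrow> ('i \<Rightarrow> 'c cot sfun)
    \<Rightarrow> real \<Rightarrow> ('i, 'c cot) oper" where
  "Q_double A X S lam i g z =
     hamiltonian_vf A (linear_hamiltonian A X) i g z + lam *\<^sub>R hamiltonian_vf A S i g z"

end

theory Submission
  imports Defs
begin

text \<open>
  On \<open>T\<^sup>*M\<close> put \<open>H = Q + \<lambda> S\<close>.  The field is \<open>X\<^sub>H\<close>, and for odd \<open>H\<close> its square vanishes as soon as
  \<open>{H, H} = {Q, Q} + 2 \<lambda> {Q, S} + \<lambda>\<^sup>2 {S, S}\<close> does.  The first term vanishes because the base field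
  squares to zero and the last by assumption.  The second momentum derivatives of \<open>{Q, S}\<close>, a function quadratic in
  the momenta, express the derivation property on pairs of coordinates, so it vanishes by Euler's
  identity.  Likewise the coefficients of \<open>S\<close> are its second momentum derivatives, so they are
  homogeneous, and with the total weight \<open>w + (q - s) d\<close> both \<open>Q\<close> and \<open>S\<close> have weight
  \<open>2 q - s\<close>, while the bracket has weight \<open>s - q\<close>.

  That \<open>T\<^sup>*M\<close> is a graded manifold and that Hamiltonian fields do not depend on the chart both come from
  the chain rule for substitution of superfunctions.  Writing \<open>n\<^sup>b\<close> for the nilpotent part of the
  substituted element, the Taylor terms satisfy \<open>T\<^sub>k\<^sub>+\<^sub>1 F = \<Sum>\<^sub>b n\<^sup>b T\<^sub>k (\<partial>\<^sub>b F)\<close>, and scaling \<open>n\<close> by \<open>t\<close>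
  turns every identity between substitutions into uniqueness for a nilpotent linear differential
  equation in \<open>t\<close>.
\<close>

section \<open>The Grassmann algebra\<close>

text \<open>The shift in \<open>w + (q - s) d\<close> is forced: adding \<open>m d\<close> gives
  \<open>Q\<close> the weight \<open>q + m\<close> and \<open>S\<close> the weight
  \<open>s + 2 m\<close>, which agree exactly for \<open>m = q - s\<close>; the bracket pairs each
  coordinate with its momentum and so lowers weights by \<open>m\<close>. Three obstacles shape the
  argument. Superfunctions are total functions that matter only on relatively open subsets of the
  body, so every identity between them is kept on an open set before it is differentiated. Elements
  of the Grassmann algebra may be inhomogeneous, so signs come either from a parity assumption or
  from the twist \<open>gtwist\<close>. Substitution is a truncated Taylor sum, from which neither
  multiplicativity nor associativity can be read off directly. Invariance of the field is not
  deduced from invariance of the whole Poisson bracket: only the values on coordinate functions have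
  to be compared, and there the second derivatives of the changes of coordinates cancel by
  symmetry.\<close>

lemma gmul_nth: "(x \<cdot> y) $ K = (\<Sum>I\<in>Pow K. gsign I (K - I) * (x $ I) * (y $ (K - I)))"
  by (simp add: gmul_def)

lemma bilinear_gmul: "bilinear (gmul :: ('c::{finite,linorder}) grass \<Rightarrow> _)"
  unfolding bilinear_def linear_iff
  by (auto simp: vec_eq_iff gmul_nth algebra_simps sum.distrib sum_distrib_left)

interpretation gmul: bounded_bilinear "gmul :: ('c::{finite,linorder}) grass \<Rightarrow> _"
  using bilinear_gmul by (simp add: bilinear_conv_bounded_bilinear)

declare gmul.zero_left [simp] gmul.zero_right [simp]

lemmas gmul_linear = gmul.add_left gmul.add_right gmul.diff_left gmul.diff_right
  gmul.minus_left gmul.minus_right gmul.scaleR_left gmul.scaleR_right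

section \<open>Signs of shuffles\<close>

lemma gsign_empty [simp]: "gsign {} J = 1" "gsign I {} = 1"
  by (auto simp: gsign_def)

lemma gsign_square [simp]: "gsign I J * gsign I J = 1"
  by (simp add: gsign_def flip: power_add)

lemma gsign_square_left [simp]: "gsign I J * (gsign I J * c) = c"
  by (simp flip: mult.assoc)

lemma gsign_Un_left:
  fixes I :: "('c::{finite,linorder}) set"
  assumes "I \<inter> I' = {}"
  shows "gsign (I \<union> I') J = gsign I J * gsign I' J"
proof -
  have "{(i, j). i \<in> I \<union> I' \<and> j \<in> J \<and> j < i} =
      {(i, j). i \<in> I \<and> j \<in> J \<and> j < i} \<union> {(i, j). i \<in> I' \<and> j \<in> J \<and> j < i}"
    by auto
  moreover have "{(i, j). i \<in> I \<and> j \<in> J \<and> j < i} \<inter> {(i, j). i \<in> I' \<and> j \<in> J \<and> j < i} = {}"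
    using assms by auto
  ultimately show ?thesis
    unfolding gsign_def by (simp add: card_Un_disjoint power_add)
qed

lemma gsign_Un_right:
  fixes I :: "('c::{finite,linorder}) set"
  assumes "J \<inter> J' = {}"
  shows "gsign I (J \<union> J') = gsign I J * gsign I J'"
proof -
  have "{(i, j). i \<in> I \<and> j \<in> J \<union> J' \<and> j < i} =
      {(i, j). i \<in> I \<and> j \<in> J \<and> j < i} \<union> {(i, j). i \<in> I \<and> j \<in> J' \<and> j < i}"
    by auto
  moreover have "{(i, j). i \<in> I \<and> j \<in> J \<and> j < i} \<inter> {(i, j). i \<in> I \<and> j \<in> J' \<and> j < i} = {}"
    using assms by auto
  ultimately show ?thesis
    unfolding gsign_def by (simp add: card_Un_disjoint power_add)
qed

lemma gsign_insert_left:
  "a \<notin> I \<Longrightarrow> gsign (insert a I) J = gsign {a} J * gsign I J" for a :: "'c::{finite,linorder}"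
  using gsign_Un_left[of "{a}" I J] by simp

lemma gsign_insert_right:
  "a \<notin> J \<Longrightarrow> gsign I (insert a J) = gsign I {a} * gsign I J" for a :: "'c::{finite,linorder}"
  using gsign_Un_right[of "{a}" J I] by simp

text \<open>Every pair in \<open>I \<times> J\<close> is an inversion either of (\<open>I\<close>,
  \<open>J\<close>) or, read backwards, of (\<open>J\<close>, \<open>I\<close>); disjointness
  excludes ties. So the two inversion counts add up to the product of the cardinalities.\<close>

lemma gsign_swap:
  fixes I :: "('c::{finite,linorder}) set"
  assumes "I \<inter> J = {}"
  shows "gsign J I = (- 1) ^ (card I * card J) * gsign I J"
proof -
  let ?A = "{(i, j). i \<in> I \<and> j \<in> J \<and> j < i}" and ?B = "{(j, i). j \<in> J \<and> i \<in> I \<and> i < j}"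
  have "I \<times> J = ?A \<union> prod.swap ` ?B"
    using assms by (auto simp: image_iff)
  moreover have "?A \<inter> prod.swap ` ?B = {}"
    by auto
  moreover have "card (prod.swap ` ?B) = card ?B"
    by (intro card_image inj_onI) auto
  ultimately have "card I * card J = card ?A + card ?B"
    using card_Un_disjoint[OF finite finite, of ?A "prod.swap ` ?B"] card_cartesian_product[of I J]
    by presburger
  then have "(- 1::real) ^ (card I * card J) = gsign I J * gsign J I"
    by (simp add: gsign_def power_add)
  then show ?thesis
    by (simp add: ac_simps)
qed

lemma gsign_swap_single:
  "a \<notin> I \<Longrightarrow> gsign I {a} = (- 1) ^ card I * gsign {a} I" for a :: "'c::{finite,linorder}"
  using gsign_swap[of "{a}" I] by simp

text \<open>Both sides sum over ordered partitions of \<open>K\<close> into three blocks. The pairs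
  (\<open>L\<close>, \<open>I\<close>) with \<open>I \<subseteq> L\<close> and (\<open>I\<close>,
  \<open>L - I\<close>) encode the same partition, and the signs agree because \<open>gsign\<close>
  is multiplicative over disjoint unions.\<close>

lemma gmul_assoc: "(x \<cdot> y) \<cdot> z = x \<cdot> (y \<cdot> z)"
proof (rule vec_eq_iff[THEN iffD2, rule_format])
  fix K
  have "(x \<cdot> y \<cdot> z) $ K = (\<Sum>(L, I)\<in>Sigma (Pow K) Pow.
      gsign L (K - L) * gsign I (L - I) * x $ I * y $ (L - I) * z $ (K - L))"
    by (simp add: gmul_nth sum_distrib_left sum_distrib_right sum.Sigma[symmetric] ac_simps)
  also have "\<dots> = (\<Sum>(I, J)\<in>Sigma (Pow K) (\<lambda>I. Pow (K - I)).
      gsign I (K - I) * gsign J (K - I - J) * x $ I * y $ J * z $ (K - I - J))"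
  proof (rule sum.reindex_bij_witness[where i = "\<lambda>(I, J). (I \<union> J, I)" and j = "\<lambda>(L, I). (I, L - I)"])
    fix p assume p: "p \<in> Sigma (Pow K) Pow"
    obtain L I where [simp]: "p = (L, I)" by force
    have LI: "I \<subseteq> L" "L \<subseteq> K" using p by auto
    then have eq: "L = I \<union> (L - I)" "K - I = (L - I) \<union> (K - L)" "K - I - (L - I) = K - L"
      by auto
    have "gsign L (K - L) = gsign I (K - L) * gsign (L - I) (K - L)"
      by (subst eq(1), subst gsign_Un_left) auto
    moreover have "gsign I (K - I) = gsign I (L - I) * gsign I (K - L)"
      by (subst eq(2), subst gsign_Un_right) auto
    ultimately show "(case case p of (L, I) \<Rightarrow> (I, L - I) of
        (I, J) \<Rightarrow> gsign I (K - I) * gsign J (K - I - J) * x $ I * y $ J * z $ (K - I - J)) =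
        (case p of (L, I) \<Rightarrow> gsign L (K - L) * gsign I (L - I) * x $ I * y $ (L - I) * z $ (K - L))"
      using eq(3) by simp
  qed auto
  also have "\<dots> = (x \<cdot> (y \<cdot> z)) $ K"
    by (simp add: gmul_nth sum_distrib_left sum_distrib_right sum.Sigma[symmetric] ac_simps)
  finally show "(x \<cdot> y \<cdot> z) $ K = (x \<cdot> (y \<cdot> z)) $ K" .
qed

lemma gone_nth: "gone $ I = (if I = {} then 1 else 0)"
  by (simp add: gone_def axis_def)

lemma gmul_gone_left [simp]: "gone \<cdot> x = x"
proof (rule vec_eq_iff[THEN iffD2, rule_format])
  fix K
  have "(gone \<cdot> x) $ K = (\<Sum>I\<in>{{}}. gsign I (K - I) * (gone $ I) * (x $ (K - I)))"
    unfolding gmul_nth by (rule sum.mono_neutral_right) (auto simp: gone_nth)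
  then show "(gone \<cdot> x) $ K = x $ K" by (simp add: gone_nth)
qed

lemma gmul_gone_right [simp]: "x \<cdot> gone = x"
proof (rule vec_eq_iff[THEN iffD2, rule_format])
  fix K
  have "(x \<cdot> gone) $ K = (\<Sum>I\<in>{K}. gsign I (K - I) * (x $ I) * (gone $ (K - I)))"
    unfolding gmul_nth by (rule sum.mono_neutral_right) (auto simp: gone_nth)
  then show "(x \<cdot> gone) $ K = x $ K" by (simp add: gone_nth)
qed

lemma gmul_body [simp]: "(x \<cdot> y) $ {} = x $ {} * y $ {}"
  by (simp add: gmul_nth)

section \<open>Parity and supercommutativity\<close>

definition gpar :: "bool \<Rightarrow> ('c::finite) grass \<Rightarrow> bool" where
  "gpar e x \<longleftrightarrow> (\<forall>I. odd (card I) \<noteq> e \<longrightarrow> x $ I = 0)"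

lemma gparI: "(\<And>I. x $ I \<noteq> 0 \<Longrightarrow> odd (card I) = e) \<Longrightarrow> gpar e x"
  by (auto simp: gpar_def)

lemma has_parity_iff: "has_parity U e f \<longleftrightarrow> (\<forall>u\<in>U. gpar e (f u))"
  by (auto simp: has_parity_def gpar_def)

lemma gpar_0 [simp]: "gpar e 0"
  and gpar_gone [simp]: "gpar False gone"
  and gpar_add: "gpar e x \<Longrightarrow> gpar e y \<Longrightarrow> gpar e (x + y)"
  and gpar_minus: "gpar e x \<Longrightarrow> gpar e (- x)"
  and gpar_scaleR: "gpar e x \<Longrightarrow> gpar e (c *\<^sub>R x)"
  by (auto simp: gpar_def gone_nth)

lemma gpar_sum: "(\<And>i. i \<in> A \<Longrightarrow> gpar e (f i)) \<Longrightarrow> gpar e (sum f A)"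
  by (induction A rule: infinite_finite_induct) (auto intro: gpar_add)

text \<open>Reduces statements about the support of a product, such as parity, filtration level,
  admissible generators or weight, to additivity over a splitting of the index set.\<close>

lemma gmul_nth_nonzero:
  assumes "(x \<cdot> y) $ K \<noteq> 0"
  obtains I where "I \<subseteq> K" "x $ I \<noteq> 0" "y $ (K - I) \<noteq> 0"
  using assms unfolding gmul_nth by (auto elim!: sum.not_neutral_contains_not_neutral)

lemma gpar_gmul:
  fixes x y :: "('c::{finite,linorder}) grass"
  assumes "gpar e x" "gpar e' y"
  shows "gpar (e \<noteq> e') (x \<cdot> y)"
proof (rule gparI)
  fix K assume "(x \<cdot> y) $ K \<noteq> 0"
  then obtain I where I: "I \<subseteq> K" "x $ I \<noteq> 0" "y $ (K - I) \<noteq> 0" by (rule gmul_nth_nonzero)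
  have "card K = card I + card (K - I)"
    using I(1) by (metis card_Un_disjoint Diff_disjoint Diff_partition finite)
  then show "odd (card K) = (e \<noteq> e')"
    using assms I by (auto simp: gpar_def)
qed

lemma gpar_odd_body: "gpar True x \<Longrightarrow> x $ {} = 0"
  by (auto simp: gpar_def)

lemma ksign_square [simp]: "ksign a b * ksign a b = 1" "ksign a b *\<^sub>R ksign a b *\<^sub>R (x :: 'v::real_vector) = x"
  by (auto simp: ksign_def)

lemma ksign_False [simp]: "ksign False b = 1" "ksign a False = 1"
  by (auto simp: ksign_def)

lemma ksign_commute: "ksign a b = ksign b a"
  by (auto simp: ksign_def)

text \<open>Replacing \<open>I\<close> by its complement in \<open>K\<close> turns one product sum
  into the other. By \<open>gsign_swap\<close> each term changes by the parity of
  \<open>card I * card (K - I)\<close>, which is the same for all terms that do not vanish.\<close>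

lemma gmul_supercommute:
  fixes x y :: "('c::{finite,linorder}) grass"
  assumes "gpar e x" "gpar e' y"
  shows "x \<cdot> y = ksign e e' *\<^sub>R (y \<cdot> x)"
proof (rule vec_eq_iff[THEN iffD2, rule_format])
  fix K
  have "(y \<cdot> x) $ K = (\<Sum>I\<in>Pow K. gsign (K - I) I * y $ (K - I) * x $ I)"
    unfolding gmul_nth
    by (rule sum.reindex_bij_witness[where i = "\<lambda>I. K - I" and j = "\<lambda>I. K - I"])
      (auto simp: double_diff)
  then have "(ksign e e' *\<^sub>R (y \<cdot> x)) $ K =
      (\<Sum>I\<in>Pow K. ksign e e' * (gsign (K - I) I * y $ (K - I) * x $ I))"
    by (simp add: sum_distrib_left)
  also have "\<dots> = (x \<cdot> y) $ K"
    unfolding gmul_nth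
  proof (rule sum.cong)
    fix I assume "I \<in> Pow K"
    show "ksign e e' * (gsign (K - I) I * y $ (K - I) * x $ I) = gsign I (K - I) * x $ I * y $ (K - I)"
    proof (cases "x $ I = 0 \<or> y $ (K - I) = 0")
      case False
      then have "odd (card I) = e" "odd (card (K - I)) = e'"
        using assms by (auto simp: gpar_def)
      moreover have "gsign (K - I) I = (- 1) ^ (card I * card (K - I)) * gsign I (K - I)"
        by (rule gsign_swap) auto
      ultimately show ?thesis
        by (cases "odd (card I)"; cases "odd (card (K - I))")
          (simp_all add: ksign_def minus_one_power_iff)
    qed auto
  qed simp
  finally show "(x \<cdot> y) $ K = (ksign e e' *\<^sub>R (y \<cdot> x)) $ K" by simp
qed

definition gpart :: "bool \<Rightarrow> ('c::finite) grass \<Rightarrow> 'c grass" where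
  "gpart e x = (\<chi> I. if odd (card I) = e then x $ I else 0)"

lemma gpar_gpart: "gpar e (gpart e x)"
  by (simp add: gpart_def gpar_def)

lemma gpart_sum: "gpart False x + gpart True x = x"
  by (simp add: gpart_def vec_eq_iff)

lemma gpart_id: "gpar e x \<Longrightarrow> gpart e x = x"
  by (auto simp: gpart_def vec_eq_iff gpar_def)

lemma gpart_other: "gpar e x \<Longrightarrow> gpart (\<not> e) x = 0"
  by (auto simp: gpart_def vec_eq_iff gpar_def)

text \<open>\<open>gtwist e\<close> is the sign picked up when an object of parity \<open>e\<close> moves past its argument.\<close>

definition gtwist :: "bool \<Rightarrow> ('c::finite) grass \<Rightarrow> 'c grass" where
  "gtwist e x = (\<chi> I. ksign e (odd (card I)) * x $ I)"

lemma linear_gtwist: "linear (gtwist e)"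
  by (auto simp: linear_iff gtwist_def vec_eq_iff algebra_simps)

lemma gtwist_False [simp]: "gtwist False x = x"
  by (simp add: gtwist_def vec_eq_iff)

lemma gtwist_gpar: "gpar e x \<Longrightarrow> gtwist p x = ksign p e *\<^sub>R x"
  by (auto simp: gtwist_def vec_eq_iff gpar_def ksign_def)

text \<open>Moves \<open>x\<close> past an inhomogeneous \<open>y\<close>: on each parity part of
  \<open>y\<close> this is supercommutativity, and both sides are linear in
  \<open>y\<close>.\<close>

lemma gmul_gtwist:
  assumes "gpar e x"
  shows "x \<cdot> gtwist e y = y \<cdot> x"
proof -
  have "x \<cdot> gtwist e (gpart d y) = gpart d y \<cdot> x" for d
    using gtwist_gpar[OF gpar_gpart, of e d y] gmul_supercommute[OF assms gpar_gpart, of d y]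
    by (simp add: gmul_linear)
  then show ?thesis
    by (subst (1 2) gpart_sum[of y, symmetric])
      (simp add: gmul_linear linear_add[OF linear_gtwist])
qed

text \<open>The odd branch of \<open>pder\<close> as an operator on the Grassmann algebra itself.
  There it is an odd derivation, to which the general chain rule applies.\<close>

definition oder :: "'c::{finite,linorder} \<Rightarrow> 'c grass \<Rightarrow> 'c grass" where
  "oder a x = (\<chi> I. if a \<in> I then 0 else (- 1) ^ card {b\<in>I. b < a} * (x $ insert a I))"

lemma linear_oder: "linear (oder a)"
  by (auto simp: linear_iff oder_def vec_eq_iff algebra_simps)

lemma oder_nth: "oder a x $ I = (if a \<in> I then 0 else gsign {a} I * x $ insert a I)"
proof -
  have "{(i, j). i \<in> {a} \<and> j \<in> I \<and> j < i} = Pair a ` {b\<in>I. b < a}" by auto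
  then have "card {(i, j). i \<in> {a} \<and> j \<in> I \<and> j < i} = card {b\<in>I. b < a}"
    by (simp add: card_image inj_on_def)
  then show ?thesis by (simp add: oder_def gsign_def)
qed

lemma gpar_oder: "gpar e x \<Longrightarrow> gpar (\<not> e) (oder a x)"
  by (auto simp: gpar_def oder_nth split: if_splits)

lemma oder_gone [simp]: "oder a gone = 0"
  by (simp add: vec_eq_iff oder_nth gone_nth)

lemma oder_axis: "oder a (axis {b} 1) = (if a = b then gone else 0)"
  by (auto simp: vec_eq_iff oder_nth gone_nth axis_def)

text \<open>Both sides read off the coefficient at \<open>I\<close> with \<open>a\<close> and
  \<open>b\<close> inserted; exactly one of \<open>a\<close>, \<open>b\<close> precedes the other,
  which accounts for the sign. For equal indices both sides vanish.\<close>

lemma oder_anticommute: "oder a (oder b x) = - oder b (oder a x)"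
proof (cases "a = b")
  case False
  moreover have "gsign {b} {a} = - gsign {a} {b}"
    using gsign_swap[of "{a}" "{b}"] calculation by simp
  moreover have "gsign {a} I * gsign {b} (insert a I) = - (gsign {b} I * gsign {a} (insert b I))"
    if "a \<notin> I" "b \<notin> I" for I
    using that calculation(2) gsign_insert_right[of a I "{b}"] gsign_insert_right[of b I "{a}"] by simp
  ultimately show ?thesis
    by (auto simp: vec_eq_iff oder_nth insert_commute simp flip: mult.assoc)
qed (simp add: vec_eq_iff oder_nth)

lemma sum_Pow_insert:
  assumes "a \<notin> K" "finite K"
  shows "(\<Sum>I\<in>Pow (insert a K). f I) = (\<Sum>I\<in>Pow K. f (insert a I)) + (\<Sum>I\<in>Pow K. f I)"
proof -
  have "inj_on (insert a) (Pow K)"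
    using assms by (auto simp: inj_on_def) 
  moreover have "Pow K \<inter> insert a ` Pow K = {}" using assms by auto
  ultimately show ?thesis
    using assms by (simp add: Pow_insert sum.union_disjoint sum.reindex add.commute)
qed

text \<open>\<open>gtwist True\<close> is the grade involution, which puts the Leibniz rule into a
  form valid for inhomogeneous \<open>x\<close>. Coefficients are compared by splitting index sets
  according to whether they contain \<open>a\<close>.\<close>

lemma oder_gmul: "oder a (x \<cdot> y) = oder a x \<cdot> y + gtwist True x \<cdot> oder a y"
proof (rule vec_eq_iff[THEN iffD2, rule_format])
  fix K :: "'a set"
  have ks: "ksign True (odd (card I)) = (- 1) ^ card I" for I :: "'a set"
    by (simp add: ksign_def minus_one_power_iff)
  show "oder a (x \<cdot> y) $ K = (oder a x \<cdot> y + gtwist True x \<cdot> oder a y) $ K"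
  proof (cases "a \<in> K")
    \<comment> \<open>The left-hand side has no coefficient here, so the two sums on the right, over
      the \<open>I\<close> that lack \<open>a\<close> and over those that contain it, have to
      cancel.\<close>
    case True
    then obtain L where L: "K = insert a L" "a \<notin> L" by (metis mk_disjoint_insert)
    have "gsign I (insert a (L - I)) * gsign {a} I * x $ insert a I * y $ insert a (L - I) =
      gsign (insert a I) (L - I) * (- 1) ^ card I * x $ insert a I * gsign {a} (L - I) * y $ insert a (L - I)"
      if "I \<subseteq> L" for I
    proof -
      have "a \<notin> I" "a \<notin> L - I" using that L by auto
      then show ?thesis by (simp add: gsign_insert_left[of a I] gsign_insert_right[of a "L - I"] gsign_swap_single ac_simps)
    qed
    then have "gsign I (insert a L - I) * (gsign {a} I * x $ insert a I) * y $ (insert a L - I) +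
        gsign (insert a I) (L - I) * ((- 1) ^ card (insert a I) * x $ insert a I) *
          (gsign {a} (L - I) * y $ insert a (L - I)) = 0" if "I \<in> Pow L" for I
      using that L(2) by (auto simp: insert_Diff_if card_insert_if ac_simps)
    then have "(\<Sum>I\<in>Pow L. gsign I (insert a L - I) * (gsign {a} I * x $ insert a I) * y $ (insert a L - I)) +
        (\<Sum>I\<in>Pow L. gsign (insert a I) (L - I) * ((- 1) ^ card (insert a I) * x $ insert a I) *
          (gsign {a} (L - I) * y $ insert a (L - I))) = 0"
      unfolding sum.distrib[symmetric] by (rule sum.neutral[OF ballI])
    moreover have "(oder a x \<cdot> y) $ K =
        (\<Sum>I\<in>Pow L. gsign I (insert a L - I) * (gsign {a} I * x $ insert a I) * y $ (insert a L - I))"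
      unfolding gmul_nth L(1) sum_Pow_insert[OF L(2) finite]
      using L(2) by (auto simp: oder_nth intro!: sum.cong)
    moreover have "(gtwist True x \<cdot> oder a y) $ K =
        (\<Sum>I\<in>Pow L. gsign (insert a I) (L - I) * ((- 1) ^ card (insert a I) * x $ insert a I) *
          (gsign {a} (L - I) * y $ insert a (L - I)))"
      unfolding gmul_nth L(1) sum_Pow_insert[OF L(2) finite]
      using L(2) by (auto simp: oder_nth gtwist_def ks subset_iff intro!: sum.cong sum.neutral)
    ultimately show ?thesis using True by (simp add: oder_nth)
  next
    case False
    \<comment> \<open>Subsets that contain \<open>a\<close> contribute to the first summand of the
      Leibniz rule, the others to the second.\<close>
    have "gsign {a} K * (gsign (insert a I) (K - I) * x $ insert a I * y $ (K - I)) =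
        gsign I (K - I) * (gsign {a} I * x $ insert a I) * y $ (K - I)"
      "gsign {a} K * (gsign I (insert a (K - I)) * x $ I * y $ insert a (K - I)) =
        gsign I (K - I) * ((- 1) ^ card I * x $ I) * (gsign {a} (K - I) * y $ insert a (K - I))"
      if "I \<subseteq> K" for I
    proof -
      have aI: "a \<notin> I" "a \<notin> K - I" "K = I \<union> (K - I)" using that False by auto
      have "gsign {a} K = gsign {a} I * gsign {a} (K - I)"
        by (subst aI(3), subst gsign_Un_right) auto
      then show "gsign {a} K * (gsign (insert a I) (K - I) * x $ insert a I * y $ (K - I)) =
        gsign I (K - I) * (gsign {a} I * x $ insert a I) * y $ (K - I)"
      "gsign {a} K * (gsign I (insert a (K - I)) * x $ I * y $ insert a (K - I)) =
        gsign I (K - I) * ((- 1) ^ card I * x $ I) * (gsign {a} (K - I) * y $ insert a (K - I))"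
        using aI by (simp_all add: gsign_insert_left[of a I] gsign_insert_right[of a "K - I"] gsign_swap_single ac_simps)
    qed
    moreover have "insert a K - I = insert a (K - I)" "insert a K - insert a I = K - I" "a \<notin> I"
      if "I \<in> Pow K" for I using that False by auto
    ultimately have
      "(\<Sum>I\<in>Pow K. gsign {a} K * (gsign (insert a I) (insert a K - insert a I) * x $ insert a I * y $ (insert a K - insert a I)))
        = (oder a x \<cdot> y) $ K"
      "(\<Sum>I\<in>Pow K. gsign {a} K * (gsign I (insert a K - I) * x $ I * y $ (insert a K - I)))
        = (gtwist True x \<cdot> oder a y) $ K"
      unfolding gmul_nth by (auto simp: oder_nth gtwist_def ks False intro!: sum.cong)
    moreover have "oder a (x \<cdot> y) $ K = gsign {a} K *
      ((\<Sum>I\<in>Pow K. gsign (insert a I) (insert a K - insert a I) * x $ insert a I * y $ (insert a K - insert a I))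
       + (\<Sum>I\<in>Pow K. gsign I (insert a K - I) * x $ I * y $ (insert a K - I)))"
      using False by (simp add: oder_nth gmul_nth sum_Pow_insert)
    ultimately show ?thesis
      by (simp only: vector_add_component distrib_left sum_distrib_left)
  qed
qed

lemma oder_gmul_gpar:
  "gpar e x \<Longrightarrow> oder a (x \<cdot> y) = oder a x \<cdot> y + ksign True e *\<^sub>R (x \<cdot> oder a y)"
  by (simp add: oder_gmul gtwist_gpar gmul_linear)

text \<open>The filtration by powers of the ideal of nilpotent elements.\<close>

definition lev :: "nat \<Rightarrow> ('c::finite) grass \<Rightarrow> bool" where
  "lev k x \<longleftrightarrow> (\<forall>I. card I < k \<longrightarrow> x $ I = 0)"

lemma lev_0 [simp]: "lev 0 x"
  and lev_zero [simp]: "lev k 0"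
  and lev_scaleR: "lev k x \<Longrightarrow> lev k (c *\<^sub>R x)"
  by (auto simp: lev_def)

lemma lev_1: "lev (Suc 0) x \<longleftrightarrow> x $ {} = 0"
  by (auto simp: lev_def)

lemma lev_sum: "(\<And>i. i \<in> A \<Longrightarrow> lev k (f i)) \<Longrightarrow> lev k (sum f A)"
  by (simp add: lev_def)

lemma lev_gmul:
  fixes x y :: "('c::{finite,linorder}) grass"
  assumes "lev j x" "lev k y"
  shows "lev (j + k) (x \<cdot> y)"
  unfolding lev_def
proof (intro allI impI, rule ccontr)
  fix K :: "'c set" assume K: "card K < j + k" and "(x \<cdot> y) $ K \<noteq> 0"
  then obtain I where I: "I \<subseteq> K" "x $ I \<noteq> 0" "y $ (K - I) \<noteq> 0"
    using gmul_nth_nonzero by metis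
  have "card K = card I + card (K - I)"
    using I(1) by (metis card_Un_disjoint Diff_disjoint Diff_partition finite)
  then show False
    using assms I K by (metis lev_def add_mono not_less)
qed

text \<open>Index sets have at most \<open>CARD('c)\<close> elements. This bound justifies the
  truncation of Taylor sums and ends the induction in the uniqueness argument for flows.\<close>

lemma lev_gt_eq_0:
  assumes "lev k (x :: ('c::finite) grass)" "CARD('c) < k"
  shows "x = 0"
  using assms by (auto simp: lev_def vec_eq_iff intro: le_less_trans[OF card_mono[OF finite subset_UNIV]])

definition gnil :: "('c::finite) grass \<Rightarrow> 'c grass" where
  "gnil x = x - (x $ {}) *\<^sub>R gone"

lemma linear_gnil: "linear gnil"
  by (auto simp: linear_iff gnil_def algebra_simps)

lemma lev_gnil: "lev (Suc 0) (gnil x)"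
  by (simp add: lev_1 gnil_def gone_nth)

lemma gpar_gnil: "gpar e x \<Longrightarrow> gpar e (gnil x)"
  by (auto simp: gnil_def gpar_def gone_nth)

lemma oder_gnil [simp]: "oder a (gnil x) = oder a x"
  by (simp add: gnil_def linear_diff[OF linear_oder] linear_scale[OF linear_oder])

text \<open>Records which generators may occur; the values of a superfunction are supported on the
  odd coordinates.\<close>

definition gsupp :: "'c set \<Rightarrow> ('c::finite) grass \<Rightarrow> bool" where
  "gsupp A x \<longleftrightarrow> (\<forall>I. \<not> I \<subseteq> A \<longrightarrow> x $ I = 0)"

lemma gsuppI: "(\<And>I. x $ I \<noteq> 0 \<Longrightarrow> I \<subseteq> A) \<Longrightarrow> gsupp A x"
  by (auto simp: gsupp_def)

lemma gsupp_0 [simp]: "gsupp A 0"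
  and gsupp_gone [simp]: "gsupp A gone"
  and gsupp_add: "gsupp A x \<Longrightarrow> gsupp A y \<Longrightarrow> gsupp A (x + y)"
  and gsupp_scaleR: "gsupp A x \<Longrightarrow> gsupp A (c *\<^sub>R x)"
  and gsupp_axis: "gsupp A (axis {a} 1) \<longleftrightarrow> a \<in> A"
  by (auto simp: gsupp_def gone_nth axis_def)

lemma gsupp_oder: "gsupp A x \<Longrightarrow> gsupp A (oder a x)"
  by (auto simp: gsupp_def oder_nth split: if_splits)

lemma gsupp_gnil: "gsupp A x \<Longrightarrow> gsupp A (gnil x)"
  by (auto simp: gsupp_def gnil_def gone_nth)

lemma gsupp_gtwist: "gsupp A x \<Longrightarrow> gsupp A (gtwist e x)"
  by (auto simp: gsupp_def gtwist_def)

lemma gsupp_sum: "(\<And>i. i \<in> B \<Longrightarrow> gsupp A (f i)) \<Longrightarrow> gsupp A (sum f B)"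
  by (induction B rule: infinite_finite_induct) (auto intro: gsupp_add)

lemma gsupp_gmul:
  fixes x y :: "('c::{finite,linorder}) grass"
  assumes "gsupp A x" "gsupp A y"
  shows "gsupp A (x \<cdot> y)"
proof (rule gsuppI)
  fix K assume "(x \<cdot> y) $ K \<noteq> 0"
  then obtain I where "I \<subseteq> K" "x $ I \<noteq> 0" "y $ (K - I) \<noteq> 0" by (rule gmul_nth_nonzero)
  then have "I \<subseteq> A" "K - I \<subseteq> A" using assms by (metis gsupp_def)+
  then show "K \<subseteq> A" by auto
qed

section \<open>Calculus of superfunctions\<close>

text \<open>When odd coordinates are present, such a set has empty interior in the coordinate space.
  Derivatives are therefore taken within it, and only even directions stay inside.\<close>

abbreviation obody :: "('c::finite \<Rightarrow> bool) \<Rightarrow> 'c point set \<Rightarrow> bool" where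
  "obody pr U \<equiv> openin (top_of_set (body_space pr)) U"

lemma obody_subset: "obody pr U \<Longrightarrow> u \<in> U \<Longrightarrow> u \<in> body_space pr"
  by (meson openin_subset subsetD topspace_euclidean_subtopology openin_imp_subset)

text \<open>Two parameters serve the mixed second derivatives; a single line is the case where one
  of them is 0.\<close>

lemma obody_line2:
  assumes "obody pr U" "u \<in> U" "\<not> pr a" "\<not> pr b"
  obtains d where "d > 0"
    "\<And>s t. \<bar>s\<bar> < d \<Longrightarrow> \<bar>t\<bar> < d \<Longrightarrow> u + s *\<^sub>R axis a 1 + t *\<^sub>R axis b 1 \<in> U"
proof -
  obtain e where e: "e > 0" "ball u e \<inter> body_space pr \<subseteq> U"
    using assms(1,2) by (auto simp: openin_contains_ball)
  have "u + s *\<^sub>R axis a 1 + t *\<^sub>R axis b 1 \<in> U" if "\<bar>s\<bar> < e / 2" "\<bar>t\<bar> < e / 2" for s t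
  proof -
    have "norm (s *\<^sub>R axis a 1 + t *\<^sub>R axis b (1::real)) < e"
      using that norm_triangle_ineq[of "s *\<^sub>R axis a (1::real)" "t *\<^sub>R axis b 1"] by simp
    moreover have "dist u (u + (s *\<^sub>R axis a 1 + t *\<^sub>R axis b 1)) =
        norm (s *\<^sub>R axis a 1 + t *\<^sub>R axis b (1::real))"
      by (metis add_diff_cancel_left' dist_commute dist_norm)
    ultimately have "u + s *\<^sub>R axis a 1 + t *\<^sub>R axis b 1 \<in> ball u e"
      by (simp add: add.assoc)
    moreover have "u + s *\<^sub>R axis a 1 + t *\<^sub>R axis b 1 \<in> body_space pr"
      using obody_subset[OF assms(1,2)] assms(3,4) by (auto simp: body_space_def axis_def)
    ultimately show ?thesis using e(2) by blast
  qed
  then show thesis using that[of "e/2"] e(1) by simp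
qed

lemma obody_line:
  assumes "obody pr U" "u \<in> U" "\<not> pr a"
  shows "\<forall>\<^sub>F t in nhds 0. u + t *\<^sub>R axis a 1 \<in> U"
proof -
  obtain d where d: "d > 0"
    "\<And>s t. \<bar>s\<bar> < d \<Longrightarrow> \<bar>t\<bar> < d \<Longrightarrow> u + s *\<^sub>R axis a 1 + t *\<^sub>R axis a 1 \<in> U"
    using obody_line2[OF assms assms(3)] by blast
  show ?thesis
    unfolding eventually_nhds_metric
    using d(1) d(2)[of _ 0] by (intro exI[of _ d]) (auto simp: dist_real_def)
qed

text \<open>Differentiability is known only within \<open>U\<close>. An even line stays in
  \<open>U\<close> for small \<open>t\<close>, so composing with it gives an unrestricted derivative
  at 0.\<close>

lemma has_derivative_line:
  assumes "obody pr U" "u \<in> U" "\<not> pr a" "(f has_derivative f') (at u within U)"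
  shows "((\<lambda>t. f (u + t *\<^sub>R axis a 1)) has_vector_derivative f' (axis a 1)) (at 0)"
proof -
  obtain S where S: "open S" "0 \<in> S" "\<And>t. t \<in> S \<Longrightarrow> u + t *\<^sub>R axis a 1 \<in> U"
    using obody_line[OF assms(1-3)] by (auto simp: eventually_nhds)
  have "((\<lambda>t. u + t *\<^sub>R axis a 1) has_derivative (\<lambda>t. t *\<^sub>R axis a 1)) (at 0 within S)"
    using has_derivative_add[OF has_derivative_const
        bounded_linear_imp_has_derivative[OF bounded_linear_scaleR_left], of u "axis a 1"] by simp
  moreover have "(f has_derivative f') (at (u + 0 *\<^sub>R axis a 1) within (\<lambda>t. u + t *\<^sub>R axis a 1) ` S)"
    using S(3) by (auto intro: has_derivative_subset[OF assms(4)])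
  ultimately have "(f \<circ> (\<lambda>t. u + t *\<^sub>R axis a 1) has_derivative f' \<circ> (\<lambda>t. t *\<^sub>R axis a 1)) (at 0 within S)"
    by (rule diff_chain_within)
  moreover have "f' (t *\<^sub>R axis a 1) = t *\<^sub>R f' (axis a 1)" for t
    using has_derivative_linear[OF assms(4)] by (rule linear_scale)
  ultimately show ?thesis
    unfolding has_vector_derivative_def o_def at_within_open[OF S(2,1)] by simp
qed

section \<open>Rules for partial derivatives\<close>

lemma pder_odd: "pr a \<Longrightarrow> pder pr a f u = oder a (f u)"
  by (simp add: pder_def oder_def vec_eq_iff)

lemma pder_even: "\<not> pr a \<Longrightarrow> pder pr a f u = vector_derivative (\<lambda>t. f (u + t *\<^sub>R axis a 1)) (at 0)"
  by (simp add: pder_def)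

lemma pder_eqI:
  "\<not> pr a \<Longrightarrow> ((\<lambda>t. f (u + t *\<^sub>R axis a 1)) has_vector_derivative x) (at 0) \<Longrightarrow> pder pr a f u = x"
  by (simp add: pder_even vector_derivative_at)

lemma pder_line:
  assumes "obody pr U" "u \<in> U" "\<not> pr a" "f differentiable_on U"
  shows "((\<lambda>t. f (u + t *\<^sub>R axis a 1)) has_vector_derivative pder pr a f u) (at 0)"
proof -
  obtain f' where "(f has_derivative f') (at u within U)"
    using assms by (auto simp: differentiable_on_def differentiable_def)
  from has_derivative_line[OF assms(1-3) this] show ?thesis
    using pder_eqI[of pr a f u, OF assms(3)] by simp
qed

text \<open>A partial derivative depends only on values near \<open>u\<close> in the body. This is
  why equations between functions are always kept on a relatively open set.\<close>

lemma pder_cong: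
  assumes "obody pr U" "\<And>u. u \<in> U \<Longrightarrow> f u = g u" "u \<in> U"
  shows "pder pr a f u = pder pr a g u"
proof (cases "pr a")
  case False
  have "\<forall>\<^sub>F t in nhds 0. t \<in> UNIV \<longrightarrow> f (u + t *\<^sub>R axis a 1) = g (u + t *\<^sub>R axis a 1)"
    using obody_line[OF assms(1,3) False] by eventually_elim (simp add: assms(2))
  then show ?thesis
    using False by (simp add: pder_even vector_derivative_cong_eq)
qed (simp add: pder_odd assms)

text \<open>Restricted to even directions, where the derivative is a limit; an arbitrary linear map
  does not commute with the algebraic operation \<open>oder\<close>.\<close>

lemma pder_linear:
  assumes "linear L" "obody pr U" "u \<in> U" "f differentiable_on U" "\<not> pr a"
  shows "pder pr a (\<lambda>u. L (f u)) u = L (pder pr a f u)"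
  using bounded_linear.has_vector_derivative[OF _ pder_line[OF assms(2,3,5,4)]] assms(1)
  by (intro pder_eqI[of pr a, OF assms(5)]) (simp add: linear_conv_bounded_linear)

lemma pder_add:
  assumes "obody pr U" "u \<in> U" "f differentiable_on U" "g differentiable_on U"
  shows "pder pr a (\<lambda>u. f u + g u) u = pder pr a f u + pder pr a g u"
proof (cases "pr a")
  case False
  show ?thesis
    by (intro pder_eqI[of pr a, OF False] has_vector_derivative_add pder_line[OF assms(1,2) False] assms(3,4))
qed (simp add: pder_odd linear_add[OF linear_oder])

lemma pder_scaleR:
  assumes "obody pr U" "u \<in> U" "f differentiable_on U"
  shows "pder pr a (\<lambda>u. c *\<^sub>R f u) u = c *\<^sub>R pder pr a f u"
proof (cases "pr a")
  case False
  show ?thesis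
    using pder_linear[of "\<lambda>x. c *\<^sub>R x", OF _ assms False] by (simp add: linear_iff algebra_simps)
qed (simp add: pder_odd linear_scale[OF linear_oder])

lemma pder_const [simp]: "pder pr a (\<lambda>u. c *\<^sub>R gone) u = 0" "pder pr a (\<lambda>u. gone) u = 0"
    "pder pr a (\<lambda>u. 0) u = 0"
  by (cases "pr a"; simp add: pder_odd pder_even linear_scale[OF linear_oder] linear_0[OF linear_oder])+

lemma pder_sum:
  assumes "obody pr U" "u \<in> U" "\<And>i. i \<in> X \<Longrightarrow> f i differentiable_on U"
  shows "pder pr a (\<lambda>u. \<Sum>i\<in>X. f i u) u = (\<Sum>i\<in>X. pder pr a (f i) u)"
proof (cases "pr a")
  case False
  show ?thesis
    by (intro pder_eqI[of pr a, OF False] has_vector_derivative_sum pder_line[OF assms(1,2) False] assms(3))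
qed (simp add: pder_odd linear_sum[OF linear_oder])

lemma pder_gmul:
  assumes "obody pr U" "u \<in> U" "f differentiable_on U" "g differentiable_on U"
  shows "pder pr a (\<lambda>u. f u \<cdot> g u) u = pder pr a f u \<cdot> g u + gtwist (pr a) (f u) \<cdot> pder pr a g u"
proof (cases "pr a")
  case False
  show ?thesis
    using gmul.has_vector_derivative[OF pder_line[OF assms(1,2) False assms(3)]
        pder_line[OF assms(1,2) False assms(4)]] False
    by (intro pder_eqI[of pr a, OF False]) (simp add: add.commute)
qed (simp add: pder_odd oder_gmul)

lemma pder_gmul_gpar:
  assumes "obody pr U" "u \<in> U" "f differentiable_on U" "g differentiable_on U" "gpar e (f u)"
  shows "pder pr a (\<lambda>u. f u \<cdot> g u) u = pder pr a f u \<cdot> g u + ksign (pr a) e *\<^sub>R (f u \<cdot> pder pr a g u)"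
  using pder_gmul[OF assms(1-4)] gtwist_gpar[OF assms(5)] by (simp add: gmul_linear)

lemma differentiable_on_linear:
  fixes f :: "'a::euclidean_space \<Rightarrow> 'b::euclidean_space" and L :: "'b \<Rightarrow> 'd::euclidean_space"
  assumes "linear L" "f differentiable_on U"
  shows "(\<lambda>u. L (f u)) differentiable_on U"
  using assms bounded_linear.has_derivative[of L] unfolding linear_conv_bounded_linear
    differentiable_on_def differentiable_def by blast

lemma differentiable_on_gmul:
  "f differentiable_on U \<Longrightarrow> g differentiable_on U \<Longrightarrow> (\<lambda>u. f u \<cdot> g u) differentiable_on U"
  unfolding differentiable_on_def differentiable_def using gmul.FDERIV by blast

lemma differentiable_on_sum:
  "(\<And>i. i \<in> X \<Longrightarrow> f i differentiable_on U) \<Longrightarrow> (\<lambda>u. \<Sum>i\<in>X. f i u) differentiable_on U"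
  by (induction X rule: infinite_finite_induct) auto

subsection \<open>Differentiability of finite order\<close>

text \<open>\<open>smooth_on\<close> speaks of all lists of directions at once. Counting the order
  permits induction with one derivative peeled off at a time, which is how products and
  substitutions are handled.\<close>

fun ck :: "nat \<Rightarrow> ('c::{finite,linorder} \<Rightarrow> bool) \<Rightarrow> 'c point set \<Rightarrow> 'c sfun \<Rightarrow> bool" where
  "ck 0 pr U f \<longleftrightarrow> f differentiable_on U"
| "ck (Suc n) pr U f \<longleftrightarrow> f differentiable_on U \<and> (\<forall>a. \<not> pr a \<longrightarrow> ck n pr U (pder pr a f))"

lemma ck_differentiable: "ck n pr U f \<Longrightarrow> f differentiable_on U"
  by (cases n) auto

lemma ck_Suc: "ck (Suc n) pr U f \<Longrightarrow> ck n pr U f"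
  by (induction n arbitrary: f) auto

lemma differentiable_on_cong:
  "(\<And>u. u \<in> U \<Longrightarrow> f u = g u) \<Longrightarrow> f differentiable_on U \<Longrightarrow> g differentiable_on U"
  unfolding differentiable_on_def differentiable_def by (metis has_derivative_transform)

lemma ck_cong:
  assumes "obody pr U" "\<And>u. u \<in> U \<Longrightarrow> f u = g u" "ck n pr U f"
  shows "ck n pr U g"
  using assms(2,3)
proof (induction n arbitrary: f g)
  case (Suc n)
  have "ck n pr U (pder pr a g)" if "\<not> pr a" for a
  proof (rule Suc.IH)
    show "pder pr a f u = pder pr a g u" if "u \<in> U" for u
      using pder_cong[of pr U f g u a, OF assms(1) Suc.prems(1)] that by blast
    show "ck n pr U (pder pr a f)" using Suc.prems(2) that by simp
  qed
  moreover have "g differentiable_on U"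
    using differentiable_on_cong[of U f g] Suc.prems(1) ck_differentiable[OF Suc.prems(2)] by blast
  ultimately show ?case by simp
qed (auto intro: differentiable_on_cong)

lemma ck_fold:
  "ck n pr U f \<longleftrightarrow> (\<forall>as. length as \<le> n \<and> (\<forall>a\<in>set as. \<not> pr a) \<longrightarrow> fold (pder pr) as f differentiable_on U)"
  (is "_ \<longleftrightarrow> ?R n f")
proof (induction n arbitrary: f)
  case (Suc n)
  show ?case
  proof
    assume L: "ck (Suc n) pr U f"
    show "?R (Suc n) f"
    proof (intro allI impI)
      fix as assume as: "length as \<le> Suc n \<and> (\<forall>a\<in>set as. \<not> pr a)"
      then show "fold (pder pr) as f differentiable_on U"
      proof (cases as)
        case (Cons a bs)
        then have "?R n (pder pr a f)" using L as Suc by simp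
        then show ?thesis using Cons as by simp
      qed (use L in simp)
    qed
  next
    assume R: "?R (Suc n) f"
    have "ck n pr U (pder pr a f)" if "\<not> pr a" for a
      unfolding Suc
    proof (intro allI impI)
      fix as assume "length as \<le> n \<and> (\<forall>a\<in>set as. \<not> pr a)"
      then show "fold (pder pr) as (pder pr a f) differentiable_on U"
        using R[rule_format, of "a # as"] that by simp
    qed
    moreover have "f differentiable_on U" using R[rule_format, of "[]"] by simp
    ultimately show "ck (Suc n) pr U f" by simp
  qed
qed auto

lemma smooth_on_iff_ck: "smooth_on pr U f \<longleftrightarrow> (\<forall>n. ck n pr U f)"
  unfolding smooth_on_def ck_fold by auto

lemma ck_zero: "ck n pr U (\<lambda>u. 0)"
proof (induction n)
  case (Suc n)
  have "pder pr a (\<lambda>u. 0) = (\<lambda>u. 0)" for a by auto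
  then show ?case using Suc by simp
qed simp

lemma ck_const: "ck n pr U (\<lambda>u. c *\<^sub>R gone)"
proof (cases n)
  case (Suc m)
  have "pder pr a (\<lambda>u. c *\<^sub>R gone) = (\<lambda>u. 0)" for a by auto
  then show ?thesis using Suc by (simp add: ck_zero)
qed simp

lemma ck_linear:
  assumes "linear L" "obody pr U" "ck n pr U f"
  shows "ck n pr U (\<lambda>u. L (f u))"
  using assms(3)
proof (induction n arbitrary: f)
  case 0
  then show ?case using differentiable_on_linear[OF assms(1)] by simp
next
  case (Suc n)
  have "ck n pr U (pder pr a (\<lambda>u. L (f u)))" if "\<not> pr a" for a
  proof -
    have f: "f differentiable_on U" "ck n pr U (pder pr a f)" using Suc.prems that by simp_all
    show ?thesis
      by (rule ck_cong[OF assms(2) _ Suc.IH[OF f(2)]]) (simp add: pder_linear[OF assms(1,2) _ f(1) that])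
  qed
  moreover have "f differentiable_on U" using Suc.prems by simp
  ultimately show ?case using differentiable_on_linear[OF assms(1), of f U] by simp
qed

lemma ck_add:
  assumes "obody pr U" "ck n pr U f" "ck n pr U g"
  shows "ck n pr U (\<lambda>u. f u + g u)"
  using assms(2,3)
proof (induction n arbitrary: f g)
  case (Suc n)
  have "ck n pr U (pder pr a (\<lambda>u. f u + g u))" if "\<not> pr a" for a
  proof -
    have f: "f differentiable_on U" "g differentiable_on U" "ck n pr U (pder pr a f)" "ck n pr U (pder pr a g)"
      using Suc.prems that by simp_all
    show ?thesis
      by (rule ck_cong[OF assms(1) _ Suc.IH[OF f(3,4)]]) (simp add: pder_add[OF assms(1) _ f(1,2)])
  qed
  then show ?case using Suc.prems by simp
qed simp

lemma ck_sum:
  assumes "obody pr U" "\<And>i. i \<in> X \<Longrightarrow> ck n pr U (f i)"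
  shows "ck n pr U (\<lambda>u. \<Sum>i\<in>X. f i u)"
  using assms by (induction X rule: infinite_finite_induct) (auto simp: ck_zero ck_add)

text \<open>In the Leibniz rule only one factor is differentiated, so the other one is lowered by
  one order to meet the induction hypothesis.\<close>

lemma ck_gmul:
  assumes "obody pr U" "ck n pr U f" "ck n pr U g"
  shows "ck n pr U (\<lambda>u. f u \<cdot> g u)"
  using assms(2,3)
proof (induction n arbitrary: f g)
  case 0
  then show ?case by (simp add: differentiable_on_gmul)
next
  case (Suc n)
  have "ck n pr U (pder pr a (\<lambda>u. f u \<cdot> g u))" if a: "\<not> pr a" for a
  proof -
    have f: "f differentiable_on U" "g differentiable_on U" "ck n pr U (pder pr a f)" "ck n pr U (pder pr a g)"
      using Suc.prems a by simp_all
    show ?thesis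
      by (rule ck_cong[OF assms(1) _ ck_add[OF assms(1) Suc.IH[OF f(3) Suc.prems(2)[THEN ck_Suc]]
              Suc.IH[OF Suc.prems(1)[THEN ck_Suc] f(4)]]])
        (simp add: pder_gmul[OF assms(1) _ f(1,2)] a)
  qed
  then show ?case using Suc.prems by (simp add: differentiable_on_gmul)
qed

lemma pder_crd [simp]: "pder pr a (crd pr b) u = (if a = b then gone else 0)"
proof (cases "pr a")
  case True
  then show ?thesis
    by (auto simp: pder_odd crd_def oder_axis linear_scale[OF linear_oder])
next
  case False
  have "((\<lambda>t. crd pr b (u + t *\<^sub>R axis a 1)) has_vector_derivative (if a = b then gone else 0)) (at 0)"
  proof (cases "pr b")
    case True
    then show ?thesis using False by (auto simp: crd_def)
  next
    case False
    have "((\<lambda>t. (u $ b + t * axis a 1 $ b) *\<^sub>R gone) has_vector_derivative (axis a 1 $ b) *\<^sub>R gone) (at 0)"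
      by (auto intro!: derivative_eq_intros)
    then show ?thesis using False by (cases "a = b") (simp_all add: crd_def axis_def)
  qed
  then show ?thesis by (rule pder_eqI[of pr a, OF False])
qed

lemma crd_differentiable: "crd pr b differentiable_on U"
proof (cases "pr b")
  case True
  then have "crd pr b = (\<lambda>u. axis {b} 1)" by (auto simp: crd_def)
  then show ?thesis by simp
next
  case False
  then have "crd pr b = (\<lambda>u. (u $ b) *\<^sub>R gone)" by (auto simp: crd_def)
  moreover have "(\<lambda>u::'a point. u $ b) differentiable_on U"
    by (simp add: bounded_linear_imp_differentiable_on bounded_linear_vec_nth)
  ultimately show ?thesis by simp
qed

lemma ck_crd: "ck n pr U (crd pr b)"
proof (cases n)
  case (Suc m)
  have "ck m pr U (pder pr a (crd pr b))" for a
  proof -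
    have "pder pr a (crd pr b) = (\<lambda>u. (if a = b then 1 else 0) *\<^sub>R gone)" by auto
    then show ?thesis by (simp only: ck_const)
  qed
  then show ?thesis using Suc crd_differentiable by simp
qed (simp add: crd_differentiable)

subsection \<open>Symmetry of second derivatives\<close>

text \<open>The second difference over a square is the increment of a difference in the first
  variable. The mean value theorem applies to that increment and then once more in the second
  variable.\<close>

lemma mixed_derivatives_MVT:
  fixes p :: "real \<Rightarrow> real \<Rightarrow> real"
  assumes p: "\<And>s t. \<bar>s\<bar> < d \<Longrightarrow> \<bar>t\<bar> < d \<Longrightarrow> ((\<lambda>s. p s t) has_real_derivative ps s t) (at s)"
    and ps: "\<And>s t. \<bar>s\<bar> < d \<Longrightarrow> \<bar>t\<bar> < d \<Longrightarrow> ((\<lambda>t. ps s t) has_real_derivative pst s t) (at t)"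
    and h: "0 < h" "h < d"
  obtains s t where "0 < s" "s < h" "0 < t" "t < h" "p h h - p h 0 - p 0 h + p 0 0 = h * h * pst s t"
proof -
  have "\<exists>s>0. s < h \<and> (p h h - p h 0) - (p 0 h - p 0 0) = (h - 0) * (ps s h - ps s 0)"
    using h by (intro MVT2) (auto intro!: DERIV_diff p)
  then obtain s where s: "0 < s" "s < h" "(p h h - p h 0) - (p 0 h - p 0 0) = (h - 0) * (ps s h - ps s 0)"
    by blast
  have "\<exists>t>0. t < h \<and> ps s h - ps s 0 = (h - 0) * pst s t"
    using h s by (intro MVT2) (auto intro!: ps)
  then show thesis using s that by force
qed

text \<open>The theorem of Schwarz: the second difference is symmetric in the two variables, hence
  equals \<open>h * h\<close> times either mixed derivative at some interior point, and both are
  continuous at the origin.\<close>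

lemma mixed_derivatives_eq:
  fixes p :: "real \<Rightarrow> real \<Rightarrow> real"
  assumes d: "d > 0"
    and p: "\<And>s t. \<bar>s\<bar> < d \<Longrightarrow> \<bar>t\<bar> < d \<Longrightarrow> ((\<lambda>s. p s t) has_real_derivative ps s t) (at s)"
      "\<And>s t. \<bar>s\<bar> < d \<Longrightarrow> \<bar>t\<bar> < d \<Longrightarrow> ((\<lambda>t. p s t) has_real_derivative pt s t) (at t)"
      "\<And>s t. \<bar>s\<bar> < d \<Longrightarrow> \<bar>t\<bar> < d \<Longrightarrow> ((\<lambda>t. ps s t) has_real_derivative pst s t) (at t)"
      "\<And>s t. \<bar>s\<bar> < d \<Longrightarrow> \<bar>t\<bar> < d \<Longrightarrow> ((\<lambda>s. pt s t) has_real_derivative pts s t) (at s)"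
    and cont: "\<And>e. e > 0 \<Longrightarrow> \<exists>r>0. \<forall>s t. \<bar>s\<bar> < r \<longrightarrow> \<bar>t\<bar> < r \<longrightarrow> \<bar>pst s t - pst 0 0\<bar> < e"
      "\<And>e. e > 0 \<Longrightarrow> \<exists>r>0. \<forall>s t. \<bar>s\<bar> < r \<longrightarrow> \<bar>t\<bar> < r \<longrightarrow> \<bar>pts s t - pts 0 0\<bar> < e"
  shows "pst 0 0 = pts 0 0"
proof (rule ccontr)
  assume ne: "pst 0 0 \<noteq> pts 0 0"
  \<comment> \<open>Half the gap, so that no common value is within \<open>e\<close> of both
    numbers.\<close>
  define e where "e = \<bar>pst 0 0 - pts 0 0\<bar> / 2"
  have e: "e > 0" using ne by (simp add: e_def)
  obtain r where r: "r > 0" "\<And>s t. \<bar>s\<bar> < r \<Longrightarrow> \<bar>t\<bar> < r \<Longrightarrow> \<bar>pst s t - pst 0 0\<bar> < e"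
    using cont(1)[OF e] by blast
  obtain r' where r': "r' > 0" "\<And>s t. \<bar>s\<bar> < r' \<Longrightarrow> \<bar>t\<bar> < r' \<Longrightarrow> \<bar>pts s t - pts 0 0\<bar> < e"
    using cont(2)[OF e] by blast
  define h where "h = min d (min r r') / 2"
  have h: "0 < h" "h < d" "h < r" "h < r'" using d r(1) r'(1) by (auto simp: h_def)
  obtain s t where st: "0 < s" "s < h" "0 < t" "t < h"
    "p h h - p h 0 - p 0 h + p 0 0 = h * h * pst s t"
    by (rule mixed_derivatives_MVT[OF p(1) p(3) h(1,2)])
  \<comment> \<open>The same mean value argument with the two variables exchanged.\<close>
  obtain t' s' where st': "0 < t'" "t' < h" "0 < s'" "s' < h"
    "p h h - p 0 h - p h 0 + p 0 0 = h * h * pts s' t'"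
    by (rule mixed_derivatives_MVT[of d "\<lambda>t s. p s t" "\<lambda>t s. pt s t" "\<lambda>t s. pts s t",
          OF p(2)[rotated] p(4)[rotated] h(1,2)])
  have "h * h * pst s t = h * h * pts s' t'" using st(5) st'(5) by linarith
  then have "pst s t = pts s' t'" using h(1) by simp
  moreover have "\<bar>pst s t - pst 0 0\<bar> < e" using st h by (intro r(2)) auto
  moreover have "\<bar>pts s' t' - pts 0 0\<bar> < e" using st' h by (intro r'(2)) auto
  ultimately show False unfolding e_def by (smt (verit) field_sum_of_halves)
qed

lemma continuous_plane:
  fixes f :: "'c::finite point \<Rightarrow> real"
  assumes "continuous_on U f" "u \<in> U" "e > 0" "d > 0"
    and U: "\<And>s t. \<bar>s\<bar> < d \<Longrightarrow> \<bar>t\<bar> < d \<Longrightarrow> u + s *\<^sub>R axis a 1 + t *\<^sub>R axis b 1 \<in> U"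
  shows "\<exists>r>0. \<forall>s t. \<bar>s\<bar> < r \<longrightarrow> \<bar>t\<bar> < r \<longrightarrow> \<bar>f (u + s *\<^sub>R axis a 1 + t *\<^sub>R axis b 1) - f u\<bar> < e"
proof -
  obtain r where r: "r > 0" "\<And>v. v \<in> U \<Longrightarrow> dist v u < r \<Longrightarrow> \<bar>f v - f u\<bar> < e"
    using continuous_on_iff[THEN iffD1, OF assms(1), rule_format, OF assms(2,3)]
    by (auto simp: dist_real_def)
  have "\<bar>f (u + s *\<^sub>R axis a 1 + t *\<^sub>R axis b 1) - f u\<bar> < e"
    if "\<bar>s\<bar> < min d (r / 2)" "\<bar>t\<bar> < min d (r / 2)" for s t
  proof (rule r(2))
    have "norm (s *\<^sub>R axis a 1 + t *\<^sub>R axis b (1::real)) < r"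
      using that norm_triangle_ineq[of "s *\<^sub>R axis a (1::real)" "t *\<^sub>R axis b 1"] by simp
    then show "dist (u + s *\<^sub>R axis a 1 + t *\<^sub>R axis b 1) u < r"
      by (simp add: dist_norm add.assoc)
  qed (use that U in simp)
  then show ?thesis using r(1) assms(4) by (intro exI[of _ "min d (r/2)"]) simp
qed

lemma pder_line_nth:
  assumes "obody pr U" "\<not> pr a" "f differentiable_on U" "u + s *\<^sub>R axis a 1 \<in> U"
  shows "((\<lambda>s. f (u + s *\<^sub>R axis a 1) $ I) has_real_derivative pder pr a f (u + s *\<^sub>R axis a 1) $ I) (at s)"
proof -
  have "((\<lambda>t. f (u + s *\<^sub>R axis a 1 + t *\<^sub>R axis a 1) $ I) has_vector_derivative
      pder pr a f (u + s *\<^sub>R axis a 1) $ I) (at 0)"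
    using bounded_linear.has_vector_derivative[OF bounded_linear_vec_nth
        pder_line[OF assms(1,4,2,3)]] .
  then have "((\<lambda>t. f (u + (t + s) *\<^sub>R axis a 1) $ I) has_real_derivative
      pder pr a f (u + s *\<^sub>R axis a 1) $ I) (at 0)"
    by (simp add: has_real_derivative_iff_has_vector_derivative algebra_simps)
  then show ?thesis
    using DERIV_shift[of "\<lambda>t. f (u + t *\<^sub>R axis a 1) $ I" _ 0 s] by simp
qed

lemma pder_commute_even:
  assumes U: "obody pr U" "u \<in> U" and a: "\<not> pr a" "\<not> pr b" and f: "ck 2 pr U f"
  shows "pder pr a (pder pr b f) u = pder pr b (pder pr a f) u"
proof (rule vec_eq_iff[THEN iffD2, rule_format])
  fix I
  have diff: "f differentiable_on U" "pder pr a f differentiable_on U" "pder pr b f differentiable_on U"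
    "pder pr a (pder pr b f) differentiable_on U" "pder pr b (pder pr a f) differentiable_on U"
    using f a by (auto simp: numeral_2_eq_2)
  then have cont: "continuous_on U (\<lambda>u. pder pr a (pder pr b f) u $ I)"
    "continuous_on U (\<lambda>u. pder pr b (pder pr a f) u $ I)"
    using differentiable_imp_continuous_on continuous_on_component by blast+
  let ?l = "\<lambda>s t. u + s *\<^sub>R axis a 1 + t *\<^sub>R axis b 1"
  obtain d where d: "d > 0" "\<And>s t. \<bar>s\<bar> < d \<Longrightarrow> \<bar>t\<bar> < d \<Longrightarrow> ?l s t \<in> U"
    using obody_line2[OF U a] by blast
  have swap: "?l s t = u + t *\<^sub>R axis b 1 + s *\<^sub>R axis a 1" for s t by simp
  have "pder pr b (pder pr a f) (?l 0 0) $ I = pder pr a (pder pr b f) (?l 0 0) $ I"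
  proof (rule mixed_derivatives_eq[where p = "\<lambda>s t. f (?l s t) $ I"
        and ps = "\<lambda>s t. pder pr a f (?l s t) $ I" and pt = "\<lambda>s t. pder pr b f (?l s t) $ I"
        and pst = "\<lambda>s t. pder pr b (pder pr a f) (?l s t) $ I"
        and pts = "\<lambda>s t. pder pr a (pder pr b f) (?l s t) $ I"])
    show "d > 0" by fact
    fix s t :: real assume st: "\<bar>s\<bar> < d" "\<bar>t\<bar> < d"
    note l = d(2)[OF st]
    show "((\<lambda>s. f (?l s t) $ I) has_real_derivative pder pr a f (?l s t) $ I) (at s)"
      "((\<lambda>s. pder pr b f (?l s t) $ I) has_real_derivative pder pr a (pder pr b f) (?l s t) $ I) (at s)"
      using pder_line_nth[OF U(1) a(1) _ l[unfolded swap]] diff unfolding swap by blast+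
    show "((\<lambda>t. f (?l s t) $ I) has_real_derivative pder pr b f (?l s t) $ I) (at t)"
      "((\<lambda>t. pder pr a f (?l s t) $ I) has_real_derivative pder pr b (pder pr a f) (?l s t) $ I) (at t)"
      using pder_line_nth[OF U(1) a(2) _ l] diff by blast+
  next
    fix e :: real assume "e > 0"
    then show "\<exists>r>0. \<forall>s t. \<bar>s\<bar> < r \<longrightarrow> \<bar>t\<bar> < r \<longrightarrow>
        \<bar>pder pr b (pder pr a f) (?l s t) $ I - pder pr b (pder pr a f) (?l 0 0) $ I\<bar> < e"
      "\<exists>r>0. \<forall>s t. \<bar>s\<bar> < r \<longrightarrow> \<bar>t\<bar> < r \<longrightarrow>
        \<bar>pder pr a (pder pr b f) (?l s t) $ I - pder pr a (pder pr b f) (?l 0 0) $ I\<bar> < e"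
      using continuous_plane[OF cont(1) U(2) _ d] continuous_plane[OF cont(2) U(2) _ d] by simp_all
  qed
  then show "pder pr a (pder pr b f) u $ I = pder pr b (pder pr a f) u $ I" by simp
qed

subsection \<open>Closure properties\<close>

lemma superfun_iff: "superfun pr U f \<longleftrightarrow> (\<forall>n. ck n pr U f) \<and> (\<forall>u\<in>U. gsupp {a. pr a} (f u))"
  by (auto simp: superfun_def smooth_on_iff_ck gsupp_def)

lemma superfun_differentiable: "superfun pr U f \<Longrightarrow> f differentiable_on U"
  by (meson superfun_iff ck_differentiable)

lemma superfun_subset:
  assumes "superfun pr U f" "V \<subseteq> U"
  shows "superfun pr V f"
  using assms unfolding superfun_def smooth_on_def by (meson differentiable_on_subset subsetD)

lemma superfun_cong:
  "obody pr U \<Longrightarrow> (\<And>u. u \<in> U \<Longrightarrow> f u = g u) \<Longrightarrow> superfun pr U f \<Longrightarrow> superfun pr U g"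
  unfolding superfun_iff using ck_cong by metis

lemma superfun_zero [simp]: "superfun pr U (\<lambda>u. 0)"
  and superfun_const [simp]: "superfun pr U (\<lambda>u. c *\<^sub>R gone)"
  by (simp_all add: superfun_iff ck_zero ck_const gsupp_scaleR)

lemma superfun_gone [simp]: "superfun pr U (\<lambda>u. gone)"
  using superfun_const[of pr U 1] by simp

lemma superfun_crd [simp]: "superfun pr U (crd pr b)"
  by (auto simp: superfun_iff ck_crd) (auto simp: crd_def gsupp_axis gsupp_scaleR)

lemma superfun_linear:
  assumes "linear L" "\<And>x A. gsupp A x \<Longrightarrow> gsupp A (L x)" "obody pr U" "superfun pr U f"
  shows "superfun pr U (\<lambda>u. L (f u))"
  using assms(2,4) ck_linear[OF assms(1,3)] by (simp add: superfun_iff)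

lemma superfun_scaleR: "obody pr U \<Longrightarrow> superfun pr U f \<Longrightarrow> superfun pr U (\<lambda>u. c *\<^sub>R f u)"
  by (rule superfun_linear) (auto simp: linear_iff algebra_simps gsupp_scaleR)

lemma superfun_gtwist: "obody pr U \<Longrightarrow> superfun pr U f \<Longrightarrow> superfun pr U (\<lambda>u. gtwist e (f u))"
  by (rule superfun_linear) (auto simp: linear_gtwist gsupp_gtwist)

lemma superfun_add: "obody pr U \<Longrightarrow> superfun pr U f \<Longrightarrow> superfun pr U g \<Longrightarrow> superfun pr U (\<lambda>u. f u + g u)"
  by (auto simp: superfun_iff intro: ck_add gsupp_add)

lemma superfun_sum:
  "obody pr U \<Longrightarrow> (\<And>i. i \<in> X \<Longrightarrow> superfun pr U (f i)) \<Longrightarrow> superfun pr U (\<lambda>u. \<Sum>i\<in>X. f i u)"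
  by (auto simp: superfun_iff intro: ck_sum gsupp_sum)

lemma superfun_gmul: "obody pr U \<Longrightarrow> superfun pr U f \<Longrightarrow> superfun pr U g \<Longrightarrow> superfun pr U (\<lambda>u. f u \<cdot> g u)"
  by (auto simp: superfun_iff intro: ck_gmul gsupp_gmul)

text \<open>Parity, support and weight conditions all have the form \<open>L x = x\<close> for a
  projection \<open>L\<close> onto some of the coefficients. In this form they pass to even
  derivatives, because \<open>L\<close> commutes with limits.\<close>

lemma pder_invariant:
  assumes "linear L" "obody pr U" "u \<in> U" "f differentiable_on U" "\<not> pr a"
    and "\<And>u. u \<in> U \<Longrightarrow> L (f u) = f u"
  shows "L (pder pr a f u) = pder pr a f u"
  unfolding pder_linear[OF assms(1-5), symmetric] using assms(2,3,6) by (intro pder_cong)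

lemma gsupp_pder:
  assumes "obody pr U" "u \<in> U" "f differentiable_on U" "\<And>u. u \<in> U \<Longrightarrow> gsupp A (f u)"
  shows "gsupp A (pder pr a f u)"
proof (cases "pr a")
  case False
  define L :: "'a grass \<Rightarrow> 'a grass" where "L x = (\<chi> I. if I \<subseteq> A then x $ I else 0)" for x
  have "gsupp A x \<longleftrightarrow> L x = x" for x
    by (auto simp: L_def gsupp_def vec_eq_iff)
  moreover have "linear L" by (auto simp: linear_iff L_def vec_eq_iff)
  ultimately show ?thesis using pder_invariant[of L, OF _ assms(1-3) False] assms(4) by simp
qed (simp add: pder_odd gsupp_oder assms)

lemma linear_gpart: "linear (gpart e)"
  by (auto simp: linear_iff gpart_def vec_eq_iff)

lemma gpar_pder:
  assumes "obody pr U" "u \<in> U" "f differentiable_on U" "has_parity U e f"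
  shows "gpar (e \<noteq> pr a) (pder pr a f u)"
proof (cases "pr a")
  case False
  have "gpart e (pder pr a f u) = pder pr a f u"
    using assms(4) by (intro pder_invariant[OF linear_gpart assms(1-3) False])
      (simp add: gpart_id has_parity_iff)
  then show ?thesis using gpar_gpart[of e "pder pr a f u"] False by simp
qed (use assms gpar_oder[of e "f u"] in \<open>auto simp: pder_odd has_parity_iff\<close>)

lemma has_parity_pder:
  "obody pr U \<Longrightarrow> f differentiable_on U \<Longrightarrow> has_parity U e f \<Longrightarrow> has_parity U (e \<noteq> pr a) (pder pr a f)"
  unfolding has_parity_iff[of U "e \<noteq> pr a"] using gpar_pder by blast

lemma superfun_pder:
  assumes "obody pr U" "superfun pr U f"
  shows "superfun pr U (pder pr a f)"
proof -
  have "ck n pr U (pder pr a f)" for n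
  proof (cases "pr a")
    case True
    have "pder pr a f = (\<lambda>u. oder a (f u))" using True by (auto simp: pder_odd)
    then show ?thesis using ck_linear[OF linear_oder assms(1)] assms(2) by (simp add: superfun_iff)
  next
    case False
    then show ?thesis using assms(2) ck.simps(2)[of n pr U f] by (simp add: superfun_iff del: ck.simps)
  qed
  then show ?thesis
    using gsupp_pder[OF assms(1) _ superfun_differentiable[OF assms(2)]] assms(2) by (auto simp: superfun_iff)
qed

text \<open>Two even directions are the theorem of Schwarz, two odd ones
  \<open>oder_anticommute\<close>. In the mixed case \<open>oder\<close> is a linear map and
  commutes with differentiation along a line.\<close>

lemma pder_commute:
  assumes "obody pr U" "u \<in> U" "superfun pr U f"
  shows "pder pr a (pder pr b f) u = ksign (pr a) (pr b) *\<^sub>R pder pr b (pder pr a f) u"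
proof -
  have *: "pder pr b (\<lambda>u. oder a (f u)) u = oder a (pder pr b f u)" if "\<not> pr b" for a b
    using pder_linear[OF linear_oder assms(1,2) superfun_differentiable[OF assms(3)] that] .
  have odd: "pder pr a f = (\<lambda>u. oder a (f u))" if "pr a" for a
    using that by (auto simp: pder_odd)
  show ?thesis
    using *[of a b] *[of b a] pder_commute_even[OF assms(1,2), of a b f] assms(3)
      oder_anticommute[of a b "f u"]
    by (cases "pr a"; cases "pr b") (auto simp: ksign_def pder_odd odd superfun_iff)
qed

lemma has_parity_crd [simp]: "has_parity U (pr a) (crd pr a)"
  by (auto simp: has_parity_iff crd_def gpar_scaleR) (simp add: gpar_def axis_def)

lemma gpar_crd [simp]: "gpar (pr a) (crd pr a u)"
  using has_parity_crd[of UNIV pr a] by (simp add: has_parity_iff)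

section \<open>Substitution\<close>

lemma gmul_supercommute_left:
  assumes "gpar e x" "gpar e' y"
  shows "x \<cdot> (y \<cdot> z) = ksign e e' *\<^sub>R (y \<cdot> (x \<cdot> z))"
  unfolding gmul_assoc[symmetric] gmul_supercommute[OF assms] by (simp add: gmul_linear)

definition gbody :: "('d \<Rightarrow> ('c::finite) grass) \<Rightarrow> ('d::finite) point" where
  "gbody g = (\<chi> b. g b $ {})"

lemma bodymap_eq: "bodymap y u = gbody (\<lambda>b. y b u)"
  by (simp add: bodymap_def gbody_def)

text \<open>\<open>k!\<close> times the term of order \<open>k\<close> of the Taylor expansion.\<close>

primrec tsub :: "('d::{finite,linorder} \<Rightarrow> bool) \<Rightarrow> ('d \<Rightarrow> ('c::{finite,linorder}) grass) \<Rightarrow> nat \<Rightarrow>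
    'd sfun \<Rightarrow> 'c grass" where
  "tsub pr g 0 F = (F (gbody g) $ {}) *\<^sub>R gone"
| "tsub pr g (Suc k) F = (\<Sum>b\<in>UNIV. gnil (g b) \<cdot> tsub pr g k (pder pr b F))"

text \<open>\<open>subst_sfun\<close> at one point. The value depends only on the substituted
  algebra elements \<open>g\<close>, which can then be deformed independently of any point of the
  body.\<close>

definition gsub :: "('d::{finite,linorder} \<Rightarrow> bool) \<Rightarrow> ('d \<Rightarrow> ('c::{finite,linorder}) grass) \<Rightarrow>
    'd sfun \<Rightarrow> 'c grass" where
  "gsub pr g F = (\<Sum>k\<le>CARD('c). (1 / fact k) *\<^sub>R tsub pr g k F)"

text \<open>Peeling the head off a list matches the recursion: the head is differentiated first and
  its nilpotent factor stands leftmost, the order in which left derivatives give the right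
  signs.\<close>

lemma tsub_eq_sum:
  fixes g :: "'d::{finite,linorder} \<Rightarrow> ('c::{finite,linorder}) grass"
  shows "tsub pr g k F = (\<Sum>bs\<in>{bs. length bs = k}.
     (fold (pder pr) bs F (gbody g) $ {}) *\<^sub>R gprod (map (\<lambda>b. gnil (g b)) bs))"
proof (induction k arbitrary: F)
  case 0
  have "{bs. length bs = 0} = {[]}" by auto
  then show ?case by (simp add: gprod_def)
next
  case (Suc k)
  have eq: "{bs. length bs = Suc k} = (\<lambda>(b, bs). b # bs) ` (UNIV \<times> {bs :: 'd list. length bs = k})"
    by (auto simp: image_iff length_Suc_conv)
  have inj: "inj_on (\<lambda>(b, bs). b # bs) (UNIV \<times> {bs :: 'd list. length bs = k})"
    by (auto simp: inj_on_def)
  show ?case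
    unfolding tsub.simps Suc gmul.sum_right sum.cartesian_product eq sum.reindex[OF inj]
    by (intro sum.cong) (auto simp: gprod_def gmul_linear)
qed

lemma subst_sfun_eq: "subst_sfun pr F y u = gsub pr (\<lambda>b. y b u) F"
  by (simp add: subst_sfun_def gsub_def tsub_eq_sum bodymap_eq nilp_def[abs_def] gnil_def)

lemma lev_tsub: "lev k (tsub pr g k F)"
proof (induction k arbitrary: F)
  case (Suc k)
  then show ?case using lev_gmul[OF lev_gnil] by (auto intro!: lev_sum)
qed simp

lemma tsub_eq_0: "CARD('c) < k \<Longrightarrow> tsub pr g k F = 0" for g :: "'d::{finite,linorder} \<Rightarrow> ('c::{finite,linorder}) grass"
  using lev_gt_eq_0[OF lev_tsub] .

text \<open>The truncation order may be raised freely, which makes substitutions into algebras with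
  different numbers of generators comparable.\<close>

lemma gsub_extend:
  fixes g :: "'d::{finite,linorder} \<Rightarrow> ('c::{finite,linorder}) grass"
  assumes "CARD('c) \<le> n"
  shows "gsub pr g F = (\<Sum>k\<le>n. (1 / fact k) *\<^sub>R tsub pr g k F)"
  unfolding gsub_def using assms by (intro sum.mono_neutral_left) (auto simp: tsub_eq_0)

lemma gsub_body: "gsub pr g F $ {} = F (gbody g) $ {}"
proof -
  have "tsub pr g k F $ {} = 0" if "k \<noteq> 0" for k
    using lev_tsub[of k pr g F] that by (simp add: lev_def)
  then have "gsub pr g F $ {} = (\<Sum>k\<in>{0}. (1 / fact k) * (tsub pr g k F $ {}))"
    unfolding gsub_def sum_component vector_scaleR_component real_scaleR_def by (intro sum.mono_neutral_right) auto
  then show ?thesis by (simp add: gone_nth)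
qed

lemma gsub_trivial:
  assumes "\<And>b. gnil (g b) = 0"
  shows "gsub pr g F = (F (gbody g) $ {}) *\<^sub>R gone"
proof -
  have "tsub pr g k F = 0" if "k \<noteq> 0" for k
    using assms that by (cases k) auto
  then have "gsub pr g F = (\<Sum>k\<in>{0}. (1 / fact k) *\<^sub>R tsub pr g k F)"
    unfolding gsub_def by (intro sum.mono_neutral_right) auto
  then show ?thesis by simp
qed

text \<open>The algebra-valued points of the superdomain over \<open>V\<close>, in the sense of the
  functor of points.\<close>

definition gpoint :: "('d::{finite,linorder} \<Rightarrow> bool) \<Rightarrow> 'd point set \<Rightarrow> ('d \<Rightarrow> ('c::{finite,linorder}) grass) \<Rightarrow> bool" where
  "gpoint pr V g \<longleftrightarrow> obody pr V \<and> gbody g \<in> V \<and> (\<forall>b. gpar (pr b) (g b))"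

lemma gbody_body_space: "(\<And>b. gpar (pr b) (g b)) \<Longrightarrow> gbody g \<in> body_space pr"
  by (auto simp: body_space_def gbody_def intro!: gpar_odd_body) (metis (full_types))

lemma tsub_cong:
  assumes "obody pr V" "gbody g \<in> V" "\<And>v. v \<in> V \<Longrightarrow> F v = G v"
  shows "tsub pr g k F = tsub pr g k G"
  using assms(3)
proof (induction k arbitrary: F G)
  case (Suc k)
  have "tsub pr g k (pder pr b F) = tsub pr g k (pder pr b G)" for b
    by (rule Suc.IH, rule pder_cong[OF assms(1) Suc.prems])
  then show ?case by simp
qed (simp add: assms)

lemma gsub_cong:
  assumes "obody pr V" "gbody g \<in> V" "\<And>v. v \<in> V \<Longrightarrow> F v = G v"
  shows "gsub pr g F = gsub pr g G"
  unfolding gsub_def using tsub_cong[OF assms] by simp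

lemma tsub_sum:
  assumes "obody pr V" "gbody g \<in> V" "\<And>i. i \<in> X \<Longrightarrow> superfun pr V (F i)"
  shows "tsub pr g k (\<lambda>u. \<Sum>i\<in>X. F i u) = (\<Sum>i\<in>X. tsub pr g k (F i))"
  using assms(3)
proof (induction k arbitrary: F)
  case 0
  then show ?case by (simp add: scaleR_left.sum sum_component)
next
  case (Suc k)
  have "tsub pr g k (pder pr b (\<lambda>u. \<Sum>i\<in>X. F i u)) = (\<Sum>i\<in>X. tsub pr g k (pder pr b (F i)))" for b
  proof -
    have "tsub pr g k (pder pr b (\<lambda>u. \<Sum>i\<in>X. F i u)) = tsub pr g k (\<lambda>u. \<Sum>i\<in>X. pder pr b (F i) u)"
      using Suc.prems superfun_differentiable
      by (intro tsub_cong[OF assms(1,2)] pder_sum[OF assms(1)]) auto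
    also have "\<dots> = (\<Sum>i\<in>X. tsub pr g k (pder pr b (F i)))"
      using Suc.prems by (intro Suc.IH superfun_pder[OF assms(1)])
    finally show ?thesis .
  qed
  then show ?case by (simp add: gmul.sum_right) (rule sum.swap)
qed

lemma tsub_scaleR:
  assumes "obody pr V" "gbody g \<in> V" "superfun pr V F"
  shows "tsub pr g k (\<lambda>u. c *\<^sub>R F u) = c *\<^sub>R tsub pr g k F"
  using assms(3)
proof (induction k arbitrary: F)
  case (Suc k)
  have "tsub pr g k (pder pr b (\<lambda>u. c *\<^sub>R F u)) = c *\<^sub>R tsub pr g k (pder pr b F)" for b
  proof -
    have "tsub pr g k (pder pr b (\<lambda>u. c *\<^sub>R F u)) = tsub pr g k (\<lambda>u. c *\<^sub>R pder pr b F u)"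
      using superfun_differentiable[OF Suc.prems]
      by (intro tsub_cong[OF assms(1,2)] pder_scaleR[OF assms(1)]) auto
    also have "\<dots> = c *\<^sub>R tsub pr g k (pder pr b F)"
      using Suc.prems by (intro Suc.IH superfun_pder[OF assms(1)])
    finally show ?thesis .
  qed
  then show ?case by (simp add: gmul_linear scaleR_sum_right)
qed simp

lemma gsub_sum:
  assumes "obody pr V" "gbody g \<in> V" "\<And>i. i \<in> X \<Longrightarrow> superfun pr V (F i)"
  shows "gsub pr g (\<lambda>u. \<Sum>i\<in>X. F i u) = (\<Sum>i\<in>X. gsub pr g (F i))"
  by (simp add: gsub_def tsub_sum[OF assms] scaleR_sum_right) (rule sum.swap)

lemma gsub_scaleR:
  assumes "obody pr V" "gbody g \<in> V" "superfun pr V F"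
  shows "gsub pr g (\<lambda>u. c *\<^sub>R F u) = c *\<^sub>R gsub pr g F"
  unfolding gsub_def tsub_scaleR[OF assms] by (simp add: scaleR_sum_right mult.commute)

lemma gsub_add:
  assumes "obody pr V" "gbody g \<in> V" "superfun pr V F" "superfun pr V G"
  shows "gsub pr g (\<lambda>u. F u + G u) = gsub pr g F + gsub pr g G"
proof -
  have "gsub pr g (\<lambda>u. \<Sum>i\<in>UNIV. (if i then F else G) u) = (\<Sum>i\<in>UNIV. gsub pr g (if i then F else G))"
    by (rule gsub_sum[OF assms(1,2)]) (simp add: assms)
  then show ?thesis by (simp add: UNIV_bool add.commute)
qed

lemma gsub_const [simp]: "gsub pr g (\<lambda>u. c *\<^sub>R gone) = c *\<^sub>R gone"
proof -
  have "tsub pr g k (\<lambda>u. 0) = 0" for k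
  proof (induction k)
    case (Suc k)
    have "pder pr b (\<lambda>u. 0) = (\<lambda>u. 0)" for b by auto
    then show ?case using Suc by simp
  qed simp
  moreover have "pder pr b (\<lambda>u. c *\<^sub>R gone) = (\<lambda>u. 0)" for b by auto
  ultimately have "tsub pr g k (\<lambda>u. c *\<^sub>R gone) = 0" if "k \<noteq> 0" for k
    using that by (cases k) auto
  then have "gsub pr g (\<lambda>u. c *\<^sub>R gone) = (\<Sum>k\<in>{0}. (1 / fact k) *\<^sub>R tsub pr g k (\<lambda>u. c *\<^sub>R gone))"
    unfolding gsub_def by (intro sum.mono_neutral_right) auto
  then show ?thesis by (simp add: gone_nth)
qed

lemma gsub_zero [simp]: "gsub pr g (\<lambda>u. 0) = 0"
  and gsub_gone [simp]: "gsub pr g (\<lambda>u. gone) = gone"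
  using gsub_const[of pr g 0] gsub_const[of pr g 1] by simp_all

text \<open>Derivatives of a coordinate are constant, so only the Taylor terms of orders 0 and 1
  survive; they are the body of \<open>g b\<close> and its nilpotent part. For an odd coordinate the
  body is 0 by the parity assumption.\<close>

lemma gsub_crd [simp]:
  fixes g :: "'d::{finite,linorder} \<Rightarrow> ('c::{finite,linorder}) grass"
  assumes "gpar (pr b) (g b)"
  shows "gsub pr g (crd pr b) = g b"
proof -
  have t: "tsub pr g (Suc k) (crd pr b) = (if k = 0 then gnil (g b) else 0)" for k
  proof -
    have "pder pr a (crd pr b) = (\<lambda>u. (if a = b then 1 else 0) *\<^sub>R gone)" for a by auto
    moreover have "tsub pr g k (\<lambda>u. c *\<^sub>R gone) = 0" if k: "k \<noteq> 0" for c
    proof -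
      have "pder pr a (\<lambda>u. c *\<^sub>R gone) = (\<lambda>u. 0)" "pder pr a (\<lambda>u. 0) = (\<lambda>u. 0)" for a c by auto
      moreover have "tsub pr g j (\<lambda>u. 0) = 0" for j
        by (induction j) (simp_all add: calculation)
      ultimately show ?thesis using k by (cases k) simp_all
    qed
    ultimately show ?thesis
    proof (cases "k = 0")
      case True
      have "(\<Sum>x\<in>UNIV. gnil (g x) \<cdot> ((if x = b then 1 else 0) *\<^sub>R gone)) = (\<Sum>x\<in>UNIV. if x = b then gnil (g x) else 0)"
        by (intro sum.cong) auto
      with True show ?thesis
        by (simp add: \<open>\<And>a. pder pr a (crd pr b) = _ a\<close> gone_nth)
    qed (simp_all)
  qed
  have "gsub pr g (crd pr b) = (\<Sum>k\<in>{0, 1}. (1 / fact k) *\<^sub>R tsub pr g k (crd pr b))"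
    unfolding gsub_def
  proof (rule sum.mono_neutral_right)
    show "\<forall>i\<in>{..CARD('c)} - {0, 1}. (1 / fact i) *\<^sub>R tsub pr g i (crd pr b) = 0"
    proof
      fix i assume "i \<in> {..CARD('c)} - {0, 1}"
      then obtain k where "i = Suc k" "k \<noteq> 0" by (cases i) auto
      then show "(1 / fact i) *\<^sub>R tsub pr g i (crd pr b) = 0" using t by simp
    qed
  qed (auto simp: Suc_le_eq)
  also have "\<dots> = (crd pr b (gbody g) $ {}) *\<^sub>R gone + gnil (g b)"
    using t[of 0] by simp
  also have "crd pr b (gbody g) $ {} = g b $ {}"
    using gpar_odd_body[of "g b"] assms by (auto simp: crd_def gbody_def gone_nth axis_def)
  finally show ?thesis by (simp add: gnil_def)
qed

text \<open>The derivative along \<open>b\<close> and the factor \<open>gnil (g b)\<close> both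
  shift the parity by \<open>pr b\<close>, so the shifts cancel.\<close>

lemma gpar_tsub:
  assumes "gpoint pr V g" "superfun pr V F" "has_parity V e F"
  shows "gpar e (tsub pr g k F)"
  using assms(2,3)
proof (induction k arbitrary: e F)
  case 0
  then have "gpar e (F (gbody g))" using assms(1) by (simp add: has_parity_iff gpoint_def)
  then show ?case by (cases e) (simp_all add: gpar_odd_body gpar_scaleR)
next
  case (Suc k)
  have V: "obody pr V" and p: "gpar (pr b) (g b)" for b using assms(1) by (auto simp: gpoint_def)
  have "gpar e (gnil (g b) \<cdot> tsub pr g k (pder pr b F))" for b
    using gpar_gmul[OF gpar_gnil[OF p] Suc.IH[OF superfun_pder[OF V Suc.prems(1)]
          has_parity_pder[OF V superfun_differentiable[OF Suc.prems(1)] Suc.prems(2)]], of b b]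
    by (cases e; cases "pr b") simp_all
  then show ?case by (auto intro!: gpar_sum)
qed

lemma gpar_gsub:
  assumes "gpoint pr V g" "superfun pr V F" "has_parity V e F"
  shows "gpar e (gsub pr g F)"
  unfolding gsub_def using gpar_tsub[OF assms] by (intro gpar_sum gpar_scaleR)

lemma gsupp_tsub:
  "(\<And>b. gsupp A (g b)) \<Longrightarrow> gsupp A (tsub pr g k F)"
  by (induction k arbitrary: F) (auto intro!: gsupp_scaleR gsupp_sum gsupp_gmul gsupp_gnil)

lemma gsupp_gsub: "(\<And>b. gsupp A (g b)) \<Longrightarrow> gsupp A (gsub pr g F)"
  unfolding gsub_def by (intro gsupp_sum gsupp_scaleR gsupp_tsub)

subsection \<open>The chain rule\<close>

text \<open>
  \<open>D f x\<close> says that \<open>x\<close> is the derivative of \<open>f\<close> at \<open>p0\<close> with respect to a derivation of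
  parity \<open>e\<close>: differentiation along a curve or an odd derivation of the Grassmann algebra.
\<close>

locale grass_derivation =
  fixes D :: "('p \<Rightarrow> ('c::{finite,linorder}) grass) \<Rightarrow> 'c grass \<Rightarrow> bool" and e :: bool and p0 :: 'p
    and pr :: "'d::{finite,linorder} \<Rightarrow> bool" and V :: "'d point set" and g :: "'p \<Rightarrow> 'd \<Rightarrow> 'c grass"
    and \<beta> :: "'d \<Rightarrow> real" and \<nu> :: "'d \<Rightarrow> 'c grass"
  assumes D_sum: "\<And>A f f'. finite (A :: 'd set) \<Longrightarrow> (\<And>i. i \<in> A \<Longrightarrow> D (f i) (f' i)) \<Longrightarrow>
      D (\<lambda>p. \<Sum>i\<in>A. f i p) (\<Sum>i\<in>A. f' i)"
    and D_sum_nat: "\<And>A f f'. finite (A :: nat set) \<Longrightarrow> (\<And>i. i \<in> A \<Longrightarrow> D (f i) (f' i)) \<Longrightarrow>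
      D (\<lambda>p. \<Sum>i\<in>A. f i p) (\<Sum>i\<in>A. f' i)"
    and D_scaleR: "\<And>f f' c. D f f' \<Longrightarrow> D (\<lambda>p. c *\<^sub>R f p) (c *\<^sub>R f')"
    and D_gmul: "\<And>f f' k k' q. D f f' \<Longrightarrow> D k k' \<Longrightarrow> gpar q (f p0) \<Longrightarrow>
      D (\<lambda>p. f p \<cdot> k p) (f' \<cdot> k p0 + ksign e q *\<^sub>R (f p0 \<cdot> k'))"
    and D_zero: "\<And>x. D (\<lambda>p. 0) x \<Longrightarrow> x = 0"
    and gpoint: "gpoint pr V (g p0)"
    and D_gnil: "\<And>b. D (\<lambda>p. gnil (g p b)) (\<nu> b)"
    and gpar_\<nu>: "\<And>b. gpar (pr b \<noteq> e) (\<nu> b)"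
    and \<beta>_even: "\<And>b. \<beta> b \<noteq> 0 \<Longrightarrow> \<not> e \<and> \<not> pr b"
    and D_body: "\<And>F. superfun pr V F \<Longrightarrow>
      D (\<lambda>p. (F (gbody (g p)) $ {}) *\<^sub>R gone) (\<Sum>b\<in>UNIV. \<beta> b *\<^sub>R (pder pr b F (gbody (g p0)) $ {}) *\<^sub>R gone)"
begin

lemma tsub_pder_commute:
  assumes "superfun pr V F"
  shows "tsub pr (g p0) k (pder pr b (pder pr c F)) = ksign (pr b) (pr c) *\<^sub>R tsub pr (g p0) k (pder pr c (pder pr b F))"
proof -
  have V: "obody pr V" "gbody (g p0) \<in> V" using gpoint by (auto simp: gpoint_def)
  show ?thesis
    unfolding tsub_scaleR[OF V superfun_pder[OF V(1) superfun_pder[OF V(1) assms]], symmetric]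
    by (rule tsub_cong[OF V pder_commute[OF V(1) _ assms]])
qed

text \<open>The body part \<open>\<beta>\<close> differentiates \<open>F\<close> once more at the
  body. Each of the \<open>k\<close> nilpotent factors yields \<open>\<nu>\<close> once it is moved
  to the front, and by symmetry of the derivatives all \<open>k\<close> contributions agree, whence
  the factor \<open>real k\<close>.\<close>

lemma D_tsub:
  assumes "superfun pr V F"
  shows "D (\<lambda>p. tsub pr (g p) k F) ((\<Sum>c\<in>UNIV. \<beta> c *\<^sub>R tsub pr (g p0) k (pder pr c F)) +
      (\<Sum>c\<in>UNIV. \<nu> c \<cdot> (real k *\<^sub>R tsub pr (g p0) (k - 1) (pder pr c F))))"
  using assms
proof (induction k arbitrary: F)
  case 0
  then show ?case using D_body[of F] by simp
next
  case (Suc k)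
  have V: "obody pr V" and p: "gpar (pr b) (g p0 b)" for b using gpoint by (auto simp: gpoint_def)
  let ?T = "\<lambda>k F. tsub pr (g p0) k F" and ?n = "\<lambda>b. gnil (g p0 b)"
  let ?d = "\<lambda>b. (\<Sum>c\<in>UNIV. \<beta> c *\<^sub>R ?T k (pder pr c (pder pr b F))) +
      (\<Sum>c\<in>UNIV. \<nu> c \<cdot> (real k *\<^sub>R ?T (k - 1) (pder pr c (pder pr b F))))"
  \<comment> \<open>\<open>\<beta> c\<close> is nonzero only for an even derivation and an even
    coordinate \<open>c\<close>, and then all signs are trivial.\<close>
  have 1: "ksign e (pr b) *\<^sub>R (?n b \<cdot> (\<beta> c *\<^sub>R ?T k (pder pr c (pder pr b F)))) =
      \<beta> c *\<^sub>R (?n b \<cdot> ?T k (pder pr b (pder pr c F)))" for b c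
    using tsub_pder_commute[OF Suc.prems, of k b c] \<beta>_even[of c] by (cases "\<beta> c = 0") (auto simp: gmul_linear)
  \<comment> \<open>Three signs meet: passing the derivation over \<open>?n b\<close>, exchanging
    \<open>?n b\<close> with \<open>\<nu> c\<close>, and exchanging the two partial derivatives.
    Their product is 1.\<close>
  have 2: "ksign e (pr b) *\<^sub>R (?n b \<cdot> (\<nu> c \<cdot> (real k *\<^sub>R ?T (k - 1) (pder pr c (pder pr b F))))) =
      \<nu> c \<cdot> (real k *\<^sub>R (?n b \<cdot> ?T (k - 1) (pder pr b (pder pr c F))))" for b c
    unfolding gmul_supercommute_left[OF gpar_gnil[OF p[of b]] gpar_\<nu>[of c]]
      tsub_pder_commute[OF Suc.prems, of "k - 1" b c]
    by (cases "pr b"; cases "pr c"; cases e) (simp_all add: gmul_linear ksign_def)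
  have 3: "(\<Sum>b\<in>UNIV. real k *\<^sub>R (?n b \<cdot> ?T (k - 1) (pder pr b (pder pr c F)))) = real k *\<^sub>R ?T k (pder pr c F)" for c
    by (cases k) (simp_all add: scaleR_sum_right)
  have "D (\<lambda>p. \<Sum>b\<in>UNIV. gnil (g p b) \<cdot> tsub pr (g p) k (pder pr b F))
      (\<Sum>b\<in>UNIV. \<nu> b \<cdot> ?T k (pder pr b F) + ksign e (pr b) *\<^sub>R (?n b \<cdot> ?d b))"
    by (intro D_sum finite D_gmul D_gnil gpar_gnil p Suc.IH superfun_pder[OF V Suc.prems])
  also have "(\<Sum>b\<in>UNIV. \<nu> b \<cdot> ?T k (pder pr b F) + ksign e (pr b) *\<^sub>R (?n b \<cdot> ?d b)) =
      (\<Sum>b\<in>UNIV. \<nu> b \<cdot> ?T k (pder pr b F)) +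
      ((\<Sum>b\<in>UNIV. \<Sum>c\<in>UNIV. \<beta> c *\<^sub>R (?n b \<cdot> ?T k (pder pr b (pder pr c F)))) +
       (\<Sum>b\<in>UNIV. \<Sum>c\<in>UNIV. \<nu> c \<cdot> (real k *\<^sub>R (?n b \<cdot> ?T (k - 1) (pder pr b (pder pr c F))))))"
    unfolding gmul.add_right gmul.sum_right scaleR_add_right scaleR_sum_right 1 2 sum.distrib ..
  also have "(\<Sum>b\<in>UNIV. \<Sum>c\<in>UNIV. \<beta> c *\<^sub>R (?n b \<cdot> ?T k (pder pr b (pder pr c F)))) =
      (\<Sum>c\<in>UNIV. \<beta> c *\<^sub>R ?T (Suc k) (pder pr c F))"
    by (subst sum.swap) (simp add: scaleR_sum_right)
  also have "(\<Sum>b\<in>UNIV. \<Sum>c\<in>UNIV. \<nu> c \<cdot> (real k *\<^sub>R (?n b \<cdot> ?T (k - 1) (pder pr b (pder pr c F))))) =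
      (\<Sum>c\<in>UNIV. \<nu> c \<cdot> (real k *\<^sub>R ?T k (pder pr c F)))"
    by (subst sum.swap) (simp only: 3 gmul.sum_right[symmetric])
  finally show ?case
    by (simp add: gmul_linear scaleR_left_distrib sum.distrib add_ac)
qed

text \<open>The factor \<open>k\<close> cancels against the factorial and lowers the order of the
  \<open>\<nu>\<close> terms by one, so their sum stops one term short of the full Taylor sum. The
  missing term vanishes: it appears on differentiating the Taylor term of order
  \<open>Suc CARD('c)\<close>, which is identically 0.\<close>

lemma D_gsub:
  assumes "superfun pr V F"
  shows "D (\<lambda>p. gsub pr (g p) F) (\<Sum>c\<in>UNIV. (\<beta> c *\<^sub>R gone + \<nu> c) \<cdot> gsub pr (g p0) (pder pr c F))"
proof -
  let ?N = "CARD('c)" and ?T = "\<lambda>k c. tsub pr (g p0) k (pder pr c F)"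
  have "tsub pr (g p) (Suc ?N) F = 0" for p by (rule tsub_eq_0) simp
  then have "(\<Sum>c\<in>UNIV. \<beta> c *\<^sub>R ?T (Suc ?N) c) + (\<Sum>c\<in>UNIV. \<nu> c \<cdot> (real (Suc ?N) *\<^sub>R ?T (Suc ?N - 1) c)) = 0"
    by (intro D_zero) (use D_tsub[OF assms, of "Suc ?N"] in \<open>simp only:\<close>)
  moreover have "?T (Suc ?N) c = 0" for c by (rule tsub_eq_0) simp
  ultimately have "(\<Sum>c\<in>UNIV. \<nu> c \<cdot> (real (Suc ?N) *\<^sub>R ?T ?N c)) = 0"
    by (simp del: tsub.simps)
  then have "real (Suc ?N) *\<^sub>R (\<Sum>c\<in>UNIV. \<nu> c \<cdot> ?T ?N c) = 0"
    by (simp only: gmul.scaleR_right scaleR_sum_right)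
  then have last: "(\<Sum>c\<in>UNIV. \<nu> c \<cdot> ?T ?N c) = 0" by simp
  have shift: "(\<Sum>k\<le>?N. (1 / fact k) *\<^sub>R (real k *\<^sub>R ?T (k - 1) c)) = (\<Sum>k<?N. (1 / fact k) *\<^sub>R ?T k c)" for c
  proof -
    have "(\<Sum>k\<le>?N. (1 / fact k) *\<^sub>R (real k *\<^sub>R ?T (k - 1) c)) =
        (\<Sum>k<?N. (1 / fact (Suc k)) *\<^sub>R (real (Suc k) *\<^sub>R ?T (Suc k - 1) c))"
      by (subst sum.atMost_shift) simp
    also have "\<dots> = (\<Sum>k<?N. (1 / fact k) *\<^sub>R ?T k c)"
    proof (intro sum.cong refl)
      fix k
      have "(1 / fact (Suc k)) * real (Suc k) = 1 / fact k" by (simp add: fact_Suc del: of_nat_Suc)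
      then show "(1 / fact (Suc k)) *\<^sub>R (real (Suc k) *\<^sub>R ?T (Suc k - 1) c) = (1 / fact k) *\<^sub>R ?T k c"
        by (simp only: scaleR_scaleR diff_Suc_1)
    qed
    finally show ?thesis .
  qed
  have "D (\<lambda>p. gsub pr (g p) F) (\<Sum>k\<le>?N. (1 / fact k) *\<^sub>R ((\<Sum>c\<in>UNIV. \<beta> c *\<^sub>R ?T k c) +
      (\<Sum>c\<in>UNIV. \<nu> c \<cdot> (real k *\<^sub>R ?T (k - 1) c))))"
    unfolding gsub_def by (intro D_sum_nat finite_atMost D_scaleR D_tsub assms)
  also have "(\<Sum>k\<le>?N. (1 / fact k) *\<^sub>R ((\<Sum>c\<in>UNIV. \<beta> c *\<^sub>R ?T k c) +
      (\<Sum>c\<in>UNIV. \<nu> c \<cdot> (real k *\<^sub>R ?T (k - 1) c)))) =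
      (\<Sum>k\<le>?N. \<Sum>c\<in>UNIV. \<beta> c *\<^sub>R ((1 / fact k) *\<^sub>R ?T k c)) +
      (\<Sum>k\<le>?N. \<Sum>c\<in>UNIV. \<nu> c \<cdot> ((1 / fact k) *\<^sub>R (real k *\<^sub>R ?T (k - 1) c)))"
    by (simp add: scaleR_add_right scaleR_sum_right sum.distrib gmul_linear mult.commute)
  also have "(\<Sum>k\<le>?N. \<Sum>c\<in>UNIV. \<beta> c *\<^sub>R ((1 / fact k) *\<^sub>R ?T k c)) = (\<Sum>c\<in>UNIV. \<beta> c *\<^sub>R gsub pr (g p0) (pder pr c F))"
    by (subst sum.swap) (simp only: gsub_def scaleR_sum_right)
  also have "(\<Sum>k\<le>?N. \<Sum>c\<in>UNIV. \<nu> c \<cdot> ((1 / fact k) *\<^sub>R (real k *\<^sub>R ?T (k - 1) c))) =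
      (\<Sum>c\<in>UNIV. \<nu> c \<cdot> (\<Sum>k<?N. (1 / fact k) *\<^sub>R ?T k c))"
    by (subst sum.swap) (simp only: gmul.sum_right[symmetric] shift)
  also have "\<dots> = (\<Sum>c\<in>UNIV. \<nu> c \<cdot> gsub pr (g p0) (pder pr c F))"
  proof -
    have "(\<Sum>c\<in>UNIV. \<nu> c \<cdot> gsub pr (g p0) (pder pr c F)) =
        (\<Sum>c\<in>UNIV. \<nu> c \<cdot> (\<Sum>k<?N. (1 / fact k) *\<^sub>R ?T k c)) + (1 / fact ?N) *\<^sub>R (\<Sum>c\<in>UNIV. \<nu> c \<cdot> ?T ?N c)"
      by (simp add: gsub_def lessThan_Suc_atMost[symmetric] gmul_linear sum.distrib scaleR_sum_right)
    then show ?thesis using last by simp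
  qed
  finally show ?thesis by (simp add: gmul_linear sum.distrib)
qed

end

text \<open>The velocity \<open>h\<close> splits into body and nilpotent part, the data
  \<open>\<beta>\<close> and \<open>\<nu>\<close> of the derivation; on bodies the claim is the
  classical chain rule. The parity assumption near \<open>s0\<close> keeps the body of the curve in
  \<open>body_space pr\<close>, hence in \<open>V\<close>.\<close>

lemma gsub_curve:
  fixes g :: "real \<Rightarrow> 'd::{finite,linorder} \<Rightarrow> ('c::{finite,linorder}) grass"
  assumes V: "gpoint pr V (g s0)" and F: "superfun pr V F"
    and g: "\<And>b. ((\<lambda>s. g s b) has_vector_derivative h b) (at s0)" "\<And>b. gpar (pr b) (h b)"
    and near: "\<forall>\<^sub>F s in nhds s0. \<forall>b. gpar (pr b) (g s b)"
  shows "((\<lambda>s. gsub pr (g s) F) has_vector_derivative (\<Sum>b\<in>UNIV. h b \<cdot> gsub pr (g s0) (pder pr b F))) (at s0)"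
proof -
  have h: "(h b $ {}) *\<^sub>R gone + gnil (h b) = h b" for b by (simp add: gnil_def)
  have body: "((\<lambda>s. (F (gbody (g s)) $ {}) *\<^sub>R (gone :: 'c grass)) has_vector_derivative
      (\<Sum>b\<in>UNIV. (h b $ {}) *\<^sub>R (pder pr b F (gbody (g s0)) $ {}) *\<^sub>R gone)) (at s0)"
    if F: "superfun pr V F" for F
  proof -
    let ?v = "(\<chi> b. h b $ {}) :: 'd point"
    obtain F' where F': "(F has_derivative F') (at (gbody (g s0)) within V)"
      using superfun_differentiable[OF F] V by (auto simp: differentiable_on_def differentiable_def gpoint_def)
    have lin: "linear F'" using has_derivative_linear[OF F'] .
    have gder: "((\<lambda>s. gbody (g s)) has_derivative (\<lambda>t. t *\<^sub>R ?v)) (at s0)"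
    proof -
      have "((\<lambda>s. g s b $ {}) has_derivative (\<lambda>t. t *\<^sub>R h b $ {})) (at s0)" for b
        using bounded_linear.has_derivative[OF bounded_linear_vec_nth g(1)[unfolded has_vector_derivative_def]] by simp
      then show ?thesis
        by (subst has_derivative_componentwise_within) (auto simp: Basis_vec_def inner_axis gbody_def)
    qed
    obtain T where T: "open T" "V = body_space pr \<inter> T" using V by (auto simp: gpoint_def openin_open)
    have "\<forall>\<^sub>F s in nhds s0. gbody (g s) \<in> T"
    proof -
      have "isCont (\<lambda>s. gbody (g s)) s0" using gder has_derivative_continuous by blast
      then have "((\<lambda>s. gbody (g s)) \<longlongrightarrow> gbody (g s0)) (nhds s0)"
        unfolding isCont_def tendsto_at_iff_tendsto_nhds[of "\<lambda>s. gbody (g s)" s0] .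
      then show ?thesis using T V by (auto simp: gpoint_def intro: topological_tendstoD)
    qed
    then have "\<forall>\<^sub>F s in nhds s0. gbody (g s) \<in> V"
      using near by eventually_elim (use T(2) gbody_body_space in blast)
    then obtain S where S: "open S" "s0 \<in> S" "\<And>s. s \<in> S \<Longrightarrow> gbody (g s) \<in> V"
      by (auto simp: eventually_nhds)
    have "(F \<circ> (\<lambda>s. gbody (g s)) has_derivative F' \<circ> (\<lambda>t. t *\<^sub>R ?v)) (at s0 within S)"
    proof (rule diff_chain_within)
      show "((\<lambda>s. gbody (g s)) has_derivative (\<lambda>t. t *\<^sub>R ?v)) (at s0 within S)"
        using gder by (rule has_derivative_at_withinI)
      show "(F has_derivative F') (at (gbody (g s0)) within (\<lambda>s. gbody (g s)) ` S)"
        using S(3) by (auto intro: has_derivative_subset[OF F'])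
    qed
    then have "((\<lambda>s. F (gbody (g s))) has_vector_derivative F' ?v) (at s0)"
      unfolding has_vector_derivative_def at_within_open[OF S(2,1)] o_def linear_scale[OF lin] .
    then have "((\<lambda>s. F (gbody (g s)) $ {}) has_vector_derivative F' ?v $ {}) (at s0)"
      by (rule bounded_linear.has_vector_derivative[OF bounded_linear_vec_nth])
    then have 1: "((\<lambda>s. (F (gbody (g s)) $ {}) *\<^sub>R (gone :: 'c grass)) has_vector_derivative (F' ?v $ {}) *\<^sub>R gone) (at s0)"
      by (rule bounded_linear.has_vector_derivative[OF bounded_linear_scaleR_left])
    have "?v = (\<Sum>b\<in>UNIV. (h b $ {}) *\<^sub>R axis b 1)"
      by (simp add: vec_eq_iff axis_def sum_component if_distrib[of "\<lambda>x. _ * x"] cong: if_cong)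
    then have "F' ?v = (\<Sum>b\<in>UNIV. (h b $ {}) *\<^sub>R F' (axis b 1))"
      by (simp only: linear_sum[OF lin] linear_scale[OF lin] o_def)
    also have "\<dots> = (\<Sum>b\<in>UNIV. (h b $ {}) *\<^sub>R pder pr b F (gbody (g s0)))"
    proof (rule sum.cong)
      fix b
      show "(h b $ {}) *\<^sub>R F' (axis b 1) = (h b $ {}) *\<^sub>R pder pr b F (gbody (g s0))"
      proof (cases "pr b")
        \<comment> \<open>The body of an odd velocity is 0, so the mismatch between
          \<open>F' (axis b 1)\<close> and an odd \<open>pder\<close> is multiplied by 0.\<close>
        case True
        then show ?thesis using g(2)[of b] gpar_odd_body by fastforce
      next
        case False
        have "pder pr b F (gbody (g s0)) = F' (axis b 1)"
          using V has_derivative_line[of pr V _ b F F', OF _ _ False F'] by (intro pder_eqI[of pr b, OF False]) (auto simp: gpoint_def)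
        then show ?thesis by simp
      qed
    qed simp
    finally show ?thesis using 1 by (simp add: sum_component scaleR_left.sum)
  qed
  interpret grass_derivation "\<lambda>f f'. (f has_vector_derivative f') (at s0)" False s0 pr V g
    "\<lambda>b. h b $ {}" "\<lambda>b. gnil (h b)"
  proof (unfold_locales, goal_cases)
    case (4 f f' k k' q)
    then show ?case using gmul.has_vector_derivative[of f f' s0 UNIV k k'] by (simp add: add.commute)
  next
    case (5 x)
    then show ?case using vector_derivative_unique_at has_vector_derivative_const by blast
  next
    case (7 b)
    show ?case
      using g(1)[of b] linear_gnil bounded_linear.has_vector_derivative[of gnil]
      by (auto simp: linear_conv_bounded_linear)
  next
    case (9 b)
    then show ?case using g(2)[of b] gpar_odd_body by metis
  next
    case (10 F)
    then show ?case by (rule body)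
  qed (auto intro!: has_vector_derivative_sum V gpar_gnil g(2) bounded_linear.has_vector_derivative[OF bounded_linear_scaleR_right])
  show ?thesis using D_gsub[OF F] unfolding h .
qed

text \<open>\<open>oder a\<close> acts on a single algebra element, so the parameter type is
  \<open>unit\<close>, and \<open>\<beta>\<close> is 0 because \<open>oder a\<close> kills multiples
  of \<open>gone\<close>.\<close>

lemma gsub_oder:
  fixes g :: "'d::{finite,linorder} \<Rightarrow> ('c::{finite,linorder}) grass"
  assumes V: "gpoint pr V g" and F: "superfun pr V F"
  shows "oder a (gsub pr g F) = (\<Sum>b\<in>UNIV. oder a (g b) \<cdot> gsub pr g (pder pr b F))"
proof -
  interpret grass_derivation "\<lambda>f x. x = oder a (f ())" True "()" pr V "\<lambda>_. g"
    "\<lambda>b. 0" "\<lambda>b. oder a (g b)"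
  proof (unfold_locales, goal_cases)
  qed (use V in \<open>auto simp: gpar_oder gpoint_def linear_sum[OF linear_oder] linear_scale[OF linear_oder] linear_0[OF linear_oder] oder_gmul_gpar\<close>)
  show ?thesis using D_gsub[OF F] by simp
qed

lemma pder_subst:
  fixes y :: "'d::{finite,linorder} \<Rightarrow> ('c::{finite,linorder}) sfun"
  assumes U: "obody pr' U" "u \<in> U"
    and y: "\<And>b. superfun pr' U (y b)" "\<And>b. has_parity U (pr b) (y b)"
    and V: "obody pr V" "bodymap y u \<in> V" and F: "superfun pr V F"
  shows "pder pr' a (subst_sfun pr F y) u = (\<Sum>b\<in>UNIV. pder pr' a (y b) u \<cdot> subst_sfun pr (pder pr b F) y u)"
proof -
  have gp: "gpoint pr V (\<lambda>b. y b u)"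
    using assms by (auto simp: gpoint_def bodymap_eq has_parity_iff)
  show ?thesis
  proof (cases "pr' a")
    case True
    then show ?thesis using gsub_oder[OF gp F] by (simp add: pder_odd subst_sfun_eq)
  next
    case False
    have "((\<lambda>s. gsub pr (\<lambda>b. y b (u + s *\<^sub>R axis a 1)) F) has_vector_derivative
        (\<Sum>b\<in>UNIV. pder pr' a (y b) u \<cdot> gsub pr (\<lambda>b. y b (u + 0 *\<^sub>R axis a 1)) (pder pr b F))) (at 0)"
    proof (rule gsub_curve[OF _ F])
      show "gpoint pr V (\<lambda>b. y b (u + 0 *\<^sub>R axis a 1))" using gp by simp
      show "((\<lambda>s. y b (u + s *\<^sub>R axis a 1)) has_vector_derivative pder pr' a (y b) u) (at 0)" for b
        by (rule pder_line[OF U False superfun_differentiable[OF y(1)]])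
      show "gpar (pr b) (pder pr' a (y b) u)" for b
        using gpar_pder[OF U superfun_differentiable[OF y(1)] y(2), where a = a] False by simp
      show "\<forall>\<^sub>F s in nhds 0. \<forall>b. gpar (pr b) (y b (u + s *\<^sub>R axis a 1))"
        using obody_line[OF U False] by eventually_elim (use y(2) in \<open>auto simp: has_parity_iff\<close>)
    qed
    then show ?thesis
      by (intro pder_eqI[of pr' a, OF False]) (simp add: subst_sfun_eq)
  qed
qed

lemma continuous_on_bodymap:
  fixes y :: "'d::{finite,linorder} \<Rightarrow> ('c::{finite,linorder}) sfun"
  assumes "\<And>b. superfun pr' U (y b)"
  shows "continuous_on U (bodymap y)"
  unfolding bodymap_def
  by (intro continuous_on_vec_lambda continuous_on_component differentiable_imp_continuous_on
      superfun_differentiable[OF assms])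

lemma differentiable_on_bodymap:
  fixes y :: "'d::{finite,linorder} \<Rightarrow> ('c::{finite,linorder}) sfun"
  assumes "\<And>b. superfun pr' U (y b)"
  shows "bodymap y differentiable_on U"
  unfolding differentiable_on_def
proof
  fix u assume u: "u \<in> U"
  have "\<exists>f'. (y b has_derivative f') (at u within U)" for b
    using superfun_differentiable[OF assms] u by (auto simp: differentiable_on_def differentiable_def)
  then obtain y' where y': "\<And>b. (y b has_derivative y' b) (at u within U)" by metis
  have "((\<lambda>u. y b u $ {}) has_derivative (\<lambda>t. y' b t $ {})) (at u within U)" for b
    using bounded_linear.has_derivative[OF bounded_linear_vec_nth y'] .
  then have "((\<lambda>u. \<chi> b. y b u $ {}) has_derivative (\<lambda>t. \<chi> b. y' b t $ {})) (at u within U)"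
    by (subst has_derivative_componentwise_within) (auto simp: Basis_vec_def inner_axis)
  then show "bodymap y differentiable at u within U"
    by (auto simp: bodymap_def[abs_def] differentiable_def)
qed

lemma differentiable_on_subst:
  fixes y :: "'d::{finite,linorder} \<Rightarrow> ('c::{finite,linorder}) sfun"
  assumes y: "\<And>b. superfun pr' U (y b)"
    and V: "obody pr V" "bodymap y ` U \<subseteq> V" and F: "superfun pr V F"
  shows "subst_sfun pr F y differentiable_on U"
proof -
  have "(\<lambda>u. tsub pr (\<lambda>b. y b u) k F) differentiable_on U" for k
    using F
  proof (induction k arbitrary: F)
    case 0
    have "(\<lambda>u. F (bodymap y u)) differentiable_on U"
      by (rule differentiable_on_compose[of "bodymap y", OF differentiable_on_bodymap[OF y]
            differentiable_on_subset[OF superfun_differentiable[OF 0] V(2)]])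
    then have "(\<lambda>u. ((F (bodymap y u)) $ {}) *\<^sub>R (gone :: 'c grass)) differentiable_on U"
      by (rule differentiable_on_linear[rotated]) (auto simp: linear_iff algebra_simps)
    then show ?case by (simp add: bodymap_eq)
  next
    case (Suc k)
    have "(\<lambda>u. gnil (y b u) \<cdot> tsub pr (\<lambda>b. y b u) k (pder pr b F)) differentiable_on U" for b
      by (intro differentiable_on_gmul differentiable_on_linear[OF linear_gnil] superfun_differentiable[OF y]
          Suc.IH superfun_pder[OF V(1) Suc.prems])
    then show ?case unfolding tsub.simps by (rule differentiable_on_sum)
  qed
  then have "(\<lambda>u. \<Sum>k\<le>CARD('c). (1 / fact k) *\<^sub>R tsub pr (\<lambda>b. y b u) k F) differentiable_on U"
    by (intro differentiable_on_sum differentiable_on_scaleR differentiable_on_const)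
  then show ?thesis by (simp add: subst_sfun_eq[abs_def] gsub_def)
qed

text \<open>By the chain rule a derivative of the substitution is built from derivatives of
  \<open>y\<close> and substitutions into derivatives of \<open>F\<close>; the induction on the
  order therefore runs over all \<open>F\<close>.\<close>

lemma superfun_subst:
  fixes y :: "'d::{finite,linorder} \<Rightarrow> ('c::{finite,linorder}) sfun"
  assumes U: "obody pr' U"
    and y: "\<And>b. superfun pr' U (y b)" "\<And>b. has_parity U (pr b) (y b)"
    and V: "obody pr V" "bodymap y ` U \<subseteq> V" and F: "superfun pr V F"
  shows "superfun pr' U (subst_sfun pr F y)"
proof -
  have "ck n pr' U (subst_sfun pr F y)" for n
    using F
  proof (induction n arbitrary: F)
    case 0
    then show ?case using differentiable_on_subst[OF y(1) V] by simp
  next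
    case (Suc n)
    have "ck n pr' U (pder pr' a (subst_sfun pr F y))" if a: "\<not> pr' a" for a
    proof (rule ck_cong[OF U])
      show "(\<Sum>b\<in>UNIV. pder pr' a (y b) u \<cdot> subst_sfun pr (pder pr b F) y u) = pder pr' a (subst_sfun pr F y) u"
        if "u \<in> U" for u
        using V(2) that by (intro pder_subst[OF U that y V(1) _ Suc.prems, symmetric]) auto
      show "ck n pr' U (\<lambda>u. \<Sum>b\<in>UNIV. pder pr' a (y b) u \<cdot> subst_sfun pr (pder pr b F) y u)"
        using superfun_pder[OF U y(1)]
        by (intro ck_sum[OF U] ck_gmul[OF U] Suc.IH superfun_pder[OF V(1) Suc.prems]) (simp add: superfun_iff)
    qed
    then show ?case using differentiable_on_subst[OF y(1) V Suc.prems] by simp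
  qed
  then show ?thesis
    using y(1) by (auto simp: superfun_iff subst_sfun_eq intro!: gsupp_gsub)
qed

subsection \<open>Substitution is a homomorphism\<close>

text \<open>
  Identities between substitutions are proved by scaling the
  nilpotent parts of the substituted elements by \<open>t\<close> and comparing derivatives in \<open>t\<close>.
\<close>

lemma nilpotent_flow_unique:
  fixes P :: "(real \<Rightarrow> ('c::finite) grass) set"
  assumes start: "\<And>d. d \<in> P \<Longrightarrow> d 0 = 0"
    and deriv: "\<And>d t. d \<in> P \<Longrightarrow> \<exists>x. (d has_vector_derivative x) (at t) \<and>
      (\<forall>k. (\<forall>e\<in>P. lev k (e t)) \<longrightarrow> lev (Suc k) x)"
    and d: "d \<in> P"
  shows "d t = 0"
proof -
  have "\<forall>d\<in>P. \<forall>t. lev k (d t)" for k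
  proof (induction k)
    case (Suc k)
    show ?case
    proof (intro ballI allI)
      fix d t assume d: "d \<in> P"
      show "lev (Suc k) (d t)"
        unfolding lev_def
      proof (intro allI impI)
        fix I :: "'c set" assume I: "card I < Suc k"
        have "DERIV (\<lambda>t. d t $ I) t :> 0" for t
        proof -
          obtain x where x: "(d has_vector_derivative x) (at t)" "lev (Suc k) x"
            using deriv[OF d, of t] Suc by blast
          have "((\<lambda>t. d t $ I) has_vector_derivative x $ I) (at t)"
            by (rule bounded_linear.has_vector_derivative[OF bounded_linear_vec_nth x(1)])
          then show ?thesis
            using x(2) I by (simp add: lev_def has_real_derivative_iff_has_vector_derivative)
        qed
        then have "d t $ I = d 0 $ I" by (intro DERIV_isconst_all) auto
        then show "d t $ I = 0" using start[OF d] by simp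
      qed
    qed
  qed simp
  then show ?thesis using lev_gt_eq_0[of "Suc CARD('c)" "d t"] d by blast
qed

text \<open>The path from the body of \<open>g\<close> at \<open>t = 0\<close> to \<open>g\<close>
  itself at \<open>t = 1\<close>; its velocity is the nilpotent part.\<close>

definition gscale :: "real \<Rightarrow> ('d \<Rightarrow> ('c::finite) grass) \<Rightarrow> 'd \<Rightarrow> 'c grass" where
  "gscale t g b = g b + (t - 1) *\<^sub>R gnil (g b)"

lemma gscale_1 [simp]: "gscale 1 g = g"
  by (simp add: gscale_def fun_eq_iff)

lemma gnil_body [simp]: "gnil x $ {} = 0"
  by (simp add: gnil_def gone_nth)

lemma gnil_gnil [simp]: "gnil (gnil x) = gnil x"
  by (simp add: gnil_def gone_nth)

lemma gnil_gscale: "gnil (gscale t g b) = t *\<^sub>R gnil (g b)"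
  by (simp add: gscale_def linear_add[OF linear_gnil] linear_diff[OF linear_gnil]
      linear_scale[OF linear_gnil] algebra_simps)

lemma gbody_gscale [simp]: "gbody (gscale t g) = gbody g"
  by (simp add: gscale_def gbody_def)

lemma gpoint_gscale: "gpoint pr V g \<Longrightarrow> gpoint pr V (gscale t g)"
  by (auto simp: gpoint_def) (simp add: gscale_def gpar_add gpar_scaleR gpar_gnil)

lemma gsub_gscale_0: "gsub pr (gscale 0 g) F = (F (gbody g) $ {}) *\<^sub>R gone"
  by (subst gsub_trivial) (simp_all add: gnil_gscale)

lemma gsub_gscale_derivative:
  assumes "gpoint pr V g" "superfun pr V F"
  shows "((\<lambda>t. gsub pr (gscale t g) F) has_vector_derivative
    (\<Sum>b\<in>UNIV. gnil (g b) \<cdot> gsub pr (gscale t g) (pder pr b F))) (at t)"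
proof (rule gsub_curve[OF gpoint_gscale[OF assms(1)] assms(2)])
  fix b
  have "((\<lambda>t. g b + (t - 1) *\<^sub>R gnil (g b)) has_vector_derivative 1 *\<^sub>R gnil (g b)) (at t)"
    by (auto intro!: derivative_eq_intros)
  then show "((\<lambda>s. gscale s g b) has_vector_derivative gnil (g b)) (at t)"
    by (simp add: gscale_def)
  show "gpar (pr b) (gnil (g b))" using assms(1) by (simp add: gpoint_def gpar_gnil)
  show "\<forall>\<^sub>F s in nhds t. \<forall>b. gpar (pr b) (gscale s g b)"
    using gpoint_gscale[OF assms(1)] by (simp add: gpoint_def)
qed

lemma lev_add: "lev k x \<Longrightarrow> lev k y \<Longrightarrow> lev k (x + y)"
  by (simp add: lev_def)

lemma lev_Suc_gmul: "lev (Suc 0) x \<Longrightarrow> lev k y \<Longrightarrow> lev (Suc k) (x \<cdot> y)"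
  using lev_gmul[of "Suc 0" x k y] by simp

text \<open>At \<open>t = 0\<close> both sides are products of bodies. By the Leibniz rule the
  derivative of the defect \<open>D F G\<close> consists of nilpotent factors times the defects in
  which one of \<open>F\<close>, \<open>G\<close> is replaced by a partial derivative.\<close>

lemma gsub_gmul:
  assumes g: "gpoint pr V g" and FG: "superfun pr V F" "superfun pr V G" "has_parity V e F"
  shows "gsub pr g (\<lambda>u. F u \<cdot> G u) = gsub pr g F \<cdot> gsub pr g G"
proof -
  define D where "D F G = (\<lambda>t. gsub pr (gscale t g) (\<lambda>u. F u \<cdot> G u) - gsub pr (gscale t g) F \<cdot> gsub pr (gscale t g) G)" for F G
  define P where "P = {D F G | F G e. superfun pr V F \<and> superfun pr V G \<and> has_parity V e F}"
  have V: "obody pr V" using g by (simp add: gpoint_def)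
  have "D F G 1 = 0"
  proof (rule nilpotent_flow_unique[where P = P])
    show "D F G \<in> P" using FG by (auto simp: P_def)
    show "d 0 = 0" if "d \<in> P" for d
      using that by (auto simp: P_def D_def gsub_gscale_0 gmul_linear)
    fix d t assume "d \<in> P"
    then obtain F G e where FG: "d = D F G" "superfun pr V F" "superfun pr V G" "has_parity V e F"
      by (auto simp: P_def)
    let ?s = "gsub pr (gscale t g)" and ?n = "\<lambda>b. gnil (g b)"
    have t: "gpoint pr V (gscale t g)" "gbody (gscale t g) \<in> V"
      using gpoint_gscale[OF g] by (auto simp: gpoint_def)
    have 1: "?s (pder pr b (\<lambda>u. F u \<cdot> G u)) =
        ?s (\<lambda>u. pder pr b F u \<cdot> G u) + ksign (pr b) e *\<^sub>R ?s (\<lambda>u. F u \<cdot> pder pr b G u)" for b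
    proof -
      have "?s (pder pr b (\<lambda>u. F u \<cdot> G u)) =
          ?s (\<lambda>u. pder pr b F u \<cdot> G u + ksign (pr b) e *\<^sub>R (F u \<cdot> pder pr b G u))"
        using FG by (intro gsub_cong[OF V t(2)] pder_gmul_gpar[OF V])
          (auto simp: superfun_differentiable has_parity_iff)
      also have "\<dots> = ?s (\<lambda>u. pder pr b F u \<cdot> G u) + ksign (pr b) e *\<^sub>R ?s (\<lambda>u. F u \<cdot> pder pr b G u)"
        using FG by (subst gsub_add[OF V t(2)])
          (simp_all add: superfun_gmul superfun_pder superfun_scaleR V gsub_scaleR[OF V t(2)])
      finally show ?thesis .
    qed
    \<comment> \<open>The nilpotent factor is pulled out past the homogeneous \<open>?s F\<close>,
      with the same sign as in the Leibniz rule.\<close>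
    have 2: "?s F \<cdot> (?n b \<cdot> x) = ksign (pr b) e *\<^sub>R (?n b \<cdot> (?s F \<cdot> x))" for b x
    proof -
      have "gpar (pr b) (?n b)" using g by (simp add: gpoint_def gpar_gnil)
      from gmul_supercommute_left[OF gpar_gsub[OF t(1) FG(2,4)] this] show ?thesis
        by (simp add: ksign_commute)
    qed
    let ?x = "\<Sum>b\<in>UNIV. ?n b \<cdot> (D (pder pr b F) G t + ksign (pr b) e *\<^sub>R D F (pder pr b G) t)"
    have "(d has_vector_derivative (\<Sum>b\<in>UNIV. ?n b \<cdot> ?s (pder pr b (\<lambda>u. F u \<cdot> G u))) -
        (?s F \<cdot> (\<Sum>b\<in>UNIV. ?n b \<cdot> ?s (pder pr b G)) + (\<Sum>b\<in>UNIV. ?n b \<cdot> ?s (pder pr b F)) \<cdot> ?s G)) (at t)"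
      unfolding FG(1) D_def
      by (intro has_vector_derivative_diff gmul.has_vector_derivative gsub_gscale_derivative[OF g]
          superfun_gmul[OF V] FG)
    also have "(\<Sum>b\<in>UNIV. ?n b \<cdot> ?s (pder pr b (\<lambda>u. F u \<cdot> G u))) -
        (?s F \<cdot> (\<Sum>b\<in>UNIV. ?n b \<cdot> ?s (pder pr b G)) + (\<Sum>b\<in>UNIV. ?n b \<cdot> ?s (pder pr b F)) \<cdot> ?s G) = ?x"
      unfolding D_def 1 gmul.sum_left gmul.sum_right 2 sum_subtractf[symmetric] sum.distrib[symmetric]
      by (intro sum.cong) (simp_all add: gmul_linear gmul_assoc algebra_simps)
    finally have "(d has_vector_derivative ?x) (at t)" .
    moreover have "D (pder pr b F) G \<in> P" "D F (pder pr b G) \<in> P" for b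
      unfolding P_def using FG superfun_pder[OF V] has_parity_pder[OF V superfun_differentiable] by blast+
    ultimately show "\<exists>x. (d has_vector_derivative x) (at t) \<and> (\<forall>k. (\<forall>e\<in>P. lev k (e t)) \<longrightarrow> lev (Suc k) x)"
      by (intro exI[of _ ?x]) (auto intro!: lev_sum lev_Suc_gmul lev_gnil lev_add lev_scaleR)
  qed
  then show ?thesis by (simp add: D_def)
qed

text \<open>Associativity of substitution. Scaling \<open>x\<close> moves the inner values along the
  curve \<open>z\<close>, and both sides obey the chain rule with the same velocities
  \<open>?h\<close>. These are nilpotent, so the defects satisfy a nilpotent system.\<close>

lemma gsub_subst:
  fixes y :: "'d::{finite,linorder} \<Rightarrow> ('c::{finite,linorder}) sfun" and x :: "'c \<Rightarrow> ('b::{finite,linorder}) grass"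
  assumes x: "gpoint pr' U x"
    and y: "\<And>b. superfun pr' U (y b)" "\<And>b. has_parity U (pr b) (y b)"
    and V: "obody pr V" "bodymap y ` U \<subseteq> V" and F: "superfun pr V F"
  shows "gsub pr' x (subst_sfun pr F y) = gsub pr (\<lambda>b. gsub pr' x (y b)) F"
proof -
  define z where "z t b = gsub pr' (gscale t x) (y b)" for t b
  define D where "D F = (\<lambda>t. gsub pr' (gscale t x) (subst_sfun pr F y) - gsub pr (z t) F)" for F
  define P where "P = {D F | F. superfun pr V F}"
  have U: "obody pr' U" using x by (simp add: gpoint_def)
  have t: "gpoint pr' U (gscale t x)" for t using gpoint_gscale[OF x] .
  have tU: "gbody (gscale t x) \<in> U" for t using x by (simp add: gpoint_def)
  have body: "gbody (z t) = bodymap y (gbody x)" for t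
    by (simp add: gbody_def z_def bodymap_def vec_eq_iff gsub_body) (simp add: gbody_def gscale_def)
  have z: "gpoint pr V (z t)" for t
    unfolding gpoint_def body
    using V x gpar_gsub[OF t y] by (auto simp: gpoint_def z_def image_subset_iff)
  have "D F 1 = 0"
  proof (rule nilpotent_flow_unique[where P = P])
    show "D F \<in> P" using F by (auto simp: P_def)
    show "d 0 = 0" if "d \<in> P" for d
    proof -
      have "gnil (z 0 b) = 0" for b
        by (simp add: z_def gsub_gscale_0 gnil_def gone_nth)
      then have "gsub pr (z 0) F = (F (gbody (z 0)) $ {}) *\<^sub>R gone" for F
        by (rule gsub_trivial)
      then show ?thesis
        using that by (auto simp: P_def D_def gsub_gscale_0 body subst_sfun_eq gsub_body bodymap_eq)
    qed
    fix d t assume "d \<in> P"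
    then obtain F where F: "d = D F" "superfun pr V F" by (auto simp: P_def)
    let ?s = "gsub pr' (gscale t x)" and ?n = "\<lambda>a. gnil (x a)"
    let ?h = "\<lambda>b. \<Sum>a\<in>UNIV. ?n a \<cdot> ?s (pder pr' a (y b))"
    have sub: "superfun pr' U (subst_sfun pr F y)" if "superfun pr V F" for F
      by (rule superfun_subst[OF U y V that])
    have 1: "?s (pder pr' a (subst_sfun pr F y)) =
        (\<Sum>b\<in>UNIV. ?s (pder pr' a (y b)) \<cdot> ?s (subst_sfun pr (pder pr b F) y))" for a
    proof -
      have "?s (pder pr' a (subst_sfun pr F y)) =
          ?s (\<lambda>u. \<Sum>b\<in>UNIV. pder pr' a (y b) u \<cdot> subst_sfun pr (pder pr b F) y u)"
        using V F(2) by (intro gsub_cong[OF U tU] pder_subst[OF U _ y]) auto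
      also have "\<dots> = (\<Sum>b\<in>UNIV. ?s (\<lambda>u. pder pr' a (y b) u \<cdot> subst_sfun pr (pder pr b F) y u))"
        by (intro gsub_sum[OF U tU] superfun_gmul[OF U] superfun_pder[OF U] y sub superfun_pder[OF V(1)] F(2))
      also have "\<dots> = (\<Sum>b\<in>UNIV. ?s (pder pr' a (y b)) \<cdot> ?s (subst_sfun pr (pder pr b F) y))"
      proof (intro sum.cong refl)
        fix b
        show "?s (\<lambda>u. pder pr' a (y b) u \<cdot> subst_sfun pr (pder pr b F) y u) =
            ?s (pder pr' a (y b)) \<cdot> ?s (subst_sfun pr (pder pr b F) y)"
          by (rule gsub_gmul[OF t superfun_pder[OF U y(1)] sub[OF superfun_pder[OF V(1) F(2)]]
              has_parity_pder[OF U superfun_differentiable[OF y(1)] y(2)]])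
      qed
      finally show ?thesis .
    qed
    have zder: "((\<lambda>s. gsub pr (z s) F) has_vector_derivative (\<Sum>b\<in>UNIV. ?h b \<cdot> gsub pr (z t) (pder pr b F))) (at t)"
    proof (rule gsub_curve[OF z F(2)])
      show "((\<lambda>s. z s b) has_vector_derivative ?h b) (at t)" for b
        unfolding z_def by (rule gsub_gscale_derivative[OF x y(1)])
      show "gpar (pr b) (?h b)" for b
      proof (rule gpar_sum)
        fix a
        have "gpar (pr' a) (?n a)" using x by (simp add: gpoint_def gpar_gnil)
        moreover have "gpar (pr b \<noteq> pr' a) (?s (pder pr' a (y b)))"
          by (intro gpar_gsub[OF t] superfun_pder[OF U] has_parity_pder[OF U] y superfun_differentiable[OF y(1)])
        ultimately have "gpar (pr' a \<noteq> (pr b \<noteq> pr' a)) (?n a \<cdot> ?s (pder pr' a (y b)))"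
          by (rule gpar_gmul)
        then show "gpar (pr b) (?n a \<cdot> ?s (pder pr' a (y b)))" by (cases "pr b"; cases "pr' a") simp_all
      qed
      show "\<forall>\<^sub>F s in nhds t. \<forall>b. gpar (pr b) (z s b)" using z by (simp add: gpoint_def)
    qed
    let ?x = "\<Sum>b\<in>UNIV. ?h b \<cdot> D (pder pr b F) t"
    have "(d has_vector_derivative (\<Sum>a\<in>UNIV. ?n a \<cdot> ?s (pder pr' a (subst_sfun pr F y))) -
        (\<Sum>b\<in>UNIV. ?h b \<cdot> gsub pr (z t) (pder pr b F))) (at t)"
      unfolding F(1) D_def
      by (intro has_vector_derivative_diff gsub_gscale_derivative[OF x] sub F(2) zder)
    also have "(\<Sum>a\<in>UNIV. ?n a \<cdot> ?s (pder pr' a (subst_sfun pr F y))) =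
        (\<Sum>b\<in>UNIV. ?h b \<cdot> ?s (subst_sfun pr (pder pr b F) y))"
      unfolding 1 gmul.sum_right gmul.sum_left gmul_assoc by (rule sum.swap)
    finally have "(d has_vector_derivative ?x) (at t)"
      by (simp add: D_def gmul.diff_right sum_subtractf)
    moreover have "D (pder pr b F) \<in> P" for b
      unfolding P_def using F superfun_pder[OF V(1)] by blast
    moreover have "lev (Suc 0) (?h b)" for b
      using lev_Suc_gmul[OF lev_gnil lev_0] by (intro lev_sum)
    ultimately show "\<exists>x. (d has_vector_derivative x) (at t) \<and> (\<forall>k. (\<forall>e\<in>P. lev k (e t)) \<longrightarrow> lev (Suc k) x)"
      by (meson lev_sum[of UNIV] lev_Suc_gmul)
  qed
  moreover have "z 1 = (\<lambda>b. gsub pr' x (y b))" by (simp add: z_def fun_eq_iff)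
  ultimately show ?thesis by (simp add: D_def)
qed

text \<open>The substituted point has body \<open>u\<close> and the odd generators as nilpotent
  parts. Scaling these by \<open>t\<close> should multiply the coefficient at \<open>I\<close> by
  \<open>t ^ card I\<close>, which is what \<open>L\<close> does; both families satisfy the same
  equation in \<open>t\<close>.\<close>

lemma subst_crd:
  assumes U: "obody pr U" "u \<in> U" and F: "superfun pr U F"
  shows "subst_sfun pr F (crd pr) u = F u"
proof -
  let ?g = "\<lambda>b. crd pr b u"
  define L :: "real \<Rightarrow> 'a grass \<Rightarrow> 'a grass" where "L t x = (\<chi> I. t ^ card I * x $ I)" for t x
  define D where "D F = (\<lambda>t. gsub pr (gscale t ?g) F - L t (F u))" for F
  define P where "P = {D F | F. superfun pr U F}"
  have body: "gbody ?g = u"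
    using obody_subset[OF U] by (auto simp: gbody_def vec_eq_iff crd_def gone_nth axis_def body_space_def)
  then have g: "gpoint pr U ?g" using U by (simp add: gpoint_def)
  have nil: "gnil (crd pr b u) = (if pr b then axis {b} 1 else 0)" for b
    by (auto simp: gnil_def crd_def gone_nth axis_def)
  have axis: "(axis {b} 1 \<cdot> z) $ K = (if b \<in> K then gsign {b} (K - {b}) * z $ (K - {b}) else 0)" for b z and K :: "'a set"
  proof -
    have "(axis {b} 1 \<cdot> z) $ K = (\<Sum>I\<in>Pow K. if I = {b} then gsign {b} (K - {b}) * z $ (K - {b}) else 0)"
      unfolding gmul_nth by (intro sum.cong) (auto simp: axis_def)
    then show ?thesis by simp
  qed
  have Lder: "((\<lambda>t. L t (F u)) has_vector_derivative (\<Sum>b\<in>UNIV. gnil (?g b) \<cdot> L t (pder pr b F u))) (at t)"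
    if F: "superfun pr U F" for F t
  proof -
    \<comment> \<open>Multiplying an odd derivative by its own generator restores the coefficient at
      \<open>K\<close>, once for every element of \<open>K\<close>: Euler's identity in the odd
      coordinates.\<close>
    have K: "(\<Sum>b\<in>UNIV. gnil (?g b) \<cdot> L t (pder pr b F u)) $ K = real (card K) * t ^ (card K - 1) * F u $ K" for K
    proof (cases "K \<subseteq> {a. pr a}")
      case False
      have "gsupp {a. pr a} (\<Sum>b\<in>UNIV. gnil (?g b) \<cdot> L t (pder pr b F u))"
      proof (intro gsupp_sum gsupp_gmul)
        show "gsupp {a. pr a} (gnil (?g b))" for b by (auto simp: nil gsupp_axis)
        have "gsupp {a. pr a} (pder pr b F u)" for b
          using superfun_pder[OF U(1) F] U(2) by (simp add: superfun_iff)
        then show "gsupp {a. pr a} (L t (pder pr b F u))" for b by (simp add: gsupp_def L_def)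
      qed
      moreover have "gsupp {a. pr a} (F u)" using F U(2) by (simp add: superfun_iff)
      ultimately show ?thesis using False by (simp add: gsupp_def)
    next
      case True
      have "(gnil (?g b) \<cdot> L t (pder pr b F u)) $ K = (if b \<in> K then t ^ (card K - 1) * F u $ K else 0)" for b
      proof (cases "b \<in> K")
        case b: True
        then have "pr b" using True by auto
        then show ?thesis
          using b by (simp add: nil axis L_def pder_odd oder_nth insert_absorb ac_simps)
      qed (simp add: nil axis)
      then show ?thesis by (simp add: sum_component sum.If_cases)
    qed
    have "((\<lambda>t. t ^ card K * F u $ K) has_vector_derivative real (card K) * t ^ (card K - 1) * F u $ K) (at t)" for K :: "'a set"
      unfolding has_real_derivative_iff_has_vector_derivative[symmetric]
      by (auto intro!: derivative_eq_intros)
    then show ?thesis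
      unfolding has_vector_derivative_def
      by (subst has_derivative_componentwise_within) (auto simp: Basis_vec_def inner_axis L_def K[unfolded L_def sum_component])
  qed
  have "D F 1 = 0"
  proof (rule nilpotent_flow_unique[where P = P])
    show "D F \<in> P" using F by (auto simp: P_def)
    \<comment> \<open>Since \<open>0 ^ 0 = 1\<close>, the map \<open>L 0\<close> keeps exactly the
      body.\<close>
    show "d 0 = 0" if "d \<in> P" for d
      using that by (auto simp: P_def D_def gsub_gscale_0 body L_def vec_eq_iff gone_nth power_0_left)
    fix d t assume "d \<in> P"
    then obtain F where F: "d = D F" "superfun pr U F" by (auto simp: P_def)
    let ?x = "\<Sum>b\<in>UNIV. gnil (?g b) \<cdot> D (pder pr b F) t"
    have "(d has_vector_derivative ?x) (at t)"
      unfolding F(1) D_def gmul.diff_right sum_subtractf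
      by (intro has_vector_derivative_diff gsub_gscale_derivative[OF g] Lder F(2))
    moreover have "D (pder pr b F) \<in> P" for b
      unfolding P_def using F superfun_pder[OF U(1)] by blast
    ultimately show "\<exists>x. (d has_vector_derivative x) (at t) \<and> (\<forall>k. (\<forall>e\<in>P. lev k (e t)) \<longrightarrow> lev (Suc k) x)"
      by (intro exI[of _ ?x]) (auto intro!: lev_sum lev_Suc_gmul lev_gnil)
  qed
  moreover have "L 1 x = x" for x by (simp add: L_def vec_eq_iff)
  ultimately show ?thesis by (simp add: D_def subst_sfun_eq)
qed

section \<open>Weights\<close>

definition monom_at :: "('c::finite \<Rightarrow> bool) \<Rightarrow> ('c \<Rightarrow> int) \<Rightarrow> ('c \<Rightarrow> nat) \<Rightarrow> 'c point \<Rightarrow> real" where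
  "monom_at pr w k u = (\<Prod>a | \<not> pr a \<and> w a \<noteq> 0. (u $ a) ^ k a)"

definition coeff_wt :: "('c::finite \<Rightarrow> bool) \<Rightarrow> ('c \<Rightarrow> int) \<Rightarrow> int \<Rightarrow> ('c \<Rightarrow> nat) \<Rightarrow> 'c grass \<Rightarrow> bool" where
  "coeff_wt pr w r k x \<longleftrightarrow>
     (\<forall>I. x $ I \<noteq> 0 \<longrightarrow> (\<Sum>a | \<not> pr a. int (k a) * w a) + (\<Sum>a\<in>I. w a) = r)"

text \<open>The condition on a single coefficient in \<open>has_weight\<close>, separated so that
  homogeneous functions can be built term by term.\<close>

definition wt_coeff :: "('c::{finite,linorder} \<Rightarrow> bool) \<Rightarrow> ('c \<Rightarrow> int) \<Rightarrow> 'c point set \<Rightarrow> int \<Rightarrow> ('c \<Rightarrow> nat) \<Rightarrow> 'c sfun \<Rightarrow> bool" where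
  "wt_coeff pr w U r k c \<longleftrightarrow> superfun pr U c \<and>
     (\<forall>u\<in>U. \<forall>v\<in>U. (\<forall>a. w a = 0 \<longrightarrow> u $ a = v $ a) \<longrightarrow> c u = c v) \<and>
     (\<forall>u\<in>U. coeff_wt pr w r k (c u))"

lemma wt_coeffI:
  assumes "superfun pr U c" "\<And>u. u \<in> U \<Longrightarrow> coeff_wt pr w r k (c u)"
    "\<And>u v. u \<in> U \<Longrightarrow> v \<in> U \<Longrightarrow> (\<forall>a. w a = 0 \<longrightarrow> u $ a = v $ a) \<Longrightarrow> c u = c v"
  shows "wt_coeff pr w U r k c"
  unfolding wt_coeff_def using assms by blast

lemma wt_coeffD:
  assumes "wt_coeff pr w U r k c"
  shows "superfun pr U c" "u \<in> U \<Longrightarrow> coeff_wt pr w r k (c u)"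
    "u \<in> U \<Longrightarrow> v \<in> U \<Longrightarrow> \<forall>a. w a = 0 \<longrightarrow> u $ a = v $ a \<Longrightarrow> c u = c v"
  using assms unfolding wt_coeff_def by blast+

lemma has_weight_iff:
  "has_weight pr w U r f \<longleftrightarrow> superfun pr U f \<and> (\<exists>N c. finite N \<and> (\<forall>k\<in>N. wt_coeff pr w U r k (c k)) \<and>
     (\<forall>u\<in>U. f u = (\<Sum>k\<in>N. monom_at pr w k u *\<^sub>R c k u)))"
  unfolding has_weight_def poly_expansion_def wt_coeff_def coeff_wt_def monom_at_def ball_conj_distrib
  by (simp only: conj_ac)

lemma has_weight_superfun: "has_weight pr w U r f \<Longrightarrow> superfun pr U f"
  by (simp add: has_weight_def)

lemma has_weight_graded_fun: "has_weight pr w U r f \<Longrightarrow> graded_fun pr w U f"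
  by (auto simp: has_weight_def graded_fun_def)

lemma has_weight_cong:
  assumes "obody pr U" "\<And>u. u \<in> U \<Longrightarrow> f u = g u" "has_weight pr w U r f"
  shows "has_weight pr w U r g"
proof -
  have "superfun pr U g" using superfun_cong[of pr U f g] assms(1,2) has_weight_superfun[OF assms(3)] by blast
  then show ?thesis using assms(2,3) by (simp add: has_weight_iff)
qed

lemma graded_fun_superfun: "graded_fun pr w U f \<Longrightarrow> superfun pr U f"
  by (simp add: graded_fun_def)

lemma has_weight_zero [simp]: "has_weight pr w U r (\<lambda>u. 0)"
  unfolding has_weight_iff by (intro conjI exI[of _ "{}"]) simp_all

lemma coeff_wt_add:
  assumes "coeff_wt pr w r k x" "coeff_wt pr w r k y"
  shows "coeff_wt pr w r k (x + y)"
  unfolding coeff_wt_def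
proof (intro allI impI)
  fix I assume "(x + y) $ I \<noteq> 0"
  then have "x $ I \<noteq> 0 \<or> y $ I \<noteq> 0" by auto
  then show "(\<Sum>a | \<not> pr a. int (k a) * w a) + (\<Sum>a\<in>I. w a) = r"
    using assms unfolding coeff_wt_def by blast
qed

lemma wt_coeff_add:
  assumes "obody pr U" "wt_coeff pr w U r k c" "wt_coeff pr w U r k d"
  shows "wt_coeff pr w U r k (\<lambda>u. c u + d u)"
proof (rule wt_coeffI)
  show "c u + d u = c v + d v" if "u \<in> U" "v \<in> U" "\<forall>a. w a = 0 \<longrightarrow> u $ a = v $ a" for u v
    using wt_coeffD(3)[OF assms(2) that] wt_coeffD(3)[OF assms(3) that] by simp
qed (intro superfun_add coeff_wt_add assms wt_coeffD(1)[OF assms(2)] wt_coeffD(1)[OF assms(3)]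
    wt_coeffD(2)[OF assms(2)] wt_coeffD(2)[OF assms(3)]; assumption)+

lemma wt_coeff_zero: "wt_coeff pr w U r k (\<lambda>u. 0)"
  by (simp add: wt_coeff_def coeff_wt_def)

lemma has_weight_add:
  assumes U: "obody pr U" and f: "has_weight pr w U r f" and g: "has_weight pr w U r g"
  shows "has_weight pr w U r (\<lambda>u. f u + g u)"
proof -
  obtain N c where N: "finite N" "\<forall>k\<in>N. wt_coeff pr w U r k (c k)"
    "\<forall>u\<in>U. f u = (\<Sum>k\<in>N. monom_at pr w k u *\<^sub>R c k u)"
    using f by (auto simp: has_weight_iff)
  obtain M d where M: "finite M" "\<forall>k\<in>M. wt_coeff pr w U r k (d k)"
    "\<forall>u\<in>U. g u = (\<Sum>k\<in>M. monom_at pr w k u *\<^sub>R d k u)"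
    using g by (auto simp: has_weight_iff)
  define e where "e k u = (if k \<in> N then c k u else 0) + (if k \<in> M then d k u else 0)" for k u
  have "wt_coeff pr w U r k (e k)" for k
  proof -
    have "wt_coeff pr w U r k (\<lambda>u. if k \<in> N then c k u else 0)" "wt_coeff pr w U r k (\<lambda>u. if k \<in> M then d k u else 0)"
      using N(2) M(2) by (cases "k \<in> N"; cases "k \<in> M"; simp add: wt_coeff_zero)+
    then show ?thesis unfolding e_def by (rule wt_coeff_add[OF U])
  qed
  moreover have "f u + g u = (\<Sum>k\<in>N \<union> M. monom_at pr w k u *\<^sub>R e k u)" if "u \<in> U" for u
  proof -
    have "f u = (\<Sum>k\<in>N \<union> M. monom_at pr w k u *\<^sub>R (if k \<in> N then c k u else 0))"
      using N(1,3) M(1) that by (auto intro!: sum.mono_neutral_cong_left)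
    moreover have "g u = (\<Sum>k\<in>N \<union> M. monom_at pr w k u *\<^sub>R (if k \<in> M then d k u else 0))"
      using N(1) M(1,3) that by (auto intro!: sum.mono_neutral_cong_left)
    ultimately show ?thesis by (simp add: e_def scaleR_add_right sum.distrib)
  qed
  moreover have "superfun pr U (\<lambda>u. f u + g u)"
    using superfun_add[OF U] f g has_weight_superfun by blast
  ultimately show ?thesis
    unfolding has_weight_iff using N(1) M(1) by (intro conjI exI[of _ "N \<union> M"] exI[of _ e]) auto
qed

lemma has_weight_sum:
  "obody pr U \<Longrightarrow> (\<And>i. i \<in> X \<Longrightarrow> has_weight pr w U r (f i)) \<Longrightarrow> has_weight pr w U r (\<lambda>u. \<Sum>i\<in>X. f i u)"
  by (induction X rule: infinite_finite_induct) (auto intro: has_weight_add)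

text \<open>The subtraction in \<open>k a - 1\<close> is truncated for \<open>k a = 0\<close>, where
  the factor \<open>real (k a)\<close> is 0 anyway.\<close>

lemma monom_line:
  assumes "\<not> pr a"
  shows "((\<lambda>t. monom_at pr w k (u + t *\<^sub>R axis a 1)) has_real_derivative
    (if w a = 0 then 0 else real (k a) * monom_at pr w (k(a := k a - 1)) u)) (at 0)"
proof (cases "w a = 0")
  case True
  have "monom_at pr w k (u + t *\<^sub>R axis a 1) = monom_at pr w k u" for t
    unfolding monom_at_def using True by (intro prod.cong) (auto simp: axis_def)
  then show ?thesis using True by simp
next
  case False
  let ?A = "{b. \<not> pr b \<and> w b \<noteq> 0} - {a}"
  have split: "(\<Prod>b | \<not> pr b \<and> w b \<noteq> 0. f b) = f a * (\<Prod>b\<in>?A. f b)" for f :: "_ \<Rightarrow> real"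
    using False assms by (intro prod.remove) auto
  have eq: "monom_at pr w k (u + t *\<^sub>R axis a 1) = (u $ a + t) ^ k a * (\<Prod>b\<in>?A. u $ b ^ k b)" for t
    unfolding monom_at_def split by (intro arg_cong2[of _ _ _ _ "(*)"] prod.cong) (auto simp: axis_def)
  have eq': "monom_at pr w (k(a := k a - 1)) u = (u $ a) ^ (k a - 1) * (\<Prod>b\<in>?A. u $ b ^ k b)"
    unfolding monom_at_def split by (intro arg_cong2[of _ _ _ _ "(*)"] prod.cong) auto
  show ?thesis
    unfolding eq eq' using False by (auto intro!: derivative_eq_intros)
qed

lemma superfun_monom: "superfun pr U (\<lambda>u. monom_at pr w k u *\<^sub>R gone)" if U: "obody pr U"
proof -
  have pow: "superfun pr U (\<lambda>u. (u $ a) ^ n *\<^sub>R gone)" if "\<not> pr a" for a n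
  proof (induction n)
    case (Suc n)
    have "superfun pr U (\<lambda>u. crd pr a u \<cdot> ((u $ a) ^ n *\<^sub>R gone))"
      by (intro superfun_gmul[OF U] superfun_crd Suc)
    then show ?case using that by (simp add: crd_def gmul_linear mult.commute)
  qed simp
  have "superfun pr U (\<lambda>u. (\<Prod>a\<in>A. (u $ a) ^ k a) *\<^sub>R gone)" if "A \<subseteq> {a. \<not> pr a}" for A
    using finite[of A] that
  proof (induction A rule: finite_induct)
    case (insert a A)
    have "superfun pr U (\<lambda>u. ((u $ a) ^ k a *\<^sub>R gone) \<cdot> ((\<Prod>a\<in>A. (u $ a) ^ k a) *\<^sub>R gone))"
      using insert by (intro superfun_gmul[OF U] pow) auto
    then show ?case using insert(1,2) by (simp add: gmul_linear mult.commute)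
  qed simp
  from this[of "{a. \<not> pr a \<and> w a \<noteq> 0}"] show ?thesis unfolding monom_at_def by auto
qed

lemma superfun_monom_scaleR:
  assumes "obody pr U" "superfun pr U c"
  shows "superfun pr U (\<lambda>u. monom_at pr w k u *\<^sub>R c u)"
  using superfun_gmul[OF assms(1) superfun_monom[OF assms(1)] assms(2), of w k] by (simp add: gmul_linear)

lemma has_weight_monom:
  assumes "obody pr U" "wt_coeff pr w U r k c"
  shows "has_weight pr w U r (\<lambda>u. monom_at pr w k u *\<^sub>R c u)"
  unfolding has_weight_iff
proof (intro conjI exI[of _ "{k}"] exI[of _ "\<lambda>k. c"] ballI)
  show "superfun pr U (\<lambda>u. monom_at pr w k u *\<^sub>R c u)"
    by (rule superfun_monom_scaleR[OF assms(1) wt_coeffD(1)[OF assms(2)]])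
qed (simp_all add: assms(2))

lemma has_weightE:
  assumes "has_weight pr w U r f"
  obtains N c where "finite N" "\<And>k. k \<in> N \<Longrightarrow> wt_coeff pr w U r k (c k)"
    "\<And>u. u \<in> U \<Longrightarrow> f u = (\<Sum>k\<in>N. monom_at pr w k u *\<^sub>R c k u)"
  using assms unfolding has_weight_iff by blast

text \<open>The last condition on \<open>L\<close> says that it creates no new index sets, so each
  coefficient keeps its weight.\<close>

lemma has_weight_coeff_linear:
  assumes U: "obody pr U" and f: "has_weight pr w U r f"
    and L: "linear L" "\<And>x A. gsupp A x \<Longrightarrow> gsupp A (L x)" "\<And>x I. x $ I = 0 \<Longrightarrow> L x $ I = 0"
  shows "has_weight pr w U r (\<lambda>u. L (f u))"
proof -
  obtain N c where N: "finite N" "\<And>k. k \<in> N \<Longrightarrow> wt_coeff pr w U r k (c k)"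
    "\<And>u. u \<in> U \<Longrightarrow> f u = (\<Sum>k\<in>N. monom_at pr w k u *\<^sub>R c k u)"
    using has_weightE[OF f] by blast
  have "has_weight pr w U r (\<lambda>u. \<Sum>k\<in>N. monom_at pr w k u *\<^sub>R L (c k u))"
  proof (intro has_weight_sum[OF U] has_weight_monom[OF U])
    fix k assume "k \<in> N"
    then have c: "wt_coeff pr w U r k (c k)" by (rule N(2))
    show "wt_coeff pr w U r k (\<lambda>u. L (c k u))"
    proof (rule wt_coeffI)
      show "superfun pr U (\<lambda>u. L (c k u))" by (rule superfun_linear[OF L(1,2) U wt_coeffD(1)[OF c]])
      show "coeff_wt pr w r k (L (c k u))" if "u \<in> U" for u
        using wt_coeffD(2)[OF c that] L(3) unfolding coeff_wt_def by blast
      show "L (c k u) = L (c k v)" if "u \<in> U" "v \<in> U" "\<forall>a. w a = 0 \<longrightarrow> u $ a = v $ a" for u v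
        using wt_coeffD(3)[OF c that] by simp
    qed
  qed
  then show ?thesis
    by (rule has_weight_cong[OF U, rotated]) (simp add: N(3) linear_sum[OF L(1)] linear_scale[OF L(1)])
qed

lemma has_weight_scaleR:
  assumes "obody pr U" "has_weight pr w U r f"
  shows "has_weight pr w U r (\<lambda>u. x *\<^sub>R f u)"
  by (rule has_weight_coeff_linear[OF assms]) (auto simp: linear_iff algebra_simps gsupp_scaleR)

text \<open>Exponents add and coefficients multiply. Pairs with the same sum of exponents are left
  uncollected, since sums of homogeneous terms are homogeneous.\<close>

lemma has_weight_gmul:
  assumes U: "obody pr U" and f: "has_weight pr w U r f" and g: "has_weight pr w U s g"
  shows "has_weight pr w U (r + s) (\<lambda>u. f u \<cdot> g u)"
proof -
  obtain N c where N: "finite N" "\<And>k. k \<in> N \<Longrightarrow> wt_coeff pr w U r k (c k)"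
    "\<And>u. u \<in> U \<Longrightarrow> f u = (\<Sum>k\<in>N. monom_at pr w k u *\<^sub>R c k u)"
    using has_weightE[OF f] by blast
  obtain M d where M: "finite M" "\<And>k. k \<in> M \<Longrightarrow> wt_coeff pr w U s k (d k)"
    "\<And>u. u \<in> U \<Longrightarrow> g u = (\<Sum>k\<in>M. monom_at pr w k u *\<^sub>R d k u)"
    using has_weightE[OF g] by blast
  have mon: "monom_at pr w k u * monom_at pr w l u = monom_at pr w (\<lambda>a. k a + l a) u" for k l u
    by (simp add: monom_at_def prod.distrib power_add)
  have wt: "wt_coeff pr w U (r + s) (\<lambda>a. k a + l a) (\<lambda>u. c k u \<cdot> d l u)" if kl: "k \<in> N" "l \<in> M" for k l
  proof (rule wt_coeffI)
    note c = wt_coeffD[OF N(2)[OF kl(1)]] and d = wt_coeffD[OF M(2)[OF kl(2)]]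
    show "superfun pr U (\<lambda>u. c k u \<cdot> d l u)" by (rule superfun_gmul[OF U c(1) d(1)])
    show "c k u \<cdot> d l u = c k v \<cdot> d l v" if "u \<in> U" "v \<in> U" "\<forall>a. w a = 0 \<longrightarrow> u $ a = v $ a" for u v
      using c(3)[OF that] d(3)[OF that] by simp
    fix u assume u: "u \<in> U"
    show "coeff_wt pr w (r + s) (\<lambda>a. k a + l a) (c k u \<cdot> d l u)"
      unfolding coeff_wt_def
    proof (intro allI impI)
      fix K assume "(c k u \<cdot> d l u) $ K \<noteq> 0"
      then obtain I where I: "I \<subseteq> K" "c k u $ I \<noteq> 0" "d l u $ (K - I) \<noteq> 0" by (rule gmul_nth_nonzero)
      have "(\<Sum>a | \<not> pr a. int (k a) * w a) + (\<Sum>a\<in>I. w a) = r"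
        "(\<Sum>a | \<not> pr a. int (l a) * w a) + (\<Sum>a\<in>K - I. w a) = s"
        using c(2)[OF u] d(2)[OF u] I unfolding coeff_wt_def by blast+
      moreover have "(\<Sum>a\<in>K. w a) = (\<Sum>a\<in>K - I. w a) + (\<Sum>a\<in>I. w a)"
        by (rule sum.subset_diff) (auto simp: I)
      ultimately show "(\<Sum>a | \<not> pr a. int (k a + l a) * w a) + (\<Sum>a\<in>K. w a) = r + s"
        by (simp add: distrib_right sum.distrib)
    qed
  qed
  have "has_weight pr w U (r + s) (\<lambda>u. \<Sum>k\<in>N. \<Sum>l\<in>M. monom_at pr w (\<lambda>a. k a + l a) u *\<^sub>R (c k u \<cdot> d l u))"
    by (intro has_weight_sum[OF U] has_weight_monom[OF U] wt)
  then show ?thesis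
    by (rule has_weight_cong[OF U, rotated])
      (simp add: N(3) M(3) gmul.sum_left gmul.sum_right gmul_linear mon[symmetric] scaleR_sum_right
        sum.swap[of _ N M] mult.commute)
qed

text \<open>Odd coordinates and even ones of weight 0 are the directions in which a coefficient may
  vary. The shift by \<open>w a\<close> is the weight of the generator lost in the odd case.\<close>

lemma wt_coeff_pder:
  assumes U: "obody pr U" and c: "wt_coeff pr w U r k c" and a: "pr a \<or> w a = 0"
  shows "wt_coeff pr w U (r - w a) k (pder pr a c)"
proof (rule wt_coeffI)
  note sc = wt_coeffD(1)[OF c]
  then show "superfun pr U (pder pr a c)" by (rule superfun_pder[OF U])
  fix u assume u: "u \<in> U"
  show "pder pr a c u = pder pr a c v" if v: "v \<in> U" and uv: "\<forall>a. w a = 0 \<longrightarrow> u $ a = v $ a" for v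
  proof (cases "pr a")
    case True
    then show ?thesis using wt_coeffD(3)[OF c u v uv] by (simp add: pder_odd)
  next
    \<comment> \<open>Points with the same coordinates of weight 0 keep this relation along parallel
      lines, so the coefficient has the same difference quotients at both.\<close>
    case False
    have "\<forall>\<^sub>F t in nhds 0. t \<in> UNIV \<longrightarrow> c (u + t *\<^sub>R axis a 1) = c (v + t *\<^sub>R axis a 1)"
      using obody_line[OF U u False] obody_line[OF U v False]
    proof eventually_elim
      case (elim t)
      have "\<forall>b. w b = 0 \<longrightarrow> (u + t *\<^sub>R axis a 1) $ b = (v + t *\<^sub>R axis a 1) $ b" using uv by simp
      then show ?case using wt_coeffD(3)[OF c] elim by blast
    qed
    then show ?thesis using False by (simp add: pder_even vector_derivative_cong_eq)
  qed
  show "coeff_wt pr w (r - w a) k (pder pr a c u)"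
  proof (cases "pr a")
    case True
    have "coeff_wt pr w r k (c u)" by (rule wt_coeffD(2)[OF c u])
    then show ?thesis
      unfolding coeff_wt_def pder_odd[of pr a, OF True] by (auto simp: oder_nth algebra_simps split: if_splits)
  next
    case False
    \<comment> \<open>The projection onto the index sets allowed by the weight condition, to which
      \<open>pder_invariant\<close> applies.\<close>
    define L :: "'a grass \<Rightarrow> 'a grass" where
      "L x = (\<chi> I. if (\<Sum>a | \<not> pr a. int (k a) * w a) + (\<Sum>a\<in>I. w a) = r then x $ I else 0)" for x
    have L: "coeff_wt pr w r k x \<longleftrightarrow> L x = x" for x
      by (auto simp: coeff_wt_def L_def vec_eq_iff)
    have "linear L" by (auto simp: linear_iff L_def vec_eq_iff)
    then have "L (pder pr a c u) = pder pr a c u"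
      using wt_coeffD(2)[OF c] L by (intro pder_invariant[OF _ U u superfun_differentiable[OF sc] False]) blast+
    then show ?thesis using a False L by simp
  qed
qed

text \<open>Each term is a monomial times a coefficient, and a direction changes only one of them:
  odd coordinates and those of weight 0 act on the coefficient, the remaining ones on the
  monomial.\<close>

lemma has_weight_pder:
  assumes U: "obody pr U" and f: "has_weight pr w U r f"
  shows "has_weight pr w U (r - w a) (pder pr a f)"
proof -
  obtain N c where N: "finite N" "\<And>k. k \<in> N \<Longrightarrow> wt_coeff pr w U r k (c k)"
    "\<And>u. u \<in> U \<Longrightarrow> f u = (\<Sum>k\<in>N. monom_at pr w k u *\<^sub>R c k u)"
    using has_weightE[OF f] by blast
  have sc: "superfun pr U (c k)" if "k \<in> N" for k by (rule wt_coeffD(1)[OF N(2)[OF that]])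
  have trm: "has_weight pr w U (r - w a) (pder pr a (\<lambda>u. monom_at pr w k u *\<^sub>R c k u))" if k: "k \<in> N" for k
  proof -
    have eq: "pder pr a (\<lambda>u. monom_at pr w k u *\<^sub>R c k u) u =
        pder pr a (\<lambda>u. monom_at pr w k u *\<^sub>R gone) u \<cdot> c k u + monom_at pr w k u *\<^sub>R pder pr a (c k) u"
      if u: "u \<in> U" for u
    proof -
      have "pder pr a (\<lambda>u. (monom_at pr w k u *\<^sub>R gone) \<cdot> c k u) u =
        pder pr a (\<lambda>u. monom_at pr w k u *\<^sub>R gone) u \<cdot> c k u +
        ksign (pr a) False *\<^sub>R ((monom_at pr w k u *\<^sub>R gone) \<cdot> pder pr a (c k) u)"
        by (intro pder_gmul_gpar[OF U u] superfun_differentiable[OF superfun_monom[OF U]]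
            superfun_differentiable[OF sc] k gpar_scaleR gpar_gone)
      then show ?thesis by (simp add: gmul_linear)
    qed
    show ?thesis
    proof (cases "pr a \<or> w a = 0")
      case True
      have mon0: "pder pr a (\<lambda>u. monom_at pr w k u *\<^sub>R gone) u = 0" for u
      proof (cases "pr a")
        case False
        then show ?thesis
          using True monom_line[of pr a w k u, OF False]
          by (intro pder_eqI[of pr a, OF False])
            (auto simp: has_real_derivative_iff_has_vector_derivative
              dest: bounded_linear.has_vector_derivative[OF bounded_linear_scaleR_left[of gone]])
      qed (simp add: pder_odd linear_scale[OF linear_oder])
      have "has_weight pr w U (r - w a) (\<lambda>u. monom_at pr w k u *\<^sub>R pder pr a (c k) u)"
        by (intro has_weight_monom[OF U] wt_coeff_pder[OF U] N(2) k True)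
      then show ?thesis by (rule has_weight_cong[OF U, rotated]) (simp add: eq mon0)
    next
      case False
      then have a: "\<not> pr a" "w a \<noteq> 0" by auto
      have mon: "pder pr a (\<lambda>u. monom_at pr w k u *\<^sub>R gone) u =
          (real (k a) * monom_at pr w (k(a := k a - 1)) u) *\<^sub>R gone" for u
        using a(2) monom_line[of pr a w k u, OF a(1)]
        by (intro pder_eqI[of pr a, OF a(1)])
          (auto simp: has_real_derivative_iff_has_vector_derivative
            dest: bounded_linear.has_vector_derivative[OF bounded_linear_scaleR_left[of gone]])
      have const: "pder pr a (c k) u = 0" if u: "u \<in> U" for u
      proof -
        have "\<forall>\<^sub>F t in nhds 0. t \<in> UNIV \<longrightarrow> c k (u + t *\<^sub>R axis a 1) = c k u"
          using obody_line[OF U u a(1)]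
        proof eventually_elim
          case (elim t)
          have "\<forall>b. w b = 0 \<longrightarrow> (u + t *\<^sub>R axis a 1) $ b = u $ b" using a(2) by (auto simp: axis_def)
          then show ?case using wt_coeffD(3)[OF N(2)[OF k]] elim u by blast
        qed
        then have "vector_derivative (\<lambda>t. c k (u + t *\<^sub>R axis a 1)) (at 0) = vector_derivative (\<lambda>t. c k u) (at 0)"
          by (rule vector_derivative_cong_eq) auto
        then show ?thesis using a(1) by (simp add: pder_even)
      qed
      have "wt_coeff pr w U (r - w a) (k(a := k a - 1)) (\<lambda>u. real (k a) *\<^sub>R c k u)"
      proof (cases "k a = 0")
        case True
        then show ?thesis by (simp add: wt_coeff_zero)
      next
        case False
        have "(\<Sum>b | \<not> pr b. int ((k(a := k a - 1)) b) * w b) = (\<Sum>b | \<not> pr b. int (k b) * w b) - w a"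
        proof -
          have "(\<Sum>b | \<not> pr b. g b) = g a + (\<Sum>b\<in>{b. \<not> pr b} - {a}. g b)" for g :: "'a \<Rightarrow> int"
            using a(1) by (intro sum.remove) auto
          moreover have "(\<Sum>b\<in>{b. \<not> pr b} - {a}. int ((k(a := k a - 1)) b) * w b) =
              (\<Sum>b\<in>{b. \<not> pr b} - {a}. int (k b) * w b)"
            by (intro sum.cong) auto
          moreover have "int (k a - 1) = int (k a) - 1" using False by simp
          ultimately show ?thesis by (simp add: algebra_simps)
        qed
        then have "coeff_wt pr w (r - w a) (k(a := k a - 1)) (real (k a) *\<^sub>R c k u)" if "u \<in> U" for u
          using wt_coeffD(2)[OF N(2)[OF k] that] unfolding coeff_wt_def by (auto simp: algebra_simps)
        then show ?thesis
          using wt_coeffD(3)[OF N(2)[OF k]] by (intro wt_coeffI superfun_scaleR[OF U sc[OF k]]) metis+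
      qed
      then have "has_weight pr w U (r - w a) (\<lambda>u. monom_at pr w (k(a := k a - 1)) u *\<^sub>R (real (k a) *\<^sub>R c k u))"
        by (rule has_weight_monom[OF U])
      then show ?thesis
        by (rule has_weight_cong[OF U, rotated]) (simp add: eq mon const gmul_linear mult.commute)
    qed
  qed
  have "has_weight pr w U (r - w a) (\<lambda>u. \<Sum>k\<in>N. pder pr a (\<lambda>u. monom_at pr w k u *\<^sub>R c k u) u)"
    by (intro has_weight_sum[OF U] trm)
  then show ?thesis
  proof (rule has_weight_cong[OF U, rotated])
    fix u assume u: "u \<in> U"
    have "pder pr a f u = pder pr a (\<lambda>u. \<Sum>k\<in>N. monom_at pr w k u *\<^sub>R c k u) u"
      by (rule pder_cong[OF U N(3) u])
    also have "\<dots> = (\<Sum>k\<in>N. pder pr a (\<lambda>u. monom_at pr w k u *\<^sub>R c k u) u)"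
      by (intro pder_sum[OF U u] superfun_differentiable[OF superfun_monom_scaleR[OF U]] sc)
    finally show "(\<Sum>k\<in>N. pder pr a (\<lambda>u. monom_at pr w k u *\<^sub>R c k u) u) = pder pr a f u" ..
  qed
qed

text \<open>An odd coordinate, or one of weight 0, is itself a coefficient with trivial monomial;
  any other is a monomial with coefficient \<open>gone\<close>.\<close>

lemma has_weight_crd:
  assumes "obody pr U"
  shows "has_weight pr w U (w a) (crd pr a)"
proof (cases "pr a \<or> w a = 0")
  case True
  have "wt_coeff pr w U (w a) (\<lambda>b. 0) (crd pr a)"
    using True by (intro wt_coeffI superfun_crd) (auto simp: coeff_wt_def crd_def axis_def gone_nth)
  from has_weight_monom[OF assms this] show ?thesis by (simp add: monom_at_def)
next
  case False
  let ?k = "\<lambda>b. if b = a then 1 else 0 :: nat"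
  have "(\<Sum>b | \<not> pr b. int (?k b) * w b) = (\<Sum>b | \<not> pr b. if b = a then w b else 0)"
    by (intro sum.cong) auto
  then have "wt_coeff pr w U (w a) ?k (\<lambda>u. gone)"
    using False by (auto simp: wt_coeff_def coeff_wt_def gone_nth)
  from has_weight_monom[OF assms this] have "has_weight pr w U (w a) (\<lambda>u. monom_at pr w ?k u *\<^sub>R gone)" .
  moreover have "monom_at pr w ?k u = u $ a" for u
  proof -
    have "monom_at pr w ?k u = (\<Prod>b | \<not> pr b \<and> w b \<noteq> 0. if b = a then u $ b else 1)"
      unfolding monom_at_def by (intro prod.cong) auto
    then show ?thesis using False by simp
  qed
  ultimately show ?thesis
    by (rule_tac has_weight_cong[OF assms, rotated]) (use False in \<open>auto simp: crd_def\<close>)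
qed

section \<open>Functions on the cotangent bundle\<close>

lemma Pos_vimage_image [simp]: "Pos -` (Pos ` I) = I"
  by auto

lemma Pos_image_subset [simp]: "Pos ` I \<subseteq> range Pos"
  by auto

lemma sum_cot: "(\<Sum>x\<in>UNIV. f x) = (\<Sum>a\<in>UNIV. f (Pos a)) + (\<Sum>a\<in>UNIV. f (Mom a))"
  for f :: "('c::finite) cot \<Rightarrow> 'm::comm_monoid_add"
proof -
  have U: "(UNIV :: 'c cot set) = range Pos \<union> range Mom"
    by (metis (no_types) UNIV_eq_I Un_iff cot.exhaust rangeI)
  have "(\<Sum>x\<in>UNIV. f x) = sum f (range Pos) + sum f (range Mom)"
    unfolding U by (rule sum.union_disjoint) auto
  then show ?thesis by (simp add: sum.reindex inj_on_def)
qed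

lemma sum_cot_Collect:
  "(\<Sum>x | P x. f x) = (\<Sum>a | P (Pos a). f (Pos a)) + (\<Sum>a | P (Mom a). f (Mom a))"
  for f :: "('c::finite) cot \<Rightarrow> 'm::comm_monoid_add"
  using sum_cot[of "\<lambda>x. if P x then f x else 0"] by (simp add: sum.If_cases)

definition glift :: "('c::finite) grass \<Rightarrow> 'c cot grass" where
  "glift x = (\<chi> J. if J \<subseteq> range Pos then x $ (Pos -` J) else 0)"

definition grestrict :: "('c::finite) cot grass \<Rightarrow> 'c grass" where
  "grestrict X = (\<chi> I. X $ (Pos ` I))"

lemma lift_eq: "lift f z = glift (f (base_point z))"
  by (simp add: lift_def glift_def)

lemma restrict0_eq: "restrict0 F u = grestrict (F (zero_section u))"
  by (simp add: restrict0_def grestrict_def)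

lemma linear_glift: "linear glift"
  by (auto simp: linear_iff glift_def vec_eq_iff)

lemma linear_grestrict: "linear grestrict"
  by (auto simp: linear_iff grestrict_def vec_eq_iff)

lemmas glift_simps = linear_add[OF linear_glift] linear_diff[OF linear_glift] linear_0[OF linear_glift]
  linear_scale[OF linear_glift] linear_sum[OF linear_glift]

lemma grestrict_glift [simp]: "grestrict (glift x) = x"
  by (auto simp: grestrict_def glift_def vec_eq_iff)

lemma glift_body [simp]: "glift x $ {} = x $ {}"
  by (simp add: glift_def)

lemma glift_gone [simp]: "glift gone = gone"
  by (auto simp: glift_def vec_eq_iff gone_nth subset_image_iff)

lemma glift_axis: "glift (axis {a} 1) = axis {Pos a} 1"
proof -
  have "J \<subseteq> range Pos \<and> Pos -` J = {a} \<longleftrightarrow> J = {Pos a}" for J :: "'a cot set"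
    by (auto simp: subset_image_iff)
  then have "glift (axis {a} 1) $ J = axis {Pos a} 1 $ J" for J
    by (cases "J = {Pos a}") (auto simp: glift_def axis_def)
  then show ?thesis by (simp add: vec_eq_iff)
qed

lemma less_Pos [simp]: "Pos a < Pos b \<longleftrightarrow> a < b" for a :: "'c::linorder"
  by (simp add: less_cot_def less_le_not_le)

lemma gsign_Pos [simp]: "gsign (Pos ` I) (Pos ` J) = gsign I J" for I :: "('c::{finite,linorder}) set"
proof -
  have "{(i, j). i \<in> Pos ` I \<and> j \<in> Pos ` J \<and> j < i} = {(Pos i, Pos j) | i j. i \<in> I \<and> j \<in> J \<and> j < i}"
    by auto
  also have "\<dots> = (\<lambda>(i, j). (Pos i, Pos j)) ` {(i, j). i \<in> I \<and> j \<in> J \<and> j < i}"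
    by auto
  also have "card \<dots> = card {(i, j). i \<in> I \<and> j \<in> J \<and> j < i}"
    by (rule card_image) (auto simp: inj_on_def)
  finally show ?thesis by (simp add: gsign_def)
qed

text \<open>\<open>Pos\<close> preserves the order and hence the signs, and an index set leaves
  \<open>range Pos\<close> only if one of its two blocks does.\<close>

lemma glift_gmul: "glift (x \<cdot> y) = glift x \<cdot> glift y"
proof (rule vec_eq_iff[THEN iffD2, rule_format])
  fix J :: "'a cot set"
  show "glift (x \<cdot> y) $ J = (glift x \<cdot> glift y) $ J"
  proof (cases "J \<subseteq> range Pos")
    case True
    then obtain K where J: "J = Pos ` K" by (auto simp: subset_image_iff)
    have "(glift x \<cdot> glift y) $ J = (\<Sum>I\<in>Pow K. gsign I (K - I) * x $ I * y $ (K - I))"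
      unfolding gmul_nth J
    proof (rule sum.reindex_bij_witness[where i = "\<lambda>L. Pos ` L" and j = "\<lambda>I. Pos -` I"])
      fix I assume "I \<in> Pow (Pos ` K)"
      then obtain L where L: "I = Pos ` L" "L \<subseteq> K" by (auto simp: subset_image_iff)
      have d: "Pos ` K - Pos ` L = Pos ` (K - L)" by auto
      show "gsign (Pos -` I) (K - Pos -` I) * x $ (Pos -` I) * y $ (K - Pos -` I) =
          gsign I (Pos ` K - I) * glift x $ I * glift y $ (Pos ` K - I)"
        unfolding L(1) d by (auto simp: glift_def)
      show "Pos ` (Pos -` I) = I" "Pos -` I \<in> Pow K" using L by auto
    qed auto
    then show ?thesis by (simp add: J glift_def gmul_nth)
  next
    case False
    have "gsign I (J - I) * glift x $ I * glift y $ (J - I) = 0" if "I \<in> Pow J" for I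
    proof -
      have "\<not> (I \<subseteq> range Pos \<and> J - I \<subseteq> range Pos)" using False by blast
      then show ?thesis by (auto simp: glift_def)
    qed
    then have "(glift x \<cdot> glift y) $ J = 0" unfolding gmul_nth by (rule sum.neutral[OF ballI])
    then show ?thesis using False by (simp add: glift_def)
  qed
qed

lemma glift_nth_nonzero:
  assumes "glift x $ J \<noteq> 0"
  obtains I where "J = Pos ` I" "x $ I \<noteq> 0"
proof -
  have "J \<subseteq> range Pos" using assms by (auto simp: glift_def split: if_splits)
  then obtain I where I: "J = Pos ` I" by (auto simp: subset_image_iff)
  then have "x $ I \<noteq> 0" using assms by (auto simp: glift_def)
  with I show thesis by (rule that)
qed

lemma card_Pos [simp]: "card (Pos ` I) = card I"
  by (simp add: card_image inj_on_def)

lemma gpar_glift: "gpar e x \<Longrightarrow> gpar e (glift x)"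
  by (rule gparI) (auto elim!: glift_nth_nonzero simp: gpar_def)

lemma gpar_grestrict: "gpar e x \<Longrightarrow> gpar e (grestrict x)"
  by (auto simp: gpar_def grestrict_def)

lemma glift_gtwist: "glift (gtwist e x) = gtwist e (glift x)"
  by (auto simp: gtwist_def glift_def vec_eq_iff subset_image_iff)

lemma glift_gnil: "glift (gnil x) = gnil (glift x)"
  by (simp add: gnil_def glift_simps)

lemma gsupp_glift: "gsupp {a. pr a} x \<Longrightarrow> gsupp {x. cot_par pr x} (glift x)"
  by (rule gsuppI) (fastforce elim!: glift_nth_nonzero simp: gsupp_def)

lemma oder_glift_Pos: "oder (Pos a) (glift x) = glift (oder a x)"
proof (rule vec_eq_iff[THEN iffD2, rule_format])
  fix J :: "'a cot set"
  show "oder (Pos a) (glift x) $ J = glift (oder a x) $ J"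
  proof (cases "J \<subseteq> range Pos")
    case True
    then obtain I where J: "J = Pos ` I" by (auto simp: subset_image_iff)
    have "Pos -` insert (Pos a) (Pos ` I) = insert a I" by auto
    moreover have "gsign {Pos a} (Pos ` I) = gsign {a} I" using gsign_Pos[of "{a}" I] by simp
    ultimately show ?thesis by (auto simp: J oder_nth glift_def)
  qed (auto simp: oder_nth glift_def)
qed

lemma oder_glift_Mom: "oder (Mom a) (glift x) = 0"
  by (auto simp: oder_nth glift_def vec_eq_iff)

lemma oder_grestrict: "grestrict (oder (Pos a) X) = oder a (grestrict X)"
proof -
  have "gsign {Pos a} (Pos ` I) = gsign {a} I" for I using gsign_Pos[of "{a}" I] by simp
  then show ?thesis by (auto simp: oder_nth grestrict_def vec_eq_iff)
qed

section \<open>The projection and the zero section\<close>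

lemma linear_base_point: "linear base_point"
  by (auto simp: linear_iff base_point_def vec_eq_iff)

lemma linear_zero_section: "linear zero_section"
  by (auto simp: linear_iff zero_section_def vec_eq_iff split: cot.split)

lemma base_point_line [simp]:
  "base_point (z + t *\<^sub>R axis (Pos a) 1) = base_point z + t *\<^sub>R axis a 1"
  "base_point (z + t *\<^sub>R axis (Mom a) 1) = base_point z"
  by (auto simp: base_point_def vec_eq_iff axis_def)

lemma zero_section_line: "zero_section (u + t *\<^sub>R axis a 1) = zero_section u + t *\<^sub>R axis (Pos a) 1"
  by (auto simp: zero_section_def vec_eq_iff axis_def split: cot.split)

lemma base_point_zero_section [simp]: "base_point (zero_section u) = u"
  by (simp add: base_point_def zero_section_def vec_eq_iff)

lemma cot_setD: "z \<in> cot_set pr U \<Longrightarrow> base_point z \<in> U"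
  by (simp add: cot_set_def)

lemma zero_section_cot_set:
  assumes "obody pr U" "u \<in> U"
  shows "zero_section u \<in> cot_set pr U"
proof -
  have "\<And>a. pr a \<Longrightarrow> u $ a = 0" using obody_subset[OF assms] by (simp add: body_space_def)
  then have "zero_section u \<in> body_space (cot_par pr)"
    by (auto simp: body_space_def zero_section_def split: cot.split)
  then show ?thesis using assms(2) by (simp add: cot_set_def)
qed

lemma obody_cot_set:
  assumes "obody pr U"
  shows "obody (cot_par pr) (cot_set pr U)"
proof -
  obtain T where T: "open T" "U = body_space pr \<inter> T" using assms by (auto simp: openin_open)
  have "base_point z \<in> body_space pr" if "z \<in> body_space (cot_par pr)" for z
    using that by (auto simp: body_space_def base_point_def)
  then have "cot_set pr U = body_space (cot_par pr) \<inter> base_point -` T"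
    using T(2) by (auto simp: cot_set_def)
  moreover have "open (base_point -` T)"
    by (intro open_vimage T(1) linear_continuous_on linear_base_point[unfolded linear_conv_bounded_linear])
  ultimately show ?thesis by (auto simp: openin_open)
qed

lemma cot_set_mono: "U \<subseteq> V \<Longrightarrow> cot_set pr U \<subseteq> cot_set pr V"
  by (auto simp: cot_set_def)

lemma pder_lift_Pos:
  assumes "obody pr U" "f differentiable_on U" "base_point z \<in> U"
  shows "pder (cot_par pr) (Pos a) (lift f) z = lift (pder pr a f) z"
proof (cases "pr a")
  case False
  then have F: "\<not> cot_par pr (Pos a)" by simp
  have "bounded_linear (glift :: 'a grass \<Rightarrow> _)" using linear_glift by (simp add: linear_conv_bounded_linear)
  from bounded_linear.has_vector_derivative[OF this pder_line[OF assms(1,3) False assms(2)]]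
  show ?thesis by (intro pder_eqI[of "cot_par pr" "Pos a", OF F]) (simp add: lift_eq)
qed (simp add: pder_odd lift_eq oder_glift_Pos)

lemma pder_lift_Mom [simp]: "pder (cot_par pr) (Mom a) (lift f) z = 0"
  by (cases "pr a") (simp_all add: pder_odd pder_even lift_eq oder_glift_Mom)

lemma differentiable_on_lift:
  assumes "f differentiable_on U"
  shows "lift f differentiable_on cot_set pr U"
proof -
  have "(\<lambda>z. f (base_point z)) differentiable_on cot_set pr U"
  proof (rule differentiable_on_compose[of base_point _ f])
    show "base_point differentiable_on cot_set pr U"
      by (rule bounded_linear_imp_differentiable_on[OF linear_base_point[unfolded linear_conv_bounded_linear]])
    show "f differentiable_on base_point ` cot_set pr U"
      using assms by (rule differentiable_on_subset) (auto simp: cot_set_def)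
  qed
  from differentiable_on_linear[OF linear_glift this] show ?thesis by (simp add: lift_eq[abs_def])
qed

lemma ck_lift:
  assumes U: "obody pr U" and f: "ck n pr U f"
  shows "ck n (cot_par pr) (cot_set pr U) (lift f)"
  using f
proof (induction n arbitrary: f)
  case 0
  then show ?case by (simp add: differentiable_on_lift)
next
  case (Suc n)
  have "ck n (cot_par pr) (cot_set pr U) (pder (cot_par pr) x (lift f))" if x: "\<not> cot_par pr x" for x
  proof (cases x)
    case (Pos a)
    have "ck n (cot_par pr) (cot_set pr U) (lift (pder pr a f))"
      using Suc.prems x Pos by (intro Suc.IH) auto
    then show ?thesis
      unfolding Pos
      by (rule ck_cong[OF obody_cot_set[OF U], rotated])
        (rule pder_lift_Pos[OF U ck_differentiable[OF Suc.prems] cot_setD, symmetric])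
  next
    case (Mom a)
    have "pder (cot_par pr) x (lift f) = (\<lambda>z. 0)" unfolding Mom by auto
    then show ?thesis by (simp add: ck_zero)
  qed
  then show ?case using differentiable_on_lift[OF ck_differentiable[OF Suc.prems]] by simp
qed

lemma superfun_lift:
  assumes "obody pr U" "superfun pr U f"
  shows "superfun (cot_par pr) (cot_set pr U) (lift f)"
  using assms ck_lift[OF assms(1)] by (auto simp: superfun_iff lift_eq cot_setD intro!: gsupp_glift)

lemma has_parity_lift: "has_parity U e f \<Longrightarrow> has_parity (cot_set pr U) e (lift f)"
  by (simp add: has_parity_iff lift_eq cot_setD gpar_glift)

lemma lift_crd: "lift (crd pr a) = crd (cot_par pr) (Pos a)"
  by (auto simp: fun_eq_iff lift_eq crd_def glift_axis glift_simps base_point_def)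

lemma pder_restrict0:
  assumes U: "obody pr U" "u \<in> U" and F: "F differentiable_on cot_set pr U"
  shows "pder pr a (restrict0 F) u = restrict0 (pder (cot_par pr) (Pos a) F) u"
proof (cases "pr a")
  case False
  then have a: "\<not> cot_par pr (Pos a)" by simp
  have "bounded_linear (grestrict :: 'a cot grass \<Rightarrow> _)" using linear_grestrict by (simp add: linear_conv_bounded_linear)
  from bounded_linear.has_vector_derivative[OF this pder_line[OF obody_cot_set[OF U(1)] zero_section_cot_set[OF U] a F]]
  show ?thesis by (intro pder_eqI[of pr a, OF False]) (simp add: restrict0_eq zero_section_line)
qed (simp add: pder_odd restrict0_eq oder_grestrict)

lemma superfun_restrict0:
  assumes U: "obody pr U" and F: "superfun (cot_par pr) (cot_set pr U) F"
  shows "superfun pr U (restrict0 F)"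
proof -
  have d: "restrict0 F differentiable_on U" if "F differentiable_on cot_set pr U" for F
  proof -
    have "(\<lambda>u. F (zero_section u)) differentiable_on U"
    proof (rule differentiable_on_compose[of zero_section _ F])
      show "zero_section differentiable_on U"
        by (rule bounded_linear_imp_differentiable_on[OF linear_zero_section[unfolded linear_conv_bounded_linear]])
      show "F differentiable_on zero_section ` U"
        using that by (rule differentiable_on_subset) (auto intro: zero_section_cot_set[OF U])
    qed
    from differentiable_on_linear[OF linear_grestrict this] show ?thesis by (simp add: restrict0_eq[abs_def])
  qed
  have "ck n pr U (restrict0 F)" for n
    using F
  proof (induction n arbitrary: F)
    case 0
    then show ?case using d superfun_differentiable by auto
  next
    case (Suc n)
    have "ck n pr U (pder pr a (restrict0 F))" for a
    proof (rule ck_cong[OF U])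
      show "restrict0 (pder (cot_par pr) (Pos a) F) u = pder pr a (restrict0 F) u" if "u \<in> U" for u
        by (rule pder_restrict0[OF U that superfun_differentiable[OF Suc.prems], symmetric])
      show "ck n pr U (restrict0 (pder (cot_par pr) (Pos a) F))"
        by (rule Suc.IH[OF superfun_pder[OF obody_cot_set[OF U] Suc.prems]])
    qed
    then show ?case using d[OF superfun_differentiable[OF Suc.prems]] by simp
  qed
  moreover have "gsupp {a. pr a} (restrict0 F u)" if "u \<in> U" for u
  proof (rule gsuppI)
    fix I assume "restrict0 F u $ I \<noteq> 0"
    then have "F (zero_section u) $ (Pos ` I) \<noteq> 0" by (simp add: restrict0_def)
    moreover have "gsupp {x. cot_par pr x} (F (zero_section u))"
      using F zero_section_cot_set[OF U that] unfolding superfun_iff by blast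
    ultimately have "Pos ` I \<subseteq> {x. cot_par pr x}" by (metis gsupp_def)
    then show "I \<subseteq> {a. pr a}" by auto
  qed
  ultimately show ?thesis by (simp add: superfun_iff)
qed

lemma prod_cot_Collect:
  "(\<Prod>x | P x. f x) = (\<Prod>a | P (Pos a). f (Pos a)) * (\<Prod>a | P (Mom a). f (Mom a))"
  for f :: "('c::finite) cot \<Rightarrow> 'm::comm_monoid_mult"
proof -
  have eq: "{x. P x} = Pos ` {a. P (Pos a)} \<union> Mom ` {a. P (Mom a)}"
  proof (rule set_eqI)
    show "x \<in> {x. P x} \<longleftrightarrow> x \<in> Pos ` {a. P (Pos a)} \<union> Mom ` {a. P (Mom a)}" for x
      by (cases x) auto
  qed
  have "(\<Prod>x | P x. f x) = prod f (Pos ` {a. P (Pos a)}) * prod f (Mom ` {a. P (Mom a)})"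
    unfolding eq by (rule prod.union_disjoint) auto
  then show ?thesis by (simp add: prod.reindex inj_on_def)
qed

text \<open>Monomials are extended by exponent 0 on the momenta. Only the weights of positions
  enter, so one lemma covers every total weight.\<close>

lemma has_weight_lift:
  assumes U: "obody pr U" and f: "has_weight pr w U r f" and w: "\<And>a. w' (Pos a) = w a"
  shows "has_weight (cot_par pr) w' (cot_set pr U) r (lift f)"
proof -
  obtain N c where N: "finite N" "\<And>k. k \<in> N \<Longrightarrow> wt_coeff pr w U r k (c k)"
    "\<And>u. u \<in> U \<Longrightarrow> f u = (\<Sum>k\<in>N. monom_at pr w k u *\<^sub>R c k u)"
    using has_weightE[OF f] by blast
  define K where "K k = case_cot k (\<lambda>a. 0::nat)" for k :: "'a \<Rightarrow> nat"
  have "wt_coeff (cot_par pr) w' (cot_set pr U) r (K k) (lift (c k))" if k: "k \<in> N" for k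
  proof (rule wt_coeffI)
    note c = wt_coeffD[OF N(2)[OF k]]
    show "superfun (cot_par pr) (cot_set pr U) (lift (c k))" by (rule superfun_lift[OF U c(1)])
    show "lift (c k) z = lift (c k) z'"
      if z: "z \<in> cot_set pr U" "z' \<in> cot_set pr U" "\<forall>x. w' x = 0 \<longrightarrow> z $ x = z' $ x" for z z'
    proof -
      have "\<forall>a. w a = 0 \<longrightarrow> base_point z $ a = base_point z' $ a"
        using z(3) by (simp add: base_point_def w)
      then have "c k (base_point z) = c k (base_point z')" using c(3) z(1,2) by (simp add: cot_setD)
      then show ?thesis by (simp add: lift_eq)
    qed
    fix z assume "z \<in> cot_set pr U"
    then have cz: "coeff_wt pr w r k (c k (base_point z))" by (simp add: c(2) cot_setD)
    show "coeff_wt (cot_par pr) w' r (K k) (lift (c k) z)"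
      unfolding coeff_wt_def lift_eq
    proof (intro allI impI)
      fix J assume "glift (c k (base_point z)) $ J \<noteq> 0"
      then obtain I where "J = Pos ` I" "c k (base_point z) $ I \<noteq> 0" by (rule glift_nth_nonzero)
      then show "(\<Sum>x | \<not> cot_par pr x. int (K k x) * w' x) + (\<Sum>x\<in>J. w' x) = r"
        using cz by (simp add: coeff_wt_def sum_cot_Collect K_def w sum.reindex inj_on_def)
    qed
  qed
  then have "has_weight (cot_par pr) w' (cot_set pr U) r
      (\<lambda>z. \<Sum>k\<in>N. monom_at (cot_par pr) w' (K k) z *\<^sub>R lift (c k) z)"
    by (intro has_weight_sum has_weight_monom obody_cot_set[OF U])
  moreover have "monom_at (cot_par pr) w' (K k) z = monom_at pr w k (base_point z)" for k z
    by (simp add: monom_at_def prod_cot_Collect K_def w base_point_def)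
  ultimately show ?thesis
    by (elim has_weight_cong[OF obody_cot_set[OF U], rotated]) (simp add: N(3) lift_eq glift_simps cot_setD)
qed

text \<open>Even momenta of nonzero weight occur in the monomials, which vanish on the zero section
  if they contain one; the other momenta occur in the coefficients, which are evaluated
  there.\<close>

lemma has_weight_restrict0:
  assumes U: "obody pr U" and F: "has_weight (cot_par pr) w' (cot_set pr U) r F"
    and w: "\<And>a. w' (Pos a) = w a"
  shows "has_weight pr w U r (restrict0 F)"
proof -
  obtain N c where N: "finite N" "\<And>k. k \<in> N \<Longrightarrow> wt_coeff (cot_par pr) w' (cot_set pr U) r k (c k)"
    "\<And>z. z \<in> cot_set pr U \<Longrightarrow> F z = (\<Sum>k\<in>N. monom_at (cot_par pr) w' k z *\<^sub>R c k z)"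
    using has_weightE[OF F] by blast
  \<comment> \<open>The momentum part of the monomial at zero momenta, which is 1 or 0.\<close>
  define \<delta> where "\<delta> k = (if \<forall>a. \<not> pr a \<and> w' (Mom a) \<noteq> 0 \<longrightarrow> k (Mom a) = 0 then 1 else 0::real)"
    for k :: "'a cot \<Rightarrow> nat"
  note zs = zero_section_cot_set[OF U]
  have wt: "wt_coeff pr w U r (\<lambda>a. k (Pos a)) (\<lambda>u. \<delta> k *\<^sub>R restrict0 (c k) u)" if k: "k \<in> N" for k
  proof (rule wt_coeffI)
    note c = wt_coeffD[OF N(2)[OF k]]
    show "superfun pr U (\<lambda>u. \<delta> k *\<^sub>R restrict0 (c k) u)"
      by (intro superfun_scaleR[OF U] superfun_restrict0[OF U] c(1))
    show "\<delta> k *\<^sub>R restrict0 (c k) u = \<delta> k *\<^sub>R restrict0 (c k) v"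
      if u: "u \<in> U" "v \<in> U" "\<forall>a. w a = 0 \<longrightarrow> u $ a = v $ a" for u v
    proof -
      have "\<forall>x. w' x = 0 \<longrightarrow> zero_section u $ x = zero_section v $ x"
        using u(3) w by (auto simp: zero_section_def split: cot.split)
      then have "c k (zero_section u) = c k (zero_section v)" using c(3) u(1,2) zs by blast
      then show ?thesis by (simp add: restrict0_eq)
    qed
    fix u assume u: "u \<in> U"
    have cz: "coeff_wt (cot_par pr) w' r k (c k (zero_section u))" using c(2) zs[OF u] by blast
    show "coeff_wt pr w r (\<lambda>a. k (Pos a)) (\<delta> k *\<^sub>R restrict0 (c k) u)"
      unfolding coeff_wt_def
    proof (intro allI impI)
      fix I assume I: "(\<delta> k *\<^sub>R restrict0 (c k) u) $ I \<noteq> 0"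
      then have d: "\<forall>a. \<not> pr a \<and> w' (Mom a) \<noteq> 0 \<longrightarrow> k (Mom a) = 0"
        by (auto simp: \<delta>_def split: if_splits)
      have "(\<Sum>x | \<not> cot_par pr x. int (k x) * w' x) + (\<Sum>x\<in>Pos ` I. w' x) = r"
        using I cz by (simp add: coeff_wt_def restrict0_def)
      moreover have "(\<Sum>a | \<not> pr a. int (k (Mom a)) * w' (Mom a)) = 0"
        using d by (intro sum.neutral) auto
      ultimately show "(\<Sum>a | \<not> pr a. int (k (Pos a)) * w a) + (\<Sum>a\<in>I. w a) = r"
        by (simp add: sum_cot_Collect sum.reindex inj_on_def w)
    qed
  qed
  have mon: "monom_at (cot_par pr) w' k (zero_section u) = \<delta> k * monom_at pr w (\<lambda>a. k (Pos a)) u" for k u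
  proof -
    have "(\<Prod>a | \<not> pr a \<and> w' (Mom a) \<noteq> 0. (0::real) ^ k (Mom a)) = \<delta> k"
      by (auto simp: \<delta>_def intro!: prod.neutral)
    then show ?thesis by (simp add: monom_at_def prod_cot_Collect w zero_section_def)
  qed
  have "has_weight pr w U r (\<lambda>u. \<Sum>k\<in>N. monom_at pr w (\<lambda>a. k (Pos a)) u *\<^sub>R (\<delta> k *\<^sub>R restrict0 (c k) u))"
    by (intro has_weight_sum[OF U] has_weight_monom[OF U] wt)
  then show ?thesis
    by (rule has_weight_cong[OF U, rotated])
      (simp add: restrict0_eq N(3)[OF zs] linear_sum[OF linear_grestrict] linear_scale[OF linear_grestrict] mon mult.commute)
qed

text \<open>Momentum derivatives of a lift vanish, so only the position values enter the Taylor
  terms. The truncation orders differ because the cotangent algebra has more generators.\<close>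

lemma subst_lift:
  fixes y :: "'d::{finite,linorder} \<Rightarrow> ('c::{finite,linorder}) sfun"
  assumes V: "obody pr V" "bodymap y (base_point z) \<in> V" and F: "superfun pr V F"
    and Y: "\<And>b. Y (Pos b) z = lift (y b) z" "\<And>b. gpar (pr b) (Y (Mom b) z)" "\<And>b. gpar (pr b) (y b (base_point z))"
  shows "subst_sfun (cot_par pr) (lift F) Y z = lift (subst_sfun pr F y) z"
proof -
  let ?g = "\<lambda>b. y b (base_point z)" and ?G = "\<lambda>x. Y x z"
  have "gpar (cot_par pr x) (Y x z)" for x
    using Y by (cases x) (simp_all add: lift_eq gpar_glift)
  moreover have "base_point (gbody ?G) = gbody ?g"
    by (simp add: base_point_def gbody_def Y(1) lift_eq)
  ultimately have G: "gbody ?G \<in> cot_set pr V"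
    using V(2) by (auto simp: cot_set_def bodymap_eq gbody_body_space)
  note V' = obody_cot_set[OF V(1)]
  have t0: "tsub (cot_par pr) ?G k (\<lambda>z. 0) = 0" for k
  proof (induction k)
    case (Suc k)
    have "pder (cot_par pr) x (\<lambda>z. 0) = (\<lambda>z. 0)" for x by auto
    then show ?case using Suc by simp
  qed simp
  have Ypos: "Y (Pos b) z = glift (y b (base_point z))" for b
    by (simp add: Y(1) lift_eq)
  have t: "tsub (cot_par pr) ?G k (lift F) = glift (tsub pr ?g k F)" for k
    using F
  proof (induction k arbitrary: F)
    case 0
    show ?case
      using G \<open>base_point (gbody ?G) = gbody ?g\<close> by (simp add: lift_eq glift_simps)
  next
    case (Suc k)
    have "tsub (cot_par pr) ?G k (pder (cot_par pr) (Pos b) (lift F)) = glift (tsub pr ?g k (pder pr b F))" for b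
    proof -
      have "tsub (cot_par pr) ?G k (pder (cot_par pr) (Pos b) (lift F)) = tsub (cot_par pr) ?G k (lift (pder pr b F))"
        by (rule tsub_cong[OF V' G pder_lift_Pos[OF V(1) superfun_differentiable[OF Suc.prems] cot_setD]])
      then show ?thesis using Suc.IH[OF superfun_pder[OF V(1) Suc.prems]] by simp
    qed
    moreover have "pder (cot_par pr) (Mom b) (lift F) = (\<lambda>z. 0)" for b by auto
    ultimately show ?case
      by (simp add: sum_cot t0 Ypos glift_simps glift_gmul glift_gnil)
  qed
  have "inj (Pos :: 'c \<Rightarrow> 'c cot)" by (simp add: inj_def)
  then have "CARD('c) \<le> CARD('c cot)"
    by (metis card_inj_on_le finite subset_UNIV)
  from gsub_extend[OF this, of pr ?g F] show ?thesis
    by (simp add: subst_sfun_eq lift_eq[of "subst_sfun pr F y"] gsub_def[of "cot_par pr"] t glift_simps)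
qed

section \<open>Changes of coordinates\<close>

locale supermanifold_atlas =
  fixes A :: "('i, 'c::{finite,linorder}) atlas"
  assumes supermanifold: "supermanifold A"
begin

abbreviation bm :: "'i \<Rightarrow> 'i \<Rightarrow> 'c point \<Rightarrow> 'c point" where
  "bm i j \<equiv> bodymap (change A i j)"

lemmas supermanifoldD =
  supermanifold[unfolded supermanifold_def, THEN conjunct1, rule_format]
  supermanifold[unfolded supermanifold_def, THEN conjunct2, THEN conjunct1, rule_format]
  supermanifold[unfolded supermanifold_def, THEN conjunct2, THEN conjunct2, THEN conjunct1, rule_format]
  supermanifold[unfolded supermanifold_def, THEN conjunct2, THEN conjunct2, THEN conjunct2, THEN conjunct1, rule_format]
  supermanifold[unfolded supermanifold_def, THEN conjunct2, THEN conjunct2, THEN conjunct2, THEN conjunct2]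

lemma
  assumes "i \<in> charts A"
  shows dom_open: "obody (par A i) (domain A i)"
    and ov_self: "overlap A i i = domain A i"
    and change_self: "u \<in> domain A i \<Longrightarrow> change A i i b u = crd (par A i) b u"
  using supermanifoldD(1)[OF assms] by simp_all

declare ov_self [simp]

lemma
  assumes "i \<in> charts A" "j \<in> charts A"
  shows ov_openin: "openin (top_of_set (domain A i)) (overlap A i j)"
    and change_superfun: "superfun (par A i) (overlap A i j) (change A i j b)"
    and change_parity: "has_parity (overlap A i j) (par A j b) (change A i j b)"
    and bm_ov: "u \<in> overlap A i j \<Longrightarrow> bm i j u \<in> overlap A j i"
  using supermanifoldD(2)[OF assms] by (simp_all add: image_subset_iff)

lemma cocycle:
  assumes "i \<in> charts A" "j \<in> charts A" "k \<in> charts A" "u \<in> overlap A i j" "bm i j u \<in> overlap A j k"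
  shows "u \<in> overlap A i k" "change A i k b u = pullback A i j (change A j k b) u"
  using supermanifoldD(3)[OF assms] by simp_all

lemma ov_open: "i \<in> charts A \<Longrightarrow> j \<in> charts A \<Longrightarrow> obody (par A i) (overlap A i j)"
  using ov_openin dom_open openin_trans by blast

lemma ov_dom: "i \<in> charts A \<Longrightarrow> j \<in> charts A \<Longrightarrow> overlap A i j \<subseteq> domain A i"
  using ov_openin openin_imp_subset by blast

lemma change_gpar:
  "i \<in> charts A \<Longrightarrow> j \<in> charts A \<Longrightarrow> u \<in> overlap A i j \<Longrightarrow> gpar (par A j b) (change A i j b u)"
  using change_parity[of i j b] by (simp add: has_parity_iff)

lemma pullback_eq: "pullback A i j H u = gsub (par A j) (\<lambda>b. change A i j b u) H"
  by (simp add: pullback_def subst_sfun_eq)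

lemma bm_eq: "bm i j u = gbody (\<lambda>b. change A i j b u)"
  by (simp add: bodymap_eq)

lemma change_gpoint:
  assumes "i \<in> charts A" "j \<in> charts A" "u \<in> overlap A i j" "obody (par A j) V" "bm i j u \<in> V"
  shows "gpoint (par A j) V (\<lambda>b. change A i j b u)"
  using assms change_gpar by (auto simp: gpoint_def bm_eq)

lemma pullback_body: "pullback A i j H u $ {} = H (bm i j u) $ {}"
  by (simp add: pullback_eq gsub_body bm_eq)

lemma bm_bm:
  assumes "i \<in> charts A" "j \<in> charts A" "k \<in> charts A" "u \<in> overlap A i j" "bm i j u \<in> overlap A j k"
  shows "bm j k (bm i j u) = bm i k u"
  unfolding bodymap_def[of "change A j k"] bodymap_def[of "change A i k"] cocycle(2)[OF assms] pullback_body ..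

lemma bm_self:
  assumes "i \<in> charts A" "u \<in> domain A i"
  shows "bm i i u = u"
  using obody_subset[OF dom_open[OF assms(1)] assms(2)]
  by (auto simp: bodymap_def change_self[OF assms] vec_eq_iff crd_def gone_nth axis_def body_space_def)

lemma bm_inv:
  assumes "i \<in> charts A" "j \<in> charts A" "u \<in> overlap A i j"
  shows "bm j i (bm i j u) = u"
  using bm_bm[OF assms(1,2,1,3) bm_ov[OF assms]] bm_self[OF assms(1)] ov_dom[OF assms(1,2)] assms(3) by auto

definition preim :: "'i \<Rightarrow> 'i \<Rightarrow> 'c point set \<Rightarrow> 'c point set" where
  "preim i j V = overlap A i j \<inter> bm i j -` V"

lemma preim_iff: "u \<in> preim i j V \<longleftrightarrow> u \<in> overlap A i j \<and> bm i j u \<in> V"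
  by (auto simp: preim_def)

lemma preim_open:
  assumes "i \<in> charts A" "j \<in> charts A" "obody (par A j) V"
  shows "obody (par A i) (preim i j V)"
proof -
  have "bm i j \<in> overlap A i j \<rightarrow> body_space (par A j)"
    using obody_subset[OF ov_open[OF assms(2,1)]] bm_ov[OF assms(1,2)] by blast
  then have "openin (top_of_set (overlap A i j)) (preim i j V)"
    unfolding preim_def using assms(3)
    by (intro continuous_openin_preimage continuous_on_bodymap[OF change_superfun[OF assms(1,2)]])
  then show ?thesis using ov_open[OF assms(1,2)] by (rule openin_trans)
qed

lemma pullback_cong:
  assumes "obody (par A j) V" "bm i j u \<in> V" "\<And>v. v \<in> V \<Longrightarrow> F v = G v"
  shows "pullback A i j F u = pullback A i j G u"
  unfolding pullback_eq using assms gsub_cong[of "par A j" V _ F G] by (simp add: bm_eq)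

lemma pullback_sum:
  assumes "obody (par A j) V" "bm i j u \<in> V" "\<And>x. x \<in> X \<Longrightarrow> superfun (par A j) V (F x)"
  shows "pullback A i j (\<lambda>u. \<Sum>x\<in>X. F x u) u = (\<Sum>x\<in>X. pullback A i j (F x) u)"
  unfolding pullback_eq using assms by (intro gsub_sum) (auto simp: bm_eq)

lemma pullback_scaleR:
  assumes "obody (par A j) V" "bm i j u \<in> V" "superfun (par A j) V F"
  shows "pullback A i j (\<lambda>u. c *\<^sub>R F u) u = c *\<^sub>R pullback A i j F u"
  unfolding pullback_eq using assms by (intro gsub_scaleR) (auto simp: bm_eq)

lemma pullback_add:
  assumes "obody (par A j) V" "bm i j u \<in> V" "superfun (par A j) V F" "superfun (par A j) V G"
  shows "pullback A i j (\<lambda>u. F u + G u) u = pullback A i j F u + pullback A i j G u"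
  unfolding pullback_eq using assms by (intro gsub_add) (auto simp: bm_eq)

lemma pullback_gmul:
  assumes "i \<in> charts A" "j \<in> charts A" "u \<in> overlap A i j" "obody (par A j) V" "bm i j u \<in> V"
    "superfun (par A j) V F" "superfun (par A j) V G" "has_parity V e F"
  shows "pullback A i j (\<lambda>u. F u \<cdot> G u) u = pullback A i j F u \<cdot> pullback A i j G u"
  unfolding pullback_eq by (rule gsub_gmul[OF change_gpoint[OF assms(1-5)] assms(6-8)])

lemma pullback_gpar:
  assumes "i \<in> charts A" "j \<in> charts A" "u \<in> overlap A i j" "obody (par A j) V" "bm i j u \<in> V"
    "superfun (par A j) V F" "has_parity V e F"
  shows "gpar e (pullback A i j F u)"
  unfolding pullback_eq by (rule gpar_gsub[OF change_gpoint[OF assms(1-5)] assms(6,7)])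

lemma pullback_superfun:
  assumes ij: "i \<in> charts A" "j \<in> charts A" and V: "obody (par A j) V" "superfun (par A j) V F"
  shows "superfun (par A i) (preim i j V) (pullback A i j F)"
  unfolding pullback_def
proof (rule superfun_subst[OF preim_open[OF ij V(1)] _ _ V(1) _ V(2)])
  have sub: "preim i j V \<subseteq> overlap A i j" by (auto simp: preim_def)
  show "superfun (par A i) (preim i j V) (change A i j b)" for b
    using change_superfun[OF ij] sub by (rule superfun_subset)
  show "has_parity (preim i j V) (par A j b) (change A i j b)" for b
    using change_parity[OF ij, of b] sub by (auto simp: has_parity_iff)
  show "bm i j ` preim i j V \<subseteq> V" by (auto simp: preim_def)
qed

lemma pullback_superfun_ov:
  assumes ij: "i \<in> charts A" "j \<in> charts A" and F: "superfun (par A j) (overlap A j i) F"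
  shows "superfun (par A i) (overlap A i j) (pullback A i j F)"
proof -
  have "preim i j (overlap A j i) = overlap A i j" using bm_ov[OF ij] by (auto simp: preim_def)
  then show ?thesis using pullback_superfun[OF ij ov_open[OF ij(2,1)] F] by simp
qed

lemma pder_pullback:
  assumes ij: "i \<in> charts A" "j \<in> charts A" and u: "u \<in> overlap A i j"
    and V: "obody (par A j) V" "bm i j u \<in> V" "superfun (par A j) V F"
  shows "pder (par A i) a (pullback A i j F) u =
    (\<Sum>b\<in>UNIV. pder (par A i) a (change A i j b) u \<cdot> pullback A i j (pder (par A j) b F) u)"
  unfolding pullback_def
  by (rule pder_subst[OF ov_open[OF ij] u change_superfun[OF ij] change_parity[OF ij] V])

text \<open>Associativity of substitution extends the cocycle condition, which is given for
  coordinate functions, to all functions.\<close>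

lemma pullback_pullback:
  assumes i: "i \<in> charts A" "j \<in> charts A" "k \<in> charts A"
    and u: "u \<in> overlap A i j" "bm i j u \<in> overlap A j k"
    and V: "obody (par A k) V" "bm i k u \<in> V" "superfun (par A k) V F"
  shows "pullback A i j (pullback A j k F) u = pullback A i k F u"
proof -
  let ?U = "preim j k V"
  have v: "bm i j u \<in> ?U" using bm_bm[OF i u] u(2) V(2) by (simp add: preim_iff)
  have sub: "?U \<subseteq> overlap A j k" by (auto simp: preim_def)
  have "pullback A i j (pullback A j k F) u = gsub (par A j) (\<lambda>b. change A i j b u) (subst_sfun (par A k) F (change A j k))"
    by (simp add: pullback_eq pullback_def[of A j k])
  also have "\<dots> = gsub (par A k) (\<lambda>b. gsub (par A j) (\<lambda>b. change A i j b u) (change A j k b)) F"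
  proof (rule gsub_subst[OF change_gpoint[OF i(1,2) u(1) preim_open[OF i(2,3) V(1)] v] _ _ V(1) _ V(3)])
    show "superfun (par A j) ?U (change A j k b)" for b
      using change_superfun[OF i(2,3)] sub by (rule superfun_subset)
    show "has_parity ?U (par A k b) (change A j k b)" for b
      using change_parity[OF i(2,3), of b] sub by (auto simp: has_parity_iff)
    show "bm j k ` ?U \<subseteq> V" by (auto simp: preim_def)
  qed
  also have "\<dots> = pullback A i k F u"
    by (simp add: pullback_eq[of i k] cocycle(2)[OF i u] pullback_eq[of i j])
  finally show ?thesis .
qed

lemma pullback_self:
  assumes "i \<in> charts A" "u \<in> domain A i" "obody (par A i) V" "u \<in> V" "superfun (par A i) V F"
  shows "pullback A i i F u = F u"
  using subst_crd[OF assms(3-5)] by (simp add: pullback_eq change_self[OF assms(1,2)] subst_sfun_eq)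

lemma pullback_inverse:
  assumes "i \<in> charts A" "j \<in> charts A" "u \<in> overlap A i j" "obody (par A i) V" "u \<in> V" "superfun (par A i) V F"
  shows "pullback A i j (pullback A j i F) u = F u"
proof -
  have u: "u \<in> domain A i" using ov_dom[OF assms(1,2)] assms(3) by auto
  show ?thesis
    using pullback_pullback[OF assms(1,2,1,3) bm_ov[OF assms(1-3)] assms(4) _ assms(6)]
      pullback_self[OF assms(1) u assms(4-6)] bm_self[OF assms(1) u] assms(5) by simp
qed

section \<open>Jacobians\<close>

lemma jacobian_superfun:
  assumes "i \<in> charts A" "j \<in> charts A"
  shows "superfun (par A i) (overlap A i j) (jacobian A i j a b)"
  unfolding jacobian_def
  by (intro pullback_superfun_ov superfun_pder ov_open change_superfun assms)

lemma jacobian_gpar: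
  assumes "i \<in> charts A" "j \<in> charts A" "u \<in> overlap A i j"
  shows "gpar (par A i a \<noteq> par A j b) (jacobian A i j a b u)"
  unfolding jacobian_def
  by (rule pullback_gpar[OF assms ov_open[OF assms(2,1)] bm_ov[OF assms] superfun_pder
        has_parity_pder[OF ov_open[OF assms(2,1)]]])
    (simp_all add: ov_open change_superfun change_parity assms superfun_differentiable[OF change_superfun])

lemma jacobian_parity:
  "i \<in> charts A \<Longrightarrow> j \<in> charts A \<Longrightarrow> has_parity (overlap A i j) (par A i a \<noteq> par A j b) (jacobian A i j a b)"
  unfolding has_parity_iff[of _ "par A i a \<noteq> par A j b"] using jacobian_gpar by blast

text \<open>The coordinate vector field \<open>b\<close> of chart \<open>j\<close>, transported to
  chart \<open>i\<close>, has the Jacobian as components: apply the chain rule in chart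
  \<open>j\<close>, pull back, and cancel the double pullback.\<close>

lemma pullback_pder_pullback:
  assumes ij: "i \<in> charts A" "j \<in> charts A" and u: "u \<in> overlap A i j"
    and V: "obody (par A i) V" "u \<in> V" "superfun (par A i) V H"
  shows "pullback A i j (pder (par A j) b (pullback A j i H)) u =
    (\<Sum>a\<in>UNIV. jacobian A i j a b u \<cdot> pder (par A i) a H u)"
proof -
  let ?W = "preim j i V"
  have W: "obody (par A j) ?W" by (rule preim_open[OF ij(2,1) V(1)])
  have sub: "?W \<subseteq> overlap A j i" by (auto simp: preim_def)
  have bu: "bm i j u \<in> ?W" using bm_ov[OF ij u] bm_inv[OF ij u] V(2) by (simp add: preim_iff)
  have sf: "superfun (par A j) ?W (pder (par A j) b (change A j i a))" for a
    using superfun_pder[OF ov_open[OF ij(2,1)] change_superfun[OF ij(2,1)]] sub by (rule superfun_subset)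
  have pa: "has_parity ?W (par A i a \<noteq> par A j b) (pder (par A j) b (change A j i a))" for a
    using has_parity_pder[OF ov_open[OF ij(2,1)] superfun_differentiable[OF change_superfun[OF ij(2,1)]]
        change_parity[OF ij(2,1)]] sub unfolding has_parity_iff by blast
  have sp: "superfun (par A j) ?W (pullback A j i (pder (par A i) a H))" for a
    by (rule pullback_superfun[OF ij(2,1) V(1) superfun_pder[OF V(1,3)]])
  have "pullback A i j (pder (par A j) b (pullback A j i H)) u =
      pullback A i j (\<lambda>v. \<Sum>a\<in>UNIV. pder (par A j) b (change A j i a) v \<cdot> pullback A j i (pder (par A i) a H) v) u"
    by (rule pullback_cong[OF W bu], rule pder_pullback[OF ij(2,1) _ V(1) _ V(3)]) (simp_all add: preim_iff)
  also have "\<dots> = (\<Sum>a\<in>UNIV. pullback A i j (\<lambda>v. pder (par A j) b (change A j i a) v \<cdot> pullback A j i (pder (par A i) a H) v) u)"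
    by (rule pullback_sum[OF W bu superfun_gmul[OF W sf sp]])
  also have "\<dots> = (\<Sum>a\<in>UNIV. jacobian A i j a b u \<cdot> pder (par A i) a H u)"
  proof (rule sum.cong[OF refl])
    fix a
    have "pullback A i j (pullback A j i (pder (par A i) a H)) u = pder (par A i) a H u"
      by (rule pullback_inverse[OF ij u V(1,2) superfun_pder[OF V(1,3)]])
    then show "pullback A i j (\<lambda>v. pder (par A j) b (change A j i a) v \<cdot> pullback A j i (pder (par A i) a H) v) u =
        jacobian A i j a b u \<cdot> pder (par A i) a H u"
      by (simp only: pullback_gmul[OF ij u W bu sf sp pa] jacobian_def)
  qed
  finally show ?thesis .
qed

text \<open>The transported coordinate field is applied to the coordinate functions of chart
  \<open>j\<close>, to which it is dual.\<close>

lemma jacobian_change: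
  assumes ij: "i \<in> charts A" "j \<in> charts A" and u: "u \<in> overlap A i j"
  shows "(\<Sum>a\<in>UNIV. jacobian A i j a b u \<cdot> pder (par A i) a (change A i j c) u) = (if b = c then gone else 0)"
proof -
  have "(\<Sum>a\<in>UNIV. jacobian A i j a b u \<cdot> pder (par A i) a (change A i j c) u) =
      pullback A i j (pder (par A j) b (pullback A j i (change A i j c))) u"
    by (rule pullback_pder_pullback[OF ij u ov_open[OF ij] u change_superfun[OF ij], symmetric])
  also have "\<dots> = pullback A i j (\<lambda>v. (if b = c then 1 else 0) *\<^sub>R gone) u"
  proof (rule pullback_cong[OF ov_open[OF ij(2,1)] bm_ov[OF ij u]])
    fix v assume v: "v \<in> overlap A j i"
    have "pullback A j i (change A i j c) v' = crd (par A j) c v'" if v': "v' \<in> overlap A j i" for v'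
    proof -
      have "v' \<in> domain A j" using ov_dom[OF ij(2,1)] v' by auto
      then show ?thesis
        using cocycle(2)[OF ij(2,1,2) v' bm_ov[OF ij(2,1) v'], of c] by (simp add: change_self[OF ij(2)])
    qed
    then have "pder (par A j) b (pullback A j i (change A i j c)) v = pder (par A j) b (crd (par A j) c) v"
      using v by (intro pder_cong[OF ov_open[OF ij(2,1)]])
    then show "pder (par A j) b (pullback A j i (change A i j c)) v = (if b = c then 1 else 0) *\<^sub>R gone" by simp
  qed
  also have "\<dots> = (if b = c then gone else 0)" unfolding pullback_eq gsub_const by simp
  finally show ?thesis .
qed

text \<open>The other order of the factors; it comes from differentiating the coordinates of chart
  \<open>i\<close> after a change to chart \<open>j\<close> and back.\<close>

lemma change_jacobian:
  assumes ij: "i \<in> charts A" "j \<in> charts A" and u: "u \<in> overlap A i j"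
  shows "(\<Sum>b\<in>UNIV. pder (par A i) a (change A i j b) u \<cdot> jacobian A i j c b u) = (if a = c then gone else 0)"
proof -
  have "(\<Sum>b\<in>UNIV. pder (par A i) a (change A i j b) u \<cdot> jacobian A i j c b u) =
      pder (par A i) a (pullback A i j (change A j i c)) u"
    unfolding jacobian_def
    by (rule pder_pullback[OF ij u ov_open[OF ij(2,1)] bm_ov[OF ij u] change_superfun[OF ij(2,1)], symmetric])
  also have "\<dots> = pder (par A i) a (crd (par A i) c) u"
  proof (rule pder_cong[OF ov_open[OF ij] _ u])
    fix v assume v: "v \<in> overlap A i j"
    then have "v \<in> domain A i" using ov_dom[OF ij] by auto
    then show "pullback A i j (change A j i c) v = crd (par A i) c v"
      using cocycle(2)[OF ij(1,2,1) v bm_ov[OF ij v], of c] by (simp add: change_self[OF ij(1)])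
  qed
  finally show ?thesis by simp
qed

text \<open>The chain rule for a change of charts through \<open>j\<close>. The factors stand in the
  order in which momenta are transformed twice.\<close>

lemma jacobian_cocycle:
  assumes i: "i \<in> charts A" "j \<in> charts A" "k \<in> charts A"
    and u: "u \<in> overlap A i j" "bm i j u \<in> overlap A j k"
  shows "jacobian A i k a b u = (\<Sum>c\<in>UNIV. pullback A i j (jacobian A j k c b) u \<cdot> jacobian A i j a c u)"
proof -
  let ?W = "overlap A j k \<inter> overlap A j i"
  have W: "obody (par A j) ?W" by (intro openin_Int ov_open i)
  have uW: "bm i j u \<in> ?W" using u bm_ov[OF i(1,2)] by simp
  have uk: "u \<in> overlap A i k" by (rule cocycle(1)[OF i u])
  have "jacobian A i k a b u = pullback A i j (pullback A j k (pder (par A k) b (change A k i a))) u"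
    unfolding jacobian_def
    by (rule pullback_pullback[OF i u ov_open[OF i(3,1)] bm_ov[OF i(1,3) uk]
          superfun_pder[OF ov_open[OF i(3,1)] change_superfun[OF i(3,1)]], symmetric])
  also have "\<dots> = pullback A i j (\<lambda>v. \<Sum>c\<in>UNIV. jacobian A j k c b v \<cdot> pder (par A j) c (change A j i a) v) u"
  proof (rule pullback_cong[OF W uW])
    fix v assume v: "v \<in> ?W"
    let ?X = "preim k j (overlap A j i)"
    have X: "obody (par A k) ?X" by (rule preim_open[OF i(3,2) ov_open[OF i(2,1)]])
    have vX: "bm j k v \<in> ?X" using v bm_ov[OF i(2,3)] bm_inv[OF i(2,3)] by (simp add: preim_iff)
    have "change A k i a w = pullback A k j (change A j i a) w" if "w \<in> ?X" for w
      using that by (intro cocycle(2)[OF i(3,2,1)]) (simp_all add: preim_iff)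
    then have "pullback A j k (pder (par A k) b (change A k i a)) v =
        pullback A j k (pder (par A k) b (pullback A k j (change A j i a))) v"
      by (intro pullback_cong[OF X vX] pder_cong[OF X])
    also have "\<dots> = (\<Sum>c\<in>UNIV. jacobian A j k c b v \<cdot> pder (par A j) c (change A j i a) v)"
      using v by (intro pullback_pder_pullback[OF i(2,3) _ ov_open[OF i(2,1)] _ change_superfun[OF i(2,1)]]) simp_all
    finally show "pullback A j k (pder (par A k) b (change A k i a)) v =
        (\<Sum>c\<in>UNIV. jacobian A j k c b v \<cdot> pder (par A j) c (change A j i a) v)" .
  qed
  also have "\<dots> = (\<Sum>c\<in>UNIV. pullback A i j (\<lambda>v. jacobian A j k c b v \<cdot> pder (par A j) c (change A j i a) v) u)"
  proof (rule pullback_sum[OF W uW superfun_gmul[OF W]])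
    show "superfun (par A j) ?W (jacobian A j k c b)" for c
      using jacobian_superfun[OF i(2,3)] by (rule superfun_subset) simp
    show "superfun (par A j) ?W (pder (par A j) c (change A j i a))" for c
      using superfun_pder[OF ov_open[OF i(2,1)] change_superfun[OF i(2,1)]] by (rule superfun_subset) simp
  qed
  also have "\<dots> = (\<Sum>c\<in>UNIV. pullback A i j (jacobian A j k c b) u \<cdot> jacobian A i j a c u)"
  proof (rule sum.cong[OF refl])
    fix c
    show "pullback A i j (\<lambda>v. jacobian A j k c b v \<cdot> pder (par A j) c (change A j i a) v) u =
        pullback A i j (jacobian A j k c b) u \<cdot> jacobian A i j a c u"
      unfolding jacobian_def[of A i j]
    proof (rule pullback_gmul[OF i(1,2) u(1) W uW])
      show "superfun (par A j) ?W (jacobian A j k c b)"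
        using jacobian_superfun[OF i(2,3)] by (rule superfun_subset) simp
      show "superfun (par A j) ?W (pder (par A j) c (change A j i a))"
        using superfun_pder[OF ov_open[OF i(2,1)] change_superfun[OF i(2,1)]] by (rule superfun_subset) simp
      show "has_parity ?W (par A j c \<noteq> par A k b) (jacobian A j k c b)"
        using jacobian_gpar[OF i(2,3)] unfolding has_parity_iff by blast
    qed
  qed
  finally show ?thesis .
qed

section \<open>The cotangent bundle is a supermanifold\<close>

abbreviation T :: "int \<Rightarrow> ('i, 'c cot) atlas" where
  "T m \<equiv> total_cotangent A m"

abbreviation p :: "'i \<Rightarrow> 'c \<Rightarrow> 'c cot sfun" where
  "p i a \<equiv> crd (cot_par (par A i)) (Mom a)"

lemma T_simps [simp]:
  "charts (T m) = charts A" "par (T m) i = cot_par (par A i)"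
  "domain (T m) i = cot_set (par A i) (domain A i)" "overlap (T m) i j = cot_set (par A i) (overlap A i j)"
  "wt (T m) i x = induced_wt (wt A i) x + m * fibre_deg x"
  by (simp_all add: total_cotangent_def cotangent_def)

lemma change_T_Pos: "change (T m) i j (Pos b) = lift (change A i j b)"
  by (simp add: total_cotangent_def cotangent_def fun_eq_iff)

lemma change_T_Mom: "change (T m) i j (Mom b) = (\<lambda>z. \<Sum>a\<in>UNIV. lift (jacobian A i j a b) z \<cdot> p i a z)"
  by (simp add: total_cotangent_def cotangent_def fun_eq_iff)

lemma base_bodymap_T: "base_point (bodymap (change (T m) i j) z) = bm i j (base_point z)"
  by (simp add: bodymap_def base_point_def[of "vec_lambda _"] change_T_Pos lift_eq vec_eq_iff)

lemma ov_cot_open: "i \<in> charts A \<Longrightarrow> j \<in> charts A \<Longrightarrow> obody (cot_par (par A i)) (cot_set (par A i) (overlap A i j))"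
  by (intro obody_cot_set ov_open)

lemma change_T_superfun:
  assumes ij: "i \<in> charts A" "j \<in> charts A"
  shows "superfun (cot_par (par A i)) (cot_set (par A i) (overlap A i j)) (change (T m) i j x)"
proof (cases x)
  case (Pos b)
  then show ?thesis using superfun_lift[OF ov_open[OF ij] change_superfun[OF ij]] by (simp add: change_T_Pos)
next
  case (Mom b)
  then show ?thesis unfolding Mom change_T_Mom
    by (intro superfun_sum ov_cot_open ij superfun_gmul superfun_crd superfun_lift ov_open jacobian_superfun)
qed

lemma gpar_p [simp]: "gpar (par A i a) (p i a z)"
  using gpar_crd[of "cot_par (par A i)" "Mom a" z] by simp

lemma gpar_gmul': "gpar e x \<Longrightarrow> gpar e' y \<Longrightarrow> e'' = (e \<noteq> e') \<Longrightarrow> gpar e'' (x \<cdot> y)"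
  using gpar_gmul by blast

lemma change_T_gpar:
  assumes ij: "i \<in> charts A" "j \<in> charts A" and z: "base_point z \<in> overlap A i j"
  shows "gpar (cot_par (par A j) x) (change (T m) i j x z)"
proof (cases x)
  case (Pos b)
  then show ?thesis using change_gpar[OF ij z] by (simp add: change_T_Pos lift_eq gpar_glift)
next
  case (Mom b)
  have "gpar (par A j b) (lift (jacobian A i j a b) z \<cdot> p i a z)" for a
    using gpar_glift[OF jacobian_gpar[OF ij z, of a b]]
    by (intro gpar_gmul'[OF _ gpar_p]) (auto simp: lift_eq)
  then show ?thesis unfolding Mom change_T_Mom by (auto intro: gpar_sum)
qed

lemma bodymap_T:
  assumes ij: "i \<in> charts A" "j \<in> charts A" and z: "z \<in> cot_set (par A i) (overlap A i j)"
    and V: "bm i j (base_point z) \<in> V"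
  shows "bodymap (change (T m) i j) z \<in> cot_set (par A j) V"
  using V change_T_gpar[OF ij cot_setD[OF z]]
  by (simp add: cot_set_def base_bodymap_T) (simp add: bodymap_eq gbody_body_space)

lemma pullback_T_lift:
  assumes ij: "i \<in> charts A" "j \<in> charts A" and z: "base_point z \<in> overlap A i j"
    and V: "obody (par A j) V" "bm i j (base_point z) \<in> V" "superfun (par A j) V F"
  shows "pullback (T m) i j (lift F) z = lift (pullback A i j F) z"
  unfolding pullback_def T_simps
proof (rule subst_lift[OF V(1,2,3)])
  show "change (T m) i j (Pos b) z = lift (change A i j b) z" for b by (simp add: change_T_Pos)
  show "gpar (par A j b) (change (T m) i j (Mom b) z)" for b
    using change_T_gpar[OF ij z, of "Mom b"] by simp
  show "gpar (par A j b) (change A i j b (base_point z))" for b by (rule change_gpar[OF ij z])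
qed

text \<open>Serves the cocycle condition for momenta, the mixed block of the cotangent Jacobian and
  the invariance of \<open>Q\<close>, all concerned with functions linear in the momenta.\<close>

lemma pullback_T_lift_p:
  assumes ij: "i \<in> charts A" "j \<in> charts A" and z: "z \<in> cot_set (par A i) (overlap A i j)"
    and V: "obody (par A j) V" "bm i j (base_point z) \<in> V" "\<And>c. superfun (par A j) V (F c)"
      "\<And>c. has_parity V (e c) (F c)"
  shows "pullback (T m) i j (\<lambda>z. \<Sum>c\<in>UNIV. lift (F c) z \<cdot> p j c z) z =
    (\<Sum>c\<in>UNIV. lift (pullback A i j (F c)) z \<cdot> change (T m) i j (Mom c) z)"
proof -
  note V' = obody_cot_set[OF V(1)]
  have b: "bodymap (change (T m) i j) z \<in> cot_set (par A j) V" by (rule bodymap_T[OF ij z V(2)])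
  have gp: "gpoint (cot_par (par A j)) (cot_set (par A j) V) (\<lambda>x. change (T m) i j x z)"
    using V' b change_T_gpar[OF ij cot_setD[OF z]] by (simp add: gpoint_def bodymap_eq)
  have "pullback (T m) i j (\<lambda>z. \<Sum>c\<in>UNIV. lift (F c) z \<cdot> p j c z) z =
      (\<Sum>c\<in>UNIV. pullback (T m) i j (\<lambda>z. lift (F c) z \<cdot> p j c z) z)"
    unfolding pullback_def subst_sfun_eq T_simps using b
    by (intro gsub_sum[OF V'] superfun_gmul[OF V'] superfun_lift V superfun_crd) (simp add: bodymap_eq)
  also have "\<dots> = (\<Sum>c\<in>UNIV. lift (pullback A i j (F c)) z \<cdot> change (T m) i j (Mom c) z)"
  proof (rule sum.cong[OF refl])
    fix c
    have "pullback (T m) i j (\<lambda>z. lift (F c) z \<cdot> p j c z) z = pullback (T m) i j (lift (F c)) z \<cdot> pullback (T m) i j (p j c) z"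
      unfolding pullback_def subst_sfun_eq T_simps
      by (rule gsub_gmul[OF gp superfun_lift[OF V(1,3)] superfun_crd has_parity_lift[OF V(4)]])
    moreover have "pullback (T m) i j (p j c) z = change (T m) i j (Mom c) z"
      unfolding pullback_def subst_sfun_eq T_simps
      using change_T_gpar[OF ij cot_setD[OF z], of "Mom c"] by simp
    ultimately show "pullback (T m) i j (\<lambda>z. lift (F c) z \<cdot> p j c z) z =
        lift (pullback A i j (F c)) z \<cdot> change (T m) i j (Mom c) z"
      using pullback_T_lift[OF ij cot_setD[OF z] V(1,2,3)] by simp
  qed
  finally show ?thesis .
qed

lemma change_T_self:
  assumes i: "i \<in> charts A" and z: "z \<in> cot_set (par A i) (domain A i)"
  shows "change (T m) i i x z = crd (cot_par (par A i)) x z"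
proof (cases x)
  case (Pos b)
  have "lift (change A i i b) z = lift (crd (par A i) b) z"
    by (simp add: lift_eq change_self[OF i cot_setD[OF z]])
  then show ?thesis using Pos by (simp add: change_T_Pos lift_crd)
next
  case (Mom b)
  note u = cot_setD[OF z]
  have "jacobian A i i a b (base_point z) = (if a = b then gone else 0)" for a
  proof -
    have "jacobian A i i a b (base_point z) = pder (par A i) b (change A i i a) (base_point z)"
      unfolding jacobian_def
      using pullback_self[OF i u dom_open[OF i] u superfun_pder[OF dom_open[OF i]]] change_superfun[OF i i] i by simp
    also have "\<dots> = pder (par A i) b (crd (par A i) a) (base_point z)"
      by (rule pder_cong[OF dom_open[OF i] change_self[OF i] u])
    finally show ?thesis by auto
  qed
  then have "change (T m) i i (Mom b) z = (\<Sum>a\<in>UNIV. if a = b then p i a z else 0)"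
    unfolding change_T_Mom lift_eq by (intro sum.cong) (auto simp: glift_simps)
  then show ?thesis using Mom by simp
qed

text \<open>For positions this is the cocycle condition on the base, for momenta the cocycle
  condition of the Jacobians.\<close>

lemma change_T_cocycle:
  assumes i: "i \<in> charts A" "j \<in> charts A" "k \<in> charts A"
    and z: "z \<in> cot_set (par A i) (overlap A i j)" "bm i j (base_point z) \<in> overlap A j k"
  shows "change (T m) i k x z = pullback (T m) i j (change (T m) j k x) z"
proof (cases x)
  case (Pos b)
  note u = cot_setD[OF z(1)]
  have "pullback (T m) i j (lift (change A j k b)) z = lift (pullback A i j (change A j k b)) z"
    by (rule pullback_T_lift[OF i(1,2) u ov_open[OF i(2,3)] z(2) change_superfun[OF i(2,3)]])
  then show ?thesis unfolding Pos change_T_Pos by (simp add: lift_eq cocycle(2)[OF i u z(2)])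
next
  case (Mom b)
  note u = cot_setD[OF z(1)]
  have "pullback (T m) i j (change (T m) j k (Mom b)) z =
      (\<Sum>c\<in>UNIV. lift (pullback A i j (jacobian A j k c b)) z \<cdot> change (T m) i j (Mom c) z)"
    unfolding change_T_Mom[of m j k]
    by (rule pullback_T_lift_p[OF i(1,2) z(1) ov_open[OF i(2,3)] z(2) jacobian_superfun[OF i(2,3)] jacobian_parity[OF i(2,3)]])
  also have "\<dots> = (\<Sum>c\<in>UNIV. \<Sum>a\<in>UNIV. (lift (pullback A i j (jacobian A j k c b)) z \<cdot> lift (jacobian A i j a c) z) \<cdot> p i a z)"
    by (simp add: change_T_Mom gmul.sum_right gmul_assoc)
  also have "\<dots> = (\<Sum>a\<in>UNIV. (\<Sum>c\<in>UNIV. lift (pullback A i j (jacobian A j k c b)) z \<cdot> lift (jacobian A i j a c) z) \<cdot> p i a z)"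
    by (subst sum.swap) (simp add: gmul.sum_left)
  also have "\<dots> = change (T m) i k (Mom b) z"
    by (simp add: change_T_Mom lift_eq jacobian_cocycle[OF i u z(2)] glift_simps glift_gmul)
  finally show ?thesis using Mom by simp
qed

text \<open>Pairs whose base points lie on the closed graph over the base form a closed set
  \<open>B\<close>. On \<open>B\<close> the first entry lies in the overlap, where the change of
  coordinates is continuous, so equality of its image with the second entry is a closed
  condition.\<close>

lemma change_T_closed:
  assumes ij: "i \<in> charts A" "j \<in> charts A"
  shows "closedin (top_of_set (domain (T m) i \<times> domain (T m) j))
    ((\<lambda>z. (z, bodymap (change (T m) i j) z)) ` overlap (T m) i j)"
proof -
  let ?D = "domain (T m) i \<times> domain (T m) j" and ?\<psi> = "bodymap (change (T m) i j)"
  let ?b = "\<lambda>(z :: 'c cot point, z' :: 'c cot point). (base_point z, base_point z')"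
  let ?G = "(\<lambda>u. (u, bm i j u)) ` overlap A i j"
  have "closedin (top_of_set (domain A i \<times> domain A j)) ?G"
    by (rule supermanifoldD(4)[OF ij])
  then obtain C where C: "closed C" "?G = (domain A i \<times> domain A j) \<inter> C" by (auto simp: closedin_closed)
  define B where "B = ?D \<inter> ?b -` C"
  have "continuous_on ?D ?b"
    unfolding case_prod_beta
    by (intro continuous_on_Pair linear_continuous_on_compose[OF _ linear_base_point] continuous_intros)
  then have 1: "closedin (top_of_set ?D) B" unfolding B_def by (rule continuous_closedin_preimage[OF _ C(1)])
  have B: "fst x \<in> overlap (T m) i j \<and> base_point (snd x) = bm i j (base_point (fst x))" if "x \<in> B" for x
  proof -
    have "?b x \<in> ?G" using that unfolding C(2) by (auto simp: B_def cot_setD)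
    then show ?thesis using that by (auto simp: B_def cot_set_def case_prod_beta)
  qed
  have cont: "continuous_on (overlap (T m) i j) ?\<psi>"
    using change_T_superfun[OF ij] by (intro continuous_on_bodymap) simp
  have "continuous_on B (\<lambda>x. ?\<psi> (fst x) - snd x)"
    using B by (intro continuous_on_diff continuous_on_compose2[OF cont] continuous_intros) auto
  then have "closedin (top_of_set B) {x \<in> B. ?\<psi> (fst x) - snd x = 0}"
    by (rule continuous_closedin_preimage_constant)
  then have "closedin (top_of_set ?D) {x \<in> B. ?\<psi> (fst x) - snd x = 0}" using 1 by (rule closedin_trans)
  moreover have "{x \<in> B. ?\<psi> (fst x) - snd x = 0} = (\<lambda>z. (z, ?\<psi> z)) ` overlap (T m) i j"
  proof (intro equalityI subsetI)
    fix x assume "x \<in> {x \<in> B. ?\<psi> (fst x) - snd x = 0}"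
    then show "x \<in> (\<lambda>z. (z, ?\<psi> z)) ` overlap (T m) i j"
      using B by (cases x) auto
  next
    fix x assume "x \<in> (\<lambda>z. (z, ?\<psi> z)) ` overlap (T m) i j"
    then obtain z where z: "x = (z, ?\<psi> z)" "z \<in> cot_set (par A i) (overlap A i j)" by auto
    have u: "base_point z \<in> overlap A i j" by (rule cot_setD[OF z(2)])
    have "?\<psi> z \<in> cot_set (par A j) (overlap A j i)" by (rule bodymap_T[OF ij z(2) bm_ov[OF ij u]])
    then have "x \<in> ?D"
      using z cot_set_mono[OF ov_dom[OF ij]] cot_set_mono[OF ov_dom[OF ij(2,1)]] by auto
    moreover have "?b x \<in> ?G" using u by (simp add: z(1) base_bodymap_T)
    ultimately show "x \<in> {x \<in> B. ?\<psi> (fst x) - snd x = 0}"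
      using C(2) by (auto simp: B_def z(1))
  qed
  ultimately show ?thesis by simp
qed

lemma supermanifold_T: "supermanifold (T m)"
  unfolding supermanifold_def
proof (intro conjI ballI allI impI)
  fix i assume i: "i \<in> charts (T m)"
  then have i': "i \<in> charts A" by simp
  show "obody (par (T m) i) (domain (T m) i)" by (simp add: obody_cot_set dom_open i')
  show "overlap (T m) i i = domain (T m) i" by (simp add: i')
  show "change (T m) i i x z = crd (par (T m) i) x z" if "z \<in> domain (T m) i" for x z
    using that by (simp add: change_T_self i')
  fix j assume "j \<in> charts (T m)"
  then have j': "j \<in> charts A" by simp
  note ij = i' j'
  have "openin (top_of_set (domain (T m) i)) (domain (T m) i \<inter> overlap (T m) i j)"
    using ov_cot_open[OF ij] by (auto simp: openin_open cot_set_def)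
  moreover have "overlap (T m) i j \<subseteq> domain (T m) i" using cot_set_mono[OF ov_dom[OF ij]] by simp
  ultimately show "openin (top_of_set (domain (T m) i)) (overlap (T m) i j)" by (simp add: Int_absorb1)
  show "bodymap (change (T m) i j) ` overlap (T m) i j \<subseteq> overlap (T m) j i"
    using bodymap_T[OF ij _ bm_ov[OF ij cot_setD]] by auto
  show "superfun (par (T m) i) (overlap (T m) i j) (change (T m) i j x)" for x
    using change_T_superfun[OF ij] by simp
  show "has_parity (overlap (T m) i j) (par (T m) j x) (change (T m) i j x)" for x
    using change_T_gpar[OF ij cot_setD] by (auto simp: has_parity_iff)
  show "closedin (top_of_set (domain (T m) i \<times> domain (T m) j))
    ((\<lambda>z. (z, bodymap (change (T m) i j) z)) ` overlap (T m) i j)" by (rule change_T_closed[OF ij])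
  fix k z assume "k \<in> charts (T m)" and z: "z \<in> overlap (T m) i j"
    and bz: "bodymap (change (T m) i j) z \<in> overlap (T m) j k"
  then have k: "k \<in> charts A" "z \<in> cot_set (par A i) (overlap A i j)" "bm i j (base_point z) \<in> overlap A j k"
    by (simp_all add: cot_set_def base_bodymap_T)
  show "z \<in> overlap (T m) i k"
    using cocycle(1)[OF ij k(1) cot_setD[OF k(2)] k(3)] k(2) by (simp add: cot_set_def)
  show "change (T m) i k x z = pullback (T m) i j (change (T m) j k x) z" for x
    by (rule change_T_cocycle[OF ij k])
next
  obtain J where "J \<subseteq> charts A" "countable J" "\<forall>i\<in>charts A. domain A i \<subseteq> (\<Union>j\<in>J. overlap A i j)"
    using supermanifoldD(5) by blast
  then show "\<exists>J\<subseteq>charts (T m). countable J \<and> (\<forall>i\<in>charts (T m). domain (T m) i \<subseteq> (\<Union>j\<in>J. overlap (T m) i j))"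
    using cot_setD by (intro exI[of _ J]) (fastforce simp: cot_set_def)
qed

end

section \<open>Odd Hamiltonian vector fields\<close>

text \<open>The second-order terms cancel in pairs: exchanging the two components, whose parities
  are opposite to those of their coordinates, together with the two partial derivatives reverses the
  sign.\<close>

lemma odd_field_square:
  assumes U: "obody pr U" "u \<in> U" and f: "superfun pr U f"
    and X: "\<And>x. superfun pr U (X x)" "\<And>x. has_parity U (\<not> pr x) (X x)"
  shows "(\<Sum>y\<in>UNIV. X y u \<cdot> pder pr y (\<lambda>u. \<Sum>x\<in>UNIV. X x u \<cdot> pder pr x f u) u) =
    (\<Sum>x\<in>UNIV. (\<Sum>y\<in>UNIV. X y u \<cdot> pder pr y (X x) u) \<cdot> pder pr x f u)"
proof -
  have p: "gpar (\<not> pr x) (X x u)" for x using X(2) U(2) by (simp add: has_parity_iff)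
  note sf = superfun_pder[OF U(1) f]
  let ?t = "\<lambda>y x. ksign (pr y) (\<not> pr x) *\<^sub>R (X y u \<cdot> (X x u \<cdot> pder pr y (pder pr x f) u))"
  have 1: "pder pr y (\<lambda>u. \<Sum>x\<in>UNIV. X x u \<cdot> pder pr x f u) u =
      (\<Sum>x\<in>UNIV. pder pr y (X x) u \<cdot> pder pr x f u + ksign (pr y) (\<not> pr x) *\<^sub>R (X x u \<cdot> pder pr y (pder pr x f) u))" for y
  proof -
    have "pder pr y (\<lambda>u. \<Sum>x\<in>UNIV. X x u \<cdot> pder pr x f u) u = (\<Sum>x\<in>UNIV. pder pr y (\<lambda>u. X x u \<cdot> pder pr x f u) u)"
      by (rule pder_sum[OF U superfun_differentiable[OF superfun_gmul[OF U(1) X(1) sf]]])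
    also have "\<dots> = (\<Sum>x\<in>UNIV. pder pr y (X x) u \<cdot> pder pr x f u + ksign (pr y) (\<not> pr x) *\<^sub>R (X x u \<cdot> pder pr y (pder pr x f) u))"
      by (intro sum.cong refl pder_gmul_gpar[OF U superfun_differentiable[OF X(1)] superfun_differentiable[OF sf] p])
    finally show ?thesis .
  qed
  have anti: "?t y x = - ?t x y" for x y
    unfolding gmul_supercommute_left[OF p[of y] p[of x]] pder_commute[OF U f, of y x]
    by (cases "pr x"; cases "pr y") (simp_all add: ksign_def gmul_linear)
  have "(\<Sum>y\<in>UNIV. \<Sum>x\<in>UNIV. ?t y x) = (\<Sum>y\<in>UNIV. \<Sum>x\<in>UNIV. - ?t x y)"
    by (intro sum.cong refl anti)
  also have "\<dots> = - (\<Sum>y\<in>UNIV. \<Sum>x\<in>UNIV. ?t x y)"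
    by (simp only: sum_negf)
  also have "(\<Sum>y\<in>UNIV. \<Sum>x\<in>UNIV. ?t x y) = (\<Sum>y\<in>UNIV. \<Sum>x\<in>UNIV. ?t y x)"
    by (rule sum.swap)
  finally have 2: "(\<Sum>y\<in>UNIV. \<Sum>x\<in>UNIV. ?t y x) = 0"
    by (simp add: eq_neg_iff_add_eq_0 scaleR_2[symmetric])
  have "(\<Sum>y\<in>UNIV. X y u \<cdot> pder pr y (\<lambda>u. \<Sum>x\<in>UNIV. X x u \<cdot> pder pr x f u) u) =
      (\<Sum>y\<in>UNIV. \<Sum>x\<in>UNIV. X y u \<cdot> pder pr y (X x) u \<cdot> pder pr x f u) + (\<Sum>y\<in>UNIV. \<Sum>x\<in>UNIV. ?t y x)"
    unfolding 1 by (simp add: gmul.sum_right gmul_linear sum.distrib gmul_assoc)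
  also have "\<dots> = (\<Sum>x\<in>UNIV. (\<Sum>y\<in>UNIV. X y u \<cdot> pder pr y (X x) u) \<cdot> pder pr x f u)"
    unfolding 2 gmul.sum_left by (subst sum.swap) simp
  finally show ?thesis .
qed

text \<open>Components of the Hamiltonian field of an odd \<open>H\<close>, read off from the
  bracket with \<open>e = True\<close>.\<close>

definition ham_comp :: "('c::{finite,linorder} \<Rightarrow> bool) \<Rightarrow> 'c cot sfun \<Rightarrow> 'c cot \<Rightarrow> 'c cot sfun" where
  "ham_comp pr H x z = (case x of Pos a \<Rightarrow> pder (cot_par pr) (Mom a) H z
     | Mom a \<Rightarrow> (- ksign (pr a) True) *\<^sub>R pder (cot_par pr) (Pos a) H z)"

lemma poisson_hom_odd:
  "poisson_hom pr True H f z = (\<Sum>x\<in>UNIV. ham_comp pr H x z \<cdot> pder (cot_par pr) x f z)"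
  by (simp add: poisson_hom_def ham_comp_def sum_cot gmul_linear sum_subtractf sum_negf)

lemma poisson_hom_crd: "poisson_hom pr True H (crd (cot_par pr) x) z = ham_comp pr H x z"
proof -
  have "ham_comp pr H y z \<cdot> (if y = x then gone else 0) = (if y = x then ham_comp pr H x z else 0)" for y
    by simp
  then show ?thesis by (simp add: poisson_hom_odd)
qed

lemma ham_comp_superfun:
  assumes "obody (cot_par pr) W" "superfun (cot_par pr) W H"
  shows "superfun (cot_par pr) W (ham_comp pr H x)"
proof (cases x)
  case (Mom a)
  show ?thesis
    unfolding ham_comp_def[abs_def] Mom cot.case by (rule superfun_scaleR[OF assms(1) superfun_pder[OF assms]])
qed (use superfun_pder[OF assms] in \<open>simp add: ham_comp_def[abs_def]\<close>)

lemma ham_comp_parity: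
  assumes W: "obody (cot_par pr) W" and H: "superfun (cot_par pr) W H" "has_parity W True H"
  shows "has_parity W (\<not> cot_par pr x) (ham_comp pr H x)"
  unfolding has_parity_iff
proof
  fix z assume "z \<in> W"
  then have "gpar (\<not> cot_par pr y) (pder (cot_par pr) y H z)" for y
    using gpar_pder[OF W _ superfun_differentiable[OF H(1)] H(2), of z y] by simp
  from this[of "Mom a" for a] this[of "Pos a" for a]
  show "gpar (\<not> cot_par pr x) (ham_comp pr H x z)"
    by (cases x) (simp_all add: ham_comp_def gpar_scaleR gpar_minus)
qed

text \<open>For odd \<open>H\<close> the sum is one half of \<open>{H, H}\<close>. Differentiating
  it by the Leibniz rule and reordering the factors yields both halves of the bracket of
  \<open>H\<close> with its own derivative.\<close>

lemma poisson_hom_pder_self: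
  assumes W: "obody (cot_par pr) W" "z \<in> W" and H: "superfun (cot_par pr) W H" "has_parity W True H"
  shows "poisson_hom pr True H (pder (cot_par pr) y H) z = ksign (cot_par pr y) True *\<^sub>R
    pder (cot_par pr) y (\<lambda>z. \<Sum>a\<in>UNIV. pder (cot_par pr) (Mom a) H z \<cdot> pder (cot_par pr) (Pos a) H z) z"
proof -
  let ?P = "cot_par pr"
  note sf = superfun_pder[OF W(1) H(1)]
  have p1: "gpar (\<not> pr a) (pder ?P (Mom a) H z)" "gpar (\<not> pr a) (pder ?P (Pos a) H z)" for a
    using gpar_pder[OF W superfun_differentiable[OF H(1)] H(2), of "Mom a"]
      gpar_pder[OF W superfun_differentiable[OF H(1)] H(2), of "Pos a"] by simp_all
  have p2: "gpar ((\<not> pr a) \<noteq> ?P y) (pder ?P y (pder ?P (Mom a) H) z)" for a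
    using gpar_pder[OF W superfun_differentiable[OF sf] has_parity_pder[OF W(1) superfun_differentiable[OF H(1)] H(2)], where a = y, of "Mom a"]
    by simp
  have "pder ?P y (\<lambda>z. \<Sum>a\<in>UNIV. pder ?P (Mom a) H z \<cdot> pder ?P (Pos a) H z) z =
      (\<Sum>a\<in>UNIV. pder ?P y (\<lambda>z. pder ?P (Mom a) H z \<cdot> pder ?P (Pos a) H z) z)"
    by (rule pder_sum[OF W superfun_differentiable[OF superfun_gmul[OF W(1) sf sf]]])
  also have "\<dots> = (\<Sum>a\<in>UNIV. pder ?P y (pder ?P (Mom a) H) z \<cdot> pder ?P (Pos a) H z +
      ksign (?P y) (\<not> pr a) *\<^sub>R (pder ?P (Mom a) H z \<cdot> pder ?P y (pder ?P (Pos a) H) z))"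
    by (intro sum.cong refl pder_gmul_gpar[OF W superfun_differentiable[OF sf] superfun_differentiable[OF sf] p1(1)])
  also have "ksign (?P y) True *\<^sub>R \<dots> = poisson_hom pr True H (pder ?P y H) z"
    unfolding poisson_hom_def scaleR_sum_right
  proof (rule sum.cong[OF refl])
    fix a
    show "ksign (?P y) True *\<^sub>R (pder ?P y (pder ?P (Mom a) H) z \<cdot> pder ?P (Pos a) H z +
        ksign (?P y) (\<not> pr a) *\<^sub>R (pder ?P (Mom a) H z \<cdot> pder ?P y (pder ?P (Pos a) H) z)) =
      ksign (pr a) (\<not> True) *\<^sub>R (pder ?P (Mom a) H z \<cdot> pder ?P (Pos a) (pder ?P y H) z) -
        ksign (pr a) True *\<^sub>R (pder ?P (Pos a) H z \<cdot> pder ?P (Mom a) (pder ?P y H) z)"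
      unfolding gmul_supercommute[OF p2[of a] p1(2)[of a]]
      unfolding pder_commute[OF W H(1), of y "Mom a"]
        pder_commute[OF W H(1), of y "Pos a"]
      by (cases "?P y"; cases "pr a") (simp_all add: ksign_def gmul_linear)
  qed
  finally show ?thesis by simp
qed

lemma poisson_hom_scaleR:
  assumes "obody (cot_par pr) W" "z \<in> W" "superfun (cot_par pr) W f"
  shows "poisson_hom pr True H (\<lambda>z. c *\<^sub>R f z) z = c *\<^sub>R poisson_hom pr True H f z"
  by (simp add: poisson_hom_odd pder_scaleR[OF assms(1,2) superfun_differentiable[OF assms(3)]] gmul_linear scaleR_sum_right)

lemma poisson_hom_cong:
  assumes "obody (cot_par pr) W" "z \<in> W" "\<And>z. z \<in> W \<Longrightarrow> f z = g z"
  shows "poisson_hom pr e H f z = poisson_hom pr e H g z"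
  unfolding poisson_hom_def using pder_cong[of "cot_par pr" W f g z, OF assms(1,3,2)] by simp

text \<open>The square is determined by the field applied to its own components. These are, up to
  constants, derivatives of \<open>H\<close>, so their brackets with \<open>H\<close> are
  derivatives of one half of \<open>{H, H}\<close>, which vanishes on \<open>W\<close>.\<close>

lemma ham_square:
  assumes W: "obody (cot_par pr) W" "z \<in> W" and H: "superfun (cot_par pr) W H" "has_parity W True H"
    and f: "superfun (cot_par pr) W f"
    and E: "\<And>z. z \<in> W \<Longrightarrow> (\<Sum>a\<in>UNIV. pder (cot_par pr) (Mom a) H z \<cdot> pder (cot_par pr) (Pos a) H z) = 0"
  shows "poisson_hom pr True H (poisson_hom pr True H f) z = 0"
proof -
  let ?P = "cot_par pr"
  have 0: "poisson_hom pr True H (pder ?P y H) z = 0" for y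
    unfolding poisson_hom_pder_self[OF W H]
    using pder_cong[of ?P W _ "\<lambda>z. 0" z y, OF W(1) E W(2)] by simp
  have comp: "poisson_hom pr True H (ham_comp pr H x) z = 0" for x
  proof (cases x)
    case (Pos a)
    then have "ham_comp pr H x = pder ?P (Mom a) H" by (simp add: ham_comp_def fun_eq_iff)
    then show ?thesis by (simp add: 0)
  next
    case (Mom a)
    then have "ham_comp pr H x = (\<lambda>z. (- ksign (pr a) True) *\<^sub>R pder ?P (Pos a) H z)"
      by (simp add: ham_comp_def fun_eq_iff)
    then show ?thesis using poisson_hom_scaleR[OF W superfun_pder[OF W(1) H(1)]] by (simp only: 0 scaleR_zero_right)
  qed
  have "poisson_hom pr True H (poisson_hom pr True H f) z =
      (\<Sum>y\<in>UNIV. ham_comp pr H y z \<cdot> pder ?P y (\<lambda>z. \<Sum>x\<in>UNIV. ham_comp pr H x z \<cdot> pder ?P x f z) z)"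
    unfolding poisson_hom_odd[of pr H f, abs_def] by (rule poisson_hom_odd)
  also have "\<dots> = (\<Sum>x\<in>UNIV. poisson_hom pr True H (ham_comp pr H x) z \<cdot> pder ?P x f z)"
    unfolding odd_field_square[OF W f ham_comp_superfun[OF W(1) H(1)] ham_comp_parity[OF W(1) H]] poisson_hom_odd ..
  also have "\<dots> = 0" by (simp add: comp)
  finally show ?thesis .
qed

text \<open>For homogeneous \<open>F\<close> the part of the other parity vanishes on an open set,
  hence so do its derivatives.\<close>

lemma poisson_eq:
  assumes W: "obody (cot_par pr) W" "z \<in> W" and F: "has_parity W e F"
  shows "poisson pr F g z = poisson_hom pr e F g z"
proof -
  have part: "part d F z = gpart d (F z)" for d z by (simp add: part_def gpart_def)
  have 1: "pder (cot_par pr) x (part e F) z = pder (cot_par pr) x F z" for x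
    using F by (intro pder_cong[OF W(1) _ W(2)]) (simp add: part gpart_id has_parity_iff)
  have "pder (cot_par pr) x (part (\<not> e) F) z = pder (cot_par pr) x (\<lambda>z. 0) z" for x
    using F by (intro pder_cong[OF W(1) _ W(2)]) (simp add: part gpart_other has_parity_iff)
  then have 2: "poisson_hom pr d (part (\<not> e) F) g z = 0" for d
    by (simp add: poisson_hom_def)
  have "poisson_hom pr e (part e F) g z = poisson_hom pr e F g z"
    by (simp add: poisson_hom_def 1)
  with 2 show ?thesis by (cases e) (simp_all add: poisson_def)
qed

text \<open>Exchanging the factors in the second half of the bracket absorbs its sign. The result is
  symmetric in \<open>F\<close> and \<open>G\<close>, and for equal arguments it is twice a single
  sum.\<close>

lemma poisson_hom_odd_swap:
  assumes W: "obody (cot_par pr) W" "z \<in> W"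
    and F: "superfun (cot_par pr) W F" "has_parity W True F" and G: "superfun (cot_par pr) W G" "has_parity W True G"
  shows "poisson_hom pr True F G z =
    (\<Sum>a\<in>UNIV. pder (cot_par pr) (Mom a) F z \<cdot> pder (cot_par pr) (Pos a) G z +
      pder (cot_par pr) (Mom a) G z \<cdot> pder (cot_par pr) (Pos a) F z)"
  unfolding poisson_hom_def
proof (rule sum.cong[OF refl])
  fix a
  have p: "gpar (\<not> pr a) (pder (cot_par pr) (Pos a) F z)" "gpar (\<not> pr a) (pder (cot_par pr) (Mom a) G z)"
    using gpar_pder[OF W superfun_differentiable[OF F(1)] F(2), of "Pos a"]
      gpar_pder[OF W superfun_differentiable[OF G(1)] G(2), of "Mom a"] by simp_all
  show "ksign (pr a) (\<not> True) *\<^sub>R (pder (cot_par pr) (Mom a) F z \<cdot> pder (cot_par pr) (Pos a) G z) -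
      ksign (pr a) True *\<^sub>R (pder (cot_par pr) (Pos a) F z \<cdot> pder (cot_par pr) (Mom a) G z) =
    pder (cot_par pr) (Mom a) F z \<cdot> pder (cot_par pr) (Pos a) G z +
      pder (cot_par pr) (Mom a) G z \<cdot> pder (cot_par pr) (Pos a) F z"
    unfolding gmul_supercommute[OF p] by (cases "pr a") (simp_all add: ksign_def)
qed

section \<open>Functions polynomial in the momenta\<close>

text \<open>A left derivative by a momentum has to pass the coefficient standing in front of that
  momentum, whence the twist.\<close>

lemma pder_lift_p:
  fixes pr :: "'c::{finite,linorder} \<Rightarrow> bool"
  assumes U: "obody pr U" "base_point z \<in> U" and F: "\<And>c. superfun pr U (F c)"
    and z: "z \<in> cot_set pr U"
  shows "pder (cot_par pr) (Mom b) (\<lambda>z. \<Sum>c\<in>UNIV. lift (F c) z \<cdot> crd (cot_par pr) (Mom c) z) z =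
      gtwist (pr b) (lift (F b) z)"
    and "pder (cot_par pr) (Pos b) (\<lambda>z. \<Sum>c\<in>UNIV. lift (F c) z \<cdot> crd (cot_par pr) (Mom c) z) z =
      (\<Sum>c\<in>UNIV. lift (pder pr b (F c)) z \<cdot> crd (cot_par pr) (Mom c) z)"
proof -
  note W = obody_cot_set[OF U(1)]
  note d = superfun_differentiable[OF superfun_lift[OF U(1) F]]
  have *: "pder (cot_par pr) x (\<lambda>z. \<Sum>c\<in>UNIV. lift (F c) z \<cdot> crd (cot_par pr) (Mom c) z) z =
    (\<Sum>c\<in>UNIV. pder (cot_par pr) x (lift (F c)) z \<cdot> crd (cot_par pr) (Mom c) z +
      gtwist (cot_par pr x) (lift (F c) z) \<cdot> (if x = Mom c then gone else 0))" for x
    unfolding pder_sum[OF W z superfun_differentiable[OF superfun_gmul[OF W superfun_lift[OF U(1) F] superfun_crd]]]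
      pder_gmul[OF W z d crd_differentiable] pder_crd ..
  have "gtwist (pr b) (lift (F c) z) \<cdot> (if Mom b = Mom c then gone else 0) =
      (if c = b then gtwist (pr b) (lift (F b) z) else 0)" for c by simp
  then show "pder (cot_par pr) (Mom b) (\<lambda>z. \<Sum>c\<in>UNIV. lift (F c) z \<cdot> crd (cot_par pr) (Mom c) z) z =
      gtwist (pr b) (lift (F b) z)"
    unfolding * by simp
  show "pder (cot_par pr) (Pos b) (\<lambda>z. \<Sum>c\<in>UNIV. lift (F c) z \<cdot> crd (cot_par pr) (Mom c) z) z =
      (\<Sum>c\<in>UNIV. lift (pder pr b (F c)) z \<cdot> crd (cot_par pr) (Mom c) z)"
    unfolding * by (simp add: pder_lift_Pos[OF U(1) superfun_differentiable[OF F] U(2)])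
qed

text \<open>Homogeneity in the momenta is expressed by the Euler field, the even vector field \<open>p\<^sub>a \<partial>/\<partial>p\<^sub>a\<close>.\<close>

definition homog :: "('c::{finite,linorder} \<Rightarrow> bool) \<Rightarrow> 'c cot point set \<Rightarrow> real \<Rightarrow> 'c cot sfun \<Rightarrow> bool" where
  "homog pr W n F \<longleftrightarrow> superfun (cot_par pr) W F \<and> (\<forall>z\<in>W.
     (\<Sum>a\<in>UNIV. crd (cot_par pr) (Mom a) z \<cdot> pder (cot_par pr) (Mom a) F z) = n *\<^sub>R F z)"

lemma homog_superfun: "homog pr W n F \<Longrightarrow> superfun (cot_par pr) W F"
  by (simp add: homog_def)

lemma homogD:
  "homog pr W n F \<Longrightarrow> z \<in> W \<Longrightarrow>
    (\<Sum>a\<in>UNIV. crd (cot_par pr) (Mom a) z \<cdot> pder (cot_par pr) (Mom a) F z) = n *\<^sub>R F z"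
  by (simp add: homog_def)

lemma homog_cong:
  assumes "obody (cot_par pr) W" "\<And>z. z \<in> W \<Longrightarrow> F z = G z" "homog pr W n F"
  shows "homog pr W n G"
  unfolding homog_def
proof (intro conjI ballI)
  show "superfun (cot_par pr) W G"
    using superfun_cong[of "cot_par pr" W F G] assms(1,2) homog_superfun[OF assms(3)] by blast
  fix z assume z: "z \<in> W"
  have "pder (cot_par pr) x F z = pder (cot_par pr) x G z" for x
    by (rule pder_cong[OF assms(1,2) z])
  then show "(\<Sum>a\<in>UNIV. crd (cot_par pr) (Mom a) z \<cdot> pder (cot_par pr) (Mom a) G z) = n *\<^sub>R G z"
    using homogD[OF assms(3) z] assms(2)[OF z] by simp
qed

lemma homog_sum:
  assumes W: "obody (cot_par pr) W" and F: "\<And>i. i \<in> I \<Longrightarrow> homog pr W n (F i)"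
  shows "homog pr W n (\<lambda>z. \<Sum>i\<in>I. F i z)"
  unfolding homog_def
proof (intro conjI ballI)
  show "superfun (cot_par pr) W (\<lambda>z. \<Sum>i\<in>I. F i z)"
    by (intro superfun_sum[OF W] homog_superfun[OF F])
  fix z assume z: "z \<in> W"
  have "pder (cot_par pr) x (\<lambda>z. \<Sum>i\<in>I. F i z) z = (\<Sum>i\<in>I. pder (cot_par pr) x (F i) z)" for x
    by (rule pder_sum[OF W z superfun_differentiable[OF homog_superfun[OF F]]])
  then have "(\<Sum>a\<in>UNIV. crd (cot_par pr) (Mom a) z \<cdot> pder (cot_par pr) (Mom a) (\<lambda>z. \<Sum>i\<in>I. F i z) z) =
      (\<Sum>i\<in>I. \<Sum>a\<in>UNIV. crd (cot_par pr) (Mom a) z \<cdot> pder (cot_par pr) (Mom a) (F i) z)"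
    by (simp add: gmul.sum_right) (rule sum.swap)
  also have "\<dots> = (\<Sum>i\<in>I. n *\<^sub>R F i z)" by (intro sum.cong refl homogD[OF F z])
  finally show "(\<Sum>a\<in>UNIV. crd (cot_par pr) (Mom a) z \<cdot> pder (cot_par pr) (Mom a) (\<lambda>z. \<Sum>i\<in>I. F i z) z) =
      n *\<^sub>R (\<Sum>i\<in>I. F i z)" by (simp add: scaleR_sum_right)
qed

lemma homog_scaleR:
  assumes W: "obody (cot_par pr) W" and F: "homog pr W n F"
  shows "homog pr W n (\<lambda>z. c *\<^sub>R F z)"
  using homogD[OF F] superfun_scaleR[OF W homog_superfun[OF F]]
  by (simp add: homog_def pder_scaleR[OF W _ superfun_differentiable[OF homog_superfun[OF F]]] gmul_linear
      scaleR_sum_right[symmetric] mult.commute)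

text \<open>The Euler field is even and obeys the Leibniz rule without signs: the twist from an odd
  momentum derivative is undone by moving the momentum itself past the first factor.\<close>

lemma homog_gmul:
  assumes W: "obody (cot_par pr) W" and F: "homog pr W n F" and G: "homog pr W m G"
  shows "homog pr W (n + m) (\<lambda>z. F z \<cdot> G z)"
  unfolding homog_def
proof (intro conjI ballI)
  show "superfun (cot_par pr) W (\<lambda>z. F z \<cdot> G z)"
    by (intro superfun_gmul[OF W] homog_superfun[OF F] homog_superfun[OF G])
  fix z assume z: "z \<in> W"
  let ?p = "\<lambda>a. crd (cot_par pr) (Mom a) z" and ?d = "\<lambda>a. pder (cot_par pr) (Mom a)"
  have p: "?p a \<cdot> (gtwist (pr a) (F z) \<cdot> x) = F z \<cdot> (?p a \<cdot> x)" for a x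
    unfolding gmul_assoc[symmetric]
    using gmul_gtwist[of "pr a" "?p a" "F z"] gpar_crd[of "cot_par pr" "Mom a" z] by simp
  have "(\<Sum>a\<in>UNIV. ?p a \<cdot> ?d a (\<lambda>z. F z \<cdot> G z) z) =
      (\<Sum>a\<in>UNIV. (?p a \<cdot> ?d a F z) \<cdot> G z + F z \<cdot> (?p a \<cdot> ?d a G z))"
    by (simp add: pder_gmul[OF W z superfun_differentiable[OF homog_superfun[OF F]]
          superfun_differentiable[OF homog_superfun[OF G]]] gmul_linear p gmul_assoc)
  also have "\<dots> = (\<Sum>a\<in>UNIV. ?p a \<cdot> ?d a F z) \<cdot> G z + F z \<cdot> (\<Sum>a\<in>UNIV. ?p a \<cdot> ?d a G z)"
    by (simp only: sum.distrib gmul.sum_left gmul.sum_right)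
  also have "\<dots> = (n + m) *\<^sub>R (F z \<cdot> G z)"
    by (simp only: homogD[OF F z] homogD[OF G z] gmul_linear scaleR_left_distrib)
  finally show "(\<Sum>a\<in>UNIV. ?p a \<cdot> ?d a (\<lambda>z. F z \<cdot> G z) z) = (n + m) *\<^sub>R (F z \<cdot> G z)" .
qed

lemma homog_lift: "obody pr U \<Longrightarrow> superfun pr U f \<Longrightarrow> homog pr (cot_set pr U) 0 (lift f)"
  by (simp add: homog_def superfun_lift)

lemma homog_p: "homog pr W 1 (crd (cot_par pr) (Mom b))"
proof -
  have "crd (cot_par pr) (Mom a) z \<cdot> (if Mom a = Mom b then gone else 0) =
      (if a = b then crd (cot_par pr) (Mom b) z else 0)" for a z by simp
  then show ?thesis by (simp add: homog_def)
qed

text \<open>Commuting the derivative along \<open>x\<close> past the Euler field leaves one extra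
  copy of that derivative if \<open>x\<close> is a momentum and nothing otherwise.\<close>

lemma homog_pder:
  assumes W: "obody (cot_par pr) W" and F: "homog pr W n F"
  shows "homog pr W (n - fibre_deg x) (pder (cot_par pr) x F)"
  unfolding homog_def
proof (intro conjI ballI)
  let ?P = "cot_par pr"
  note sf = homog_superfun[OF F]
  show "superfun ?P W (pder ?P x F)" by (rule superfun_pder[OF W sf])
  fix z assume z: "z \<in> W"
  let ?p = "\<lambda>a. crd ?P (Mom a)" and ?d = "\<lambda>a. pder ?P (Mom a)"
  have "n *\<^sub>R pder ?P x F z = pder ?P x (\<lambda>z. n *\<^sub>R F z) z"
    by (rule pder_scaleR[OF W z superfun_differentiable[OF sf], symmetric])
  also have "\<dots> = pder ?P x (\<lambda>z. \<Sum>a\<in>UNIV. ?p a z \<cdot> ?d a F z) z"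
    by (rule pder_cong[OF W _ z]) (simp add: homogD[OF F])
  also have "\<dots> = (\<Sum>a\<in>UNIV. pder ?P x (\<lambda>z. ?p a z \<cdot> ?d a F z) z)"
    by (rule pder_sum[OF W z superfun_differentiable[OF superfun_gmul[OF W superfun_crd superfun_pder[OF W sf]]]])
  also have "\<dots> = (\<Sum>a\<in>UNIV. (if x = Mom a then ?d a F z else 0) + ?p a z \<cdot> ?d a (pder ?P x F) z)"
  proof (rule sum.cong[OF refl])
    fix a
    have "ksign (?P x) (pr a) *\<^sub>R (?p a z \<cdot> pder ?P x (?d a F) z) = ?p a z \<cdot> ?d a (pder ?P x F) z"
      unfolding pder_commute[OF W z sf, of x "Mom a"] by (simp add: gmul_linear)
    then show "pder ?P x (\<lambda>z. ?p a z \<cdot> ?d a F z) z =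
        (if x = Mom a then ?d a F z else 0) + ?p a z \<cdot> ?d a (pder ?P x F) z"
      using gpar_crd[of ?P "Mom a" z]
      by (simp add: pder_gmul_gpar[OF W z crd_differentiable superfun_differentiable[OF superfun_pder[OF W sf]], where e = "pr a"])
  qed
  also have "\<dots> = fibre_deg x *\<^sub>R pder ?P x F z + (\<Sum>a\<in>UNIV. ?p a z \<cdot> ?d a (pder ?P x F) z)"
  proof -
    have "(\<Sum>a\<in>UNIV. if x = Mom a then ?d a F z else 0) = fibre_deg x *\<^sub>R pder ?P x F z"
      by (cases x) simp_all
    then show ?thesis by (simp add: sum.distrib)
  qed
  finally show "(\<Sum>a\<in>UNIV. ?p a z \<cdot> ?d a (pder ?P x F) z) = (n - fibre_deg x) *\<^sub>R pder ?P x F z"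
    by (simp add: scaleR_left_diff_distrib)
qed

text \<open>Euler's identity, applied twice.\<close>

lemma homog_2_expansion:
  assumes W: "obody (cot_par pr) W" "z \<in> W" and F: "homog pr W 2 F"
  shows "F z = (1 / 2) *\<^sub>R (\<Sum>a\<in>UNIV. \<Sum>b\<in>UNIV. crd (cot_par pr) (Mom a) z \<cdot>
    (crd (cot_par pr) (Mom b) z \<cdot> pder (cot_par pr) (Mom b) (pder (cot_par pr) (Mom a) F) z))"
proof -
  have "pder (cot_par pr) (Mom a) F z =
      (\<Sum>b\<in>UNIV. crd (cot_par pr) (Mom b) z \<cdot> pder (cot_par pr) (Mom b) (pder (cot_par pr) (Mom a) F) z)" for a
    using homogD[OF homog_pder[OF W(1) F, of "Mom a"] W(2)] by simp
  then have "2 *\<^sub>R F z = (\<Sum>a\<in>UNIV. \<Sum>b\<in>UNIV. crd (cot_par pr) (Mom a) z \<cdot>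
    (crd (cot_par pr) (Mom b) z \<cdot> pder (cot_par pr) (Mom b) (pder (cot_par pr) (Mom a) F) z))"
    using homogD[OF F W(2)] by (simp add: gmul.sum_right)
  moreover have "F z = (1 / 2) *\<^sub>R (2 *\<^sub>R F z)" by simp
  ultimately show ?thesis by simp
qed

lemma pder_pder_sum:
  assumes "obody pr W" "z \<in> W" "\<And>i. i \<in> I \<Longrightarrow> superfun pr W (F i)"
  shows "pder pr x (pder pr y (\<lambda>z. \<Sum>i\<in>I. F i z)) z = (\<Sum>i\<in>I. pder pr x (pder pr y (F i)) z)"
proof -
  have "pder pr x (pder pr y (\<lambda>z. \<Sum>i\<in>I. F i z)) z = pder pr x (\<lambda>z. \<Sum>i\<in>I. pder pr y (F i) z) z"
    by (rule pder_cong[OF assms(1) _ assms(2)], rule pder_sum[OF assms(1)])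
      (simp_all add: superfun_differentiable[OF assms(3)])
  also have "\<dots> = (\<Sum>i\<in>I. pder pr x (pder pr y (F i)) z)"
    by (rule pder_sum[OF assms(1,2) superfun_differentiable[OF superfun_pder[OF assms(1,3)]]])
  finally show ?thesis .
qed

text \<open>Differentiating a quadratic expression twice by momenta removes all momenta. The result
  is a lift, and a lift is recovered from its values on the zero section.\<close>

lemma pder_pder_quadratic:
  assumes U: "obody pr U" and s: "\<And>a b. superfun pr U (s a b)"
    and S: "\<And>z. z \<in> cot_set pr U \<Longrightarrow> S z = (1 / 2) *\<^sub>R (\<Sum>a\<in>UNIV. \<Sum>b\<in>UNIV. lift (s a b) z \<cdot>
      (crd (cot_par pr) (Mom b) z \<cdot> crd (cot_par pr) (Mom a) z))"
  shows "homog pr (cot_set pr U) 2 S"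
    and "z \<in> cot_set pr U \<Longrightarrow> pder (cot_par pr) (Mom c) (pder (cot_par pr) (Mom d) S) z =
      lift (restrict0 (pder (cot_par pr) (Mom c) (pder (cot_par pr) (Mom d) S))) z"
proof -
  let ?P = "cot_par pr" and ?D = "cot_set pr U"
  let ?p = "\<lambda>a. crd ?P (Mom a)"
  note W = obody_cot_set[OF U]
  have t: "homog pr ?D 2 (\<lambda>z. lift (s a b) z \<cdot> (?p b z \<cdot> ?p a z))" for a b
    using homog_gmul[OF W homog_lift[OF U s] homog_gmul[OF W homog_p homog_p]] by simp
  then have h: "homog pr ?D 2 (\<lambda>z. (1 / 2) *\<^sub>R (\<Sum>a\<in>UNIV. \<Sum>b\<in>UNIV. lift (s a b) z \<cdot> (?p b z \<cdot> ?p a z)))"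
    by (intro homog_scaleR[OF W] homog_sum[OF W])
  show "homog pr ?D 2 S" by (rule homog_cong[OF W _ h]) (simp add: S)
  let ?d = "\<lambda>a. pder ?P (Mom a)" and ?\<delta> = "\<lambda>a b. if a = b then 1 else 0 :: real"
  \<comment> \<open>What matters is that some base function \<open>\<tau>\<close> exists; the
    explicit combination of Kronecker deltas is hidden behind it.\<close>
  have t2: "\<exists>\<tau>. \<forall>z\<in>?D. ?d c (?d d (\<lambda>z. lift (s a b) z \<cdot> (?p b z \<cdot> ?p a z))) z = lift \<tau> z" for a b c d
  proof -
    define s' where "s' u = gtwist (pr d) (s a b u)" for u
    have s': "superfun pr U s'" unfolding s'_def by (intro superfun_gtwist U s)
    have lift_s': "lift s' z = gtwist (pr d) (lift (s a b) z)" for z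
      by (simp add: s'_def lift_eq glift_gtwist)
    have 1: "?d d (\<lambda>z. lift (s a b) z \<cdot> (?p b z \<cdot> ?p a z)) z =
        ?\<delta> d b *\<^sub>R (lift s' z \<cdot> ?p a z) + (ksign (pr d) (pr b) * ?\<delta> d a) *\<^sub>R (lift s' z \<cdot> ?p b z)" if z: "z \<in> ?D" for z
    proof -
      have "?d d (\<lambda>z. ?p b z \<cdot> ?p a z) z = ?\<delta> d b *\<^sub>R ?p a z + (ksign (pr d) (pr b) * ?\<delta> d a) *\<^sub>R ?p b z"
        by (subst pder_gmul_gpar[OF W z crd_differentiable crd_differentiable gpar_crd]) simp
      then show ?thesis
        unfolding pder_gmul[OF W z superfun_differentiable[OF superfun_lift[OF U s]]
            superfun_differentiable[OF superfun_gmul[OF W superfun_crd superfun_crd]]]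
        by (simp add: lift_s' gmul_linear)
    qed
    have 2: "?d c (\<lambda>z. lift s' z \<cdot> ?p e z) z = ?\<delta> c e *\<^sub>R gtwist (pr c) (lift s' z)" if z: "z \<in> ?D" for z e
      unfolding pder_gmul[OF W z superfun_differentiable[OF superfun_lift[OF U s']] crd_differentiable]
      by simp
    have "?d c (?d d (\<lambda>z. lift (s a b) z \<cdot> (?p b z \<cdot> ?p a z))) z =
        lift (\<lambda>u. (?\<delta> d b * ?\<delta> c a + ksign (pr d) (pr b) * ?\<delta> d a * ?\<delta> c b) *\<^sub>R gtwist (pr c) (s' u)) z" if z: "z \<in> ?D" for z
    proof -
      have g: "superfun ?P ?D (\<lambda>z. lift s' z \<cdot> ?p e z)" for e
        by (intro superfun_gmul[OF W] superfun_lift[OF U s'] superfun_crd)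
      have "?d c (?d d (\<lambda>z. lift (s a b) z \<cdot> (?p b z \<cdot> ?p a z))) z =
        ?d c (\<lambda>z. ?\<delta> d b *\<^sub>R (lift s' z \<cdot> ?p a z) + (ksign (pr d) (pr b) * ?\<delta> d a) *\<^sub>R (lift s' z \<cdot> ?p b z)) z"
        by (rule pder_cong[OF W 1 z])
      also have "\<dots> = ?\<delta> d b *\<^sub>R (?\<delta> c a *\<^sub>R gtwist (pr c) (lift s' z)) +
          (ksign (pr d) (pr b) * ?\<delta> d a) *\<^sub>R (?\<delta> c b *\<^sub>R gtwist (pr c) (lift s' z))"
        unfolding pder_add[OF W z superfun_differentiable[OF superfun_scaleR[OF W g]] superfun_differentiable[OF superfun_scaleR[OF W g]]]
          pder_scaleR[OF W z superfun_differentiable[OF g]] 2[OF z] ..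
      finally show ?thesis by (simp add: lift_eq glift_simps glift_gtwist scaleR_left_distrib)
    qed
    then show ?thesis by blast
  qed
  define \<tau> where "\<tau> a b = (SOME \<tau>. \<forall>z\<in>?D. ?d c (?d d (\<lambda>z. lift (s a b) z \<cdot> (?p b z \<cdot> ?p a z))) z = lift \<tau> z)" for a b
  have \<tau>: "?d c (?d d (\<lambda>z. lift (s a b) z \<cdot> (?p b z \<cdot> ?p a z))) z = lift (\<tau> a b) z" if "z \<in> ?D" for a b z
    unfolding \<tau>_def using someI_ex[OF t2[of c d a b]] that by (rule bspec)
  have dd: "?d c (?d d S) z = lift (\<lambda>u. (1 / 2) *\<^sub>R (\<Sum>a\<in>UNIV. \<Sum>b\<in>UNIV. \<tau> a b u)) z" if z: "z \<in> ?D" for z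
  proof -
    have g: "superfun ?P ?D (\<lambda>z. (1 / 2) *\<^sub>R (lift (s a b) z \<cdot> (?p b z \<cdot> ?p a z)))" for a b
      by (intro superfun_scaleR[OF W] homog_superfun[OF t])
    have h: "?d c (?d d (\<lambda>z. (1 / 2) *\<^sub>R (lift (s a b) z \<cdot> (?p b z \<cdot> ?p a z)))) z = (1 / 2) *\<^sub>R lift (\<tau> a b) z" for a b
    proof -
      have "?d c (?d d (\<lambda>z. (1 / 2) *\<^sub>R (lift (s a b) z \<cdot> (?p b z \<cdot> ?p a z)))) z =
          ?d c (\<lambda>z. (1 / 2) *\<^sub>R ?d d (\<lambda>z. lift (s a b) z \<cdot> (?p b z \<cdot> ?p a z)) z) z"
        by (rule pder_cong[OF W _ z], rule pder_scaleR[OF W _ superfun_differentiable[OF homog_superfun[OF t]]])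
      also have "\<dots> = (1 / 2) *\<^sub>R lift (\<tau> a b) z"
        unfolding pder_scaleR[OF W z superfun_differentiable[OF superfun_pder[OF W homog_superfun[OF t]]]] \<tau>[OF z] ..
      finally show ?thesis .
    qed
    have "?d c (?d d S) z = ?d c (?d d (\<lambda>z. \<Sum>a\<in>UNIV. \<Sum>b\<in>UNIV. (1 / 2) *\<^sub>R (lift (s a b) z \<cdot> (?p b z \<cdot> ?p a z)))) z"
      by (intro pder_cong[OF W _ z] pder_cong[OF W]) (simp_all add: S scaleR_sum_right)
    also have "\<dots> = (\<Sum>a\<in>UNIV. \<Sum>b\<in>UNIV. (1 / 2) *\<^sub>R lift (\<tau> a b) z)"
      unfolding pder_pder_sum[OF W z superfun_sum[OF W g]] pder_pder_sum[OF W z g] h ..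
    finally show ?thesis by (simp add: lift_eq glift_simps scaleR_sum_right)
  qed
  assume z: "z \<in> ?D"
  \<comment> \<open>A lift depends only on the base point, which \<open>z\<close> shares with this
    point of the zero section.\<close>
  have "zero_section (base_point z) \<in> ?D" by (rule zero_section_cot_set[OF U cot_setD[OF z]])
  from dd[OF this] dd[OF z] show "?d c (?d d S) z = lift (restrict0 (?d c (?d d S))) z"
    by (simp add: lift_eq restrict0_eq)
qed

section \<open>Weights on the cotangent bundle\<close>

locale graded_atlas =
  fixes A :: "('i, 'c::{finite,linorder}) atlas"
  assumes graded: "graded_manifold A"

sublocale graded_atlas \<subseteq> supermanifold_atlas A
  using graded by unfold_locales (simp add: graded_manifold_def)

context graded_atlas
begin

lemma
  assumes "i \<in> charts A" "j \<in> charts A"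
  shows change_weight: "has_weight (par A i) (wt A i) (overlap A i j) (wt A j b) (change A i j b)"
    and jacobian_weight: "has_weight (par A i) (wt A i) (overlap A i j) (wt A i a - wt A j b) (jacobian A i j a b)"
  using graded assms unfolding graded_manifold_def by simp_all

lemma lift_weight:
  assumes "obody (par A i) U" "has_weight (par A i) (wt A i) U r f"
  shows "has_weight (cot_par (par A i)) (wt (T m) i) (cot_set (par A i) U) r (lift f)"
  using assms by (rule has_weight_lift) simp

lemma p_weight:
  assumes "obody (cot_par (par A i)) W"
  shows "has_weight (cot_par (par A i)) (wt (T m) i) W (m - wt A i a) (p i a)"
  using has_weight_crd[OF assms, of "wt (T m) i" "Mom a"] by simp

text \<open>Since \<open>p i c\<close> has weight \<open>m - wt A i c\<close>, the coordinate
  weights cancel. With \<open>r = - wt A j b\<close> this gives the transformed momenta, with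
  \<open>r = q\<close> the Hamiltonian \<open>Q\<close>.\<close>

lemma lift_p_weight:
  assumes U: "obody (par A i) U" and F: "\<And>c. has_weight (par A i) (wt A i) U (r + wt A i c) (F c)"
  shows "has_weight (cot_par (par A i)) (wt (T m) i) (cot_set (par A i) U) (r + m)
    (\<lambda>z. \<Sum>c\<in>UNIV. lift (F c) z \<cdot> p i c z)"
proof (rule has_weight_sum[OF obody_cot_set[OF U]])
  fix c
  show "has_weight (cot_par (par A i)) (wt (T m) i) (cot_set (par A i) U) (r + m) (\<lambda>z. lift (F c) z \<cdot> p i c z)"
    using has_weight_gmul[OF obody_cot_set[OF U] lift_weight[OF U F[of c]] p_weight[OF obody_cot_set[OF U], of m c]]
    by (simp add: algebra_simps)
qed

lemma change_T_weight:
  assumes ij: "i \<in> charts A" "j \<in> charts A"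
  shows "has_weight (cot_par (par A i)) (wt (T m) i) (cot_set (par A i) (overlap A i j)) (wt (T m) j x) (change (T m) i j x)"
proof (cases x)
  case (Pos b)
  then show ?thesis using lift_weight[OF ov_open[OF ij] change_weight[OF ij]] by (simp add: change_T_Pos)
next
  case (Mom b)
  have "has_weight (par A i) (wt A i) (overlap A i j) (- wt A j b + wt A i a) (jacobian A i j a b)" for a
    using jacobian_weight[OF ij, of a b] by (simp add: algebra_simps)
  from lift_p_weight[OF ov_open[OF ij] this, of m] show ?thesis by (simp add: Mom change_T_Mom)
qed

lemma atlas_T: "supermanifold_atlas (T m)"
  by (simp add: supermanifold_atlas_def supermanifold_T)

text \<open>Of the four blocks, positions by positions give the base Jacobian, momenta by momenta
  its inverse up to sign, positions by momenta 0. The remaining block contains second derivatives of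
  the change of coordinates and is linear in the momenta.\<close>

lemma jacobian_T_weight:
  assumes ij: "i \<in> charts A" "j \<in> charts A"
  shows "has_weight (cot_par (par A i)) (wt (T m) i) (cot_set (par A i) (overlap A i j))
    (wt (T m) i x - wt (T m) j y) (jacobian (T m) i j x y)"
proof -
  interpret TT: supermanifold_atlas "T m" by (rule atlas_T)
  let ?O = "cot_set (par A i) (overlap A i j)" and ?O' = "cot_set (par A j) (overlap A j i)"
  note U = ov_open[OF ij] and U' = ov_open[OF ij(2,1)]
  note W = obody_cot_set[OF U] and W' = obody_cot_set[OF U']
  note sf' = superfun_pder[OF U' change_superfun[OF ij(2,1)]] and js' = jacobian_superfun[OF ij(2,1)]
  have b: "TT.bm i j z \<in> ?O'" if "z \<in> ?O" for z
    using bodymap_T[OF ij that bm_ov[OF ij cot_setD[OF that]]] .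
  have pb: "jacobian (T m) i j x y z = pullback (T m) i j G z"
    if "z \<in> ?O" "\<And>v. v \<in> ?O' \<Longrightarrow> pder (cot_par (par A j)) y (change (T m) j i x) v = G v" for z G
    unfolding jacobian_def using W' b[OF that(1)] that(2) by (intro TT.pullback_cong[of j ?O']) auto
  have pl: "pullback (T m) i j (lift F) z = lift (pullback A i j F) z"
    if "z \<in> ?O" "superfun (par A j) (overlap A j i) F" for z F
    using pullback_T_lift[OF ij cot_setD[OF that(1)] U' bm_ov[OF ij cot_setD[OF that(1)]] that(2)] .
  show ?thesis
  proof (cases x)
    case x: (Pos a)
    show ?thesis
    proof (cases y)
      case y: (Pos b)
      have eq: "lift (jacobian A i j a b) z = jacobian (T m) i j x y z" if z: "z \<in> ?O" for z
      proof -
        have "jacobian (T m) i j x y z = pullback (T m) i j (lift (pder (par A j) b (change A j i a))) z"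
          unfolding x y
        proof (rule pb[unfolded x y, OF z])
          fix v assume "v \<in> ?O'"
          then show "pder (cot_par (par A j)) (Pos b) (change (T m) j i (Pos a)) v = lift (pder (par A j) b (change A j i a)) v"
            unfolding change_T_Pos
            by (rule pder_lift_Pos[OF U' superfun_differentiable[OF change_superfun[OF ij(2,1)]] cot_setD])
        qed
        then show ?thesis by (simp add: pl[OF z sf'] jacobian_def[of A i j])
      qed
      have "has_weight (cot_par (par A i)) (wt (T m) i) ?O (wt A i a - wt A j b) (lift (jacobian A i j a b))"
        by (rule lift_weight[OF U jacobian_weight[OF ij]])
      from has_weight_cong[OF W eq this] show ?thesis by (simp add: x y)
    next
      case y: (Mom b)
      have "0 = jacobian (T m) i j x y z" if z: "z \<in> ?O" for z
      proof -
        have "jacobian (T m) i j x y z = pullback (T m) i j (\<lambda>z. 0) z"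
          by (rule pb[OF z]) (simp add: x y change_T_Pos)
        then show ?thesis by (simp add: TT.pullback_eq)
      qed
      from has_weight_cong[OF W this has_weight_zero] show ?thesis .
    qed
  next
    case x: (Mom a)
    show ?thesis
    proof (cases y)
      case y: (Mom b)
      let ?e = "par A j b \<noteq> par A i a"
      have eq: "ksign (par A j b) ?e *\<^sub>R lift (pder (par A i) a (change A i j b)) z = jacobian (T m) i j x y z"
        if z: "z \<in> ?O" for z
      proof -
        have "jacobian (T m) i j x y z = pullback (T m) i j (\<lambda>z. ksign (par A j b) ?e *\<^sub>R lift (jacobian A j i b a) z) z"
        proof (rule pb[OF z])
          fix v assume v: "v \<in> ?O'"
          have "gpar ?e (lift (jacobian A j i b a) v)"
            unfolding lift_eq by (rule gpar_glift[OF jacobian_gpar[OF ij(2,1) cot_setD[OF v]]])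
          then show "pder (cot_par (par A j)) y (change (T m) j i x) v = ksign (par A j b) ?e *\<^sub>R lift (jacobian A j i b a) v"
            unfolding x y change_T_Mom pder_lift_p(1)[OF U' cot_setD[OF v] js' v] by (rule gtwist_gpar)
        qed
        also have "\<dots> = ksign (par A j b) ?e *\<^sub>R pullback (T m) i j (lift (jacobian A j i b a)) z"
          using superfun_lift[OF U' js'] b[OF z] W' by (intro TT.pullback_scaleR[of j ?O']) auto
        also have "pullback (T m) i j (lift (jacobian A j i b a)) z = lift (pullback A i j (jacobian A j i b a)) z"
          by (rule pl[OF z js'])
        finally have 1: "jacobian (T m) i j x y z = ksign (par A j b) ?e *\<^sub>R lift (pullback A i j (jacobian A j i b a)) z" .
        have "pullback A i j (jacobian A j i b a) (base_point z) = pder (par A i) a (change A i j b) (base_point z)"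
          unfolding jacobian_def
          by (rule pullback_inverse[OF ij cot_setD[OF z] U cot_setD[OF z] superfun_pder[OF U change_superfun[OF ij]]])
        then show ?thesis unfolding 1 by (simp only: lift_eq)
      qed
      have "has_weight (cot_par (par A i)) (wt (T m) i) ?O (wt A j b - wt A i a)
          (\<lambda>z. ksign (par A j b) ?e *\<^sub>R lift (pder (par A i) a (change A i j b)) z)"
        by (rule has_weight_scaleR[OF W lift_weight[OF U has_weight_pder[OF U change_weight[OF ij]]]])
      from has_weight_cong[OF W eq this] show ?thesis by (simp add: x y)
    next
      \<comment> \<open>A pulled back derivative of a Jacobian is not visibly polynomial.
        \<open>pullback_pder_pullback\<close> expresses it through Jacobians and derivatives in
        chart \<open>i\<close>, all of known weight.\<close>
      case y: (Pos b)
      let ?F = "\<lambda>c. pder (par A j) b (jacobian A j i c a)"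
      let ?G = "\<lambda>c u. \<Sum>d\<in>UNIV. jacobian A i j d b u \<cdot> pder (par A i) d (pder (par A i) a (change A i j c)) u"
      have eq: "(\<Sum>c\<in>UNIV. lift (?G c) z \<cdot> change (T m) i j (Mom c) z) = jacobian (T m) i j x y z" if z: "z \<in> ?O" for z
      proof -
        have "jacobian (T m) i j x y z = pullback (T m) i j (\<lambda>z. \<Sum>c\<in>UNIV. lift (?F c) z \<cdot> p j c z) z"
        proof (rule pb[OF z])
          fix v assume v: "v \<in> ?O'"
          show "pder (cot_par (par A j)) y (change (T m) j i x) v = (\<Sum>c\<in>UNIV. lift (?F c) v \<cdot> p j c v)"
            unfolding x y change_T_Mom by (rule pder_lift_p(2)[OF U' cot_setD[OF v] js' v])
        qed
        also have "\<dots> = (\<Sum>c\<in>UNIV. lift (pullback A i j (?F c)) z \<cdot> change (T m) i j (Mom c) z)"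
          by (rule pullback_T_lift_p[OF ij z U' bm_ov[OF ij cot_setD[OF z]] superfun_pder[OF U' js']
              has_parity_pder[OF U' superfun_differentiable[OF js'] jacobian_parity[OF ij(2,1)]]])
        finally have 1: "jacobian (T m) i j x y z = (\<Sum>c\<in>UNIV. lift (pullback A i j (?F c)) z \<cdot> change (T m) i j (Mom c) z)" .
        have "pullback A i j (?F c) (base_point z) = ?G c (base_point z)" for c
          unfolding jacobian_def[of A j i]
          by (rule pullback_pder_pullback[OF ij cot_setD[OF z] U cot_setD[OF z] superfun_pder[OF U change_superfun[OF ij]]])
        then show ?thesis unfolding 1 by (simp only: lift_eq)
      qed
      have "has_weight (cot_par (par A i)) (wt (T m) i) ?O (m - wt A i a - wt A j b)
          (\<lambda>z. \<Sum>c\<in>UNIV. lift (?G c) z \<cdot> change (T m) i j (Mom c) z)"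
      proof (rule has_weight_sum[OF W])
        fix c
        have "has_weight (par A i) (wt A i) (overlap A i j) (wt A j c - wt A i a - wt A j b) (?G c)"
        proof (rule has_weight_sum[OF U])
          fix d
          show "has_weight (par A i) (wt A i) (overlap A i j) (wt A j c - wt A i a - wt A j b)
            (\<lambda>u. jacobian A i j d b u \<cdot> pder (par A i) d (pder (par A i) a (change A i j c)) u)"
            using has_weight_gmul[OF U jacobian_weight[OF ij, of d b]
                has_weight_pder[OF U has_weight_pder[OF U change_weight[OF ij, of c], of a], of d]]
            by (simp add: algebra_simps)
        qed
        from has_weight_gmul[OF W lift_weight[OF U this, of m] change_T_weight[OF ij, of m "Mom c"]]
        show "has_weight (cot_par (par A i)) (wt (T m) i) ?O (m - wt A i a - wt A j b)
            (\<lambda>z. lift (?G c) z \<cdot> change (T m) i j (Mom c) z)"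
          by (simp add: algebra_simps)
      qed
      from has_weight_cong[OF W eq this] show ?thesis by (simp add: x y algebra_simps)
    qed
  qed
qed

lemma graded_manifold_T: "graded_manifold (T m)"
  unfolding graded_manifold_def
  using supermanifold_T change_T_weight jacobian_T_weight by simp

section \<open>Invariance of odd Hamiltonian vector fields\<close>

text \<open>The derivatives of \<open>H'\<close> come from the chain rule with the blocks
  \<open>J\<close>, \<open>K\<close>, \<open>R\<close> of the change of cotangent coordinates. On
  positions the claim reduces to \<open>J\<close> and \<open>K\<close> being inverse. On momenta two
  further sums with \<open>R\<close> appear, which cancel because the contraction \<open>Z\<close>
  of \<open>J\<close> with \<open>R\<close> is supersymmetric.\<close>

lemma ham_comp_change:
  assumes ij: "i \<in> charts A" "j \<in> charts A" and z: "z \<in> cot_set (par A i) (overlap A i j)"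
    and H: "superfun (cot_par (par A j)) (cot_set (par A j) (overlap A j i)) H"
      "has_parity (cot_set (par A j) (overlap A j i)) True H"
    and H': "\<And>z. z \<in> cot_set (par A i) (overlap A i j) \<Longrightarrow> H' z = pullback (T m) i j H z"
  shows "poisson_hom (par A i) True H' (change (T m) i j x) z = pullback (T m) i j (ham_comp (par A j) H x) z"
proof -
  interpret TT: supermanifold_atlas "T m" by (rule atlas_T)
  let ?O = "cot_set (par A i) (overlap A i j)" and ?O' = "cot_set (par A j) (overlap A j i)"
  let ?P = "cot_par (par A i)" and ?Q = "cot_par (par A j)"
  let ?u = "base_point z" and ?Y = "change (T m) i j"
  note U = ov_open[OF ij] and U' = ov_open[OF ij(2,1)]
  note W = obody_cot_set[OF U] and W' = obody_cot_set[OF U']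
  note u = cot_setD[OF z]
  have b: "TT.bm i j z \<in> ?O'" using bodymap_T[OF ij z bm_ov[OF ij u]] .
  define \<Phi> where "\<Phi> y = pullback (T m) i j (pder ?Q y H) z" for y
  define J where "J a b = lift (jacobian A i j a b) z" for a b
  define K where "K a c = lift (pder (par A i) a (change A i j c)) z" for a c
  define R where "R a b = (\<Sum>d\<in>UNIV. lift (pder (par A i) a (jacobian A i j d b)) z \<cdot> p i d z)" for a b
  note js = jacobian_superfun[OF ij]
  have gJ: "gpar (par A i a \<noteq> par A j b) (J a b)" for a b
    unfolding J_def lift_eq by (rule gpar_glift[OF jacobian_gpar[OF ij u]])
  have gK: "gpar (par A j c \<noteq> par A i a) (K a c)" for a c
    unfolding K_def lift_eq
    by (rule gpar_glift[OF gpar_pder[OF U u superfun_differentiable[OF change_superfun[OF ij]] change_parity[OF ij]]])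
  have YM: "pder ?P (Mom a) (?Y (Mom b)) z = ksign (par A i a) (par A i a \<noteq> par A j b) *\<^sub>R J a b"
    "pder ?P (Pos a) (?Y (Mom b)) z = R a b" for a b
    unfolding change_T_Mom pder_lift_p[OF U u js z] R_def
    using gtwist_gpar[OF gJ, of "par A i a" a b] by (simp_all add: J_def)
  have YP: "pder ?P (Mom a) (?Y (Pos c)) z = 0" "pder ?P (Pos a) (?Y (Pos c)) z = K a c" for a c
    unfolding change_T_Pos K_def
    using pder_lift_Pos[OF U superfun_differentiable[OF change_superfun[OF ij]] u] by simp_all
  have gR: "gpar (par A j b \<noteq> par A i a) (R a b)" for a b
  proof -
    have "has_parity ?O (par A j b) (?Y (Mom b))"
      using change_T_gpar[OF ij cot_setD, where m = m and x = "Mom b"] by (auto simp: has_parity_iff)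
    from gpar_pder[OF W z superfun_differentiable[OF change_T_superfun[OF ij]] this, of "Pos a"]
    show ?thesis by (simp add: YM)
  qed
  have g\<Phi>: "gpar (\<not> ?Q y) (\<Phi> y)" for y
    unfolding \<Phi>_def
    using TT.pullback_gpar[of i j z ?O' "pder ?Q y H" "\<not> ?Q y"] ij z b W' superfun_pder[OF W' H(1)]
      has_parity_pder[OF W' superfun_differentiable[OF H(1)] H(2), of y] by simp
  have dH: "pder ?P y H' z = (\<Sum>x\<in>UNIV. pder ?P y (?Y x) z \<cdot> \<Phi> x)" for y
  proof -
    have "pder ?P y H' z = pder ?P y (pullback (T m) i j H) z"
      by (rule pder_cong[OF W H' z])
    also have "\<dots> = (\<Sum>x\<in>UNIV. pder ?P y (?Y x) z \<cdot> \<Phi> x)"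
      unfolding \<Phi>_def using TT.pder_pullback[of i j z ?O' H y] ij z W' b H(1) by simp
    finally show ?thesis .
  qed
  have dHM: "pder ?P (Mom a) H' z = (\<Sum>b\<in>UNIV. ksign (par A i a) (par A i a \<noteq> par A j b) *\<^sub>R (J a b \<cdot> \<Phi> (Mom b)))" for a
    unfolding dH sum_cot YM YP by (simp add: gmul_linear)
  have dHP: "pder ?P (Pos a) H' z = (\<Sum>b\<in>UNIV. K a b \<cdot> \<Phi> (Pos b)) + (\<Sum>b\<in>UNIV. R a b \<cdot> \<Phi> (Mom b))" for a
    unfolding dH sum_cot YM YP ..
  have JK: "(\<Sum>a\<in>UNIV. J a b \<cdot> K a c) = (if b = c then gone else 0)" for b c
  proof -
    have "(\<Sum>a\<in>UNIV. J a b \<cdot> K a c) = glift (\<Sum>a\<in>UNIV. jacobian A i j a b ?u \<cdot> pder (par A i) a (change A i j c) ?u)"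
      by (simp add: J_def K_def lift_eq glift_simps glift_gmul)
    then show ?thesis by (simp add: jacobian_change[OF ij u] glift_simps)
  qed
  have JK': "(\<Sum>a\<in>UNIV. J a b \<cdot> (K a c \<cdot> X)) = (if b = c then X else 0)" for b c X
    unfolding gmul_assoc[symmetric] gmul.sum_left[symmetric] JK by simp
  \<comment> \<open>\<open>Z b c\<close> turns out to be the momentum-linear function with the
    second derivatives of the inverse change as coefficients, so its symmetry is that of second
    derivatives.\<close>
  define Z where "Z b c = (\<Sum>a\<in>UNIV. J a b \<cdot> R a c)" for b c
  have Zeq: "Z b c = (\<Sum>d\<in>UNIV. lift (pullback A i j (pder (par A j) b (pder (par A j) c (change A j i d)))) z \<cdot> p i d z)" for b c
  proof -
    have inner: "(\<Sum>a\<in>UNIV. jacobian A i j a b ?u \<cdot> pder (par A i) a (jacobian A i j d c) ?u) =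
        pullback A i j (pder (par A j) b (pder (par A j) c (change A j i d))) ?u" for d
    proof -
      have "(\<Sum>a\<in>UNIV. jacobian A i j a b ?u \<cdot> pder (par A i) a (jacobian A i j d c) ?u) =
          pullback A i j (pder (par A j) b (pullback A j i (jacobian A i j d c))) ?u"
        by (rule pullback_pder_pullback[OF ij u U u js, symmetric])
      also have "\<dots> = pullback A i j (pder (par A j) b (pder (par A j) c (change A j i d))) ?u"
      proof (rule pullback_cong[OF U' bm_ov[OF ij u]], rule pder_cong[OF U'])
        fix v assume v: "v \<in> overlap A j i"
        show "pullback A j i (jacobian A i j d c) v = pder (par A j) c (change A j i d) v"
          unfolding jacobian_def
          by (rule pullback_inverse[OF ij(2,1) v U' v superfun_pder[OF U' change_superfun[OF ij(2,1)]]])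
      qed
      finally show ?thesis .
    qed
    have "Z b c = (\<Sum>d\<in>UNIV. glift (\<Sum>a\<in>UNIV. jacobian A i j a b ?u \<cdot> pder (par A i) a (jacobian A i j d c) ?u) \<cdot> p i d z)"
      unfolding Z_def J_def R_def lift_eq gmul.sum_right
      by (subst sum.swap) (simp add: glift_simps glift_gmul gmul.sum_left gmul_assoc)
    then show ?thesis by (simp only: inner lift_eq)
  qed
  have Zsym: "Z b c = ksign (par A j b) (par A j c) *\<^sub>R Z c b" for b c
  proof -
    have "pullback A i j (pder (par A j) b (pder (par A j) c (change A j i d))) ?u =
        ksign (par A j b) (par A j c) *\<^sub>R pullback A i j (pder (par A j) c (pder (par A j) b (change A j i d))) ?u" for d
      unfolding pullback_scaleR[OF U' bm_ov[OF ij u] superfun_pder[OF U' superfun_pder[OF U' change_superfun[OF ij(2,1)]]], symmetric]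
      by (rule pullback_cong[OF U' bm_ov[OF ij u] pder_commute[OF U' _ change_superfun[OF ij(2,1)]]])
    then show ?thesis unfolding Zeq by (simp add: lift_eq glift_simps gmul_linear scaleR_sum_right)
  qed
  have pbc: "pullback (T m) i j (\<lambda>z. c *\<^sub>R pder ?Q y H z) z = c *\<^sub>R \<Phi> y" for c y
    unfolding \<Phi>_def using TT.pullback_scaleR[of j ?O' i z "pder ?Q y H" c] b W' superfun_pder[OF W' H(1)] by simp
  show ?thesis
  proof (cases x)
    case (Pos c)
    have "poisson_hom (par A i) True H' (?Y x) z = (\<Sum>a\<in>UNIV. \<Sum>b\<in>UNIV.
        ksign (par A i a) (par A i a \<noteq> par A j b) *\<^sub>R (J a b \<cdot> (\<Phi> (Mom b) \<cdot> K a c)))"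
      unfolding Pos poisson_hom_def YP dHM by (simp add: gmul.sum_left gmul_linear gmul_assoc)
    also have "\<dots> = (\<Sum>a\<in>UNIV. \<Sum>b\<in>UNIV.
        (ksign (par A j b) (par A j c) * ksign (par A j c) True) *\<^sub>R (J a b \<cdot> (K a c \<cdot> \<Phi> (Mom b))))"
    proof (intro sum.cong refl)
      fix a b
      show "ksign (par A i a) (par A i a \<noteq> par A j b) *\<^sub>R (J a b \<cdot> (\<Phi> (Mom b) \<cdot> K a c)) =
          (ksign (par A j b) (par A j c) * ksign (par A j c) True) *\<^sub>R (J a b \<cdot> (K a c \<cdot> \<Phi> (Mom b)))"
        unfolding gmul_supercommute[OF g\<Phi>[of "Mom b"] gK[of c a]]
        by (cases "par A i a"; cases "par A j b"; cases "par A j c") (simp_all add: ksign_def gmul_linear)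
    qed
    also have "\<dots> = (\<Sum>b\<in>UNIV. (ksign (par A j b) (par A j c) * ksign (par A j c) True) *\<^sub>R (if b = c then \<Phi> (Mom b) else 0))"
      by (subst sum.swap) (simp only: scaleR_sum_right[symmetric] JK')
    also have "\<dots> = (\<Sum>b\<in>UNIV. if b = c then \<Phi> (Mom c) else 0)"
      by (intro sum.cong) (auto simp: ksign_def)
    also have "\<dots> = \<Phi> (Mom c)" by simp
    finally show ?thesis using Pos pbc[of 1 "Mom c"] by (simp add: ham_comp_def[abs_def])
  next
    case (Mom c)
    let ?s = "\<lambda>b. ksign (par A j b) (par A j c) * ksign (par A j c) True"
    let ?t = "\<lambda>a c. ksign (par A i a) True * ksign (par A i a) (par A i a \<noteq> par A j c)"
    have "poisson_hom (par A i) True H' (?Y x) z = (\<Sum>a\<in>UNIV.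
        (\<Sum>b\<in>UNIV. ksign (par A i a) (par A i a \<noteq> par A j b) *\<^sub>R (J a b \<cdot> (\<Phi> (Mom b) \<cdot> R a c))) -
        (\<Sum>b\<in>UNIV. ?t a c *\<^sub>R (K a b \<cdot> (\<Phi> (Pos b) \<cdot> J a c))) -
        (\<Sum>b\<in>UNIV. ?t a c *\<^sub>R (R a b \<cdot> (\<Phi> (Mom b) \<cdot> J a c))))"
      unfolding Mom poisson_hom_def YM dHM dHP
      by (simp add: gmul.sum_left gmul_linear gmul_assoc scaleR_sum_right scaleR_add_right mult.commute diff_diff_eq)
    also have "\<dots> = (\<Sum>a\<in>UNIV.
        (\<Sum>b\<in>UNIV. ?s b *\<^sub>R (J a b \<cdot> (R a c \<cdot> \<Phi> (Mom b)))) -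
        (\<Sum>b\<in>UNIV. ksign (par A j c) True *\<^sub>R (J a c \<cdot> (K a b \<cdot> \<Phi> (Pos b)))) -
        (\<Sum>b\<in>UNIV. ksign (par A j c) True *\<^sub>R (J a c \<cdot> (R a b \<cdot> \<Phi> (Mom b)))))"
    proof (intro sum.cong refl arg_cong2[of _ _ _ _ "(-)"])
      fix a b
      show "ksign (par A i a) (par A i a \<noteq> par A j b) *\<^sub>R (J a b \<cdot> (\<Phi> (Mom b) \<cdot> R a c)) =
          ?s b *\<^sub>R (J a b \<cdot> (R a c \<cdot> \<Phi> (Mom b)))"
        unfolding gmul_supercommute[OF g\<Phi>[of "Mom b"] gR[of c a]]
        by (cases "par A i a"; cases "par A j b"; cases "par A j c") (simp_all add: ksign_def gmul_linear)
      have 1: "gpar (\<not> par A i a) (K a b \<cdot> \<Phi> (Pos b))"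
        by (rule gpar_gmul'[OF gK g\<Phi>]) auto
      have 2: "gpar (\<not> par A i a) (R a b \<cdot> \<Phi> (Mom b))"
        by (rule gpar_gmul'[OF gR g\<Phi>]) auto
      show "?t a c *\<^sub>R (K a b \<cdot> (\<Phi> (Pos b) \<cdot> J a c)) = ksign (par A j c) True *\<^sub>R (J a c \<cdot> (K a b \<cdot> \<Phi> (Pos b)))"
        unfolding gmul_assoc[symmetric, of "K a b"] gmul_supercommute[OF 1 gJ[of a c]]
        by (cases "par A i a"; cases "par A j c") (simp_all add: ksign_def)
      show "?t a c *\<^sub>R (R a b \<cdot> (\<Phi> (Mom b) \<cdot> J a c)) = ksign (par A j c) True *\<^sub>R (J a c \<cdot> (R a b \<cdot> \<Phi> (Mom b)))"
        unfolding gmul_assoc[symmetric, of "R a b"] gmul_supercommute[OF 2 gJ[of a c]]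
        by (cases "par A i a"; cases "par A j c") (simp_all add: ksign_def)
    qed
    also have "\<dots> = (\<Sum>b\<in>UNIV. ?s b *\<^sub>R (Z b c \<cdot> \<Phi> (Mom b))) -
        (\<Sum>b\<in>UNIV. ksign (par A j c) True *\<^sub>R (if c = b then \<Phi> (Pos b) else 0)) -
        (\<Sum>b\<in>UNIV. ksign (par A j c) True *\<^sub>R (Z c b \<cdot> \<Phi> (Mom b)))"
    proof -
      have "(\<Sum>a\<in>UNIV. \<Sum>b\<in>UNIV. ?s b *\<^sub>R (J a b \<cdot> (R a c \<cdot> \<Phi> (Mom b)))) = (\<Sum>b\<in>UNIV. ?s b *\<^sub>R (Z b c \<cdot> \<Phi> (Mom b)))"
        unfolding Z_def gmul.sum_left gmul_assoc by (subst sum.swap) (simp only: scaleR_sum_right)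
      moreover have "(\<Sum>a\<in>UNIV. \<Sum>b\<in>UNIV. ksign (par A j c) True *\<^sub>R (J a c \<cdot> (K a b \<cdot> \<Phi> (Pos b)))) =
          (\<Sum>b\<in>UNIV. ksign (par A j c) True *\<^sub>R (if c = b then \<Phi> (Pos b) else 0))"
        by (subst sum.swap) (simp only: scaleR_sum_right[symmetric] JK')
      moreover have "(\<Sum>a\<in>UNIV. \<Sum>b\<in>UNIV. ksign (par A j c) True *\<^sub>R (J a c \<cdot> (R a b \<cdot> \<Phi> (Mom b)))) =
          (\<Sum>b\<in>UNIV. ksign (par A j c) True *\<^sub>R (Z c b \<cdot> \<Phi> (Mom b)))"
        unfolding Z_def gmul.sum_left gmul_assoc by (subst sum.swap) (simp only: scaleR_sum_right)
      ultimately show ?thesis by (simp only: sum_subtractf)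
    qed
    \<comment> \<open>By symmetry of \<open>Z\<close> the two sums with \<open>R\<close> are equal,
      and they enter with opposite signs.\<close>
    also have "(\<Sum>b\<in>UNIV. ?s b *\<^sub>R (Z b c \<cdot> \<Phi> (Mom b))) = (\<Sum>b\<in>UNIV. ksign (par A j c) True *\<^sub>R (Z c b \<cdot> \<Phi> (Mom b)))"
    proof (intro sum.cong refl)
      fix b
      show "?s b *\<^sub>R (Z b c \<cdot> \<Phi> (Mom b)) = ksign (par A j c) True *\<^sub>R (Z c b \<cdot> \<Phi> (Mom b))"
        by (subst Zsym) (simp add: gmul_linear ksign_def)
    qed
    finally have "poisson_hom (par A i) True H' (?Y x) z =
        - (\<Sum>b\<in>UNIV. ksign (par A j c) True *\<^sub>R (if c = b then \<Phi> (Pos b) else 0))" by simp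
    also have "\<dots> = (- ksign (par A j c) True) *\<^sub>R \<Phi> (Pos c)"
      by (simp add: if_distrib[of "\<lambda>x. _ *\<^sub>R x"] cong: if_cong)
    finally show ?thesis unfolding Mom ham_comp_def[abs_def] cot.case pbc .
  qed
qed

end

section \<open>QS-manifolds\<close>

locale QS_atlas =
  fixes A :: "('i, 'c::{finite,linorder}) atlas" and X :: "('i, 'c) oper" and S :: "'i \<Rightarrow> 'c cot sfun"
    and q s :: int
  assumes QS: "graded_QS_manifold A X S"
    and X_weight: "vf_has_weight A X q"
    and S_weight: "schouten_has_weight A S s"

sublocale QS_atlas \<subseteq> graded_atlas A
  using QS by unfold_locales (simp add: graded_QS_manifold_def graded_Q_manifold_def)

context QS_atlas
begin

abbreviation C :: "'i \<Rightarrow> 'c \<Rightarrow> 'c sfun" where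
  "C i a \<equiv> component A X i a"

abbreviation Q :: "'i \<Rightarrow> 'c cot sfun" where
  "Q i \<equiv> linear_hamiltonian A X i"

abbreviation D :: "'i \<Rightarrow> 'c cot point set" where
  "D i \<equiv> cot_set (par A i) (domain A i)"

abbreviation dd :: "'i \<Rightarrow> 'c cot \<Rightarrow> 'c cot sfun \<Rightarrow> 'c cot sfun" where
  "dd i \<equiv> pder (cot_par (par A i))"

lemma C_eq: "X i (crd (par A i) a) = C i a"
  by (simp add: component_def)

lemma vector_field_X: "vector_field A X"
  using QS by (simp add: graded_QS_manifold_def graded_Q_manifold_def homological_def odd_vector_field_def)

lemma C_weight: "i \<in> charts A \<Longrightarrow> has_weight (par A i) (wt A i) (domain A i) (q + wt A i a) (C i a)"
  using X_weight by (simp add: vf_has_weight_def)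

lemma C_superfun: "i \<in> charts A \<Longrightarrow> superfun (par A i) (domain A i) (C i a)"
  by (rule has_weight_superfun[OF C_weight])

lemma C_parity: "i \<in> charts A \<Longrightarrow> has_parity (domain A i) (\<not> par A i a) (C i a)"
  using QS by (simp add: graded_QS_manifold_def graded_Q_manifold_def homological_def odd_vector_field_def)

lemma X_local: "local_fun A i W f \<Longrightarrow> u \<in> W \<Longrightarrow> X i f u = (\<Sum>a\<in>UNIV. C i a u \<cdot> pder (par A i) a f u)"
  using vector_field_X unfolding vector_field_def by blast

lemma X_change:
  assumes "i \<in> charts A" "j \<in> charts A" "u \<in> overlap A i j"
  shows "X i (change A i j b) u = pullback A i j (C j b) u"
proof -
  have "\<forall>i\<in>charts A. \<forall>j\<in>charts A. \<forall>b. \<forall>u\<in>overlap A i j. X i (change A i j b) u = pullback A i j (C j b) u"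
    using vector_field_X unfolding vector_field_def by (elim conjE)
  then show ?thesis using assms by blast
qed

lemma X_square: "local_fun A i W f \<Longrightarrow> u \<in> W \<Longrightarrow> X i (X i f) u = 0"
  using QS unfolding graded_QS_manifold_def graded_Q_manifold_def homological_def by blast

lemma local_fun_domain:
  "i \<in> charts A \<Longrightarrow> has_weight (par A i) (wt A i) (domain A i) r f \<Longrightarrow> local_fun A i (domain A i) f"
  by (simp add: local_fun_def has_weight_graded_fun)

lemma crd_local: "i \<in> charts A \<Longrightarrow> local_fun A i (domain A i) (crd (par A i) a)"
  by (rule local_fun_domain[OF _ has_weight_crd[OF dom_open]])

lemma D_open: "i \<in> charts A \<Longrightarrow> obody (cot_par (par A i)) (D i)"
  by (intro obody_cot_set dom_open)

lemma Q_eq: "Q i = (\<lambda>z. \<Sum>a\<in>UNIV. lift (C i a) z \<cdot> p i a z)"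
  by (simp add: linear_hamiltonian_def[abs_def])

lemma Q_homog:
  assumes "i \<in> charts A"
  shows "homog (par A i) (D i) 1 (Q i)"
  unfolding Q_eq
  using homog_gmul[OF D_open[OF assms] homog_lift[OF dom_open[OF assms] C_superfun[OF assms]] homog_p]
  by (intro homog_sum[OF D_open[OF assms]]) simp

lemma Q_superfun: "i \<in> charts A \<Longrightarrow> superfun (cot_par (par A i)) (D i) (Q i)"
  by (rule homog_superfun[OF Q_homog])

lemma Q_parity:
  assumes i: "i \<in> charts A"
  shows "has_parity (D i) True (Q i)"
  unfolding has_parity_iff Q_eq
proof (intro ballI gpar_sum)
  fix z a assume "z \<in> D i"
  then have "gpar (\<not> par A i a) (lift (C i a) z)"
    using C_parity[OF i, of a] cot_setD by (auto simp: lift_eq has_parity_iff intro!: gpar_glift)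
  then show "gpar True (lift (C i a) z \<cdot> p i a z)" by (rule gpar_gmul'[OF _ gpar_p]) simp
qed

text \<open>Invariance of the base field expresses its components in chart \<open>j\<close> through
  derivatives of the change of coordinates. These meet the Jacobians of the transformed momenta and
  contract to the identity by \<open>change_jacobian\<close>.\<close>

lemma Q_global:
  assumes ij: "i \<in> charts A" "j \<in> charts A" and z: "z \<in> cot_set (par A i) (overlap A i j)"
  shows "Q i z = pullback (T m) i j (Q j) z"
proof -
  let ?u = "base_point z"
  note u = cot_setD[OF z]
  have C: "pullback A i j (C j c) ?u = (\<Sum>a\<in>UNIV. C i a ?u \<cdot> pder (par A i) a (change A i j c) ?u)" for c
  proof -
    have "local_fun A i (overlap A i j) (change A i j c)"
      unfolding local_fun_def using ij ov_openin[OF ij] has_weight_graded_fun[OF change_weight[OF ij]] by simp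
    from X_local[OF this u] X_change[OF ij u] show ?thesis by simp
  qed
  have "pullback (T m) i j (Q j) z = (\<Sum>c\<in>UNIV. lift (pullback A i j (C j c)) z \<cdot> change (T m) i j (Mom c) z)"
    unfolding Q_eq
  proof (rule pullback_T_lift_p[OF ij z ov_open[OF ij(2,1)] bm_ov[OF ij u]])
    show "superfun (par A j) (overlap A j i) (C j c)" for c
      using C_superfun[OF ij(2)] ov_dom[OF ij(2,1)] by (rule superfun_subset)
    show "has_parity (overlap A j i) (\<not> par A j c) (C j c)" for c
      using C_parity[OF ij(2), of c] ov_dom[OF ij(2,1)] by (auto simp: has_parity_iff)
  qed
  also have "\<dots> = (\<Sum>c\<in>UNIV. \<Sum>d\<in>UNIV. \<Sum>a\<in>UNIV.
      glift (C i a ?u \<cdot> (pder (par A i) a (change A i j c) ?u \<cdot> jacobian A i j d c ?u)) \<cdot> p i d z)"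
    by (simp add: lift_eq C change_T_Mom gmul.sum_left gmul.sum_right glift_simps glift_gmul gmul_assoc)
  also have "\<dots> = (\<Sum>d\<in>UNIV. \<Sum>a\<in>UNIV. \<Sum>c\<in>UNIV.
      glift (C i a ?u \<cdot> (pder (par A i) a (change A i j c) ?u \<cdot> jacobian A i j d c ?u)) \<cdot> p i d z)"
    by (subst sum.swap, rule sum.cong[OF refl], rule sum.swap)
  also have "\<dots> = (\<Sum>d\<in>UNIV. \<Sum>a\<in>UNIV.
      glift (C i a ?u \<cdot> (\<Sum>c\<in>UNIV. pder (par A i) a (change A i j c) ?u \<cdot> jacobian A i j d c ?u)) \<cdot> p i d z)"
    by (simp add: gmul.sum_left gmul.sum_right glift_simps)
  also have "\<dots> = (\<Sum>d\<in>UNIV. \<Sum>a\<in>UNIV. if a = d then lift (C i d) z \<cdot> p i d z else 0)"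
    unfolding change_jacobian[OF ij u] by (intro sum.cong refl) (auto simp: lift_eq glift_simps)
  also have "\<dots> = Q i z" by (simp add: Q_eq)
  finally show ?thesis ..
qed

section \<open>The quadratic Hamiltonian and its coefficients\<close>

lemma schouten: "schouten_function A S"
  using QS by (simp add: graded_QS_manifold_def)

lemma S_parity: "i \<in> charts A \<Longrightarrow> has_parity (D i) True (S i)"
  and S_S: "i \<in> charts A \<Longrightarrow> z \<in> D i \<Longrightarrow> poisson (par A i) (S i) (S i) z = 0"
  using schouten by (simp_all add: schouten_function_def cotangent_def)

lemma S_quadratic:
  assumes "i \<in> charts A"
  obtains t where "\<And>a b. superfun (par A i) (domain A i) (t a b)"
    "\<And>z. z \<in> D i \<Longrightarrow> S i z = (1/2) *\<^sub>R (\<Sum>a\<in>UNIV. \<Sum>b\<in>UNIV. lift (t a b) z \<cdot> (p i b z \<cdot> p i a z))"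
proof -
  have "fibrewise_quadratic A S" using schouten by (simp add: schouten_function_def)
  then obtain t where t: "\<forall>a b. graded_fun (par A i) (wt A i) (domain A i) (t a b)"
    "\<forall>z\<in>domain (cotangent A) i. S i z = (1/2) *\<^sub>R (\<Sum>a\<in>UNIV. \<Sum>b\<in>UNIV. lift (t a b) z \<cdot> (p i b z \<cdot> p i a z))"
    using assms unfolding fibrewise_quadratic_def by blast
  have "domain (cotangent A) i = D i" by (simp add: cotangent_def)
  with t(2) have "\<And>z. z \<in> D i \<Longrightarrow> S i z = (1/2) *\<^sub>R (\<Sum>a\<in>UNIV. \<Sum>b\<in>UNIV. lift (t a b) z \<cdot> (p i b z \<cdot> p i a z))"
    by blast
  with t(1)[rule_format, THEN graded_fun_superfun] show thesis by (rule that)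
qed

lemma S_homog: "i \<in> charts A \<Longrightarrow> homog (par A i) (D i) 2 (S i)"
  by (rule S_quadratic, assumption) (rule pder_pder_quadratic(1)[OF dom_open])

lemma S_superfun: "i \<in> charts A \<Longrightarrow> superfun (cot_par (par A i)) (D i) (S i)"
  by (rule homog_superfun[OF S_homog])

text \<open>Coefficients of \<open>S\<close>, taken as second momentum derivatives rather than from
  \<open>fibrewise_quadratic\<close>: the functions there are only known to be graded, whereas these
  inherit parity, symmetry and weight from \<open>S\<close>.\<close>

definition \<sigma> :: "'i \<Rightarrow> 'c \<Rightarrow> 'c \<Rightarrow> 'c sfun" where
  "\<sigma> i a b = restrict0 (dd i (Mom a) (dd i (Mom b) (S i)))"

lemma lift_\<sigma>:
  assumes "i \<in> charts A" "z \<in> D i"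
  shows "dd i (Mom a) (dd i (Mom b) (S i)) z = lift (\<sigma> i a b) z"
proof -
  obtain t where t: "\<And>a b. superfun (par A i) (domain A i) (t a b)"
    "\<And>z. z \<in> D i \<Longrightarrow> S i z = (1/2) *\<^sub>R (\<Sum>a\<in>UNIV. \<Sum>b\<in>UNIV. lift (t a b) z \<cdot> (p i b z \<cdot> p i a z))"
    using S_quadratic[OF assms(1)] by blast
  show ?thesis unfolding \<sigma>_def by (rule pder_pder_quadratic(2)[OF dom_open[OF assms(1)] t assms(2)])
qed

lemma \<sigma>_weight:
  assumes i: "i \<in> charts A"
  shows "has_weight (par A i) (wt A i) (domain A i) (s + wt A i a + wt A i b) (\<sigma> i a b)"
proof -
  have "has_weight (cot_par (par A i)) (induced_wt (wt A i)) (D i) s (S i)"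
    using S_weight i by (simp add: schouten_has_weight_def cotangent_def)
  from has_weight_pder[OF D_open[OF i] has_weight_pder[OF D_open[OF i] this, of "Mom b"], of "Mom a"]
  have "has_weight (cot_par (par A i)) (induced_wt (wt A i)) (D i) (s + wt A i a + wt A i b) (dd i (Mom a) (dd i (Mom b) (S i)))"
    by (simp add: algebra_simps)
  then show ?thesis unfolding \<sigma>_def by (rule has_weight_restrict0[OF dom_open[OF i]]) simp
qed

lemma \<sigma>_superfun: "i \<in> charts A \<Longrightarrow> superfun (par A i) (domain A i) (\<sigma> i a b)"
  by (rule has_weight_superfun[OF \<sigma>_weight])

lemma dd_S_gpar:
  assumes i: "i \<in> charts A" and z: "z \<in> D i"
  shows "gpar (\<not> cot_par (par A i) x) (dd i x (S i) z)"
  using gpar_pder[OF D_open[OF i] z superfun_differentiable[OF S_superfun[OF i]] S_parity[OF i], of x] by simp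

lemma \<sigma>_gpar:
  assumes i: "i \<in> charts A" and u: "u \<in> domain A i"
  shows "gpar ((\<not> par A i b) \<noteq> par A i a) (\<sigma> i a b u)"
proof -
  note W = D_open[OF i] and z = zero_section_cot_set[OF dom_open[OF i] u]
  have "has_parity (D i) (\<not> par A i b) (dd i (Mom b) (S i))"
    unfolding has_parity_iff using dd_S_gpar[OF i, of _ "Mom b"] by simp
  from gpar_pder[OF W z superfun_differentiable[OF superfun_pder[OF W S_superfun[OF i]]] this, of "Mom a"]
  show ?thesis unfolding \<sigma>_def restrict0_eq by (intro gpar_grestrict) simp
qed

lemma \<sigma>_swap:
  assumes i: "i \<in> charts A" and u: "u \<in> domain A i"
  shows "\<sigma> i a b u = ksign (par A i a) (par A i b) *\<^sub>R \<sigma> i b a u"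
  using pder_commute[OF D_open[OF i] zero_section_cot_set[OF dom_open[OF i] u] S_superfun[OF i], of "Mom a" "Mom b"]
  by (simp add: \<sigma>_def restrict0_eq linear_scale[OF linear_grestrict])

text \<open>A lifted \<open>f\<close> has no momentum derivatives, so the outer bracket uses only
  momentum derivatives of the inner one. The inner bracket is linear in the momenta, and these
  derivatives produce \<open>\<sigma>\<close>.\<close>

lemma schouten_bracket_eq:
  assumes i: "i \<in> charts A" and u: "u \<in> domain A i"
    and f: "superfun (par A i) (domain A i) f" "has_parity (domain A i) e f"
    and g: "superfun (par A i) (domain A i) g"
  shows "schouten_bracket A S i f g u = - (\<Sum>c\<in>UNIV. \<Sum>d\<in>UNIV.
    ksign (par A i c) e *\<^sub>R (pder (par A i) c f u \<cdot> (\<sigma> i c d u \<cdot> pder (par A i) d g u)))"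
proof -
  let ?pr = "par A i" and ?z = "zero_section u"
  let ?G = "\<lambda>z. \<Sum>d\<in>UNIV. dd i (Mom d) (S i) z \<cdot> lift (pder ?pr d g) z"
  note U = dom_open[OF i] and W = D_open[OF i]
  note z = zero_section_cot_set[OF U u]
  note dS = superfun_pder[OF W S_superfun[OF i]] and dg = superfun_lift[OF U superfun_pder[OF U g]]
  have G: "poisson ?pr (S i) (lift g) z = ?G z" if z: "z \<in> D i" for z
    unfolding poisson_eq[OF W z S_parity[OF i]] poisson_hom_def
    by (simp add: pder_lift_Pos[OF U superfun_differentiable[OF g] cot_setD[OF z]])
  have dG: "dd i (Mom c) ?G ?z = (\<Sum>d\<in>UNIV. lift (\<sigma> i c d) ?z \<cdot> lift (pder ?pr d g) ?z)" for c
    unfolding pder_sum[OF W z superfun_differentiable[OF superfun_gmul[OF W dS dg]]]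
      pder_gmul[OF W z superfun_differentiable[OF dS] superfun_differentiable[OF dg]] lift_\<sigma>[OF i z] by simp
  have "poisson ?pr (lift f) (poisson ?pr (S i) (lift g)) ?z = poisson_hom ?pr e (lift f) ?G ?z"
    unfolding poisson_eq[OF W z has_parity_lift[OF f(2)]] by (rule poisson_hom_cong[OF W z G])
  also have "\<dots> = - (\<Sum>c\<in>UNIV. ksign (?pr c) e *\<^sub>R (lift (pder ?pr c f) ?z \<cdot> (\<Sum>d\<in>UNIV. lift (\<sigma> i c d) ?z \<cdot> lift (pder ?pr d g) ?z)))"
    unfolding poisson_hom_def dG
    by (simp add: pder_lift_Pos[OF U superfun_differentiable[OF f(1)] cot_setD[OF z]] sum_negf)
  also have "\<dots> = glift (- (\<Sum>c\<in>UNIV. \<Sum>d\<in>UNIV.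
    ksign (?pr c) e *\<^sub>R (pder ?pr c f u \<cdot> (\<sigma> i c d u \<cdot> pder ?pr d g u))))"
    by (simp add: lift_eq glift_simps linear_neg[OF linear_glift] glift_gmul gmul.sum_right scaleR_sum_right)
  finally show ?thesis by (simp add: schouten_bracket_def restrict0_eq)
qed

text \<open>The derivation property evaluated on the coordinate functions \<open>a\<close> and
  \<open>b\<close>: the field takes them to its components, and their bracket is
  \<open>\<sigma> i a b\<close> up to sign.\<close>

lemma derivation_identity:
  assumes i: "i \<in> charts A" and u: "u \<in> domain A i"
  shows "(\<Sum>c\<in>UNIV. ksign (par A i a) True *\<^sub>R (C i c u \<cdot> pder (par A i) c (\<sigma> i a b) u)
    - ksign (par A i c) (\<not> par A i a) *\<^sub>R (pder (par A i) c (C i a) u \<cdot> \<sigma> i c b u)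
    + \<sigma> i a c u \<cdot> pder (par A i) c (C i b) u) = 0"
proof -
  let ?pr = "par A i" and ?x = "\<lambda>a. crd (par A i) a"
  note U = dom_open[OF i]
  note loc = crd_local[OF i]
  have br: "schouten_bracket A S i (?x a) (?x b) v = (- ksign (?pr a) True) *\<^sub>R \<sigma> i a b v" if v: "v \<in> domain A i" for v
  proof -
    have "(\<Sum>d\<in>UNIV. ksign (?pr c) (?pr a) *\<^sub>R ((if c = a then gone else 0) \<cdot> (\<sigma> i c d v \<cdot> (if d = b then gone else 0)))) =
        (if c = a then ksign (?pr a) True *\<^sub>R \<sigma> i a b v else 0)" for c
    proof -
      have "ksign (?pr c) (?pr a) *\<^sub>R ((if c = a then gone else 0) \<cdot> (\<sigma> i c d v \<cdot> (if d = b then gone else 0))) =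
          (if d = b then if c = a then ksign (?pr a) True *\<^sub>R \<sigma> i a b v else 0 else 0)" for d
        by (simp add: ksign_def)
      then show ?thesis by simp
    qed
    then show ?thesis
      unfolding schouten_bracket_eq[OF i v superfun_crd has_parity_crd superfun_crd] pder_crd by simp
  qed
  have brX: "schouten_bracket A S i (C i a) (?x b) u = - (\<Sum>c\<in>UNIV. ksign (?pr c) (\<not> ?pr a) *\<^sub>R (pder ?pr c (C i a) u \<cdot> \<sigma> i c b u))"
  proof -
    have "ksign (?pr c) (\<not> ?pr a) *\<^sub>R (pder ?pr c (C i a) u \<cdot> (\<sigma> i c d u \<cdot> (if d = b then gone else 0))) =
        (if d = b then ksign (?pr c) (\<not> ?pr a) *\<^sub>R (pder ?pr c (C i a) u \<cdot> \<sigma> i c b u) else 0)" for c d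
      by simp
    then show ?thesis
      unfolding schouten_bracket_eq[OF i u C_superfun[OF i] C_parity[OF i] superfun_crd] pder_crd by simp
  qed
  have Xbr: "schouten_bracket A S i (?x a) (C i b) u = - (\<Sum>d\<in>UNIV. ksign (?pr a) True *\<^sub>R (\<sigma> i a d u \<cdot> pder ?pr d (C i b) u))"
  proof -
    have "ksign (?pr c) (?pr a) *\<^sub>R ((if c = a then gone else 0) \<cdot> (\<sigma> i c d u \<cdot> pder ?pr d (C i b) u)) =
        (if c = a then ksign (?pr a) True *\<^sub>R (\<sigma> i a d u \<cdot> pder ?pr d (C i b) u) else 0)" for c d
      by (simp add: ksign_def)
    then show ?thesis
      unfolding schouten_bracket_eq[OF i u superfun_crd has_parity_crd C_superfun[OF i]] pder_crd
      by (subst sum.swap) simp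
  qed
  have X\<sigma>: "X i (schouten_bracket A S i (?x a) (?x b)) u =
      (- ksign (?pr a) True) *\<^sub>R (\<Sum>c\<in>UNIV. C i c u \<cdot> pder ?pr c (\<sigma> i a b) u)"
  proof -
    have w: "has_weight ?pr (wt A i) (domain A i) (s + wt A i a + wt A i b) (schouten_bracket A S i (?x a) (?x b))"
      by (rule has_weight_cong[OF U br[symmetric] has_weight_scaleR[OF U \<sigma>_weight[OF i]]])
    have "pder ?pr c (schouten_bracket A S i (?x a) (?x b)) u = (- ksign (?pr a) True) *\<^sub>R pder ?pr c (\<sigma> i a b) u" for c
      unfolding pder_scaleR[OF U u superfun_differentiable[OF \<sigma>_superfun[OF i]], symmetric]
      by (rule pder_cong[OF U br u])
    then show ?thesis
      unfolding X_local[OF local_fun_domain[OF i w] u] by (simp add: gmul_linear scaleR_sum_right sum_negf)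
  qed
  have "derivation_of_bracket A X S" using QS by (simp add: graded_QS_manifold_def)
  then have "X i (schouten_bracket A S i (?x a) (?x b)) u = schouten_bracket A S i (X i (?x a)) (?x b) u
      + ksign True (\<not> ?pr a) *\<^sub>R schouten_bracket A S i (?x a) (X i (?x b)) u"
    using loc[of a] loc[of b] has_parity_crd[of "domain A i" ?pr a] u unfolding derivation_of_bracket_def by blast
  then have "(- ksign (?pr a) True) *\<^sub>R (\<Sum>c\<in>UNIV. C i c u \<cdot> pder ?pr c (\<sigma> i a b) u) =
      - (\<Sum>c\<in>UNIV. ksign (?pr c) (\<not> ?pr a) *\<^sub>R (pder ?pr c (C i a) u \<cdot> \<sigma> i c b u))
      + ksign True (\<not> ?pr a) *\<^sub>R - (\<Sum>d\<in>UNIV. ksign (?pr a) True *\<^sub>R (\<sigma> i a d u \<cdot> pder ?pr d (C i b) u))"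
    unfolding X\<sigma> C_eq brX Xbr .
  then show ?thesis
    by (cases "?pr a") (simp_all add: ksign_def sum.distrib sum_subtractf sum_negf algebra_simps)
qed

lemma dd_Q:
  assumes i: "i \<in> charts A" and z: "z \<in> D i"
  shows "dd i (Mom a) (Q i) z = lift (C i a) z"
    and "dd i (Pos a) (Q i) z = (\<Sum>c\<in>UNIV. lift (pder (par A i) a (C i c)) z \<cdot> p i c z)"
proof -
  have "gpar (\<not> par A i a) (lift (C i a) z)"
    using C_parity[OF i, of a] cot_setD[OF z] by (auto simp: lift_eq has_parity_iff intro!: gpar_glift)
  then have "gtwist (par A i a) (lift (C i a) z) = lift (C i a) z"
    by (simp add: gtwist_gpar ksign_def)
  then show "dd i (Mom a) (Q i) z = lift (C i a) z"
    unfolding Q_eq pder_lift_p(1)[OF dom_open[OF i] cot_setD[OF z] C_superfun[OF i] z] .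
  show "dd i (Pos a) (Q i) z = (\<Sum>c\<in>UNIV. lift (pder (par A i) a (C i c)) z \<cdot> p i c z)"
    unfolding Q_eq by (rule pder_lift_p(2)[OF dom_open[OF i] cot_setD[OF z] C_superfun[OF i] z])
qed

text \<open>The coefficient of the momentum \<open>c\<close> is the base field applied twice to the
  coordinate \<open>c\<close>.\<close>

lemma Q_Q:
  assumes i: "i \<in> charts A" and z: "z \<in> D i"
  shows "(\<Sum>a\<in>UNIV. dd i (Mom a) (Q i) z \<cdot> dd i (Pos a) (Q i) z) = 0"
proof -
  let ?u = "base_point z"
  note u = cot_setD[OF z]
  have "(\<Sum>a\<in>UNIV. C i a ?u \<cdot> pder (par A i) a (C i c) ?u) = 0" for c
    using X_local[OF local_fun_domain[OF i C_weight[OF i]] u, of c] X_square[OF crd_local[OF i] u, of c]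
    by (simp add: C_eq)
  then have "(\<Sum>c\<in>UNIV. glift (\<Sum>a\<in>UNIV. C i a ?u \<cdot> pder (par A i) a (C i c) ?u) \<cdot> p i c z) = 0"
    by (simp add: glift_simps)
  moreover have "(\<Sum>a\<in>UNIV. dd i (Mom a) (Q i) z \<cdot> dd i (Pos a) (Q i) z) =
      (\<Sum>c\<in>UNIV. glift (\<Sum>a\<in>UNIV. C i a ?u \<cdot> pder (par A i) a (C i c) ?u) \<cdot> p i c z)"
    unfolding dd_Q[OF i z] gmul.sum_right
    by (subst sum.swap) (simp add: lift_eq glift_simps glift_gmul gmul.sum_left gmul_assoc)
  ultimately show ?thesis by simp
qed

text \<open>The left-hand side is \<open>{Q, S}\<close>.  Up to sign, its second momentum derivatives are the left-hand sides of
  the derivation identity.\<close>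

lemma Q_S:
  assumes i: "i \<in> charts A" and z: "z \<in> D i"
  shows "(\<Sum>c\<in>UNIV. dd i (Mom c) (Q i) z \<cdot> dd i (Pos c) (S i) z + dd i (Mom c) (S i) z \<cdot> dd i (Pos c) (Q i) z) = 0"
proof -
  let ?pr = "par A i" and ?P = "cot_par (par A i)"
  note U = dom_open[OF i] and W = D_open[OF i]
  define K where "K z = (\<Sum>c\<in>UNIV. dd i (Mom c) (Q i) z \<cdot> dd i (Pos c) (S i) z + dd i (Mom c) (S i) z \<cdot> dd i (Pos c) (Q i) z)" for z
  define R where "R c z = (\<Sum>d\<in>UNIV. lift (pder ?pr c (C i d)) z \<cdot> p i d z)" for c z
  \<comment> \<open>The bracket removes one momentum from total degree three, so the sum is
    quadratic and determined by its second momentum derivatives.\<close>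
  have "homog ?pr (D i) 2 (\<lambda>z. dd i (Mom c) (Q i) z \<cdot> dd i (Pos c) (S i) z + dd i (Mom c) (S i) z \<cdot> dd i (Pos c) (Q i) z)" for c
  proof -
    have h: "homog ?pr (D i) 2 (\<lambda>z. dd i (Mom c) (Q i) z \<cdot> dd i (Pos c) (S i) z)"
      "homog ?pr (D i) 2 (\<lambda>z. dd i (Mom c) (S i) z \<cdot> dd i (Pos c) (Q i) z)"
      using homog_gmul[OF W homog_pder[OF W Q_homog[OF i], of "Mom c"] homog_pder[OF W S_homog[OF i], of "Pos c"]]
        homog_gmul[OF W homog_pder[OF W S_homog[OF i], of "Mom c"] homog_pder[OF W Q_homog[OF i], of "Pos c"]]
      by simp_all
    show ?thesis
      using homog_sum[OF W, where I = UNIV and n = 2 and F = "\<lambda>b. if b then (\<lambda>z. dd i (Mom c) (Q i) z \<cdot> dd i (Pos c) (S i) z)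
          else (\<lambda>z. dd i (Mom c) (S i) z \<cdot> dd i (Pos c) (Q i) z)"] h
      by (simp add: UNIV_bool add.commute)
  qed
  then have K: "homog ?pr (D i) 2 K" unfolding K_def by (rule homog_sum[OF W])
  have lC: "superfun ?P (D i) (lift (C i c))" for c by (rule superfun_lift[OF U C_superfun[OF i]])
  have ldC: "superfun ?P (D i) (lift (pder ?pr c (C i d)))" for c d
    by (rule superfun_lift[OF U superfun_pder[OF U C_superfun[OF i]]])
  have l\<sigma>: "superfun ?P (D i) (lift (\<sigma> i a b))" for a b by (rule superfun_lift[OF U \<sigma>_superfun[OF i]])
  have sR: "superfun ?P (D i) (R c)" for c
    unfolding R_def by (intro superfun_sum[OF W] superfun_gmul[OF W] ldC superfun_crd)
  note dS = superfun_pder[OF W S_superfun[OF i]]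
  note ddS = superfun_pder[OF W superfun_pder[OF W S_superfun[OF i]]]
  have gC: "gpar (\<not> ?pr c) (lift (C i c) z)" if "z \<in> D i" for c z
    using C_parity[OF i, of c] cot_setD[OF that] by (auto simp: lift_eq has_parity_iff intro!: gpar_glift)
  have gdC: "gpar ((\<not> ?pr d) \<noteq> ?pr c) (pder ?pr c (C i d) u)" if "u \<in> domain A i" for c d u
    by (rule gpar_pder[OF U that superfun_differentiable[OF C_superfun[OF i]] C_parity[OF i]])
  have dR: "dd i (Mom a) (R c) z = ksign (?pr a) ((\<not> ?pr a) \<noteq> ?pr c) *\<^sub>R lift (pder ?pr c (C i a)) z" if z: "z \<in> D i" for a c z
    unfolding R_def pder_lift_p(1)[OF U cot_setD[OF z] superfun_pder[OF U C_superfun[OF i]] z]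
    unfolding lift_eq by (rule gtwist_gpar[OF gpar_glift[OF gdC[OF cot_setD[OF z]]]])
  \<comment> \<open>\<open>?k1\<close> is the sign for moving a momentum derivative past the first
    factor of a product, \<open>?k2\<close> the twist of a differentiated component of the field
    under that derivative.\<close>
  let ?k1 = "\<lambda>b c. ksign (?pr b) (\<not> ?pr c)" and ?k2 = "\<lambda>b c. ksign (?pr b) ((\<not> ?pr b) \<noteq> ?pr c)"
  have dK: "dd i (Mom b) K z = (\<Sum>c\<in>UNIV. ?k1 b c *\<^sub>R (lift (C i c) z \<cdot> dd i (Mom b) (dd i (Pos c) (S i)) z)
      + (lift (\<sigma> i b c) z \<cdot> R c z + (?k1 b c * ?k2 b c) *\<^sub>R (dd i (Mom c) (S i) z \<cdot> lift (pder ?pr c (C i b)) z)))"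
    if z: "z \<in> D i" for b z
  proof -
    have "dd i (Mom b) K z = dd i (Mom b) (\<lambda>z. \<Sum>c\<in>UNIV. lift (C i c) z \<cdot> dd i (Pos c) (S i) z + dd i (Mom c) (S i) z \<cdot> R c z) z"
      by (rule pder_cong[OF W _ z]) (simp add: K_def dd_Q[OF i] R_def)
    also have "\<dots> = (\<Sum>c\<in>UNIV. dd i (Mom b) (\<lambda>z. lift (C i c) z \<cdot> dd i (Pos c) (S i) z + dd i (Mom c) (S i) z \<cdot> R c z) z)"
      by (rule pder_sum[OF W z superfun_differentiable[OF superfun_add[OF W superfun_gmul[OF W lC dS] superfun_gmul[OF W dS sR]]]])
    also have "\<dots> = (\<Sum>c\<in>UNIV. ?k1 b c *\<^sub>R (lift (C i c) z \<cdot> dd i (Mom b) (dd i (Pos c) (S i)) z)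
      + (lift (\<sigma> i b c) z \<cdot> R c z + (?k1 b c * ?k2 b c) *\<^sub>R (dd i (Mom c) (S i) z \<cdot> lift (pder ?pr c (C i b)) z)))"
    proof (rule sum.cong[OF refl])
      fix c
      have g: "gpar (\<not> ?pr c) (dd i (Mom c) (S i) z)" using dd_S_gpar[OF i z, of "Mom c"] by simp
      show "dd i (Mom b) (\<lambda>z. lift (C i c) z \<cdot> dd i (Pos c) (S i) z + dd i (Mom c) (S i) z \<cdot> R c z) z =
        ?k1 b c *\<^sub>R (lift (C i c) z \<cdot> dd i (Mom b) (dd i (Pos c) (S i)) z)
        + (lift (\<sigma> i b c) z \<cdot> R c z + (?k1 b c * ?k2 b c) *\<^sub>R (dd i (Mom c) (S i) z \<cdot> lift (pder ?pr c (C i b)) z))"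
        unfolding pder_add[OF W z superfun_differentiable[OF superfun_gmul[OF W lC dS]] superfun_differentiable[OF superfun_gmul[OF W dS sR]]]
          pder_gmul_gpar[OF W z superfun_differentiable[OF lC] superfun_differentiable[OF dS] gC[OF z]]
          pder_gmul_gpar[OF W z superfun_differentiable[OF dS] superfun_differentiable[OF sR] g] lift_\<sigma>[OF i z] dR[OF z]
        by (simp add: gmul_linear)
    qed
    finally show ?thesis .
  qed
  have ddK: "dd i (Mom a) (dd i (Mom b) K) z = 0" if z: "z \<in> D i" for a b z
  proof -
    let ?u = "base_point z"
    note u = cot_setD[OF z]
    let ?t1 = "\<lambda>c z. lift (C i c) z \<cdot> dd i (Mom b) (dd i (Pos c) (S i)) z"
    let ?t2 = "\<lambda>c z. lift (\<sigma> i b c) z \<cdot> R c z"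
    let ?t3 = "\<lambda>c z. dd i (Mom c) (S i) z \<cdot> lift (pder ?pr c (C i b)) z"
    have s1: "superfun ?P (D i) (?t1 c)" and s2: "superfun ?P (D i) (?t2 c)" and s3: "superfun ?P (D i) (?t3 c)" for c
      by (intro superfun_gmul[OF W] lC ddS l\<sigma> sR dS ldC)+
    \<comment> \<open>Both momentum derivatives are moved inside the position derivative, where they
      produce \<open>\<sigma>\<close>.\<close>
    have d3: "dd i (Mom a) (dd i (Mom b) (dd i (Pos c) (S i))) z =
        (ksign (?pr b) (?pr c) * ksign (?pr a) (?pr c)) *\<^sub>R lift (pder ?pr c (\<sigma> i a b)) z" for c
    proof -
      have "dd i (Mom a) (dd i (Mom b) (dd i (Pos c) (S i))) z =
          dd i (Mom a) (\<lambda>z. ksign (?pr b) (?pr c) *\<^sub>R dd i (Pos c) (dd i (Mom b) (S i)) z) z"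
        using pder_commute[OF W _ S_superfun[OF i], of _ "Mom b" "Pos c"] by (intro pder_cong[OF W _ z]) simp
      also have "\<dots> = ksign (?pr b) (?pr c) *\<^sub>R dd i (Mom a) (dd i (Pos c) (dd i (Mom b) (S i))) z"
        by (rule pder_scaleR[OF W z superfun_differentiable[OF ddS]])
      also have "dd i (Mom a) (dd i (Pos c) (dd i (Mom b) (S i))) z =
          ksign (?pr a) (?pr c) *\<^sub>R dd i (Pos c) (dd i (Mom a) (dd i (Mom b) (S i))) z"
        using pder_commute[OF W z dS, of "Mom a" "Pos c"] by simp
      also have "dd i (Pos c) (dd i (Mom a) (dd i (Mom b) (S i))) z = dd i (Pos c) (lift (\<sigma> i a b)) z"
        by (rule pder_cong[OF W lift_\<sigma>[OF i] z])
      also have "\<dots> = lift (pder ?pr c (\<sigma> i a b)) z"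
        by (rule pder_lift_Pos[OF U superfun_differentiable[OF \<sigma>_superfun[OF i]] u])
      finally show ?thesis by simp
    qed
    have "dd i (Mom a) (dd i (Mom b) K) z =
        dd i (Mom a) (\<lambda>z. \<Sum>c\<in>UNIV. ?k1 b c *\<^sub>R ?t1 c z + (?t2 c z + (?k1 b c * ?k2 b c) *\<^sub>R ?t3 c z)) z"
      by (rule pder_cong[OF W dK z])
    also have "\<dots> = (\<Sum>c\<in>UNIV. dd i (Mom a) (\<lambda>z. ?k1 b c *\<^sub>R ?t1 c z + (?t2 c z + (?k1 b c * ?k2 b c) *\<^sub>R ?t3 c z)) z)"
      by (intro pder_sum[OF W z superfun_differentiable[OF superfun_add[OF W superfun_scaleR[OF W s1]
            superfun_add[OF W s2 superfun_scaleR[OF W s3]]]]])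
    also have "\<dots> = (\<Sum>c\<in>UNIV. ?k1 b c *\<^sub>R dd i (Mom a) (?t1 c) z + (dd i (Mom a) (?t2 c) z +
        (?k1 b c * ?k2 b c) *\<^sub>R dd i (Mom a) (?t3 c) z))"
      unfolding pder_add[OF W z superfun_differentiable[OF superfun_scaleR[OF W s1]] superfun_differentiable[OF superfun_add[OF W s2 superfun_scaleR[OF W s3]]]]
        pder_add[OF W z superfun_differentiable[OF s2] superfun_differentiable[OF superfun_scaleR[OF W s3]]]
        pder_scaleR[OF W z superfun_differentiable[OF s1]] pder_scaleR[OF W z superfun_differentiable[OF s3]] ..
    \<comment> \<open>Term by term this is the derivation identity times a sign that does not depend
      on \<open>c\<close>.\<close>
    also have "\<dots> = (\<Sum>c\<in>UNIV. ksign (?pr b) True *\<^sub>R glift (ksign (?pr a) True *\<^sub>R (C i c ?u \<cdot> pder ?pr c (\<sigma> i a b) ?u)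
        - ksign (?pr c) (\<not> ?pr a) *\<^sub>R (pder ?pr c (C i a) ?u \<cdot> \<sigma> i c b ?u)
        + \<sigma> i a c ?u \<cdot> pder ?pr c (C i b) ?u))"
    proof (rule sum.cong[OF refl])
      fix c
      have g\<sigma>: "gpar ((\<not> ?pr c) \<noteq> ?pr b) (lift (\<sigma> i b c) z)"
        unfolding lift_eq by (rule gpar_glift[OF \<sigma>_gpar[OF i u]])
      have 1: "dd i (Mom a) (?t1 c) z = (ksign (?pr a) (\<not> ?pr c) * (ksign (?pr b) (?pr c) * ksign (?pr a) (?pr c))) *\<^sub>R
          glift (C i c ?u \<cdot> pder ?pr c (\<sigma> i a b) ?u)"
        unfolding pder_gmul_gpar[OF W z superfun_differentiable[OF lC] superfun_differentiable[OF ddS] gC[OF z]] d3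
        by (simp add: gmul_linear lift_eq glift_gmul)
      \<comment> \<open>The factors are brought into the order of the derivation identity, and
        \<open>\<sigma>_swap\<close> exchanges the indices of \<open>\<sigma>\<close> at the same
        time.\<close>
      have sw: "\<sigma> i b c ?u \<cdot> pder ?pr c (C i a) ?u =
          (ksign (?pr b) (?pr c) * ksign ((\<not> ?pr b) \<noteq> ?pr c) ((\<not> ?pr a) \<noteq> ?pr c)) *\<^sub>R (pder ?pr c (C i a) ?u \<cdot> \<sigma> i c b ?u)"
        unfolding \<sigma>_swap[OF i u, of b c] gmul.scaleR_left gmul_supercommute[OF \<sigma>_gpar[OF i u] gdC[OF u]] by simp
      have 2: "dd i (Mom a) (?t2 c) z = (ksign (?pr a) ((\<not> ?pr c) \<noteq> ?pr b) * (?k2 a c *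
          (ksign (?pr b) (?pr c) * ksign ((\<not> ?pr b) \<noteq> ?pr c) ((\<not> ?pr a) \<noteq> ?pr c)))) *\<^sub>R
          glift (pder ?pr c (C i a) ?u \<cdot> \<sigma> i c b ?u)"
      proof -
        have "dd i (Mom a) (?t2 c) z = (ksign (?pr a) ((\<not> ?pr c) \<noteq> ?pr b) * ?k2 a c) *\<^sub>R
            glift (\<sigma> i b c ?u \<cdot> pder ?pr c (C i a) ?u)"
          unfolding pder_gmul_gpar[OF W z superfun_differentiable[OF l\<sigma>] superfun_differentiable[OF sR] g\<sigma>] dR[OF z]
          by (simp add: gmul_linear lift_eq glift_gmul)
        then show ?thesis unfolding sw glift_simps by (simp add: mult.assoc)
      qed
      have 3: "dd i (Mom a) (?t3 c) z = glift (\<sigma> i a c ?u \<cdot> pder ?pr c (C i b) ?u)"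
        unfolding pder_gmul[OF W z superfun_differentiable[OF dS] superfun_differentiable[OF ldC]] lift_\<sigma>[OF i z]
        by (simp add: lift_eq glift_gmul)
      show "?k1 b c *\<^sub>R dd i (Mom a) (?t1 c) z + (dd i (Mom a) (?t2 c) z + (?k1 b c * ?k2 b c) *\<^sub>R dd i (Mom a) (?t3 c) z) =
        ksign (?pr b) True *\<^sub>R glift (ksign (?pr a) True *\<^sub>R (C i c ?u \<cdot> pder ?pr c (\<sigma> i a b) ?u)
        - ksign (?pr c) (\<not> ?pr a) *\<^sub>R (pder ?pr c (C i a) ?u \<cdot> \<sigma> i c b ?u)
        + \<sigma> i a c ?u \<cdot> pder ?pr c (C i b) ?u)"
        unfolding 1 2 3 glift_simps
        by (cases "?pr a"; cases "?pr b"; cases "?pr c") (simp_all add: ksign_def)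
    qed
    also have "\<dots> = 0"
      unfolding scaleR_sum_right[symmetric] linear_sum[OF linear_glift, symmetric] derivation_identity[OF i u]
      by (simp add: glift_simps)
    finally show ?thesis .
  qed
  have "K z = 0"
    unfolding homog_2_expansion[OF W z K] by (simp add: ddK[OF z])
  then show ?thesis by (simp add: K_def)
qed

section \<open>The combined Hamiltonian and its field\<close>

definition H :: "real \<Rightarrow> 'i \<Rightarrow> 'c cot sfun" where
  "H lam i z = Q i z + lam *\<^sub>R S i z"

lemma H_superfun: "i \<in> charts A \<Longrightarrow> superfun (cot_par (par A i)) (D i) (H lam i)"
  unfolding H_def[abs_def] by (intro superfun_add superfun_scaleR D_open Q_superfun S_superfun)

lemma H_parity:
  assumes "i \<in> charts A"
  shows "has_parity (D i) True (H lam i)"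
  using Q_parity[OF assms] S_parity[OF assms] by (simp add: has_parity_iff H_def gpar_add gpar_scaleR)

lemma dd_H:
  assumes i: "i \<in> charts A" and z: "z \<in> D i"
  shows "dd i x (H lam i) z = dd i x (Q i) z + lam *\<^sub>R dd i x (S i) z"
  unfolding H_def[abs_def]
    pder_add[OF D_open[OF i] z superfun_differentiable[OF Q_superfun[OF i]]
      superfun_differentiable[OF superfun_scaleR[OF D_open[OF i] S_superfun[OF i]]]]
    pder_scaleR[OF D_open[OF i] z superfun_differentiable[OF S_superfun[OF i]]] ..

text \<open>Expansion in powers of \<open>lam\<close>; the sum for \<open>S\<close> alone is one
  half of its bracket with itself.\<close>

lemma H_H:
  assumes i: "i \<in> charts A" and z: "z \<in> D i"
  shows "(\<Sum>a\<in>UNIV. dd i (Mom a) (H lam i) z \<cdot> dd i (Pos a) (H lam i) z) = 0"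
proof -
  let ?e = "\<lambda>F G. \<Sum>a\<in>UNIV. dd i (Mom a) F z \<cdot> dd i (Pos a) G z"
  have "2 *\<^sub>R ?e (S i) (S i) = poisson (par A i) (S i) (S i) z"
    unfolding poisson_eq[OF D_open[OF i] z S_parity[OF i]]
      poisson_hom_odd_swap[OF D_open[OF i] z S_superfun[OF i] S_parity[OF i] S_superfun[OF i] S_parity[OF i]]
    by (simp only: sum.distrib scaleR_2)
  then have SS: "?e (S i) (S i) = 0" using S_S[OF i z] by simp
  have "?e (H lam i) (H lam i) = ?e (Q i) (Q i) + lam *\<^sub>R (\<Sum>c\<in>UNIV. dd i (Mom c) (Q i) z \<cdot> dd i (Pos c) (S i) z +
      dd i (Mom c) (S i) z \<cdot> dd i (Pos c) (Q i) z) + (lam * lam) *\<^sub>R ?e (S i) (S i)"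
    unfolding dd_H[OF i z]
    by (simp add: gmul_linear sum.distrib scaleR_add_right scaleR_sum_right)
  then show ?thesis by (simp only: Q_Q[OF i z] Q_S[OF i z] SS) simp
qed

text \<open>Both Hamiltonians are odd, so their brackets carry the same signs and add up to the
  bracket with a single Hamiltonian.\<close>

lemma Q_double_eq:
  assumes i: "i \<in> charts A" and z: "z \<in> D i"
  shows "Q_double A X S lam i f z = poisson_hom (par A i) True (H lam i) f z"
  unfolding Q_double_def hamiltonian_vf_def poisson_eq[OF D_open[OF i] z Q_parity[OF i]]
    poisson_eq[OF D_open[OF i] z S_parity[OF i]] poisson_hom_def dd_H[OF i z]
  by (simp add: gmul_linear sum.distrib sum_subtractf scaleR_add_right scaleR_diff_right scaleR_sum_right mult.commute
      sum_negf)

lemma component_Q_double: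
  assumes "i \<in> charts A" "z \<in> D i"
  shows "component (T m) (Q_double A X S lam) i x z = ham_comp (par A i) (H lam i) x z"
  by (simp add: component_def Q_double_eq[OF assms] poisson_hom_crd)

lemma H_global:
  assumes ij: "i \<in> charts A" "j \<in> charts A" and z: "z \<in> cot_set (par A i) (overlap A i j)"
  shows "H lam i z = pullback (T m) i j (H lam j) z"
proof -
  interpret TT: supermanifold_atlas "T m" by (rule atlas_T)
  \<comment> \<open>Pullbacks do not see weights, so invariance of \<open>S\<close> on
    \<open>cotangent A\<close> transfers to the total weight.\<close>
  have eq: "pullback (cotangent A) i j F z = pullback (T m) i j F z" for F
    by (simp add: pullback_def total_cotangent_def)
  have "S i z = pullback (T m) i j (S j) z"
    using schouten ij z unfolding schouten_function_def global_fun_def eq[symmetric] by (simp add: cotangent_def)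
  moreover have "pullback (T m) i j (H lam j) z = pullback (T m) i j (Q j) z + lam *\<^sub>R pullback (T m) i j (S j) z"
  proof -
    have b: "TT.bm i j z \<in> D j"
      using bodymap_T[OF ij z bm_ov[OF ij cot_setD[OF z]], of m] cot_set_mono[OF ov_dom[OF ij(2,1)]] by blast
    note W = D_open[OF ij(2)]
    show ?thesis
      unfolding H_def[abs_def]
      using TT.pullback_add[of j "D j" i z "Q j" "\<lambda>z. lam *\<^sub>R S j z"] TT.pullback_scaleR[of j "D j" i z "S j" lam]
        W b Q_superfun[OF ij(2)] S_superfun[OF ij(2)] superfun_scaleR[OF W S_superfun[OF ij(2)]] by simp
  qed
  ultimately show ?thesis using Q_global[OF ij z, of m] by (simp add: H_def)
qed

text \<open>An expansion of \<open>S\<close> for the induced weight need not be one for the total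
  weight, since other momenta may have weight 0. The weight is therefore rebuilt from the
  coefficients \<open>\<sigma>\<close> by Euler's identity.\<close>

lemma H_weight:
  assumes i: "i \<in> charts A"
  shows "has_weight (cot_par (par A i)) (wt (T (q - s)) i) (D i) (q + (q - s)) (H lam i)"
proof -
  note U = dom_open[OF i] and W = D_open[OF i]
  let ?m = "q - s"
  have "has_weight (cot_par (par A i)) (wt (T ?m) i) (D i) (q + ?m) (Q i)"
    unfolding Q_eq by (rule lift_p_weight[OF U C_weight[OF i]])
  moreover have "has_weight (cot_par (par A i)) (wt (T ?m) i) (D i) (q + ?m)
      (\<lambda>z. (1 / 2) *\<^sub>R (\<Sum>a\<in>UNIV. \<Sum>b\<in>UNIV. p i a z \<cdot> (p i b z \<cdot> lift (\<sigma> i b a) z)))"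
  proof (intro has_weight_scaleR[OF W] has_weight_sum[OF W])
    fix a b
    from has_weight_gmul[OF W p_weight[OF W] has_weight_gmul[OF W p_weight[OF W] lift_weight[OF U \<sigma>_weight[OF i]]], of ?m a b b a]
    show "has_weight (cot_par (par A i)) (wt (T ?m) i) (D i) (q + ?m) (\<lambda>z. p i a z \<cdot> (p i b z \<cdot> lift (\<sigma> i b a) z))"
      by (simp add: algebra_simps)
  qed
  then have "has_weight (cot_par (par A i)) (wt (T ?m) i) (D i) (q + ?m) (S i)"
    by (rule has_weight_cong[OF W, rotated]) (simp add: homog_2_expansion[OF W _ S_homog[OF i]] lift_\<sigma>[OF i])
  ultimately show ?thesis
    unfolding H_def[abs_def] by (intro has_weight_add[OF W] has_weight_scaleR[OF W])
qed

text \<open>A component is, up to sign, the derivative of \<open>H\<close> along the conjugate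
  coordinate. Conjugate weights add up to \<open>q - s\<close>, so from weight
  \<open>2 q - s\<close> there remains \<open>q\<close> plus the weight of the coordinate.\<close>

lemma Q_double_weight: "vf_has_weight (T (q - s)) (Q_double A X S lam) q"
  unfolding vf_has_weight_def
proof (intro ballI allI)
  fix i x assume "i \<in> charts (T (q - s))"
  then have i: "i \<in> charts A" by simp
  let ?w = "wt (T (q - s)) i"
  have "has_weight (cot_par (par A i)) ?w (D i) (q + ?w x) (ham_comp (par A i) (H lam i) x)"
  proof (cases x)
    case (Pos a)
    then have "ham_comp (par A i) (H lam i) x = dd i (Mom a) (H lam i)" by (simp add: ham_comp_def fun_eq_iff)
    then show ?thesis using has_weight_pder[OF D_open[OF i] H_weight[OF i], of "Mom a" lam] Pos by (simp add: algebra_simps)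
  next
    case (Mom a)
    then have "ham_comp (par A i) (H lam i) x = (\<lambda>z. (- ksign (par A i a) True) *\<^sub>R dd i (Pos a) (H lam i) z)"
      by (simp add: ham_comp_def fun_eq_iff)
    then show ?thesis
      using has_weight_scaleR[OF D_open[OF i] has_weight_pder[OF D_open[OF i] H_weight[OF i], of "Pos a" lam],
          where x = "- ksign (par A i a) True"] Mom
      by (simp add: algebra_simps)
  qed
  then have "has_weight (cot_par (par A i)) ?w (D i) (q + ?w x) (component (T (q - s)) (Q_double A X S lam) i x)"
    by (rule has_weight_cong[OF D_open[OF i], rotated]) (simp add: component_Q_double[OF i])
  then show "has_weight (par (T (q - s)) i) ?w (domain (T (q - s)) i) (q + ?w x) (component (T (q - s)) (Q_double A X S lam) i x)"
    by simp
qed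

lemma local_fun_T:
  assumes "local_fun (T m) i W f"
  shows "i \<in> charts A" "obody (cot_par (par A i)) W" "W \<subseteq> D i" "superfun (cot_par (par A i)) W f"
proof -
  show i: "i \<in> charts A" using assms by (simp add: local_fun_def)
  have "graded_fun (cot_par (par A i)) (wt (T m) i) W f" using assms by (simp add: local_fun_def)
  then show "superfun (cot_par (par A i)) W f" by (rule graded_fun_superfun)
  have "openin (top_of_set (D i)) W" using assms by (simp add: local_fun_def)
  then show "obody (cot_par (par A i)) W" "W \<subseteq> D i"
    using D_open[OF i] openin_trans openin_imp_subset by blast+
qed

text \<open>Compatibility between charts is a condition on coordinate functions, which is what
  \<open>ham_comp_change\<close> supplies.\<close>

lemma Q_double_vector_field: "vector_field (T (q - s)) (Q_double A X S lam)"
  unfolding vector_field_def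
proof (intro conjI ballI allI impI)
  fix i x assume "i \<in> charts (T (q - s))"
  then show "graded_fun (par (T (q - s)) i) (wt (T (q - s)) i) (domain (T (q - s)) i) (component (T (q - s)) (Q_double A X S lam) i x)"
    using Q_double_weight[of lam] has_weight_graded_fun unfolding vf_has_weight_def by blast
next
  fix i W f z assume f: "local_fun (T (q - s)) i W f" and z: "z \<in> W"
  note i = local_fun_T[OF f]
  have z: "z \<in> D i" using z i(3) by blast
  show "Q_double A X S lam i f z =
      (\<Sum>x\<in>UNIV. component (T (q - s)) (Q_double A X S lam) i x z \<cdot> pder (par (T (q - s)) i) x f z)"
    by (simp add: Q_double_eq[OF i(1) z] component_Q_double[OF i(1) z] poisson_hom_odd)
next
  fix i j x z assume "i \<in> charts (T (q - s))" "j \<in> charts (T (q - s))" "z \<in> overlap (T (q - s)) i j"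
  then have ij: "i \<in> charts A" "j \<in> charts A" and z: "z \<in> cot_set (par A i) (overlap A i j)" by simp_all
  interpret TT: supermanifold_atlas "T (q - s)" by (rule atlas_T)
  let ?O' = "cot_set (par A j) (overlap A j i)"
  have sub: "cot_set (par A i) (overlap A i j) \<subseteq> D i" "?O' \<subseteq> D j"
    using cot_set_mono[OF ov_dom[OF ij]] cot_set_mono[OF ov_dom[OF ij(2,1)]] by blast+
  have "Q_double A X S lam i (change (T (q - s)) i j x) z =
      poisson_hom (par A i) True (H lam i) (change (T (q - s)) i j x) z"
    using Q_double_eq[OF ij(1)] sub(1) z by blast
  also have "\<dots> = pullback (T (q - s)) i j (ham_comp (par A j) (H lam j) x) z"
  proof (rule ham_comp_change[OF ij z _ _ H_global[OF ij]])
    show "superfun (cot_par (par A j)) ?O' (H lam j)" using H_superfun[OF ij(2)] sub(2) by (rule superfun_subset)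
    show "has_parity ?O' True (H lam j)" using H_parity[OF ij(2), of lam] sub(2) by (auto simp: has_parity_iff)
  qed
  also have "\<dots> = pullback (T (q - s)) i j (component (T (q - s)) (Q_double A X S lam) j x) z"
    using component_Q_double[OF ij(2)] D_open[OF ij(2)] bodymap_T[OF ij z bm_ov[OF ij cot_setD[OF z]], of "q - s"] sub(2)
    by (intro TT.pullback_cong[of j "D j"]) auto
  finally show "Q_double A X S lam i (change (T (q - s)) i j x) z =
      pullback (T (q - s)) i j (component (T (q - s)) (Q_double A X S lam) j x) z" .
qed

text \<open>Local functions live on open subsets \<open>W\<close> of a chart domain, so
  \<open>H\<close> and its identities are restricted to \<open>W\<close> before
  \<open>ham_square\<close> applies.\<close>

lemma Q_double_homological: "homological (T (q - s)) (Q_double A X S lam)"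
  unfolding homological_def odd_vector_field_def
proof (intro conjI Q_double_vector_field ballI allI impI)
  fix i x assume "i \<in> charts (T (q - s))"
  then have i: "i \<in> charts A" by simp
  show "has_parity (domain (T (q - s)) i) (\<not> par (T (q - s)) i x) (component (T (q - s)) (Q_double A X S lam) i x)"
    using ham_comp_parity[OF D_open[OF i] H_superfun[OF i] H_parity[OF i], of x]
    by (simp add: has_parity_iff component_Q_double[OF i])
next
  fix i W f z assume f: "local_fun (T (q - s)) i W f" and z: "z \<in> W"
  note i = local_fun_T[OF f]
  have zD: "z \<in> D i" using z i(3) by blast
  have "Q_double A X S lam i (Q_double A X S lam i f) z =
      poisson_hom (par A i) True (H lam i) (Q_double A X S lam i f) z"
    by (rule Q_double_eq[OF i(1) zD])
  also have "\<dots> = poisson_hom (par A i) True (H lam i) (poisson_hom (par A i) True (H lam i) f) z"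
    using i(3) by (intro poisson_hom_cong[OF i(2) z] Q_double_eq[OF i(1)]) blast
  also have "\<dots> = 0"
  proof (rule ham_square[OF i(2) z _ _ i(4)])
    show "superfun (cot_par (par A i)) W (H lam i)" using H_superfun[OF i(1)] i(3) by (rule superfun_subset)
    show "has_parity W True (H lam i)" using H_parity[OF i(1), of lam] i(3) by (auto simp: has_parity_iff)
    show "(\<Sum>a\<in>UNIV. dd i (Mom a) (H lam i) z \<cdot> dd i (Pos a) (H lam i) z) = 0" if "z \<in> W" for z
      using H_H[OF i(1)] i(3) that by blast
  qed
  finally show "Q_double A X S lam i (Q_double A X S lam i f) z = 0" .
qed

end

theorem theorem5p1:
  fixes M :: "('i, 'c::{finite,linorder}) atlas"
    and Qhat :: "('i, 'c) oper"
    and S :: "'i \<Rightarrow> 'c cot sfun"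
    and q s :: int
    and lam :: real
  assumes "graded_QS_manifold M Qhat S"
    and "vf_has_weight M Qhat q"
    and "schouten_has_weight M S s"
  shows "graded_Q_manifold (total_cotangent M (q - s)) (Q_double M Qhat S lam) \<and>
         vf_has_weight (total_cotangent M (q - s)) (Q_double M Qhat S lam) q"
proof -
  interpret QS_atlas M Qhat S q s
    using assms by unfold_locales
  show ?thesis
    using graded_manifold_T Q_double_homological Q_double_weight by (simp add: graded_Q_manifold_def)
qed

end
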